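(* Let $N\ge 1$, let $\Omega\subset\mathbb{R}^N$ be a bounded domain with smooth boundary, let $p>1$ and $0<\alpha<1$, and set $m^*=\frac{Np}{Np-(1-\alpha)(N-p)}$. Let $f\in L^m(\Omega)$ with $f\ge0$, $f\not\equiv 0$, and $m\ge m^*>1$. Then the problem $$-\mathrm{div}(|\nabla u|^{p-2}\nabla u)+|u|^{p-2}u=\frac{f(x)}{u^\alpha}\ \text{ in }\Omega,\qquad u=0\ \text{ on }\partial\Omega,$$ has a solution $u\in W^{1,p}_0(\Omega)$ satisfying $$\int_\Omega |\nabla u|^{p-2}\nabla u\cdot\nabla\varphi\,dx+\int_\Omega |u|^{p-2}u\,\varphi\,dx=\int_\Omega\frac{f\varphi}{u^\alpha}\,dx\qquad\text{for all }\varphi\in C_0^\infty(\Omega).$$ Moreover, the solution $u$ satisfies: (i) if $m>\frac{N}{p}$ and $2-\frac{2}{m}<p<N$, then $u\in L^\infty(\Omega)$; (ii) if $1<m^*\le m<\frac{N}{p}$, then $u\in L^s(\Omega)$ for $1<s\le\frac{(p+\alpha-1)Nm}{N-pm}$.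
   Context: Solutions are positive a.e. in $\Omega$, so that $f/u^\alpha$ makes sense, and all integrals in the weak identity are understood to be well defined and finite. *)

theory Defs
  imports "HOL-Analysis.Analysis"
begin

section \<open>Smooth functions, gradients and test functions\<close>

definition grad :: "('a::euclidean_space \<Rightarrow> real) \<Rightarrow> 'a \<Rightarrow> 'a" where
  "grad \<phi> x = (\<Sum>b\<in>Basis. frechet_derivative \<phi> (at x) b *\<^sub>R b)"

primrec C_k :: "nat \<Rightarrow> ('a::euclidean_space \<Rightarrow> real) \<Rightarrow> bool" where
  "C_k 0 \<phi> \<longleftrightarrow> continuous_on UNIV \<phi>"
| "C_k (Suc k) \<phi> \<longleftrightarrow>
     (\<forall>x. \<phi> differentiable (at x)) \<and>
     (\<forall>b\<in>Basis. C_k k (\<lambda>x. frechet_derivative \<phi> (at x) b))"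

definition smooth :: "('a::euclidean_space \<Rightarrow> real) \<Rightarrow> bool" where
  "smooth \<phi> \<longleftrightarrow> (\<forall>k. C_k k \<phi>)"

text \<open>Test functions on \<open>\<Omega>\<close> are functions on the whole space, that is, they are extended by zero
  outside \<open>\<Omega>\<close>.\<close>

definition C0_infinity :: "'a::euclidean_space set \<Rightarrow> ('a \<Rightarrow> real) set" where
  "C0_infinity \<Omega> =
     {\<phi>. smooth \<phi> \<and> compact (closure {x. \<phi> x \<noteq> 0}) \<and> closure {x. \<phi> x \<noteq> 0} \<subseteq> \<Omega>}"

section \<open>Domains with smooth boundary\<close>

definition domain :: "'a::euclidean_space set \<Rightarrow> bool" where
  "domain \<Omega> \<longleftrightarrow> open \<Omega> \<and> connected \<Omega> \<and> \<Omega> \<noteq> {}"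

text \<open>Near each boundary point, \<open>\<Omega>\<close> is the strict epigraph of a smooth function in the direction of
  some unit vector \<open>e\<close>.  The function \<open>\<gamma>\<close> of the remaining \<open>N - 1\<close> variables is represented by a
  smooth function on the whole space evaluated at the projection onto the hyperplane
  orthogonal to \<open>e\<close>.\<close>

definition smooth_boundary :: "'a::euclidean_space set \<Rightarrow> bool" where
  "smooth_boundary \<Omega> \<longleftrightarrow>
     (\<forall>x0\<in>frontier \<Omega>. \<exists>r>0. \<exists>e. norm e = 1 \<and>
        (\<exists>\<gamma>. smooth \<gamma> \<and>
           \<Omega> \<inter> ball x0 r = {x \<in> ball x0 r. x \<bullet> e > \<gamma> (x - (x \<bullet> e) *\<^sub>R e)}))"

section \<open>Lebesgue and Sobolev spaces\<close>

definition Lp :: "real \<Rightarrow> 'a::euclidean_space set \<Rightarrow> ('a \<Rightarrow> 'b::euclidean_space) set" where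
  "Lp q \<Omega> = {v. v \<in> borel_measurable (lebesgue_on \<Omega>) \<and>
               integrable (lebesgue_on \<Omega>) (\<lambda>x. norm (v x) powr q)}"

definition Lp_norm :: "real \<Rightarrow> 'a::euclidean_space set \<Rightarrow> ('a \<Rightarrow> 'b::euclidean_space) \<Rightarrow> real" where
  "Lp_norm q \<Omega> v = (LINT x|lebesgue_on \<Omega>. norm (v x) powr q) powr (1 / q)"

definition L_infinity :: "'a::euclidean_space set \<Rightarrow> ('a \<Rightarrow> real) set" where
  "L_infinity \<Omega> = {v. v \<in> borel_measurable (lebesgue_on \<Omega>) \<and>
                      (\<exists>C. AE x in lebesgue_on \<Omega>. \<bar>v x\<bar> \<le> C)}"

text \<open>\<open>Du\<close> is a version of the distributional gradient of \<open>u\<close> on \<open>\<Omega>\<close>; it is unique up to null sets.\<close>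

definition has_weak_gradient ::
  "('a::euclidean_space \<Rightarrow> real) \<Rightarrow> ('a \<Rightarrow> 'a) \<Rightarrow> 'a set \<Rightarrow> bool" where
  "has_weak_gradient u Du \<Omega> \<longleftrightarrow>
     (\<forall>K. compact K \<and> K \<subseteq> \<Omega> \<longrightarrow>
        u absolutely_integrable_on K \<and> Du absolutely_integrable_on K) \<and>
     (\<forall>\<phi>\<in>C0_infinity \<Omega>. \<forall>b\<in>Basis.
        (LINT x|lebesgue_on \<Omega>. u x * (grad \<phi> x \<bullet> b)) =
        - (LINT x|lebesgue_on \<Omega>. (Du x \<bullet> b) * \<phi> x))"

text \<open>\<open>W\<^sub>0\<^sup>1\<^sup>,\<^sup>p(\<Omega>)\<close> is the closure of \<open>C\<^sub>0\<^sup>\<infinity>(\<Omega>)\<close> in \<open>W\<^sup>1\<^sup>,\<^sup>p(\<Omega>)\<close>; membership in it is the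
  meaning of the condition \<open>u = 0\<close> on the boundary.\<close>

definition W1p :: "real \<Rightarrow> 'a::euclidean_space set \<Rightarrow> ('a \<Rightarrow> real) set" where
  "W1p p \<Omega> = {u \<in> Lp p \<Omega>. \<exists>Du\<in>Lp p \<Omega>. has_weak_gradient u Du \<Omega>}"

definition W1p_0 :: "real \<Rightarrow> 'a::euclidean_space set \<Rightarrow> ('a \<Rightarrow> real) set" where
  "W1p_0 p \<Omega> = {u \<in> W1p p \<Omega>. \<exists>Du\<in>Lp p \<Omega>. has_weak_gradient u Du \<Omega> \<and>
     (\<exists>\<phi>. (\<forall>n::nat. \<phi> n \<in> C0_infinity \<Omega>) \<and>
        (\<lambda>n. Lp_norm p \<Omega> (\<lambda>x. \<phi> n x - u x) + Lp_norm p \<Omega> (\<lambda>x. grad (\<phi> n) x - Du x))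
          \<longlonglongrightarrow> 0)}"

section \<open>The singular problem\<close>

text \<open>At a zero of the gradient or of \<open>u\<close>, \<open>0 powr (p - 2) = 0\<close>; since \<open>p > 1\<close>, the terms
  \<open>\<bar>\<nabla>u\<bar>\<^sup>p\<^sup>-\<^sup>2\<nabla>u\<close> and \<open>\<bar>u\<bar>\<^sup>p\<^sup>-\<^sup>2u\<close> vanish there, as intended also for \<open>p < 2\<close>.\<close>

definition weak_solution ::
  "real \<Rightarrow> real \<Rightarrow> ('a::euclidean_space \<Rightarrow> real) \<Rightarrow> 'a set \<Rightarrow> ('a \<Rightarrow> real) \<Rightarrow> bool" where
  "weak_solution p \<alpha> f \<Omega> u \<longleftrightarrow>
     u \<in> W1p_0 p \<Omega> \<and>
     (AE x in lebesgue_on \<Omega>. u x > 0) \<and>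
     (\<exists>Du\<in>Lp p \<Omega>. has_weak_gradient u Du \<Omega> \<and>
       (\<forall>\<phi>\<in>C0_infinity \<Omega>.
          integrable (lebesgue_on \<Omega>) (\<lambda>x. norm (Du x) powr (p - 2) * (Du x \<bullet> grad \<phi> x)) \<and>
          integrable (lebesgue_on \<Omega>) (\<lambda>x. \<bar>u x\<bar> powr (p - 2) * u x * \<phi> x) \<and>
          integrable (lebesgue_on \<Omega>) (\<lambda>x. f x * \<phi> x / u x powr \<alpha>) \<and>
          (LINT x|lebesgue_on \<Omega>. norm (Du x) powr (p - 2) * (Du x \<bullet> grad \<phi> x)) +
          (LINT x|lebesgue_on \<Omega>. \<bar>u x\<bar> powr (p - 2) * u x * \<phi> x) =
          (LINT x|lebesgue_on \<Omega>. f x * \<phi> x / u x powr \<alpha>)))"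

definition m_star :: "real \<Rightarrow> real \<Rightarrow> real \<Rightarrow> real" where
  "m_star N p \<alpha> = N * p / (N * p - (1 - \<alpha>) * (N - p))"

end

theory Submission
  imports Defs
begin

text \<open>
  On nonnegative functions of \<open>W\<^sub>0\<^sup>1\<^sup>,\<^sup>p\<close> the energy
  \<open>J v = (1/p) \<integral> |\<nabla>v|\<^sup>p + (1/p) \<integral> v\<^sup>p - (1/(1-\<alpha>)) \<integral> f v\<^sup>1\<^sup>-\<^sup>\<alpha>\<close> is finite and coercive by
  Sobolev's inequality and \<open>m \<ge> m*\<close>, and it is convex because \<open>v \<mapsto> v\<^sup>1\<^sup>-\<^sup>\<alpha>\<close> is concave.  Uniform convexity
  of the p-th power makes minimizing sequences Cauchy, so the minimizer \<open>u\<close> needs no weak compactness.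
  Difference quotients of \<open>J\<close> at \<open>u\<close>, Fatou's lemma and the convexity of the cone give a variational
  inequality for all \<open>\<psi>\<close> with \<open>u + \<psi> \<ge> 0\<close>, from which everything else follows by the choice of \<open>\<psi>\<close>:

  \<^item> \<open>\<psi> = \<eta> (u + \<epsilon>)\<^sup>1\<^sup>-\<^sup>p\<close> bounds \<open>\<nabla> ln (u + \<epsilon>)\<close> locally, uniformly in \<open>\<epsilon>\<close>, so that \<open>u\<close> is almost everywhere
    zero or almost everywhere positive on small balls, hence positive on the connected set \<open>\<Omega>\<close>;
  \<^item> \<open>\<psi> = \<phi>\<close> and \<open>\<psi> = - c \<phi> u\<^sup>2 / (u\<^sup>2 + \<epsilon>\<^sup>2)\<close> with \<open>\<phi> \<ge> 0\<close> give the two inequalities of the equation;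
  \<^item> negative multiples of truncations and of regularized powers of \<open>u\<close>, combined with Sobolev's
    inequality, give the bounds (i) and (ii).

  Functions on \<open>\<Omega>\<close> are extended by zero, and all nonlinear functions of \<open>u\<close> that occur are smooth, so
  that test functions are mapped to test functions.
\<close>

section \<open>Smooth functions\<close>

text \<open>The obstacle is u^(-\<alpha>), unbounded near zeros of u: \<open>J\<close> has no
  derivative there, and only competitors u + t \<psi> \<ge> 0 are available. Concavity helps: the
  difference quotients of v^(1-\<alpha>) grow as t decreases, so the quotient at t = 1 is an
  integrable minorant for Fatou's lemma, and integrability of f \<psi> / u^\<alpha> comes out as a
  conclusion. The exponent \<open>m_star\<close> is conjugate to ps / (1 - \<alpha>), where ps = N p
  / (N - p) is Sobolev's exponent; this pairs f with v^(1-\<alpha>) in Hoelder's inequality.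
  Moreover \<open>m_star\<close> > 1 forces p < N. Positivity has to be found for a function defined
  up to null sets. As \<epsilon> tends to 0, ln (u + \<epsilon>) jumps by an unbounded amount
  between {u > 0} and {u = 0}, whereas the gradient bound limits its mean change under a
  translation. The value m = N / p separates (i) from (ii): above it the level sets in Stampacchia's
  recursion enter with a power larger than one; below it the power to be absorbed in (ii) is smaller
  than one.\<close>

lemma C_k_SucI:
  assumes "\<And>x. (\<phi> has_derivative \<phi>' x) (at x)"
    and "\<And>b. b \<in> Basis \<Longrightarrow> C_k k (\<lambda>x. \<phi>' x b)"
  shows "C_k (Suc k) \<phi>"
proof -
  have "frechet_derivative \<phi> (at x) = \<phi>' x" for x
    using frechet_derivative_at[OF assms(1)] by simp
  then show ?thesis
    using assms by (auto simp: differentiable_def)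
qed

lemma C_k_SucD: "C_k (Suc k) \<phi> \<Longrightarrow> C_k k \<phi>"
proof (induction k arbitrary: \<phi>)
  case 0
  then have "\<And>x. \<phi> differentiable (at x)" by simp
  then show ?case
    by (simp add: continuous_on_eq_continuous_at differentiable_imp_continuous_within)
qed auto

lemma C_k_has_derivative:
  assumes "C_k (Suc k) \<phi>"
  shows "(\<phi> has_derivative frechet_derivative \<phi> (at x)) (at x)"
  using assms frechet_derivative_works by auto

lemma C_k_const: "C_k k (\<lambda>x::'a::euclidean_space. c)"
proof (induction k arbitrary: c)
  case (Suc k)
  show ?case
    by (rule C_k_SucI[where \<phi>' = "\<lambda>x h. 0"]) (auto intro: Suc)
qed auto

lemma C_k_add: "C_k k \<phi> \<Longrightarrow> C_k k \<psi> \<Longrightarrow> C_k k (\<lambda>x. \<phi> x + \<psi> x)"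
proof (induction k arbitrary: \<phi> \<psi>)
  case 0
  then show ?case by (auto intro: continuous_intros)
next
  case (Suc k)
  show ?case
    by (rule C_k_SucI[OF has_derivative_add])
       (use Suc in \<open>auto intro: C_k_has_derivative\<close>)
qed

lemma C_k_mult: "C_k k \<phi> \<Longrightarrow> C_k k \<psi> \<Longrightarrow> C_k k (\<lambda>x. \<phi> x * \<psi> x)"
proof (induction k arbitrary: \<phi> \<psi>)
  case 0
  then show ?case by (auto intro: continuous_intros)
next
  case (Suc k)
  note D = C_k_SucD[OF Suc.prems(1)] C_k_SucD[OF Suc.prems(2)]
  show ?case
    by (rule C_k_SucI[OF has_derivative_mult])
       (use Suc D in \<open>auto intro!: C_k_add Suc.IH intro: C_k_has_derivative\<close>)
qed

text \<open>The exponent is generalised because each differentiation lowers it by one;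
  \<open>h\<close> is smooth outright, so the induction hypothesis applies at the new
  exponent.\<close>

lemma C_k_powr:
  assumes "smooth h" and "\<And>x. h x > 0"
  shows "C_k k (\<lambda>x. h x powr a)"
proof (induction k arbitrary: a)
  case 0
  have "C_k 0 h" using assms(1) by (auto simp: smooth_def)
  then show ?case using assms(2) by (auto intro!: continuous_intros simp: less_imp_neq[symmetric])
next
  case (Suc k)
  have h: "C_k (Suc k) h" using assms(1) by (auto simp: smooth_def)
  have der: "((\<lambda>x. h x powr a) has_derivative
      (\<lambda>b. a * h x powr (a - 1) * frechet_derivative h (at x) b)) (at x)" for x
  proof -
    have "((\<lambda>t. t powr a) has_real_derivative a * h x powr (a - 1)) (at (h x))"
      using assms(2)[of x] by (auto intro!: derivative_eq_intros)
    from has_derivative_compose[OF C_k_has_derivative[OF h] this[unfolded has_field_derivative_def]]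
    show ?thesis by simp
  qed
  show ?case
    by (rule C_k_SucI[OF der]) (use h in \<open>auto intro!: C_k_mult C_k_const Suc.IH\<close>)
qed

lemma smooth_C_k: "smooth \<phi> \<Longrightarrow> C_k k \<phi>"
  by (simp add: smooth_def)

lemma smooth_const: "smooth (\<lambda>x. c)"
  and smooth_add: "smooth \<phi> \<Longrightarrow> smooth \<psi> \<Longrightarrow> smooth (\<lambda>x. \<phi> x + \<psi> x)"
  and smooth_mult: "smooth \<phi> \<Longrightarrow> smooth \<psi> \<Longrightarrow> smooth (\<lambda>x. \<phi> x * \<psi> x)"
  and smooth_powr: "smooth \<phi> \<Longrightarrow> (\<And>x. \<phi> x > 0) \<Longrightarrow> smooth (\<lambda>x. \<phi> x powr a)"
  by (auto simp: smooth_def intro: C_k_const C_k_add C_k_mult C_k_powr[unfolded smooth_def])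

lemma smooth_minus: "smooth \<phi> \<Longrightarrow> smooth (\<lambda>x. - \<phi> x)"
  using smooth_mult[OF smooth_const[of "-1"]] by simp

lemma smooth_diff: "smooth \<phi> \<Longrightarrow> smooth \<psi> \<Longrightarrow> smooth (\<lambda>x. \<phi> x - \<psi> x)"
  using smooth_add[OF _ smooth_minus] by fastforce

lemma smooth_power: "smooth \<phi> \<Longrightarrow> smooth (\<lambda>x. \<phi> x ^ n)"
  by (induction n) (auto intro: smooth_const smooth_mult)

lemma smooth_sum: "finite I \<Longrightarrow> (\<And>i. i \<in> I \<Longrightarrow> smooth (\<phi> i)) \<Longrightarrow> smooth (\<lambda>x. \<Sum>i\<in>I. \<phi> i x)"
  by (induction I rule: finite_induct) (auto intro: smooth_const smooth_add)

lemma smooth_ln: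
  assumes "smooth h" and pos: "\<And>x. h x > 0"
  shows "smooth (\<lambda>x. ln (h x))"
  unfolding smooth_def
proof
  fix k
  have der: "((\<lambda>x. ln (h x)) has_derivative
      (\<lambda>b. h x powr (-1) * frechet_derivative h (at x) b)) (at x)" for x
  proof -
    have "(ln has_real_derivative h x powr (-1)) (at (h x))"
      using pos[of x] by (auto intro!: derivative_eq_intros simp: powr_minus divide_simps)
    from has_derivative_compose[OF C_k_has_derivative[OF smooth_C_k[OF assms(1), of "Suc 0"]]
        this[unfolded has_field_derivative_def]]
    show ?thesis by simp
  qed
  \<comment> \<open>One differentiation turns the logarithm into \<open>h powr (-1)\<close>, whose
    regularity is known; the surplus order is dropped afterwards.\<close>
  have "C_k (Suc k) (\<lambda>x. ln (h x))"
    by (rule C_k_SucI[OF der])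
      (intro C_k_mult C_k_powr assms; use smooth_C_k[OF assms(1), of "Suc k"] in simp)
  then show "C_k k (\<lambda>x. ln (h x))"
    by (rule C_k_SucD)
qed

lemma smooth_inner_const: "smooth (\<lambda>x. (x::'a::euclidean_space) \<bullet> c)"
  unfolding smooth_def
proof
  fix k
  have "C_k (Suc k) (\<lambda>x. (x::'a::euclidean_space) \<bullet> c)"
    by (rule C_k_SucI[where \<phi>' = "\<lambda>x b. b \<bullet> c"]) (auto intro!: derivative_eq_intros C_k_const)
  then show "C_k k (\<lambda>x. (x::'a::euclidean_space) \<bullet> c)"
    by (rule C_k_SucD)
qed

lemma smooth_norm_square: "smooth (\<lambda>x. (norm (x - c::'a::euclidean_space))\<^sup>2)"
proof -
  have "(\<lambda>x. (norm (x - c))\<^sup>2) = (\<lambda>x. \<Sum>b\<in>Basis. (x \<bullet> b - c \<bullet> b)\<^sup>2)"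
    by (intro ext, subst power2_norm_eq_inner, subst euclidean_inner)
      (simp only: power2_eq_square inner_diff_left)
  then show ?thesis
    by (auto intro!: smooth_sum smooth_power smooth_diff smooth_inner_const smooth_const)
qed

text \<open>The functions t^(-j) exp (-1/t), extended by zero. The whole family is taken because its
  span is closed under differentiation, so that smoothness becomes an induction with
  \<open>j\<close> arbitrary.\<close>

definition exp_flat :: "nat \<Rightarrow> real \<Rightarrow> real" where
  "exp_flat j t = (if t \<le> 0 then 0 else inverse t ^ j / exp (inverse t))"

lemma exp_flat_tendsto_0: "(exp_flat j \<longlongrightarrow> 0) (at 0)"
proof -
  have "((\<lambda>t::real. inverse t ^ j / exp (inverse t)) \<longlongrightarrow> 0) (at_right 0)"
    by (rule filterlim_compose[OF tendsto_power_div_exp_0 filterlim_inverse_at_top_right])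
  then have "(exp_flat j \<longlongrightarrow> 0) (at_right 0)"
    by (rule Lim_transform_eventually) (auto simp: eventually_at_filter exp_flat_def)
  moreover have "(exp_flat j \<longlongrightarrow> 0) (at_left 0)"
    by (rule Lim_transform_eventually[OF tendsto_const])
      (auto simp: eventually_at_filter exp_flat_def)
  ultimately show ?thesis
    by (simp add: filterlim_split_at)
qed

lemma exp_flat_has_derivative:
  "(exp_flat j has_real_derivative exp_flat (j + 2) t - j * exp_flat (j + 1) t) (at t)"
proof -
  consider "t < 0" | "t = 0" | "t > 0" by linarith
  then show ?thesis
  proof cases
    case 1
    have "((\<lambda>t. 0) has_real_derivative 0) (at t)" by simp
    moreover have "\<forall>\<^sub>F s in nhds t. exp_flat j s = 0"
      using eventually_nhds_in_open[of "{..<0}" t] 1 by (auto simp: exp_flat_def elim: eventually_mono)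
    ultimately have "(exp_flat j has_real_derivative 0) (at t)"
      by (subst DERIV_cong_ev[OF refl _ refl])
    then show ?thesis using 1 by (simp add: exp_flat_def)
  next
    case 2
    \<comment> \<open>At 0 the difference quotient of \<open>exp_flat j\<close> is
      \<open>exp_flat (j + 1)\<close> itself, so the limit already proved gives the derivative
      0.\<close>
    have "((\<lambda>h. (exp_flat j (0 + h) - exp_flat j 0) / h) \<longlongrightarrow> 0) (at 0)"
      by (rule Lim_transform_eventually[OF exp_flat_tendsto_0[of "j + 1"]])
        (auto simp: exp_flat_def eventually_at_filter divide_simps)
    then show ?thesis using 2 by (simp add: DERIV_def exp_flat_def)
  next
    case 3
    have "((\<lambda>t. inverse t ^ j / exp (inverse t)) has_real_derivative
        exp_flat (j + 2) t - j * exp_flat (j + 1) t) (at t)"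
    proof -
      have "((\<lambda>t. inverse t ^ j * exp (- inverse t)) has_real_derivative
          (real j * inverse t ^ (j - 1) * (- (inverse t)\<^sup>2)) * exp (- inverse t)
            + inverse t ^ j * (exp (- inverse t) * (inverse t)\<^sup>2)) (at t)"
        using 3 by (auto intro!: derivative_eq_intros simp: power2_eq_square)
      \<comment> \<open>The split on \<open>j\<close> is for the truncated \<open>j - 1\<close> at
        \<open>j = 0\<close>, where the factor \<open>real j\<close> kills the term.\<close>
      moreover have "(real j * inverse t ^ (j - 1) * (- (inverse t)\<^sup>2)) * exp (- inverse t)
            + inverse t ^ j * (exp (- inverse t) * (inverse t)\<^sup>2)
          = exp_flat (j + 2) t - j * exp_flat (j + 1) t"
        using 3 by (cases j) (auto simp: exp_flat_def exp_minus divide_simps power2_eq_square)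
      ultimately show ?thesis by (simp add: exp_minus divide_inverse)
    qed
    moreover have "\<forall>\<^sub>F s in nhds t. exp_flat j s = inverse s ^ j / exp (inverse s)"
      using eventually_nhds_in_open[of "{0<..}" t] 3 by (auto simp: exp_flat_def elim: eventually_mono)
    ultimately show ?thesis
      by (subst DERIV_cong_ev[OF refl _ refl])
  qed
qed

lemma C_k_exp_flat:
  assumes "smooth h"
  shows "C_k k (\<lambda>x. exp_flat j (h x))"
proof (induction k arbitrary: j)
  case 0
  have "continuous_on UNIV (exp_flat j)"
    using exp_flat_has_derivative
    by (meson DERIV_isCont continuous_at_imp_continuous_on)
  then show ?case
    using smooth_C_k[OF assms, of 0] continuous_on_compose2[of UNIV "exp_flat j" UNIV h] by simp
next
  case (Suc k)
  have h: "C_k (Suc k) h" using assms by (auto simp: smooth_def)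
  have der: "((\<lambda>x. exp_flat j (h x)) has_derivative
      (\<lambda>b. (exp_flat (j + 2) (h x) + (- real j) * exp_flat (j + 1) (h x))
         * frechet_derivative h (at x) b)) (at x)" (is "(_ has_derivative (\<lambda>b. ?e x * _)) _") for x
    using has_derivative_compose[OF C_k_has_derivative[OF h]
        exp_flat_has_derivative[unfolded has_field_derivative_def]]
    by simp
  show ?case
  proof (rule C_k_SucI[OF der])
    fix b :: 'a
    assume "b \<in> Basis"
    then show "C_k k (\<lambda>x. ?e x * frechet_derivative h (at x) b)"
      using h by (intro C_k_mult C_k_add C_k_const Suc.IH) auto
  qed
qed

lemma smooth_exp_flat: "smooth h \<Longrightarrow> smooth (\<lambda>x. exp_flat j (h x))"
  by (simp add: smooth_def C_k_exp_flat[unfolded smooth_def])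

section \<open>Gradients and test functions\<close>

lemma grad_eqI:
  assumes "(\<phi> has_derivative (\<lambda>h. g \<bullet> h)) (at x)"
  shows "grad \<phi> x = g"
  by (simp add: grad_def euclidean_representation flip: frechet_derivative_at[OF assms])

lemma smooth_has_derivative:
  assumes "smooth \<phi>"
  shows "(\<phi> has_derivative (\<lambda>h. grad \<phi> x \<bullet> h)) (at x)"
proof -
  have d: "(\<phi> has_derivative frechet_derivative \<phi> (at x)) (at x)"
    by (rule C_k_has_derivative[OF smooth_C_k[OF assms, of "Suc 0"]])
  then have lin: "linear (frechet_derivative \<phi> (at x))"
    by (rule has_derivative_linear)
  have "frechet_derivative \<phi> (at x) h = grad \<phi> x \<bullet> h" for h
  proof -
    have "frechet_derivative \<phi> (at x) h = frechet_derivative \<phi> (at x) (\<Sum>b\<in>Basis. (h \<bullet> b) *\<^sub>R b)"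
      by (simp add: euclidean_representation)
    also have "\<dots> = grad \<phi> x \<bullet> h"
      unfolding linear_sum[OF lin] linear_cmul[OF lin] grad_def inner_sum_left inner_scaleR_left
      by (intro sum.cong refl) (simp add: inner_commute mult.commute)
    finally show ?thesis .
  qed
  then show ?thesis using d by presburger
qed

lemma smooth_continuous: "smooth \<phi> \<Longrightarrow> continuous_on S \<phi>"
  using smooth_C_k[of \<phi> 0] continuous_on_subset by auto

lemma smooth_grad_continuous:
  assumes "smooth \<phi>"
  shows "continuous_on S (grad \<phi>)"
proof -
  have "continuous_on UNIV (\<lambda>x. frechet_derivative \<phi> (at x) b)" if "b \<in> Basis" for b
    using smooth_C_k[OF assms, of 1] that by simp
  then have "continuous_on UNIV (grad \<phi>)"
    unfolding grad_def[abs_def] by (intro continuous_intros) auto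
  then show ?thesis by (rule continuous_on_subset) simp
qed

lemma grad_const: "grad (\<lambda>x. c) x = 0"
  by (rule grad_eqI) (auto intro!: derivative_eq_intros)

lemma grad_add: "smooth \<phi> \<Longrightarrow> smooth \<psi> \<Longrightarrow> grad (\<lambda>x. \<phi> x + \<psi> x) x = grad \<phi> x + grad \<psi> x"
  by (rule grad_eqI) (auto intro!: derivative_eq_intros smooth_has_derivative simp: inner_add_left)

lemma grad_mult:
  "smooth \<phi> \<Longrightarrow> smooth \<psi> \<Longrightarrow> grad (\<lambda>x. \<phi> x * \<psi> x) x = \<phi> x *\<^sub>R grad \<psi> x + \<psi> x *\<^sub>R grad \<phi> x"
  by (rule grad_eqI)
    (auto intro!: derivative_eq_intros smooth_has_derivative simp: inner_add_left mult.commute)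

lemma grad_cmult: "smooth \<phi> \<Longrightarrow> grad (\<lambda>x. c * \<phi> x) x = c *\<^sub>R grad \<phi> x"
  using grad_mult[OF smooth_const] by (simp add: grad_const)

lemma grad_compose:
  assumes "smooth \<phi>" and "(G has_real_derivative G') (at (\<phi> x))"
  shows "grad (\<lambda>x. G (\<phi> x)) x = G' *\<^sub>R grad \<phi> x"
  by (rule grad_eqI)
    (use has_derivative_compose[OF smooth_has_derivative[OF assms(1)] assms(2)[unfolded has_field_derivative_def]]
      in simp)

lemma C0_infinity_smooth: "\<phi> \<in> C0_infinity \<Omega> \<Longrightarrow> smooth \<phi>"
  by (simp add: C0_infinity_def)

text \<open>The way nonlinear functions enter: for smooth G with G 0 = 0, the composition G (\<phi>
  x) vanishes wherever \<phi> does, so its support stays compact in \<Omega>.\<close>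

lemma C0_infinity_supportI:
  assumes "\<phi> \<in> C0_infinity \<Omega>" and "smooth \<psi>" and "\<And>x. \<phi> x = 0 \<Longrightarrow> \<psi> x = 0"
  shows "\<psi> \<in> C0_infinity \<Omega>"
proof -
  have "closure {x. \<psi> x \<noteq> 0} \<subseteq> closure {x. \<phi> x \<noteq> 0}"
    using assms(3) by (intro closure_mono) auto
  moreover from this have "compact (closure {x. \<psi> x \<noteq> 0})"
    using assms(1) unfolding C0_infinity_def
    by (metis (mono_tags, lifting) bounded_subset closed_closure compact_eq_bounded_closed mem_Collect_eq)
  ultimately show ?thesis using assms by (auto simp: C0_infinity_def)
qed

lemma C0_infinity_zero: "(\<lambda>x. 0) \<in> C0_infinity \<Omega>"
  by (simp add: C0_infinity_def smooth_const)

lemma C0_infinity_add: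
  assumes "\<phi> \<in> C0_infinity \<Omega>" and "\<psi> \<in> C0_infinity \<Omega>"
  shows "(\<lambda>x. \<phi> x + \<psi> x) \<in> C0_infinity \<Omega>"
proof -
  have "closure {x. \<phi> x + \<psi> x \<noteq> 0} \<subseteq> closure ({x. \<phi> x \<noteq> 0} \<union> {x. \<psi> x \<noteq> 0})"
    by (intro closure_mono) auto
  then have sub: "closure {x. \<phi> x + \<psi> x \<noteq> 0} \<subseteq> closure {x. \<phi> x \<noteq> 0} \<union> closure {x. \<psi> x \<noteq> 0}"
    by (simp add: closure_Un)
  moreover have "compact (closure {x. \<phi> x \<noteq> 0} \<union> closure {x. \<psi> x \<noteq> 0})"
    using assms by (intro compact_Un) (auto simp: C0_infinity_def)
  ultimately have "compact (closure {x. \<phi> x + \<psi> x \<noteq> 0})"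
    using sub by (meson bounded_subset closed_closure compact_eq_bounded_closed)
  then show ?thesis
    using sub assms by (auto simp: C0_infinity_def intro: smooth_add)
qed

lemma C0_infinity_mult:
  assumes "\<phi> \<in> C0_infinity \<Omega>" and "smooth \<psi>"
  shows "(\<lambda>x. \<psi> x * \<phi> x) \<in> C0_infinity \<Omega>"
  by (rule C0_infinity_supportI[OF assms(1)])
    (auto intro: smooth_mult assms C0_infinity_smooth)

lemma C0_infinity_cmult: "\<phi> \<in> C0_infinity \<Omega> \<Longrightarrow> (\<lambda>x. c * \<phi> x) \<in> C0_infinity \<Omega>"
  by (rule C0_infinity_mult[OF _ smooth_const])

lemma C0_infinity_sum:
  "finite I \<Longrightarrow> (\<And>i. i \<in> I \<Longrightarrow> \<phi> i \<in> C0_infinity \<Omega>) \<Longrightarrow> (\<lambda>x. \<Sum>i\<in>I. \<phi> i x) \<in> C0_infinity \<Omega>"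
  by (induction I rule: finite_induct) (auto intro: C0_infinity_zero C0_infinity_add)

lemma C0_infinity_eq_0: "\<phi> \<in> C0_infinity \<Omega> \<Longrightarrow> x \<notin> \<Omega> \<Longrightarrow> \<phi> x = 0"
  using closure_subset[of "{x. \<phi> x \<noteq> 0}"] unfolding C0_infinity_def by blast

lemma grad_eq_0:
  assumes "x \<notin> closure {x. \<phi> x \<noteq> 0}"
  shows "grad \<phi> x = 0"
proof (rule grad_eqI)
  have "((\<lambda>x. 0) has_derivative (\<lambda>h. 0 \<bullet> h)) (at x)" by simp
  then show "(\<phi> has_derivative (\<lambda>h. 0 \<bullet> h)) (at x)"
    by (rule has_derivative_transform_within_open[of _ _ _ _ "- closure {x. \<phi> x \<noteq> 0}"])
      (use assms closure_subset[of "{x. \<phi> x \<noteq> 0}"] in auto)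
qed

lemma C0_infinity_grad_eq_0: "\<phi> \<in> C0_infinity \<Omega> \<Longrightarrow> x \<notin> \<Omega> \<Longrightarrow> grad \<phi> x = 0"
  by (rule grad_eq_0) (auto simp: C0_infinity_def)

lemma bounded_of_compact_support:
  fixes g :: "'a::euclidean_space \<Rightarrow> 'b::real_normed_vector"
  assumes "continuous_on UNIV g" and "compact K" and "\<And>x. x \<notin> K \<Longrightarrow> g x = 0"
  obtains C where "C > 0" and "\<And>x. norm (g x) \<le> C"
proof -
  have "bounded (g ` K)"
    using assms by (intro compact_imp_bounded compact_continuous_image) (auto intro: continuous_on_subset)
  then obtain B where B: "B > 0" "\<And>x. x \<in> K \<Longrightarrow> norm (g x) \<le> B"
    by (auto simp: bounded_pos)
  show thesis
    using assms(3) B by (intro that[of B]) (metis less_imp_le norm_zero)+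
qed

lemma C0_infinity_bounded:
  assumes "\<phi> \<in> C0_infinity \<Omega>"
  obtains C where "C > 0" and "\<And>x. \<bar>\<phi> x\<bar> \<le> C" and "\<And>x. norm (grad \<phi> x) \<le> C"
proof -
  let ?K = "closure {x. \<phi> x \<noteq> 0}"
  have K: "compact ?K" and s: "smooth \<phi>" using assms by (auto simp: C0_infinity_def)
  obtain C1 where C1: "C1 > 0" "\<And>x. norm (\<phi> x) \<le> C1"
    by (rule bounded_of_compact_support[OF smooth_continuous[OF s] K])
      (use closure_subset[of "{x. \<phi> x \<noteq> 0}"] in auto)
  obtain C2 where C2: "C2 > 0" "\<And>x. norm (grad \<phi> x) \<le> C2"
    by (rule bounded_of_compact_support[OF smooth_grad_continuous[OF s] K]) (auto intro: grad_eq_0)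
  show thesis
    by (rule that[of "max C1 C2"]) (use C1 C2 in \<open>auto simp: le_max_iff_disj\<close>)
qed

section \<open>Bump and cutoff functions\<close>

lemma bump_exists:
  fixes c :: "'a::euclidean_space"
  assumes "r > 0" and "cball c r \<subseteq> \<Omega>"
  obtains \<beta> where "\<beta> \<in> C0_infinity \<Omega>" and "\<And>x. 0 \<le> \<beta> x" and "\<And>x. \<beta> x \<le> 1"
    and "\<And>x. \<beta> x > 0 \<longleftrightarrow> x \<in> ball c r"
proof
  \<comment> \<open>The squared distance is used because the distance itself is not smooth at the
    centre.\<close>
  define \<beta> where "\<beta> x = exp_flat 0 (r\<^sup>2 - (norm (x - c))\<^sup>2)" for x
  have pos: "\<beta> x > 0 \<longleftrightarrow> x \<in> ball c r" for x
  proof -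
    have "\<beta> x > 0 \<longleftrightarrow> (norm (x - c))\<^sup>2 < r\<^sup>2"
      by (simp add: \<beta>_def exp_flat_def)
    also have "\<dots> \<longleftrightarrow> norm (x - c) < r"
      using \<open>r > 0\<close> by (simp add: power_mono_iff linorder_not_le[symmetric])
    finally show ?thesis by (simp add: dist_norm norm_minus_commute)
  qed
  show "0 \<le> \<beta> x" "\<beta> x \<le> 1" for x
    by (auto simp: \<beta>_def exp_flat_def divide_simps)
  have "{x. \<beta> x \<noteq> 0} = ball c r"
    using pos \<open>\<And>x. 0 \<le> \<beta> x\<close> by (force simp: less_le)
  moreover have "smooth \<beta>"
    unfolding \<beta>_def[abs_def] by (intro smooth_exp_flat smooth_diff smooth_const smooth_norm_square)
  ultimately show "\<beta> \<in> C0_infinity \<Omega>"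
    using assms by (auto simp: C0_infinity_def)
  show "\<beta> x > 0 \<longleftrightarrow> x \<in> ball c r" for x by (rule pos)
qed

text \<open>Finitely many bumps cover \<open>K\<close>, their sum has a positive minimum there, and
  it is rescaled by that minimum. In \<open>equation\<close> a multiple of \<zeta> is added to a
  test function supported in \<open>K\<close> to make it nonnegative.\<close>

lemma cutoff_exists:
  fixes \<Omega> :: "'a::euclidean_space set"
  assumes "open \<Omega>" and "compact K" and "K \<subseteq> \<Omega>"
  obtains \<zeta> where "\<zeta> \<in> C0_infinity \<Omega>" and "\<And>x. 0 \<le> \<zeta> x" and "\<And>x. x \<in> K \<Longrightarrow> 1 \<le> \<zeta> x"
proof -
  have "\<exists>\<beta>. \<beta> \<in> C0_infinity \<Omega> \<and> (\<forall>y. 0 \<le> \<beta> y) \<and> \<beta> x > 0" if x: "x \<in> K" for x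
  proof -
    obtain r where "r > 0" "cball x r \<subseteq> \<Omega>"
      using assms(1,3) x open_contains_cball_eq by blast
    then show ?thesis
      using bump_exists[of r x \<Omega>] by (metis centre_in_ball)
  qed
  then obtain \<beta> where \<beta>: "\<And>x. x \<in> K \<Longrightarrow> \<beta> x \<in> C0_infinity \<Omega> \<and> (\<forall>y. 0 \<le> \<beta> x y) \<and> \<beta> x x > 0"
    by metis
  have "open {y. \<beta> x y > 0}" if "x \<in> K" for x
    using \<beta>[OF that] smooth_continuous[OF C0_infinity_smooth]
    by (intro open_Collect_less) auto
  then obtain D where D: "D \<subseteq> K" "finite D" "K \<subseteq> (\<Union>x\<in>D. {y. \<beta> x y > 0})"
    using \<beta> by (elim compactE_image[OF \<open>compact K\<close>, of K "\<lambda>x. {y. \<beta> x y > 0}"]) auto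
  define \<xi> where "\<xi> = (\<lambda>y. \<Sum>x\<in>D. \<beta> x y)"
  have \<xi>: "\<xi> \<in> C0_infinity \<Omega>" "0 \<le> \<xi> y" for y
    unfolding \<xi>_def using D \<beta> by (auto intro!: C0_infinity_sum sum_nonneg)
  have \<xi>_pos: "\<xi> y > 0" if y: "y \<in> K" for y
  proof -
    obtain x where "x \<in> D" "\<beta> x y > 0" using D y by auto
    then show ?thesis
      unfolding \<xi>_def using D \<beta> by (intro sum_pos2[of D x]) auto
  qed
  obtain c where c: "c > 0" "\<And>y. y \<in> K \<Longrightarrow> c \<le> \<xi> y"
  proof (cases "K = {}")
    case False
    then obtain y where "y \<in> K" "\<And>z. z \<in> K \<Longrightarrow> \<xi> y \<le> \<xi> z"
      using continuous_attains_inf[OF \<open>compact K\<close> False smooth_continuous[OF C0_infinity_smooth[OF \<xi>(1)]]]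
      by blast
    then show thesis using \<xi>_pos that by blast
  qed (use that[of 1] in auto)
  show thesis
    by (rule that[of "\<lambda>y. inverse c * \<xi> y"])
      (use c \<xi> C0_infinity_cmult[OF \<xi>(1), of "inverse c"] in \<open>auto simp: field_simps\<close>)
qed

section \<open>Integration of test functions\<close>

lemma nn_integral_lborel_translate:
  fixes c :: "'a::euclidean_space"
  assumes [measurable]: "g \<in> borel_measurable borel"
  shows "(\<integral>\<^sup>+ x. g (x + c) \<partial>lborel) = (\<integral>\<^sup>+ x. g x \<partial>lborel)"
proof -
  have "(\<integral>\<^sup>+ x. g x \<partial>lborel) = (\<integral>\<^sup>+ x. g x \<partial>distr lborel borel ((+) c))"
    by (simp add: lborel_distr_plus)
  also have "\<dots> = (\<integral>\<^sup>+ x. g (x + c) \<partial>lborel)"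
    by (subst nn_integral_distr) (auto simp: add.commute)
  finally show ?thesis by simp
qed

lemma integral_lborel_translate:
  fixes g :: "'a::euclidean_space \<Rightarrow> real"
  assumes [measurable]: "g \<in> borel_measurable borel"
  shows "(LINT x|lborel. g (x + c)) = (LINT x|lborel. g x)"
proof -
  have "(LINT x|lborel. g x) = (LINT x|distr lborel borel ((+) c). g x)"
    by (simp add: lborel_distr_plus)
  also have "\<dots> = (LINT x|lborel. g (x + c))"
    by (subst integral_distr) (auto simp: add.commute)
  finally show ?thesis by simp
qed

lemma integrable_lborel_translate:
  fixes g :: "'a::euclidean_space \<Rightarrow> real"
  assumes "integrable lborel g"
  shows "integrable lborel (\<lambda>x. g (x + c))"
proof -
  have [measurable]: "g \<in> borel_measurable borel" using assms by simp
  have "integrable (distr lborel borel ((+) c)) g"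
    using assms by (simp add: lborel_distr_plus)
  then have "integrable lborel (\<lambda>x. g (c + x))"
    by (subst (asm) integrable_distr_eq) auto
  then show ?thesis by (simp add: add.commute)
qed

lemma integrable_continuous_compact_support:
  fixes g :: "'a::euclidean_space \<Rightarrow> 'b::{banach, second_countable_topology}"
  assumes "continuous_on UNIV g" and "compact K" and "\<And>x. x \<notin> K \<Longrightarrow> g x = 0"
  shows "integrable lborel g"
proof -
  have "integrable lborel (\<lambda>x. indicator K x *\<^sub>R g x)"
    using assms by (intro borel_integrable_compact) (auto intro: continuous_on_subset)
  also have "(\<lambda>x. indicator K x *\<^sub>R g x) = g"
    using assms(3) by (auto simp: indicator_def)
  finally show ?thesis .
qed

lemma C0_infinity_support:
  assumes "\<phi> \<in> C0_infinity \<Omega>"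
  obtains K where "compact K" and "K \<subseteq> \<Omega>" and "\<And>x. x \<notin> K \<Longrightarrow> \<phi> x = 0" and "\<And>x. x \<notin> K \<Longrightarrow> grad \<phi> x = 0"
proof
  show "compact (closure {x. \<phi> x \<noteq> 0})" and "closure {x. \<phi> x \<noteq> 0} \<subseteq> \<Omega>"
    using assms by (auto simp: C0_infinity_def)
  show "\<And>x. x \<notin> closure {x. \<phi> x \<noteq> 0} \<Longrightarrow> \<phi> x = 0"
    using closure_subset[of "{x. \<phi> x \<noteq> 0}"] by blast
qed (rule grad_eq_0)

lemma smooth_measurable:
  assumes "smooth \<phi>"
  shows "\<phi> \<in> borel_measurable borel" and "grad \<phi> \<in> borel_measurable borel"
  using smooth_continuous[OF assms, of UNIV] smooth_grad_continuous[OF assms, of UNIV]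
  by (auto intro: borel_measurable_continuous_onI)

lemma integrable_C0_infinity_comp:
  assumes "\<phi> \<in> C0_infinity \<Omega>" and "continuous_on UNIV g" and "g (0, 0) = 0"
  shows "integrable lborel (\<lambda>x. g (\<phi> x, grad \<phi> x) :: real)"
proof -
  obtain K where K: "compact K" "\<And>x. x \<notin> K \<Longrightarrow> \<phi> x = 0" "\<And>x. x \<notin> K \<Longrightarrow> grad \<phi> x = 0"
    using C0_infinity_support[OF assms(1)] by metis
  show ?thesis
  proof (rule integrable_continuous_compact_support[OF _ K(1)])
    show "continuous_on UNIV (\<lambda>x. g (\<phi> x, grad \<phi> x))"
      using assms(1) by (intro continuous_on_compose2[OF assms(2)] continuous_intros)
        (auto intro: smooth_continuous smooth_grad_continuous C0_infinity_smooth)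
  qed (use K assms(3) in auto)
qed

lemma continuous_on_norm_powr: "q > 0 \<Longrightarrow> continuous_on S g \<Longrightarrow> continuous_on S (\<lambda>x. norm (g x) powr q)"
  by (intro continuous_on_powr' continuous_intros) auto

lemma integrable_C0_infinity_powr:
  assumes "\<phi> \<in> C0_infinity \<Omega>" and "q > 0"
  shows "integrable lborel (\<lambda>x. norm (\<phi> x) powr q)"
    and "integrable lborel (\<lambda>x. norm (grad \<phi> x) powr q)"
proof -
  have "continuous_on UNIV (\<lambda>z::real \<times> 'a. norm (fst z) powr q)"
    and "continuous_on UNIV (\<lambda>z::real \<times> 'a. norm (snd z) powr q)"
    by (intro continuous_on_norm_powr[OF assms(2)] continuous_intros)+
  from this[THEN integrable_C0_infinity_comp[OF assms(1)]] assms(2)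
  show "integrable lborel (\<lambda>x. norm (\<phi> x) powr q)"
    and "integrable lborel (\<lambda>x. norm (grad \<phi> x) powr q)"
    by simp_all
qed

lemma line_has_derivative:
  assumes "smooth \<phi>"
  shows "((\<lambda>t. \<phi> (x + t *\<^sub>R z)) has_real_derivative grad \<phi> (x + t *\<^sub>R z) \<bullet> z) (at t)"
proof -
  have "((\<lambda>t. x + t *\<^sub>R z) has_derivative (\<lambda>h. h *\<^sub>R z)) (at t)"
    by (auto intro!: derivative_eq_intros)
  from has_derivative_compose[OF this smooth_has_derivative[OF assms]]
  show ?thesis by (simp add: has_field_derivative_def mult.commute[of _ "grad _ _ \<bullet> _"] fun_eq_iff)
qed

lemma C0_infinity_lipschitz:
  assumes "smooth \<phi>" and "\<And>x. norm (grad \<phi> x) \<le> C"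
  shows "\<bar>\<phi> (x + z) - \<phi> x\<bar> \<le> C * norm z"
proof -
  have "norm (\<phi> (x + z) - \<phi> x) \<le> C * norm (x + z - x)"
  proof (rule differentiable_bound[of UNIV])
    show "(\<phi> has_derivative (\<lambda>h. grad \<phi> y \<bullet> h)) (at y within UNIV)" for y
      using smooth_has_derivative[OF assms(1)] by simp
    show "onorm (\<lambda>h. grad \<phi> y \<bullet> h) \<le> C" for y
    proof (rule onorm_le)
      fix h
      show "norm (grad \<phi> y \<bullet> h) \<le> C * norm h"
        using Cauchy_Schwarz_ineq2[of "grad \<phi> y" h] mult_right_mono[OF assms(2)[of y], of "norm h"] by simp
    qed
  qed auto
  then show ?thesis by simp
qed

text \<open>Translation invariance makes every difference quotient of \<phi> integrate to zero, and
  dominated convergence passes to the derivative. The majorant is the Lipschitz bound on the ball of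
  radius R + |z|, since a shift by \<open>e n *\<^sub>R z\<close> moves points by at most
  |z|.\<close>

lemma integral_grad_C0_infinity:
  fixes \<phi> :: "'a::euclidean_space \<Rightarrow> real"
  assumes "\<phi> \<in> C0_infinity \<Omega>"
  shows "(LINT x|lborel. grad \<phi> x \<bullet> z) = 0"
proof -
  have s: "smooth \<phi>" by (rule C0_infinity_smooth[OF assms])
  note [measurable] = smooth_measurable[OF s]
  obtain C where C: "C > 0" "\<And>x. norm (grad \<phi> x) \<le> C"
    using C0_infinity_bounded[OF assms] by metis
  obtain K where K: "compact K" "\<And>x. x \<notin> K \<Longrightarrow> \<phi> x = 0"
    using C0_infinity_support[OF assms] by metis
  obtain R where R: "\<And>x. x \<in> K \<Longrightarrow> norm x \<le> R"
    using compact_imp_bounded[OF K(1)] by (auto simp: bounded_iff)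
  define e where "e n = inverse (real (Suc n))" for n
  have e: "0 < e n" "e n \<le> 1" for n
    unfolding e_def by (auto simp: field_simps)
  have e0: "e \<longlonglongrightarrow> 0"
    unfolding e_def by (rule LIMSEQ_inverse_real_of_nat)
  define d where "d n x = (\<phi> (x + e n *\<^sub>R z) - \<phi> x) / e n" for n x
  have int_\<phi>: "integrable lborel \<phi>"
    using integrable_C0_infinity_comp[OF assms, of fst] by (simp add: continuous_on_fst)
  have d0: "integral\<^sup>L lborel (d n) = 0" for n
    unfolding d_def
    by (simp add: Bochner_Integration.integral_diff integrable_lborel_translate int_\<phi> integral_lborel_translate)
  have "(\<lambda>n. integral\<^sup>L lborel (d n)) \<longlonglongrightarrow> (LINT x|lborel. grad \<phi> x \<bullet> z)"
  proof (rule integral_dominated_convergence[where w = "\<lambda>x. (C * norm z) * indicator (cball 0 (R + norm z)) x"])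
    show "integrable lborel (\<lambda>x. (C * norm z) * indicator (cball 0 (R + norm z)) x)"
      by (intro integrable_mult_right integrable_real_indicator) (use emeasure_lborel_cball_finite[of 0 "R + norm z"] in \<open>auto simp: top.not_eq_extremum\<close>)
    show "AE x in lborel. (\<lambda>n. d n x) \<longlonglongrightarrow> grad \<phi> x \<bullet> z"
    proof (rule AE_I2)
      fix x
      have "((\<lambda>h. (\<phi> (x + h *\<^sub>R z) - \<phi> x) / h) \<longlongrightarrow> grad \<phi> x \<bullet> z) (at 0)"
        using line_has_derivative[OF s, of x z 0] by (simp add: DERIV_def)
      moreover have "filterlim e (at 0) sequentially"
        using e0 e by (auto simp: filterlim_at intro!: always_eventually less_imp_neq[symmetric])
      ultimately show "(\<lambda>n. d n x) \<longlonglongrightarrow> grad \<phi> x \<bullet> z"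
        unfolding d_def by (rule filterlim_compose)
    qed
    show "AE x in lborel. norm (d n x) \<le> (C * norm z) * indicator (cball 0 (R + norm z)) x" for n
    proof (rule AE_I2)
      fix x
      show "norm (d n x) \<le> (C * norm z) * indicator (cball 0 (R + norm z)) x"
      proof (cases "norm x \<le> R + norm z")
        case True
        have "\<bar>\<phi> (x + e n *\<^sub>R z) - \<phi> x\<bar> \<le> C * (e n * norm z)"
          using C0_infinity_lipschitz[OF s C(2), of x "e n *\<^sub>R z"] e[of n] by simp
        then show ?thesis
          using True e[of n] by (simp add: d_def abs_divide divide_simps mult_ac)
      next
        case False
        have "norm (e n *\<^sub>R z) \<le> norm z"
          using e[of n] by (simp add: mult_left_le_one_le)
        then have "R < norm (x + e n *\<^sub>R z)" and "R < norm x"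
          using False norm_triangle_ineq2[of x "- (e n *\<^sub>R z)"] norm_ge_zero[of z]
            unfolding norm_minus_cancel diff_minus_eq_add not_le by linarith+
        then have "x + e n *\<^sub>R z \<notin> K" "x \<notin> K" using R by (meson not_le)+
        then show ?thesis using C(1) by (simp add: d_def K)
      qed
    qed
  qed (auto simp: d_def[abs_def])
  then show ?thesis
    using d0 LIMSEQ_unique[OF tendsto_const] by fastforce
qed

lemma integral_by_parts_C0_infinity:
  assumes "\<phi> \<in> C0_infinity \<Omega>" and "smooth \<psi>"
  shows "(LINT x|lborel. \<psi> x * (grad \<phi> x \<bullet> b)) = - (LINT x|lborel. (grad \<psi> x \<bullet> b) * \<phi> x)"
proof -
  have s: "smooth \<phi>" by (rule C0_infinity_smooth[OF assms(1)])
  obtain K where K: "compact K" "\<And>x. x \<notin> K \<Longrightarrow> \<phi> x = 0" "\<And>x. x \<notin> K \<Longrightarrow> grad \<phi> x = 0"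
    using C0_infinity_support[OF assms(1)] by metis
  have i1: "integrable lborel (\<lambda>x. \<psi> x * (grad \<phi> x \<bullet> b))"
    by (rule integrable_continuous_compact_support[OF _ K(1)])
      (use K in \<open>auto intro!: continuous_intros smooth_continuous[OF assms(2)] smooth_grad_continuous[OF s]\<close>)
  have i2: "integrable lborel (\<lambda>x. (grad \<psi> x \<bullet> b) * \<phi> x)"
    by (rule integrable_continuous_compact_support[OF _ K(1)])
      (use K in \<open>auto intro!: continuous_intros smooth_continuous[OF s] smooth_grad_continuous[OF assms(2)]\<close>)
  have "(LINT x|lborel. \<psi> x * (grad \<phi> x \<bullet> b)) + (LINT x|lborel. (grad \<psi> x \<bullet> b) * \<phi> x)
      = (LINT x|lborel. grad (\<lambda>x. \<psi> x * \<phi> x) x \<bullet> b)"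
    by (subst Bochner_Integration.integral_add[OF i1 i2, symmetric])
      (simp add: grad_mult assms(2) s inner_add_left mult.commute[of "\<phi> _"] del: Bochner_Integration.integral_add)
  also have "\<dots> = 0"
    by (rule integral_grad_C0_infinity[OF C0_infinity_mult[OF assms]])
  finally show ?thesis by simp
qed

lemma FTC_abs_le_nn_integral:
  fixes g g' :: "real \<Rightarrow> real"
  assumes "a \<le> b" and "\<And>t. (g has_real_derivative g' t) (at t)" and "continuous_on UNIV g'"
  shows "ennreal \<bar>g b - g a\<bar> \<le> (\<integral>\<^sup>+ t. ennreal \<bar>g' t\<bar> * indicator {a..b} t \<partial>lborel)"
proof -
  have i: "integrable lborel (\<lambda>t. indicator {a..b} t *\<^sub>R g' t)"
    using assms(3) by (intro borel_integrable_compact) (auto intro: continuous_on_subset)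
  have "g b - g a = (LINT t|lborel. indicator {a..b} t *\<^sub>R g' t)"
    using integral_FTC_Icc[OF assms(1), of g g']
    by (metis assms(2,3) continuous_on_subset has_real_derivative_iff_has_vector_derivative
        has_vector_derivative_at_within scaleR_conv_of_real top_greatest)
  then have "ennreal \<bar>g b - g a\<bar> \<le> ennreal (LINT t|lborel. norm (indicator {a..b} t *\<^sub>R g' t))"
    using integral_norm_bound[of lborel "\<lambda>t. indicator {a..b} t *\<^sub>R g' t"] by (simp add: ennreal_leI)
  also have "\<dots> = (\<integral>\<^sup>+ t. ennreal (norm (indicator {a..b} t *\<^sub>R g' t)) \<partial>lborel)"
    using i by (intro nn_integral_eq_integral[symmetric]) auto
  also have "\<dots> = (\<integral>\<^sup>+ t. ennreal \<bar>g' t\<bar> * indicator {a..b} t \<partial>lborel)"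
    by (intro nn_integral_cong) (auto simp: indicator_def)
  finally show ?thesis .
qed

text \<open>The increment is the integral of the derivative along the segment from x to x + z;
  Tonelli's theorem and translation invariance then give the bound. \<open>B'\<close> collects the
  segments that start in \<open>B\<close>, which keeps the estimate local.\<close>

lemma translation_estimate_smooth:
  fixes \<phi> :: "'a::euclidean_space \<Rightarrow> real"
  assumes s: "smooth \<phi>" and [measurable]: "B \<in> sets borel" "B' \<in> sets borel"
    and sub: "\<And>x t. x \<in> B \<Longrightarrow> 0 \<le> t \<Longrightarrow> t \<le> 1 \<Longrightarrow> x + t *\<^sub>R z \<in> B'"
  shows "(\<integral>\<^sup>+ x. ennreal \<bar>\<phi> (x + z) - \<phi> x\<bar> * indicator B x \<partial>lborel)
      \<le> ennreal (norm z) * (\<integral>\<^sup>+ x. ennreal (norm (grad \<phi> x)) * indicator B' x \<partial>lborel)"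
proof -
  note [measurable] = smooth_measurable[OF s]
  let ?I = "\<integral>\<^sup>+ x. ennreal (norm (grad \<phi> x)) * indicator B' x \<partial>lborel"
  have "(\<integral>\<^sup>+ x. ennreal \<bar>\<phi> (x + z) - \<phi> x\<bar> * indicator B x \<partial>lborel)
      \<le> (\<integral>\<^sup>+ x. \<integral>\<^sup>+ t. ennreal (norm z) * (ennreal (norm (grad \<phi> (x + t *\<^sub>R z))) * indicator B' (x + t *\<^sub>R z))
            * indicator {0..1::real} t \<partial>lborel \<partial>lborel)"
  proof (intro nn_integral_mono)
    fix x
    show "ennreal \<bar>\<phi> (x + z) - \<phi> x\<bar> * indicator B x \<le>
      (\<integral>\<^sup>+ t. ennreal (norm z) * (ennreal (norm (grad \<phi> (x + t *\<^sub>R z))) * indicator B' (x + t *\<^sub>R z))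
            * indicator {0..1::real} t \<partial>lborel)"
    proof (cases "x \<in> B")
      case True
      have "continuous_on UNIV (\<lambda>t. grad \<phi> (x + t *\<^sub>R z) \<bullet> z)"
        by (intro continuous_intros continuous_on_compose2[OF smooth_grad_continuous[OF s, of UNIV]]) auto
      from FTC_abs_le_nn_integral[OF zero_le_one line_has_derivative[OF s] this]
      have "ennreal \<bar>\<phi> (x + z) - \<phi> x\<bar>
          \<le> (\<integral>\<^sup>+ t. ennreal \<bar>grad \<phi> (x + t *\<^sub>R z) \<bullet> z\<bar> * indicator {0..1} t \<partial>lborel)"
        by simp
      also have "\<dots> \<le> (\<integral>\<^sup>+ t. ennreal (norm z) * (ennreal (norm (grad \<phi> (x + t *\<^sub>R z))) * indicator B' (x + t *\<^sub>R z))
            * indicator {0..1::real} t \<partial>lborel)"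
      proof (intro nn_integral_mono)
        fix t :: real
        have "\<bar>grad \<phi> (x + t *\<^sub>R z) \<bullet> z\<bar> \<le> norm z * norm (grad \<phi> (x + t *\<^sub>R z))"
          by (metis Cauchy_Schwarz_ineq2 mult.commute)
        then show "ennreal \<bar>grad \<phi> (x + t *\<^sub>R z) \<bullet> z\<bar> * indicator {0..1} t
          \<le> ennreal (norm z) * (ennreal (norm (grad \<phi> (x + t *\<^sub>R z))) * indicator B' (x + t *\<^sub>R z))
            * indicator {0..1::real} t"
          using sub[OF True, of t] by (auto simp: indicator_def ennreal_mult[symmetric] intro!: ennreal_leI)
      qed
      finally show ?thesis using True by simp
    qed simp
  qed
  also have "\<dots> = (\<integral>\<^sup>+ t. \<integral>\<^sup>+ x. ennreal (norm z) * (ennreal (norm (grad \<phi> (x + t *\<^sub>R z))) * indicator B' (x + t *\<^sub>R z))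
            * indicator {0..1::real} t \<partial>lborel \<partial>lborel)"
    by (rule lborel_pair.Fubini') measurable
  also have "\<dots> = (\<integral>\<^sup>+ t. ennreal (norm z) * ?I * indicator {0..1::real} t \<partial>lborel)"
  proof (intro nn_integral_cong)
    fix t :: real
    have "(\<integral>\<^sup>+ x. ennreal (norm (grad \<phi> (x + t *\<^sub>R z))) * indicator B' (x + t *\<^sub>R z) \<partial>lborel) = ?I"
      by (rule nn_integral_lborel_translate[of "\<lambda>x. ennreal (norm (grad \<phi> x)) * indicator B' x"]) measurable
    then show "(\<integral>\<^sup>+ x. ennreal (norm z) * (ennreal (norm (grad \<phi> (x + t *\<^sub>R z))) * indicator B' (x + t *\<^sub>R z))
            * indicator {0..1::real} t \<partial>lborel) = ennreal (norm z) * ?I * indicator {0..1::real} t"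
      by (simp add: nn_integral_multc nn_integral_cmult)
  qed
  also have "\<dots> = ennreal (norm z) * ?I"
    by (simp add: nn_integral_cmult)
  finally show ?thesis .
qed

section \<open>Hoelder's inequality\<close>

lemma Holder:
  fixes f g :: "'a \<Rightarrow> real"
  assumes pq: "p > 1" "q > 1" "1 / p + 1 / q = 1"
    and [measurable]: "f \<in> borel_measurable M" "g \<in> borel_measurable M"
    and f: "integrable M (\<lambda>x. \<bar>f x\<bar> powr p)" and g: "integrable M (\<lambda>x. \<bar>g x\<bar> powr q)"
  shows "integrable M (\<lambda>x. f x * g x)"
    and "(LINT x|M. \<bar>f x * g x\<bar>) \<le> (LINT x|M. \<bar>f x\<bar> powr p) powr (1 / p) * (LINT x|M. \<bar>g x\<bar> powr q) powr (1 / q)"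
proof -
  have young: "\<bar>a * b\<bar> \<le> \<bar>a\<bar> powr p / p + \<bar>b\<bar> powr q / q" for a b :: real
    using Youngs_inequality[OF pq, of "\<bar>a\<bar>" "\<bar>b\<bar>"] by (simp add: abs_mult)
  show int: "integrable M (\<lambda>x. f x * g x)"
  proof (rule Bochner_Integration.integrable_bound)
    show "integrable M (\<lambda>x. \<bar>f x\<bar> powr p / p + \<bar>g x\<bar> powr q / q)" using f g by simp
    show "AE x in M. norm (f x * g x) \<le> norm (\<bar>f x\<bar> powr p / p + \<bar>g x\<bar> powr q / q)"
      using young by (auto intro!: order_trans[OF _ abs_ge_self])
  qed simp
  let ?A = "LINT x|M. \<bar>f x\<bar> powr p" and ?B = "LINT x|M. \<bar>g x\<bar> powr q"
  have AB: "?A \<ge> 0" "?B \<ge> 0" by (auto intro: integral_nonneg_AE)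
  have z: "(LINT x|M. \<bar>f x * g x\<bar>) = 0" if "AE x in M. f x = 0 \<or> g x = 0"
    using integral_cong_AE[of "\<lambda>x. \<bar>f x * g x\<bar>" M "\<lambda>x. 0"] that by auto
  \<comment> \<open>Normalising by the two norms fails if one of them is zero; then the product
    vanishes almost everywhere.\<close>
  consider "?A = 0" | "?B = 0" | "?A > 0" "?B > 0" using AB by linarith
  then show "(LINT x|M. \<bar>f x * g x\<bar>) \<le> ?A powr (1 / p) * ?B powr (1 / q)"
  proof cases
    case 1
    then have "AE x in M. \<bar>f x\<bar> powr p = 0" using integral_nonneg_eq_0_iff_AE[OF f] by simp
    then have "(LINT x|M. \<bar>f x * g x\<bar>) = 0" by (intro z) auto
    then show ?thesis by simp
  next
    case 2
    then have "AE x in M. \<bar>g x\<bar> powr q = 0" using integral_nonneg_eq_0_iff_AE[OF g] by simp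
    then have "(LINT x|M. \<bar>f x * g x\<bar>) = 0" by (intro z) auto
    then show ?thesis by simp
  next
    case 3
    let ?a = "?A powr (1 / p)" and ?b = "?B powr (1 / q)"
    have ab: "?a > 0" "?b > 0" using 3 by auto
    have "(LINT x|M. \<bar>f x * g x\<bar> / (?a * ?b)) \<le> (LINT x|M. \<bar>f x\<bar> powr p / (p * ?A) + \<bar>g x\<bar> powr q / (q * ?B))"
    proof (rule integral_mono)
      show "integrable M (\<lambda>x. \<bar>f x * g x\<bar> / (?a * ?b))" using int by simp
      show "integrable M (\<lambda>x. \<bar>f x\<bar> powr p / (p * ?A) + \<bar>g x\<bar> powr q / (q * ?B))" using f g by simp
      fix x
      show "\<bar>f x * g x\<bar> / (?a * ?b) \<le> \<bar>f x\<bar> powr p / (p * ?A) + \<bar>g x\<bar> powr q / (q * ?B)"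
        using young[of "f x / ?a" "g x / ?b"] ab 3 pq
        by (simp add: abs_mult powr_divide powr_powr mult_ac)
    qed
    also have "\<dots> = ?A / (p * ?A) + ?B / (q * ?B)"
      using f g by simp
    also have "\<dots> = 1" using 3 pq by (simp add: field_simps)
    finally show ?thesis using ab by (simp add: field_simps)
  qed
qed

section \<open>The Gagliardo--Nirenberg--Sobolev inequality\<close>

lemma ennreal_power_le_imp_le:
  fixes x y :: ennreal
  assumes "x ^ k \<le> y ^ k" and "k > 0"
  shows "x \<le> y"
proof (cases x; cases y)
  fix a b assume ab: "0 \<le> a" "x = ennreal a" "0 \<le> b" "y = ennreal b"
  then have "a ^ k \<le> b ^ k" using assms(1) by (simp add: ennreal_power)
  then show ?thesis using ab assms(2) by (simp add: power_mono_iff ennreal_leI)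
next
  fix b assume "x = top" "0 \<le> b" "y = ennreal b"
  then show ?thesis using assms by (simp add: ennreal_power power_eq_top_ennreal_iff top_unique)
qed auto

lemma prod_mono_ennreal:
  fixes f g :: "'i \<Rightarrow> ennreal"
  shows "(\<And>b. b \<in> S \<Longrightarrow> f b \<le> g b) \<Longrightarrow> prod f S \<le> prod g S"
  by (induction S rule: infinite_finite_induct) (auto intro: mult_mono)

text \<open>The root of \<open>top\<close> is \<open>top\<close>, so that
  \<open>ennroot_power\<close> holds without any finiteness condition.\<close>

definition ennroot :: "nat \<Rightarrow> ennreal \<Rightarrow> ennreal" where
  "ennroot k x = (if x = top then top else ennreal (root k (enn2real x)))"

lemma ennroot_power: "k > 0 \<Longrightarrow> ennroot k x ^ k = x"
  by (cases x) (auto simp: ennroot_def ennreal_power real_root_pow_pos2 power_eq_top_ennreal_iff)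

lemma ennroot_measurable [measurable]:
  assumes "k > 0"
  shows "ennroot k \<in> borel_measurable borel"
proof -
  have [measurable]: "root k \<in> borel_measurable borel"
    by (intro borel_measurable_continuous_onI continuous_on_real_root continuous_on_id)
  show ?thesis unfolding ennroot_def[abs_def] by measurable
qed

text \<open>The free weights \<open>a b\<close> serve \<open>nn_integral_prod_le\<close>, which
  inserts the integrals of \<open>r b ^ card S\<close>; this is the normalisation in the usual proof
  of Hoelder's inequality.\<close>

lemma AM_GM_ennreal:
  fixes r :: "'i \<Rightarrow> ennreal" and a :: "'i \<Rightarrow> real"
  assumes "finite S" "S \<noteq> {}" and a: "\<And>b. b \<in> S \<Longrightarrow> 0 < a b"
  shows "(\<Prod>b\<in>S. r b) \<le> ennreal ((\<Prod>b\<in>S. a b) powr (1 / card S)) *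
    (\<Sum>b\<in>S. ennreal (1 / (card S * a b)) * r b ^ card S)"
proof (cases "\<exists>b\<in>S. r b = top")
  case True
  then obtain b where b: "b \<in> S" "r b = top" by blast
  have k: "card S > 0" using assms by (simp add: card_gt_0_iff)
  then have "ennreal (1 / (card S * a b)) * r b ^ card S = top"
    using a[OF b(1)] b by (simp add: power_eq_top_ennreal_iff ennreal_mult_eq_top_iff top_power_ennreal)
  then have "(\<Sum>b\<in>S. ennreal (1 / (card S * a b)) * r b ^ card S) = top"
    using assms(1) b(1) by (intro ennreal_sum_eq_top[THEN iffD2]) auto
  moreover have "(\<Prod>b\<in>S. a b) > 0" using a by (simp add: prod_pos)
  ultimately show ?thesis by (simp add: ennreal_mult_top)
next
  case False
  define s where "s b = enn2real (r b)" for b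
  have r: "r b = ennreal (s b)" "s b \<ge> 0" if "b \<in> S" for b
    using False that by (auto simp: s_def top.not_eq_extremum)
  let ?k = "card S"
  have k: "?k > 0" using assms by (simp add: card_gt_0_iff)
  let ?P = "\<Prod>b\<in>S. a b"
  have P: "?P > 0" using a by (simp add: prod_pos)
  have am: "(\<Prod>b\<in>S. s b ^ ?k / a b) powr (1 / ?k) \<le> (\<Sum>b\<in>S. s b ^ ?k / a b / ?k)"
    using assms(1,2) a r(2) by (intro arith_geom_mean) (auto simp: less_imp_le)
  have "(\<Prod>b\<in>S. s b ^ ?k / a b) powr (1 / ?k) = (\<Prod>b\<in>S. s b) / ?P powr (1 / ?k)"
  proof -
    have nn: "(\<Prod>b\<in>S. s b) \<ge> 0" using r(2) by (simp add: prod_nonneg)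
    have "(\<Prod>b\<in>S. s b ^ ?k / a b) = (\<Prod>b\<in>S. s b) ^ ?k / ?P"
      by (simp add: prod_dividef prod_power_distrib)
    moreover have "((\<Prod>b\<in>S. s b) ^ ?k) powr (1 / ?k) = (\<Prod>b\<in>S. s b)"
      using k nn by (simp add: powr_realpow'[symmetric] powr_powr flip: powr_realpow)
    ultimately show ?thesis using P nn by (simp add: powr_divide)
  qed
  with am P have "(\<Prod>b\<in>S. s b) \<le> ?P powr (1 / ?k) * (\<Sum>b\<in>S. s b ^ ?k / a b / ?k)"
    by (simp add: field_simps)
  then have "ennreal (\<Prod>b\<in>S. s b) \<le> ennreal (?P powr (1 / ?k)) * ennreal (\<Sum>b\<in>S. (1 / (?k * a b)) * s b ^ ?k)"
    using P by (subst ennreal_mult'[symmetric]) (auto intro!: ennreal_leI simp: field_simps)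
  also have "ennreal (\<Sum>b\<in>S. (1 / (?k * a b)) * s b ^ ?k) = (\<Sum>b\<in>S. ennreal (1 / (?k * a b)) * r b ^ ?k)"
    using r a by (subst sum_ennreal[symmetric])
      (auto intro!: sum.cong simp: ennreal_mult'[symmetric] ennreal_power less_imp_le)
  also have "ennreal (\<Prod>b\<in>S. s b) = (\<Prod>b\<in>S. r b)"
    using r by (subst prod_ennreal[symmetric]) auto
  finally show ?thesis .
qed

lemma nn_integral_prod_le:
  fixes r :: "'i \<Rightarrow> 'a \<Rightarrow> ennreal"
  assumes S: "finite S" "S \<noteq> {}" and [measurable]: "\<And>b. b \<in> S \<Longrightarrow> r b \<in> borel_measurable M"
  shows "(\<integral>\<^sup>+ x. (\<Prod>b\<in>S. r b x) \<partial>M) ^ card S \<le> (\<Prod>b\<in>S. \<integral>\<^sup>+ x. r b x ^ card S \<partial>M)"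
proof -
  let ?k = "card S" and ?A = "\<lambda>b. \<integral>\<^sup>+ x. r b x ^ card S \<partial>M"
  have k: "?k > 0" using S by (simp add: card_gt_0_iff)
  \<comment> \<open>Normalisation requires all integrals to be finite and non-zero. The zero case is
    separated first, because 0 * \<open>top\<close> = 0 while a product of non-zero factors one of
    which is \<open>top\<close> equals \<open>top\<close>.\<close>
  consider (zero) b where "b \<in> S" "?A b = 0"
    | (top) b where "b \<in> S" "?A b = top" "\<And>b. b \<in> S \<Longrightarrow> ?A b \<noteq> 0"
    | (fin) "\<And>b. b \<in> S \<Longrightarrow> ?A b \<noteq> 0 \<and> ?A b \<noteq> top" by blast
  then show ?thesis
  proof cases
    case zero
    then have "AE x in M. r b x ^ ?k = 0"
      using assms(3) by (subst (asm) nn_integral_0_iff_AE) auto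
    then have "AE x in M. (\<Prod>b\<in>S. r b x) = 0"
      using zero(1) S k by (auto elim!: eventually_mono simp: prod_zero_iff)
    then have "(\<integral>\<^sup>+ x. (\<Prod>b\<in>S. r b x) \<partial>M) = (\<integral>\<^sup>+ x. 0 \<partial>M)"
      by (rule nn_integral_cong_AE)
    then show ?thesis using k by (simp add: zero_power)
  next
    case top
    then have "(\<Prod>b\<in>S. ?A b) = top"
      using S by (auto simp: ennreal_prod_eq_top)
    then show ?thesis by simp
  next
    case fin
    define a where "a b = enn2real (?A b)" for b
    have a: "?A b = ennreal (a b)" "a b > 0" if "b \<in> S" for b
      using fin[OF that] by (auto simp: a_def enn2real_positive_iff top.not_eq_extremum zero_less_iff_neq_zero)
    let ?P = "\<Prod>b\<in>S. a b"
    have P: "?P > 0" using a by (simp add: prod_pos)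
    have "(\<integral>\<^sup>+ x. (\<Prod>b\<in>S. r b x) \<partial>M) \<le> (\<integral>\<^sup>+ x. ennreal (?P powr (1 / ?k)) *
        (\<Sum>b\<in>S. ennreal (1 / (?k * a b)) * r b x ^ ?k) \<partial>M)"
      using a by (intro nn_integral_mono AM_GM_ennreal S) auto
    also have "\<dots> = ennreal (?P powr (1 / ?k)) * (\<Sum>b\<in>S. ennreal (1 / (?k * a b)) * ?A b)"
      by (simp add: nn_integral_cmult nn_integral_sum)
    also have "(\<Sum>b\<in>S. ennreal (1 / (?k * a b)) * ?A b) = (\<Sum>b\<in>S. ennreal (1 / ?k))"
    proof (intro sum.cong refl)
      fix b assume b: "b \<in> S"
      show "ennreal (1 / (?k * a b)) * ?A b = ennreal (1 / ?k)"
        unfolding a(1)[OF b] using a(2)[OF b] by (subst ennreal_mult''[symmetric]) auto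
    qed
    also have "\<dots> = 1"
      using k by (simp add: ennreal_of_nat_eq_real_of_nat ennreal_mult'[symmetric])
    finally have "(\<integral>\<^sup>+ x. (\<Prod>b\<in>S. r b x) \<partial>M) ^ ?k \<le> ennreal (?P powr (1 / ?k)) ^ ?k"
      by (intro power_mono) auto
    also have "\<dots> = ennreal ?P"
      using P k by (simp add: ennreal_power powr_powr flip: powr_realpow)
    also have "\<dots> = (\<Prod>b\<in>S. ?A b)"
      using a by (simp add: prod_ennreal less_imp_le)
    finally show ?thesis .
  qed
qed

section \<open>The Loomis-Whitney inequality\<close>

text \<open>Integration of \<open>g\<close> over the affine span of the directions in \<open>J\<close> through the point \<open>x\<close>.\<close>

definition int_dirs :: "('a::euclidean_space) set \<Rightarrow> ('a \<Rightarrow> ennreal) \<Rightarrow> 'a \<Rightarrow> ennreal" where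
  "int_dirs J g x = (\<integral>\<^sup>+ y. g (x + (\<Sum>b\<in>J. y b *\<^sub>R b)) \<partial>(\<Pi>\<^sub>M b\<in>J. (lborel :: real measure)))"

interpretation lborel_product: product_sigma_finite "\<lambda>_. lborel :: real measure"
  by standard

lemma int_dirs_measurable:
  assumes [measurable]: "g \<in> borel_measurable borel" and J: "finite J"
  shows "int_dirs J g \<in> borel_measurable borel"
proof -
  interpret finite_product_sigma_finite "\<lambda>_. lborel :: real measure" J
    by standard (rule J)
  have [measurable]: "(\<lambda>p::'a \<times> ('a \<Rightarrow> real). fst p + (\<Sum>b\<in>J. snd p b *\<^sub>R b)) \<in> borel_measurable (borel \<Otimes>\<^sub>M (\<Pi>\<^sub>M b\<in>J. lborel))"
    by measurable
  show ?thesis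
    unfolding int_dirs_def[abs_def]
    by (rule borel_measurable_nn_integral) (simp add: split_beta)
qed

lemma int_dirs_empty: "int_dirs {} g x = g x"
  unfolding int_dirs_def by (subst lborel_product.nn_integral_empty) auto

lemma int_dirs_insert:
  assumes [measurable]: "g \<in> borel_measurable borel" and J: "finite J" "j \<notin> J"
  shows "int_dirs (insert j J) g x = (\<integral>\<^sup>+ t. int_dirs J g (x + t *\<^sub>R j) \<partial>lborel)"
proof -
  have "(\<Sum>b\<in>J. (if b = j then t else y b) *\<^sub>R b) = (\<Sum>b\<in>J. y b *\<^sub>R b)" for y :: "'a \<Rightarrow> real" and t
    using J by (intro sum.cong) auto
  then have "(\<lambda>t y. g (x + (\<Sum>b\<in>insert j J. (y(j := t)) b *\<^sub>R b))) = (\<lambda>t y. g (x + t *\<^sub>R j + (\<Sum>b\<in>J. y b *\<^sub>R b)))"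
    using J by (simp add: add_ac)
  moreover have "(\<lambda>y. g (x + (\<Sum>b\<in>insert j J. y b *\<^sub>R b))) \<in> borel_measurable (\<Pi>\<^sub>M b\<in>insert j J. lborel)"
    by measurable
  ultimately show ?thesis
    unfolding int_dirs_def
    using lborel_product.product_nn_integral_insert_rev[OF J, of "\<lambda>y. g (x + (\<Sum>b\<in>insert j J. y b *\<^sub>R b))"]
    by (simp add: fun_eq_iff)
qed

lemma int_dirs_translate:
  assumes [measurable]: "g \<in> borel_measurable borel" and J: "finite J" "j \<in> J"
  shows "int_dirs J g (x + s *\<^sub>R j) = int_dirs J g x"
proof -
  have J': "insert j (J - {j}) = J" using J by auto
  note ins = int_dirs_insert[OF assms(1), of "J - {j}" j, unfolded J']
  note [measurable] = int_dirs_measurable[OF assms(1), of "J - {j}"]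
  have "int_dirs J g (x + s *\<^sub>R j) = (\<integral>\<^sup>+ t. int_dirs (J - {j}) g (x + (t + s) *\<^sub>R j) \<partial>lborel)"
    using J by (subst ins) (auto simp: scaleR_add_left add_ac)
  also have "\<dots> = (\<integral>\<^sup>+ t. int_dirs (J - {j}) g (x + t *\<^sub>R j) \<partial>lborel)"
    using J by (intro nn_integral_lborel_translate[of "\<lambda>t. int_dirs (J - {j}) g (x + t *\<^sub>R j)"]) simp
  also have "\<dots> = int_dirs J g x"
    using J by (subst ins) auto
  finally show ?thesis .
qed

lemma int_dirs_Basis:
  fixes g :: "'a::euclidean_space \<Rightarrow> ennreal"
  assumes [measurable]: "g \<in> borel_measurable borel"
  shows "int_dirs Basis g x = (\<integral>\<^sup>+ y. g y \<partial>lborel)"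
proof -
  have "int_dirs Basis g x = (\<integral>\<^sup>+ y. g (x + y) \<partial>lborel)"
    unfolding int_dirs_def by (subst lborel_eq) (simp add: nn_integral_distr)
  also have "\<dots> = (\<integral>\<^sup>+ y. g y \<partial>lborel)"
    using nn_integral_lborel_translate[of g x] by (simp add: add.commute)
  finally show ?thesis .
qed

text \<open>The Loomis--Whitney inequality with only the coordinates in \<open>J\<close> integrated out, in which form it
  is accessible to induction on \<open>J\<close>.\<close>

lemma loomis_whitney_dirs:
  fixes g :: "'a::euclidean_space \<Rightarrow> ennreal"
  assumes [measurable]: "g \<in> borel_measurable borel" and k: "k = DIM('a) - 1" "k > 0"
    and J: "finite J" "J \<subseteq> Basis"
  shows "int_dirs J (\<lambda>y. \<Prod>b\<in>Basis. ennroot k (int_dirs {b} g y)) x ^ k \<le> (\<Prod>b\<in>Basis. int_dirs (insert b J) g x)"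
  using J
proof (induction J arbitrary: x rule: finite_induct)
  case empty
  show ?case
    by (simp add: int_dirs_empty prod_power_distrib ennroot_power k(2))
next
  case (insert j J)
  note [measurable] = int_dirs_measurable[OF assms(1)] ennroot_measurable[OF k(2)]
  let ?F = "\<lambda>y. \<Prod>b\<in>Basis. ennroot k (int_dirs {b} g y)"
  let ?B = "Basis - {j}"
  have jB: "j \<in> Basis" and finJ: "finite J" "j \<notin> J" using insert by auto
  have card_B: "card ?B = k" using jB k(1) by simp
  then have card: "card ?B = k" "?B \<noteq> {}" using k(2) by (simp, metis card.empty less_not_refl)
  define e where "e b t = ennroot k (int_dirs (insert b J) g (x + t *\<^sub>R j))" for b t
  have [measurable]: "e b \<in> borel_measurable borel" for b
    unfolding e_def using finJ by (intro measurable_compose[OF _ ennroot_measurable[OF k(2)]]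
        measurable_compose[OF _ int_dirs_measurable[OF assms(1)]]) auto
  \<comment> \<open>The factor that is already integrated in the direction \<open>j\<close> is
    constant along \<open>j\<close> and leaves the integral. The remaining \<open>k\<close> factors
    are \<open>k\<close>-th roots, just the number that \<open>nn_integral_prod_le\<close> can
    take.\<close>
  have ej: "e j t = e j 0" for t
    using int_dirs_translate[OF assms(1), of "insert j J" j x t] finJ by (simp add: e_def)
  have [measurable]: "?F \<in> borel_measurable borel"
    by (intro borel_measurable_prod_ennreal measurable_compose[OF _ ennroot_measurable[OF k(2)]] int_dirs_measurable) auto
  have "int_dirs (insert j J) ?F x = (\<integral>\<^sup>+ t. int_dirs J ?F (x + t *\<^sub>R j) \<partial>lborel)"
    by (rule int_dirs_insert[OF _ finJ]) measurable
  also have "\<dots> \<le> (\<integral>\<^sup>+ t. e j 0 * (\<Prod>b\<in>?B. e b t) \<partial>lborel)"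
  proof (intro nn_integral_mono)
    fix t :: real
    have "int_dirs J ?F (x + t *\<^sub>R j) ^ k \<le> (\<Prod>b\<in>Basis. int_dirs (insert b J) g (x + t *\<^sub>R j))"
      using insert by simp
    also have "\<dots> = (\<Prod>b\<in>Basis. e b t) ^ k"
      by (simp add: e_def prod_power_distrib ennroot_power k(2))
    finally have "int_dirs J ?F (x + t *\<^sub>R j) \<le> (\<Prod>b\<in>Basis. e b t)"
      by (rule ennreal_power_le_imp_le[OF _ k(2)])
    also have "\<dots> = e j 0 * (\<Prod>b\<in>?B. e b t)"
      using jB by (subst prod.remove[of _ j]) (auto simp: ej[of t])
    finally show "int_dirs J ?F (x + t *\<^sub>R j) \<le> e j 0 * (\<Prod>b\<in>?B. e b t)" .
  qed
  also have "\<dots> = e j 0 * (\<integral>\<^sup>+ t. (\<Prod>b\<in>?B. e b t) \<partial>lborel)"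
    by (intro nn_integral_cmult) measurable
  finally have "int_dirs (insert j J) ?F x ^ k \<le> (e j 0 * (\<integral>\<^sup>+ t. (\<Prod>b\<in>?B. e b t) \<partial>lborel)) ^ k"
    by (intro power_mono) auto
  also have "\<dots> = int_dirs (insert j J) g x * (\<integral>\<^sup>+ t. (\<Prod>b\<in>?B. e b t) \<partial>lborel) ^ k"
    by (simp add: power_mult_distrib e_def ennroot_power k(2))
  also have "\<dots> \<le> int_dirs (insert j J) g x * (\<Prod>b\<in>?B. \<integral>\<^sup>+ t. e b t ^ k \<partial>lborel)"
    using nn_integral_prod_le[of ?B e lborel] card by (intro mult_left_mono) auto
  also have "(\<Prod>b\<in>?B. \<integral>\<^sup>+ t. e b t ^ k \<partial>lborel) = (\<Prod>b\<in>?B. int_dirs (insert b (insert j J)) g x)"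
  proof (intro prod.cong refl)
    fix b assume b: "b \<in> ?B"
    have "(\<integral>\<^sup>+ t. e b t ^ k \<partial>lborel) = (\<integral>\<^sup>+ t. int_dirs (insert b J) g (x + t *\<^sub>R j) \<partial>lborel)"
      by (simp add: e_def ennroot_power k(2))
    also have "\<dots> = int_dirs (insert j (insert b J)) g x"
      using finJ b by (intro int_dirs_insert[symmetric]) auto
    finally show "(\<integral>\<^sup>+ t. e b t ^ k \<partial>lborel) = int_dirs (insert b (insert j J)) g x"
      by (simp add: insert_commute)
  qed
  also have "int_dirs (insert j J) g x * \<dots> = (\<Prod>b\<in>Basis. int_dirs (insert b (insert j J)) g x)"
    using jB by (subst (2) prod.remove[of _ j]) auto
  finally show ?case .
qed

text \<open>Multiplying the N line bounds gives v^N at most the product of the line integrals of g,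
  so v^(N/(N-1)) is at most the product of their (N-1)-th roots. Loomis-Whitney with all coordinates
  integrated out finishes; everything is raised to the power N - 1 to stay with natural
  powers.\<close>

lemma gagliardo:
  fixes v :: "'a::euclidean_space \<Rightarrow> real" and g :: "'a \<Rightarrow> ennreal"
  assumes [measurable]: "g \<in> borel_measurable borel" and dim: "DIM('a) \<ge> 2"
    and v: "\<And>x. v x \<ge> 0"
    and le: "\<And>x b. b \<in> Basis \<Longrightarrow> ennreal (v x) \<le> (\<integral>\<^sup>+ t. g (x + t *\<^sub>R b) \<partial>lborel)"
  shows "(\<integral>\<^sup>+ x. ennreal (v x powr (DIM('a) / (DIM('a) - 1))) \<partial>lborel) ^ (DIM('a) - 1)
      \<le> (\<integral>\<^sup>+ x. g x \<partial>lborel) ^ DIM('a)"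
proof -
  define k where "k = DIM('a) - 1"
  have k: "k > 0" "real k = DIM('a) - 1" using dim by (auto simp: k_def)
  let ?F = "\<lambda>y. \<Prod>b\<in>Basis. ennroot k (int_dirs {b} g y)"
  have [measurable]: "?F \<in> borel_measurable borel"
    by (intro borel_measurable_prod_ennreal measurable_compose[OF _ ennroot_measurable[OF k(1)]] int_dirs_measurable) auto
  have "ennreal (v x powr (DIM('a) / (DIM('a) - 1))) \<le> ?F x" for x
  proof (rule ennreal_power_le_imp_le[OF _ k(1)])
    have "ennreal (v x powr (DIM('a) / (DIM('a) - 1))) ^ k = ennreal (v x) ^ DIM('a)"
    proof (cases "v x = 0")
      case False
      then have "(v x powr (DIM('a) / (DIM('a) - 1))) ^ k = v x ^ DIM('a)"
        using v[of x] k dim by (simp add: powr_powr flip: powr_realpow)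
      then show ?thesis using v[of x] by (simp add: ennreal_power)
    qed (use k in \<open>simp add: zero_power\<close>)
    also have "\<dots> = (\<Prod>b\<in>(Basis :: 'a set). ennreal (v x))"
      by simp
    also have "\<dots> \<le> (\<Prod>b\<in>Basis. int_dirs {b} g x)"
      using le int_dirs_insert[OF assms(1), of "{}"]
      by (intro prod_mono_ennreal) (simp add: int_dirs_empty)
    also have "\<dots> = ?F x ^ k"
      by (simp add: prod_power_distrib ennroot_power k(1))
    finally show "ennreal (v x powr (DIM('a) / (DIM('a) - 1))) ^ k \<le> ?F x ^ k" .
  qed
  then have "(\<integral>\<^sup>+ x. ennreal (v x powr (DIM('a) / (DIM('a) - 1))) \<partial>lborel) ^ k \<le> (\<integral>\<^sup>+ x. ?F x \<partial>lborel) ^ k"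
    by (intro power_mono nn_integral_mono) auto
  also have "\<dots> \<le> (\<Prod>b\<in>Basis. int_dirs (insert b Basis) g 0)"
    using loomis_whitney_dirs[OF assms(1) k_def k(1), of Basis 0] by (simp add: int_dirs_Basis)
  also have "\<dots> = (\<integral>\<^sup>+ x. g x \<partial>lborel) ^ DIM('a)"
    by (simp add: insert_absorb int_dirs_Basis)
  finally show ?thesis by (simp add: k_def)
qed

section \<open>Sobolev's inequality for test functions\<close>

lemma DERIV_abs_powr:
  fixes \<gamma> :: real
  assumes "\<gamma> > 1"
  shows "((\<lambda>s. \<bar>s\<bar> powr \<gamma>) has_real_derivative \<gamma> * (\<bar>s\<bar> powr (\<gamma> - 1) * sgn s)) (at s)"
proof -
  consider "s > 0" | "s < 0" | "s = 0" by linarith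
  then show ?thesis
  proof cases
    case 1
    have "((\<lambda>s. s powr \<gamma>) has_real_derivative \<gamma> * s powr (\<gamma> - 1)) (at s)"
      using 1 by (auto intro!: derivative_eq_intros)
    moreover have "\<forall>\<^sub>F t in nhds s. \<bar>t\<bar> powr \<gamma> = t powr \<gamma>"
      using eventually_nhds_in_open[of "{0<..}" s] 1 by (auto elim!: eventually_mono)
    ultimately show ?thesis
      using 1 by (subst DERIV_cong_ev[OF refl _ refl]) auto
  next
    case 2
    have "((\<lambda>s. (- s) powr \<gamma>) has_real_derivative \<gamma> * ((- s) powr (\<gamma> - 1) * -1)) (at s)"
      using 2 by (auto intro!: derivative_eq_intros)
    moreover have "\<forall>\<^sub>F t in nhds s. \<bar>t\<bar> powr \<gamma> = (- t) powr \<gamma>"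
      using eventually_nhds_in_open[of "{..<0}" s] 2 by (auto elim!: eventually_mono)
    ultimately show ?thesis
      using 2 by (subst DERIV_cong_ev[OF refl _ refl]) auto
  next
    case 3
    have "((\<lambda>h::real. \<bar>h\<bar> powr (\<gamma> - 1)) \<longlongrightarrow> 0) (at 0)"
      using assms by (intro tendsto_eq_intros | simp)+
    then have "((\<lambda>h::real. \<bar>h\<bar> powr \<gamma> / h) \<longlongrightarrow> 0) (at 0)"
    proof (rule tendsto_rabs_zero_cancel[OF Lim_transform_eventually])
      show "\<forall>\<^sub>F h in at 0. \<bar>h\<bar> powr (\<gamma> - 1) = \<bar>\<bar>h::real\<bar> powr \<gamma> / h\<bar>"
        by (auto simp: eventually_at_filter abs_divide powr_diff)
    qed
    then show ?thesis using 3 by (simp add: DERIV_def)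
  qed
qed

text \<open>\<open>gagliardo\<close> is applied to |\<phi>|^\<gamma> with \<gamma> = p (N - 1) / (N
  - p). This value makes both \<gamma> N / (N - 1) and (\<gamma> - 1) p / (p - 1) equal to the
  critical exponent, so that after Hoelder's inequality the same integral \<open>X\<close> stands on
  both sides and a power of it can be cancelled.\<close>

lemma sobolev_C0_infinity:
  fixes \<phi> :: "'a::euclidean_space \<Rightarrow> real" and N p :: real
  defines "N \<equiv> real DIM('a)"
  assumes \<phi>: "\<phi> \<in> C0_infinity \<Omega>" and p: "1 < p" "p < N"
  shows "(LINT x|lborel. \<bar>\<phi> x\<bar> powr (N * p / (N - p))) \<le>
    (p * (N - 1) / (N - p)) powr (N * p / (N - p)) * (LINT x|lborel. norm (grad \<phi> x) powr p) powr (N / (N - p))"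
proof -
  have dim: "DIM('a) \<ge> 2" using p by (simp add: N_def)
  have N: "N \<ge> 2" using dim by (simp add: N_def)
  have s: "smooth \<phi>" by (rule C0_infinity_smooth[OF \<phi>])
  define \<gamma> where "\<gamma> = p * (N - 1) / (N - p)"
  define q where "q = p / (p - 1)"
  define ps where "ps = N * p / (N - p)"
  have g1: "\<gamma> - 1 = N * (p - 1) / (N - p)" unfolding \<gamma>_def using p by (simp add: field_simps)
  have \<gamma>: "\<gamma> > 1" using g1 p N by (smt (verit) divide_pos_pos mult_pos_pos)
  have q: "q > 1" "1 / q + 1 / p = 1" unfolding q_def using p by (auto simp: field_simps)
  have gq: "(\<gamma> - 1) * q = ps" unfolding g1 q_def ps_def using p by simp
  have gN: "\<gamma> * (N / (N - 1)) = ps" unfolding \<gamma>_def ps_def using p N by (auto simp: divide_simps)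
  have ps: "ps > 0" using p N by (simp add: ps_def)
  define g where "g x = \<gamma> * \<bar>\<phi> x\<bar> powr (\<gamma> - 1) * norm (grad \<phi> x)" for x
  note [measurable] = smooth_measurable[OF s]
  have [measurable]: "g \<in> borel_measurable borel" unfolding g_def by measurable
  have g_nn: "g x \<ge> 0" for x using \<gamma> by (simp add: g_def)
  obtain K where K: "compact K" "\<And>x. x \<notin> K \<Longrightarrow> \<phi> x = 0"
    using C0_infinity_support[OF \<phi>] by metis
  obtain R where R: "\<And>x. x \<in> K \<Longrightarrow> norm x \<le> R"
    using compact_imp_bounded[OF K(1)] by (auto simp: bounded_iff)
  have le: "ennreal (\<bar>\<phi> x\<bar> powr \<gamma>) \<le> (\<integral>\<^sup>+ t. ennreal (g (x + t *\<^sub>R b)) \<partial>lborel)" if b: "b \<in> Basis" for x b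
  proof -
    \<comment> \<open>Far enough along the line for \<phi> to vanish: |x - T b| \<ge> T - |x|
      exceeds the radius \<open>R\<close> of a ball containing the support.\<close>
    define T where "T = \<bar>R\<bar> + norm x + 1"
    have "norm (x - T *\<^sub>R b) \<ge> T - norm x"
      using norm_triangle_ineq2[of "T *\<^sub>R b" x] b by (simp add: norm_minus_commute T_def)
    then have "x - T *\<^sub>R b \<notin> K" using R[of "x - T *\<^sub>R b"] by (auto simp: T_def)
    then have 0: "\<phi> (x + (- T) *\<^sub>R b) = 0" using K by simp
    let ?h = "\<lambda>t. \<bar>\<phi> (x + t *\<^sub>R b)\<bar> powr \<gamma>"
    let ?h' = "\<lambda>t. \<gamma> * (\<bar>\<phi> (x + t *\<^sub>R b)\<bar> powr (\<gamma> - 1) * sgn (\<phi> (x + t *\<^sub>R b))) * (grad \<phi> (x + t *\<^sub>R b) \<bullet> b)"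
    have der: "(?h has_real_derivative ?h' t) (at t)" for t
      using DERIV_chain2[OF DERIV_abs_powr[OF \<gamma>] line_has_derivative[OF s]] .
    have cont1: "continuous_on UNIV (\<lambda>s::real. \<bar>s\<bar> powr (\<gamma> - 1) * sgn s)"
    proof (rule continuous_at_imp_continuous_on, rule ballI)
      fix s :: real
      consider "s > 0" | "s < 0" | "s = 0" by linarith
      then show "isCont (\<lambda>s::real. \<bar>s\<bar> powr (\<gamma> - 1) * sgn s) s"
      proof cases
        case 3
        have "((\<lambda>s::real. \<bar>s\<bar> powr (\<gamma> - 1)) \<longlongrightarrow> 0) (at 0)"
          using \<gamma> by (intro tendsto_eq_intros | simp)+
        then have "((\<lambda>s::real. \<bar>s\<bar> powr (\<gamma> - 1) * sgn s) \<longlongrightarrow> 0) (at 0)"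
          by (rule Lim_null_comparison[rotated])
            (auto simp: eventually_at_filter abs_mult abs_sgn_eq)
        then show ?thesis using 3 by (simp add: isCont_def)
      qed (auto intro!: continuous_intros)
    qed
    have cont: "continuous_on UNIV ?h'"
      by (intro continuous_intros continuous_on_compose2[OF cont1] continuous_on_compose2[OF smooth_continuous[OF s, of UNIV]]
          continuous_on_compose2[OF smooth_grad_continuous[OF s, of UNIV]]) (auto simp: mult.assoc)
    have "ennreal (\<bar>\<phi> x\<bar> powr \<gamma>) = ennreal \<bar>?h 0 - ?h (- T)\<bar>"
      using 0 by simp
    also have "\<dots> \<le> (\<integral>\<^sup>+ t. ennreal \<bar>?h' t\<bar> * indicator {- T..0} t \<partial>lborel)"
      by (rule FTC_abs_le_nn_integral[OF _ der cont]) (use norm_ge_zero[of x] abs_ge_zero[of R] in \<open>unfold T_def, linarith\<close>)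
    also have "\<dots> \<le> (\<integral>\<^sup>+ t. ennreal (g (x + t *\<^sub>R b)) \<partial>lborel)"
    proof (intro nn_integral_mono)
      fix t
      have "\<bar>grad \<phi> (x + t *\<^sub>R b) \<bullet> b\<bar> \<le> norm (grad \<phi> (x + t *\<^sub>R b))"
        by (rule Basis_le_norm[OF b])
      then have "\<bar>?h' t\<bar> \<le> g (x + t *\<^sub>R b)"
        unfolding g_def abs_mult using \<gamma> by (intro mult_mono) (auto simp: abs_sgn_eq mult_left_le)
      then show "ennreal \<bar>?h' t\<bar> * indicator {- T..0} t \<le> ennreal (g (x + t *\<^sub>R b))"
        by (auto simp: indicator_def intro!: ennreal_leI)
    qed
    finally show ?thesis .
  qed
  define X where "X = (LINT x|lborel. \<bar>\<phi> x\<bar> powr ps)"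
  define Y where "Y = (LINT x|lborel. norm (grad \<phi> x) powr p)"
  have XY: "X \<ge> 0" "Y \<ge> 0" by (auto simp: X_def Y_def)
  have eq_powr: "(\<bar>\<phi> x\<bar> powr \<gamma>) powr (N / (N - 1)) = \<bar>\<phi> x\<bar> powr ps" for x
    by (simp only: powr_powr gN)
  have X: "(\<integral>\<^sup>+ x. ennreal ((\<bar>\<phi> x\<bar> powr \<gamma>) powr (N / (N - 1))) \<partial>lborel) = ennreal X"
    unfolding X_def eq_powr using integrable_C0_infinity_powr(1)[OF \<phi> ps]
    by (intro nn_integral_eq_integral) auto
  have "((\<bar>\<phi> x\<bar> powr (\<gamma> - 1)) powr q) = \<bar>\<phi> x\<bar> powr ps" for x
    by (simp only: powr_powr gq)
  then have iX: "integrable lborel (\<lambda>x. \<bar>\<bar>\<phi> x\<bar> powr (\<gamma> - 1)\<bar> powr q)"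
    and eX: "(LINT x|lborel. \<bar>\<bar>\<phi> x\<bar> powr (\<gamma> - 1)\<bar> powr q) = X"
    using integrable_C0_infinity_powr(1)[OF \<phi> ps] by (auto simp: X_def)
  have iY: "integrable lborel (\<lambda>x. \<bar>norm (grad \<phi> x)\<bar> powr p)"
    using integrable_C0_infinity_powr(2)[OF \<phi>, of p] p by simp
  note H = Holder[OF q(1) p(1) q(2) _ _ iX iY]
  have intg: "integrable lborel g" 
    using integrable_mult_right[OF H(1), of \<gamma>] unfolding g_def by (simp add: mult.assoc)
  define Z where "Z = integral\<^sup>L lborel g"
  have Z0: "Z \<ge> 0" unfolding Z_def using g_nn by simp
  have "(LINT x|lborel. \<bar>\<bar>\<phi> x\<bar> powr (\<gamma> - 1) * norm (grad \<phi> x)\<bar>) \<le> X powr (1 / q) * Y powr (1 / p)"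
    using H(2) unfolding eX by (simp add: Y_def)
  then have Z: "Z \<le> \<gamma> * (X powr (1 / q) * Y powr (1 / p))"
    unfolding Z_def g_def using \<gamma> by (simp add: mult.assoc)
  have "ennreal X ^ (DIM('a) - 1) \<le> (\<integral>\<^sup>+ x. ennreal (g x) \<partial>lborel) ^ DIM('a)"
    using gagliardo[OF _ dim _ le] X by (simp add: N_def)
  also have "(\<integral>\<^sup>+ x. ennreal (g x) \<partial>lborel) = ennreal Z"
    unfolding Z_def using intg g_nn by (intro nn_integral_eq_integral) auto
  finally have "X ^ (DIM('a) - 1) \<le> Z ^ DIM('a)"
    using XY Z0 by (simp add: ennreal_power)
  also have "\<dots> \<le> (\<gamma> * (X powr (1 / q) * Y powr (1 / p))) ^ DIM('a)"
    using Z Z0 by (rule power_mono)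
  finally have main: "X ^ (DIM('a) - 1) \<le> (\<gamma> * (X powr (1 / q) * Y powr (1 / p))) ^ DIM('a)" .
  have "X \<le> \<gamma> powr ps * Y powr (N / (N - p))"
  proof (cases "X = 0")
    case False
    with XY have X0: "X > 0" by simp
    have "Y \<noteq> 0"
    proof
      assume "Y = 0"
      then have "X ^ (DIM('a) - 1) \<le> 0" using main dim by (simp add: zero_power)
      then show False using X0 zero_less_power[OF X0, of "DIM('a) - 1"] by linarith
    qed
    with XY have Y0: "Y > 0" by simp
    have "X powr (N - 1) \<le> (\<gamma> * (X powr (1 / q) * Y powr (1 / p))) powr N"
      using main X0 Y0 \<gamma> dim by (simp add: N_def powr_realpow of_nat_diff flip: powr_realpow)
    also have "\<dots> = \<gamma> powr N * X powr (N / q) * Y powr (N / p)"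
      using X0 Y0 \<gamma> by (simp add: powr_mult powr_powr)
    finally have "X powr (N - 1) / X powr (N / q) \<le> \<gamma> powr N * Y powr (N / p)"
      using X0 by (simp add: field_simps)
    \<comment> \<open>The exponent of \<open>X\<close> left after the cancellation; it is positive
      because p < N, so \<open>X\<close> can be isolated.\<close>
    moreover have "N - 1 - N / q = (N - p) / p"
      unfolding q_def using p by (simp add: field_simps)
    ultimately have "X powr ((N - p) / p) \<le> \<gamma> powr N * Y powr (N / p)"
      by (simp add: powr_diff[symmetric])
    then have "(X powr ((N - p) / p)) powr (p / (N - p)) \<le> (\<gamma> powr N * Y powr (N / p)) powr (p / (N - p))"
      using p by (intro powr_mono2) auto
    then show ?thesis
      using X0 Y0 \<gamma> p by (simp add: powr_mult powr_powr ps_def)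
  qed simp
  then show ?thesis by (simp add: X_def Y_def \<gamma>_def ps_def)
qed

section \<open>The p-th power integral\<close>

text \<open>The p-th power of the L^p norm, without the root and in \<open>ennreal\<close>, so that
  it makes sense before integrability is known. In return the triangle inequality takes the form
  \<open>pint_add\<close>, with the factor \<open>2 powr p\<close>.\<close>

definition pint :: "'b measure \<Rightarrow> real \<Rightarrow> ('b \<Rightarrow> 'c::real_normed_vector) \<Rightarrow> ennreal" where
  "pint M p g = (\<integral>\<^sup>+ x. ennreal (norm (g x) powr p) \<partial>M)"

lemma norm_add_powr_le:
  fixes a b :: "'c::real_normed_vector"
  assumes "p > 0"
  shows "norm (a + b) powr p \<le> 2 powr p * (norm a powr p + norm b powr p)"
proof -
  have "norm (a + b) powr p \<le> (2 * max (norm a) (norm b)) powr p"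
    using assms norm_triangle_ineq[of a b] by (intro powr_mono2) auto
  also have "\<dots> = 2 powr p * max (norm a) (norm b) powr p"
    by (subst powr_mult) auto
  also have "\<dots> \<le> 2 powr p * (norm a powr p + norm b powr p)"
    by (intro mult_left_mono) (auto simp: max_def)
  finally show ?thesis .
qed

lemma pint_add:
  assumes "p > 0" and [measurable]: "f \<in> borel_measurable M" "g \<in> borel_measurable M"
  shows "pint M p (\<lambda>x. f x + g x :: 'c::euclidean_space) \<le> ennreal (2 powr p) * (pint M p f + pint M p g)"
proof -
  have "pint M p (\<lambda>x. f x + g x) \<le> (\<integral>\<^sup>+ x. ennreal (2 powr p) * (ennreal (norm (f x) powr p) + ennreal (norm (g x) powr p)) \<partial>M)"
    unfolding pint_def
    by (intro nn_integral_mono)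
      (simp add: norm_add_powr_le[OF assms(1)] ennreal_leI flip: ennreal_plus ennreal_mult)
  also have "\<dots> = ennreal (2 powr p) * (pint M p f + pint M p g)"
    unfolding pint_def by (simp add: nn_integral_cmult nn_integral_add)
  finally show ?thesis .
qed

lemma pint_cmult:
  assumes [measurable]: "f \<in> borel_measurable M"
  shows "pint M p (\<lambda>x. c *\<^sub>R f x :: 'c::euclidean_space) = ennreal (\<bar>c\<bar> powr p) * pint M p f"
  unfolding pint_def by (subst nn_integral_cmult[symmetric]) (auto simp: powr_mult ennreal_mult)

lemma pint_mono:
  assumes "p > 0" "AE x in M. norm (f x) \<le> norm (g x)"
  shows "pint M p f \<le> pint M p g"
  unfolding pint_def
proof (rule nn_integral_mono_AE, use assms(2) in eventually_elim)
  case (elim x)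
  then show ?case using assms(1) by (intro ennreal_leI powr_mono2) auto
qed

lemma pint_finite_iff:
  fixes f :: "'b \<Rightarrow> 'c::euclidean_space"
  assumes [measurable]: "f \<in> borel_measurable M"
  shows "pint M p f < top \<longleftrightarrow> integrable M (\<lambda>x. norm (f x) powr p)"
  unfolding pint_def by (subst integrable_iff_bounded) (auto simp: top.not_eq_extremum infinity_ennreal_def)

lemma pint_eq_integral:
  assumes "integrable M (\<lambda>x. norm (f x) powr p)"
  shows "pint M p f = ennreal (LINT x|M. norm (f x) powr p)"
  unfolding pint_def by (rule nn_integral_eq_integral[OF assms]) auto

lemma pint_Fatou:
  fixes g :: "nat \<Rightarrow> 'b \<Rightarrow> 'c::euclidean_space"
  assumes "p > 0" and [measurable]: "\<And>n. g n \<in> borel_measurable M"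
    and lim: "AE x in M. (\<lambda>n. g n x) \<longlonglongrightarrow> u x"
  shows "pint M p u \<le> liminf (\<lambda>n. pint M p (g n))"
proof -
  have "pint M p u = (\<integral>\<^sup>+ x. liminf (\<lambda>n. ennreal (norm (g n x) powr p)) \<partial>M)"
    unfolding pint_def
  proof (rule nn_integral_cong_AE, use lim in eventually_elim)
    case (elim x)
    then have "(\<lambda>n. ennreal (norm (g n x) powr p)) \<longlonglongrightarrow> ennreal (norm (u x) powr p)"
      using assms(1) by (intro tendsto_ennrealI tendsto_powr' tendsto_norm tendsto_const) auto
    then show ?case by (intro lim_imp_Liminf[symmetric]) auto
  qed
  also have "\<dots> \<le> liminf (\<lambda>n. \<integral>\<^sup>+ x. ennreal (norm (g n x) powr p) \<partial>M)"
    by (rule nn_integral_liminf) measurable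
  finally show ?thesis by (simp add: pint_def)
qed

lemma pint_AE_subseq:
  fixes g :: "nat \<Rightarrow> 'b \<Rightarrow> 'c::euclidean_space"
  assumes p: "p > 0" and [measurable]: "\<And>n. g n \<in> borel_measurable M" "u \<in> borel_measurable M"
    and lim: "(\<lambda>n. pint M p (\<lambda>x. g n x - u x)) \<longlonglongrightarrow> 0"
  obtains r where "strict_mono r" and "AE x in M. (\<lambda>n. g (r n) x) \<longlonglongrightarrow> u x"
proof -
  have "\<forall>\<^sub>F n in sequentially. pint M p (\<lambda>x. g n x - u x) < 1"
    using lim by (rule order_tendstoD) auto
  then obtain n0 where n0: "\<And>n. n \<ge> n0 \<Longrightarrow> pint M p (\<lambda>x. g n x - u x) < 1"
    by (auto simp: eventually_sequentially)
  let ?d = "\<lambda>n x. norm (g (n + n0) x - u x) powr p"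
  have int: "integrable M (?d n)" for n
    using n0[of "n + n0"] by (subst pint_finite_iff[symmetric]) (auto intro: less_trans ennreal_one_less_top)
  have "(\<lambda>n. ennreal (integral\<^sup>L M (?d n))) \<longlonglongrightarrow> ennreal 0"
    using LIMSEQ_ignore_initial_segment[OF lim, of n0] by (simp add: pint_eq_integral[OF int])
  then have "(\<lambda>n. \<integral>x. norm (?d n x) \<partial>M) \<longlonglongrightarrow> 0"
    by (subst (asm) tendsto_ennreal_iff) auto
  from tendsto_L1_AE_subseq[OF int this] obtain r where r: "strict_mono r" "AE x in M. (\<lambda>n. ?d (r n) x) \<longlonglongrightarrow> 0"
    by auto
  have "AE x in M. (\<lambda>n. g (r n + n0) x) \<longlonglongrightarrow> u x"
    using r(2)
  proof eventually_elim
    case (elim x)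
    from tendsto_powr'[OF elim tendsto_const, of "1 / p"] p
    have "(\<lambda>n. norm (g (r n + n0) x - u x)) \<longlonglongrightarrow> 0"
      by (simp add: powr_powr)
    then show ?case by (simp add: tendsto_norm_zero_iff LIM_zero_iff)
  qed
  then show thesis
    using r(1) by (intro that[of "\<lambda>n. r n + n0"]) (auto simp: strict_mono_def)
qed

lemma tendsto_0_ennrealI:
  fixes X :: "'b \<Rightarrow> ennreal"
  assumes "\<And>e::real. e > 0 \<Longrightarrow> \<forall>\<^sub>F n in F. X n \<le> ennreal e"
  shows "(X \<longlongrightarrow> 0) F"
proof (rule order_tendstoI)
  fix a :: ennreal assume "0 < a"
  then obtain b :: ennreal where b: "0 < b" "b < a" using dense by blast
  then have "b = ennreal (enn2real b)" "enn2real b > 0"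
    by (auto simp: enn2real_positive_iff dest: less_top_ennreal[THEN iffD2] order.strict_trans2[OF _ top_greatest])
  with assms[of "enn2real b"] b show "\<forall>\<^sub>F n in F. X n < a"
    by (auto elim!: eventually_mono)
qed simp

lemma liminf_le_const:
  fixes X :: "nat \<Rightarrow> 'b::complete_linorder"
  assumes "\<forall>\<^sub>F n in sequentially. X n \<le> C"
  shows "liminf X \<le> C"
  using Liminf_le_Limsup[of sequentially X] Limsup_bounded[OF assms] by (meson order_trans sequentially_bot)

text \<open>Riesz-Fischer: a rapidly converging subsequence converges almost everywhere, and Fatou's
  lemma turns the Cauchy condition into convergence to its limit.\<close>

theorem pint_complete:
  fixes g :: "nat \<Rightarrow> 'b \<Rightarrow> 'c::euclidean_space"
  assumes p: "p > 0" and [measurable]: "\<And>n. g n \<in> borel_measurable M"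
    and Cauchy: "\<And>e. e > 0 \<Longrightarrow> \<exists>n0. \<forall>m\<ge>n0. \<forall>n\<ge>n0. pint M p (\<lambda>x. g m x - g n x) \<le> ennreal e"
  obtains u where "u \<in> borel_measurable M" and "(\<lambda>n. pint M p (\<lambda>x. g n x - u x)) \<longlonglongrightarrow> 0"
proof -
  \<comment> \<open>The rate 4^(-p k) leaves room for the weight 2^(p k). Finiteness of the weighted
    sum at a point bounds the k-th increment there by a constant times 2^(-k), whatever p > 0
    is.\<close>
  let ?e = "\<lambda>k::nat. (1 / 4) powr (p * k)"
  have "\<exists>n0. \<forall>m\<ge>n0. \<forall>n\<ge>n0. pint M p (\<lambda>x. g m x - g n x) \<le> ennreal (?e k)" for k
    by (rule Cauchy) auto
  then obtain N where N: "\<And>k m n. m \<ge> N k \<Longrightarrow> n \<ge> N k \<Longrightarrow> pint M p (\<lambda>x. g m x - g n x) \<le> ennreal (?e k)"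
    by metis
  \<comment> \<open>Summing the thresholds makes \<open>r\<close> increasing while keeping it above
    both \<open>N k\<close> and \<open>k\<close>.\<close>
  define r where "r k = (\<Sum>i\<le>k. N i) + k" for k
  have rN: "r k \<ge> N k" for k
    unfolding r_def by (rule trans_le_add1, rule member_le_sum) auto
  have r_mono: "r k \<le> r (k + 1)" and rk: "k \<le> r k" for k by (simp_all add: r_def)
  define h where "h k = g (r k)" for k
  have [measurable]: "h k \<in> borel_measurable M" for k by (simp add: h_def)
  have step: "pint M p (\<lambda>x. h (k + 1) x - h k x) \<le> ennreal (?e k)" for k
    unfolding h_def using rN[of k] r_mono[of k] by (intro N) auto
  have "(\<integral>\<^sup>+ x. (\<Sum>k. ennreal (2 powr (p * k)) * ennreal (norm (h (k + 1) x - h k x) powr p)) \<partial>M)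
      = (\<Sum>k. ennreal (2 powr (p * k)) * pint M p (\<lambda>x. h (k + 1) x - h k x))"
    unfolding pint_def by (subst nn_integral_suminf) (auto simp: nn_integral_cmult)
  also have "\<dots> \<le> (\<Sum>k. ennreal ((1 / 2 powr p) ^ k))"
  proof (rule suminf_le)
    fix k
    have "ennreal (2 powr (p * k)) * pint M p (\<lambda>x. h (k + 1) x - h k x) \<le> ennreal (2 powr (p * k)) * ennreal (?e k)"
      by (intro mult_left_mono step) auto
    also have "\<dots> = ennreal ((2 * (1 / 4)) powr (p * k))"
      by (subst powr_mult) (auto simp: ennreal_mult)
    also have "(2 * (1 / 4)) powr (p * k) = (1 / 2 powr p) ^ k"
      by (simp add: powr_powr[symmetric] powr_realpow powr_divide power_divide)
    finally show "ennreal (2 powr (p * k)) * pint M p (\<lambda>x. h (k + 1) x - h k x) \<le> ennreal ((1 / 2 powr p) ^ k)" .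
  qed auto
  also have "\<dots> < top"
  proof -
    have "summable (\<lambda>k. (1 / 2 powr p) ^ k)"
      using p by (intro summable_geometric) auto
    then have "(\<Sum>k. ennreal ((1 / 2 powr p) ^ k)) = ennreal (\<Sum>k. (1 / 2 powr p) ^ k)"
      by (intro suminf_ennreal2) auto
    then show ?thesis by simp
  qed
  finally have "AE x in M. (\<Sum>k. ennreal (2 powr (p * k)) * ennreal (norm (h (k + 1) x - h k x) powr p)) \<noteq> top"
    by (intro nn_integral_noteq_infinite[unfolded infinity_ennreal_def]) auto
  then have conv: "AE x in M. convergent (\<lambda>k. h k x)"
  proof eventually_elim
    case (elim x)
    let ?t = "\<lambda>k. norm (h (k + 1) x - h k x)"
    define S where "S = enn2real (\<Sum>k. ennreal (2 powr (p * k)) * ennreal (?t k powr p))"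
    have "?t k \<le> S powr (1 / p) * (1 / 2) ^ k" for k
    proof -
      have "ennreal (2 powr (p * k)) * ennreal (?t k powr p) \<le> ennreal S"
        using sum_le_suminf[of "\<lambda>k. ennreal (2 powr (p * k)) * ennreal (?t k powr p)" "{k}"] elim
        by (simp add: S_def top.not_eq_extremum)
      then have "2 powr (p * k) * ?t k powr p \<le> S"
        by (simp add: S_def flip: ennreal_mult)
      then have "(2 powr (p * k) * ?t k powr p) powr (1 / p) \<le> S powr (1 / p)"
        using p by (intro powr_mono2) auto
      then have "2 ^ k * ?t k \<le> S powr (1 / p)"
        using p by (simp add: powr_mult powr_powr powr_realpow)
      then show ?thesis by (simp add: field_simps power_divide)
    qed
    moreover have "summable (\<lambda>k. S powr (1 / p) * (1 / 2) ^ k)"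
      by (intro summable_mult summable_geometric) auto
    ultimately have "summable (\<lambda>k. h (k + 1) x - h k x)"
      by (intro summable_comparison_test'[of _ 0 "\<lambda>k. h (k + 1) x - h k x"])
    then have "convergent (\<lambda>n. \<Sum>k<n. h (k + 1) x - h k x)"
      by (simp add: summable_iff_convergent)
    then have "convergent (\<lambda>n. (h n x - h 0 x) + h 0 x)"
      using sum_lessThan_telescope[of "\<lambda>k. h k x"] by (intro convergent_add convergent_const) simp
    then show ?case by simp
  qed
  define u where "u x = lim (\<lambda>k. h k x)" for x
  have [measurable]: "u \<in> borel_measurable M"
    unfolding u_def by (rule borel_measurable_lim_metric) measurable
  have lim: "AE x in M. (\<lambda>k. h k x) \<longlonglongrightarrow> u x"
    using conv by eventually_elim (simp add: u_def convergent_LIMSEQ_iff)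
  have "(\<lambda>n. pint M p (\<lambda>x. g n x - u x)) \<longlonglongrightarrow> 0"
  proof (rule tendsto_0_ennrealI)
    fix e :: real assume "e > 0"
    from Cauchy[OF this] obtain n0 where n0: "\<And>m n. m \<ge> n0 \<Longrightarrow> n \<ge> n0 \<Longrightarrow> pint M p (\<lambda>x. g m x - g n x) \<le> ennreal e"
      by blast
    have "pint M p (\<lambda>x. g n x - u x) \<le> ennreal e" if n: "n \<ge> n0" for n
    proof -
      have "pint M p (\<lambda>x. g n x - u x) \<le> liminf (\<lambda>k. pint M p (\<lambda>x. g n x - h k x))"
        using lim by (intro pint_Fatou p) (auto elim!: eventually_mono intro!: tendsto_intros)
      also have "\<dots> \<le> ennreal e"
      proof (rule liminf_le_const)
        show "\<forall>\<^sub>F k in sequentially. pint M p (\<lambda>x. g n x - h k x) \<le> ennreal e"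
          unfolding h_def using n rk by (intro eventually_sequentiallyI[of n0] n0) (auto intro: order_trans)
      qed
      finally show ?thesis .
    qed
    then show "\<forall>\<^sub>F n in sequentially. pint M p (\<lambda>x. g n x - u x) \<le> ennreal e"
      by (rule eventually_sequentiallyI)
  qed
  then show thesis by (intro that) auto
qed

section \<open>Convexity of the p-th power\<close>

text \<open>The gradient of |\<xi>|^p / p. It is used for vectors (grad u) and for reals (u itself),
  so that the diffusion term and the zeroth-order term share all lemmas.\<close>

definition pflux :: "real \<Rightarrow> 'c::real_normed_vector \<Rightarrow> 'c" where
  "pflux p \<xi> = norm \<xi> powr (p - 2) *\<^sub>R \<xi>"

lemma norm_pflux: "norm (pflux p \<xi>) = norm \<xi> powr (p - 1)"
  using powr_mult_base[of "norm \<xi>" "p - 2"] by (cases "\<xi> = 0") (simp_all add: pflux_def mult.commute)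

lemma pflux_inner_self: "pflux p \<xi> \<bullet> \<xi> = norm (\<xi>::'c::euclidean_space) powr p"
proof (cases "\<xi> = 0")
  case False
  have "norm \<xi> powr p = norm \<xi> powr (p - 2) * norm \<xi> powr 2"
    by (subst powr_add[symmetric]) simp
  then show ?thesis using False by (simp add: pflux_def power2_norm_eq_inner)
qed (simp add: pflux_def)

lemma abs_pflux_inner_le: "\<bar>pflux p \<xi> \<bullet> \<eta>\<bar> \<le> norm \<xi> powr (p - 1) * norm (\<eta>::'c::euclidean_space)"
  using Cauchy_Schwarz_ineq2[of "pflux p \<xi>" \<eta>] by (simp add: norm_pflux)

lemma pflux_measurable [measurable]:
  "pflux p \<in> borel_measurable (borel :: 'c::euclidean_space measure)"
  unfolding pflux_def by measurable

lemma continuous_pflux: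
  assumes "p > 1"
  shows "isCont (pflux p) (\<xi>::'c::euclidean_space)"
proof (cases "\<xi> = 0")
  case True
  have "((\<lambda>\<eta>::'c. norm \<eta> powr (p - 1)) \<longlongrightarrow> 0) (at 0)"
    using assms by (intro tendsto_eq_intros | simp)+
  then have "((\<lambda>\<eta>::'c. pflux p \<eta>) \<longlongrightarrow> 0) (at 0)"
    by (rule Lim_null_comparison[rotated]) (simp add: norm_pflux)
  then show ?thesis using True by (simp add: isCont_def) (simp add: pflux_def[of p 0])
next
  case False
  then show ?thesis
    unfolding pflux_def by (intro continuous_intros) auto
qed

text \<open>Convexity of |\<xi>|^p in tangent form, read off from Young's inequality with the
  conjugate exponent p / (p - 1).\<close>

lemma powr_tangent:
  fixes \<xi> \<eta> :: "'c::euclidean_space"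
  assumes "p > 1"
  shows "norm \<xi> powr p + p * (pflux p \<xi> \<bullet> \<eta>) \<le> norm (\<xi> + \<eta>) powr p"
proof -
  let ?q = "p / (p - 1)"
  have q: "?q > 1" "1 / p + 1 / ?q = 1" using assms by (auto simp: field_simps)
  have "pflux p \<xi> \<bullet> (\<xi> + \<eta>) \<le> norm (\<xi> + \<eta>) * norm \<xi> powr (p - 1)"
    using abs_pflux_inner_le[of p \<xi> "\<xi> + \<eta>"] by (simp add: mult.commute)
  also have "\<dots> \<le> norm (\<xi> + \<eta>) powr p / p + (norm \<xi> powr (p - 1)) powr ?q / ?q"
    by (rule Youngs_inequality) (use assms q in auto)
  also have "(norm \<xi> powr (p - 1)) powr ?q / ?q = norm \<xi> powr p * (p - 1) / p"
    using assms by (simp add: powr_powr)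
  finally have "p * (norm \<xi> powr p + pflux p \<xi> \<bullet> \<eta>) \<le> norm (\<xi> + \<eta>) powr p + norm \<xi> powr p * (p - 1)"
    using assms by (simp add: inner_add_right pflux_inner_self field_simps)
  then show ?thesis by (simp add: algebra_simps)
qed

lemma powr_midpoint_real_strict:
  fixes s t :: real
  assumes "p > 1" "0 \<le> s" "s < t"
  shows "((s + t) / 2) powr p < (s powr p + t powr p) / 2"
proof -
  let ?m = "(s + t) / 2"
  have d: "((\<lambda>x. \<bar>x\<bar> powr p) has_real_derivative p * (\<bar>x\<bar> powr (p - 1) * sgn x)) (at x)" for x
    by (rule DERIV_abs_powr[OF assms(1)])
  have sm: "s < ?m" "?m < t" using assms by auto
  obtain x where x: "s < x" "x < ?m"
    "\<bar>?m\<bar> powr p - \<bar>s\<bar> powr p = (?m - s) * (p * (\<bar>x\<bar> powr (p - 1) * sgn x))"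
    using MVT2[OF sm(1) d] by blast
  obtain y where y: "?m < y" "y < t"
    "\<bar>t\<bar> powr p - \<bar>?m\<bar> powr p = (t - ?m) * (p * (\<bar>y\<bar> powr (p - 1) * sgn y))"
    using MVT2[OF sm(2) d] by blast
  have "x powr (p - 1) < y powr (p - 1)"
    using assms x y by (intro powr_less_mono2) auto
  then have "(t - s) / 2 * p * x powr (p - 1) < (t - s) / 2 * p * y powr (p - 1)"
    using assms by (intro mult_strict_left_mono) auto
  moreover have "?m - s = (t - s) / 2" "t - ?m = (t - s) / 2"
    by (simp_all add: field_simps)
  ultimately have "(?m - s) * (p * x powr (p - 1)) < (t - ?m) * (p * y powr (p - 1))"
    by (simp only: mult.assoc)
  then have "?m powr p - s powr p < t powr p - ?m powr p"
    using x(3) y(3) x(1,2) y(1,2) assms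
    by (simp only: abs_of_nonneg[of s] abs_of_nonneg[of t] abs_of_nonneg[of ?m] abs_of_nonneg[of x] abs_of_nonneg[of y]
        sgn_pos[of x] sgn_pos[of y] mult_1_right)
  moreover have "A < (B + C) / 2" if "A - B < C - A" for A B C :: real
    using that by simp
  ultimately show ?thesis by blast
qed

text \<open>The gap in midpoint convexity of |.|^p. For a minimizing sequence the energy controls
  its integral, and its integral in turn controls the distance of the two functions.\<close>

definition mid_defect :: "real \<Rightarrow> 'c::real_normed_vector \<Rightarrow> 'c \<Rightarrow> real" where
  "mid_defect p a b = (norm a powr p + norm b powr p) / 2 - norm ((1 / 2) *\<^sub>R (a + b)) powr p"

lemma mid_defect_scaleR:
  "mid_defect p (c *\<^sub>R a) (c *\<^sub>R b) = \<bar>c\<bar> powr p * mid_defect p a b"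
proof -
  have "(1 / 2) *\<^sub>R (c *\<^sub>R a + c *\<^sub>R b) = c *\<^sub>R ((1 / 2) *\<^sub>R (a + b))"
    by (simp add: scaleR_add_right)
  then show ?thesis
    by (simp only: mid_defect_def norm_scaleR powr_mult) (simp add: algebra_simps add_divide_distrib)
qed

text \<open>If the norms differ, strict convexity of t^p on the half-line decides; if they agree,
  the parallelogram identity makes the midpoint strictly shorter.\<close>

lemma mid_defect_pos:
  fixes a b :: "'c::euclidean_space"
  assumes "p > 1" "a \<noteq> b"
  shows "mid_defect p a b > 0"
proof -
  let ?m = "norm ((1 / 2) *\<^sub>R (a + b))"
  have m: "?m \<le> (norm a + norm b) / 2" using norm_triangle_ineq[of a b] by simp
  show ?thesis
  proof (cases "norm a = norm b")
    case False
    have "((norm a + norm b) / 2) powr p < (norm a powr p + norm b powr p) / 2"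
      using powr_midpoint_real_strict[OF assms(1), of "norm a" "norm b"]
        powr_midpoint_real_strict[OF assms(1), of "norm b" "norm a"] False
      by (cases "norm a < norm b") (auto simp: add.commute)
    moreover have "?m powr p \<le> ((norm a + norm b) / 2) powr p"
      using m assms(1) by (intro powr_mono2) auto
    ultimately show ?thesis by (simp add: mid_defect_def)
  next
    case True
    have "(norm (a + b))\<^sup>2 + (norm (a - b))\<^sup>2 = 2 * ((norm a)\<^sup>2 + (norm b)\<^sup>2)"
      by (simp add: power2_norm_eq_inner inner_add_left inner_add_right inner_diff_left inner_diff_right)
    moreover have "(norm (a - b))\<^sup>2 > 0" using assms(2) by simp
    ultimately have "(norm (a + b))\<^sup>2 < (2 * norm a)\<^sup>2"
      using True by (simp add: power2_eq_square)
    then have "norm (a + b) < 2 * norm a"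
      by (rule power_less_imp_less_base) auto
    then have "?m powr p < norm a powr p"
      using assms(1) by (intro powr_less_mono2) auto
    then show ?thesis using True by (simp add: mid_defect_def)
  qed
qed

lemma mid_defect_nonneg:
  fixes a b :: "'c::euclidean_space"
  shows "p > 1 \<Longrightarrow> mid_defect p a b \<ge> 0"
proof (cases "a = b")
  case True
  have "norm ((1 / 2) *\<^sub>R (b + b)) = norm b" by (metis scaleR_half_double)
  then show ?thesis using True by (simp add: mid_defect_def)
qed (simp add: mid_defect_pos less_imp_le)

text \<open>Uniform convexity, obtained from strict convexity by compactness and homogeneity.\<close>

lemma mid_defect_lower_bound:
  assumes p: "p > 1" and "\<epsilon> > 0"
  obtains \<delta> where "\<delta> > 0" and
    "\<And>a b::'c::euclidean_space. \<epsilon> * (norm a + norm b) \<le> norm (a - b) \<Longrightarrow>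
       \<delta> * (norm a powr p + norm b powr p) \<le> mid_defect p a b"
proof -
  define S where "S = {z::'c \<times> 'c. norm (fst z) + norm (snd z) = 1 \<and> \<epsilon> \<le> norm (fst z - snd z)}"
  have "compact S"
  proof -
    have "closed S"
      unfolding S_def by (intro closed_Collect_conj closed_Collect_eq closed_Collect_le continuous_intros)
    moreover have "bounded S"
    proof (rule boundedI)
      fix z assume "z \<in> S"
      then show "norm z \<le> 1"
        using norm_Pair_le[of "fst z" "snd z"] by (simp add: S_def)
    qed
    ultimately show ?thesis by (simp add: compact_eq_bounded_closed)
  qed
  have cont: "continuous_on S (\<lambda>z. mid_defect p (fst z) (snd z))"
    unfolding mid_defect_def using p
    by (intro continuous_intros continuous_on_norm_powr) auto
  have pos: "mid_defect p (fst z) (snd z) > 0" if "z \<in> S" for z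
    using that \<open>\<epsilon> > 0\<close> by (intro mid_defect_pos p) (auto simp: S_def)
  obtain \<delta> where \<delta>: "\<delta> > 0" "\<And>z. z \<in> S \<Longrightarrow> \<delta> \<le> mid_defect p (fst z) (snd z)"
  proof (cases "S = {}")
    case False
    then obtain z where "z \<in> S" "\<And>w. w \<in> S \<Longrightarrow> mid_defect p (fst z) (snd z) \<le> mid_defect p (fst w) (snd w)"
      using continuous_attains_inf[OF \<open>compact S\<close> False cont] by blast
    then show thesis using pos that by blast
  qed (use that[of 1] in auto)
  show thesis
  \<comment> \<open>Halved because |a|^p and |b|^p are each bounded by (|a| + |b|)^p.\<close>
  proof (rule that[of "\<delta> / 2"])
    fix a b :: 'c
    assume ab: "\<epsilon> * (norm a + norm b) \<le> norm (a - b)"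
    let ?s = "norm a + norm b"
    show "\<delta> / 2 * (norm a powr p + norm b powr p) \<le> mid_defect p a b"
    proof (cases "?s = 0")
      case True
      then have "a = 0" "b = 0" by (simp_all add: add_nonneg_eq_0_iff)
      then show ?thesis by (simp add: mid_defect_def)
    next
      case False
      then have s: "?s > 0" using norm_ge_zero[of a] norm_ge_zero[of b] by linarith
      let ?z = "(a /\<^sub>R ?s, b /\<^sub>R ?s)"
      have n: "norm (a /\<^sub>R ?s) = norm a / ?s" "norm (b /\<^sub>R ?s) = norm b / ?s"
        using s by (auto simp: divide_inverse mult.commute)
      have n3: "norm (a /\<^sub>R ?s - b /\<^sub>R ?s) = norm (a - b) / ?s"
        using s by (simp add: divide_inverse mult.commute flip: scaleR_diff_right)
      have "?z \<in> S"
        using s ab n3 unfolding S_def mem_Collect_eq fst_conv snd_conv n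
        by (simp add: pos_le_divide_eq flip: add_divide_distrib)
      then have "\<delta> \<le> mid_defect p (a /\<^sub>R ?s) (b /\<^sub>R ?s)"
        using \<delta>(2) by fastforce
      also have "\<dots> = mid_defect p a b / ?s powr p"
        using s unfolding mid_defect_scaleR by (simp add: inverse_eq_divide powr_divide)
      finally have "\<delta> * ?s powr p \<le> mid_defect p a b"
        using s by (simp add: field_simps)
      moreover have "norm a powr p \<le> ?s powr p" "norm b powr p \<le> ?s powr p"
        using p by (auto intro!: powr_mono2)
      then have "\<delta> / 2 * (norm a powr p + norm b powr p) \<le> \<delta> / 2 * (2 * ?s powr p)"
        using \<delta>(1) by (intro mult_left_mono) auto
      ultimately show ?thesis by simp
    qed
  qed (use \<delta> in auto)
qed

lemma mid_defect_measurable [measurable]: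
  fixes f g :: "'b \<Rightarrow> 'c::euclidean_space"
  assumes [measurable]: "f \<in> borel_measurable M" "g \<in> borel_measurable M"
  shows "(\<lambda>x. mid_defect p (f x) (g x)) \<in> borel_measurable M"
  unfolding mid_defect_def by measurable

lemma integrable_powr_add:
  fixes f g :: "'b \<Rightarrow> 'c::euclidean_space"
  assumes "p > 0" and [measurable]: "f \<in> borel_measurable M" "g \<in> borel_measurable M"
    and "integrable M (\<lambda>x. norm (f x) powr p)" "integrable M (\<lambda>x. norm (g x) powr p)"
  shows "integrable M (\<lambda>x. norm (f x + g x) powr p)"
proof (rule Bochner_Integration.integrable_bound)
  show "integrable M (\<lambda>x. 2 powr p * (norm (f x) powr p + norm (g x) powr p))"
    using assms by simp
  show "AE x in M. norm (norm (f x + g x) powr p) \<le> norm (2 powr p * (norm (f x) powr p + norm (g x) powr p))"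
    using norm_add_powr_le[OF assms(1)] by (intro AE_I2) simp
qed measurable

lemma integrable_powr_scaleR:
  fixes f :: "'b \<Rightarrow> 'c::euclidean_space"
  assumes "integrable M (\<lambda>x. norm (f x) powr p)"
  shows "integrable M (\<lambda>x. norm (c *\<^sub>R f x) powr p)"
  using integrable_mult_right[OF assms, of "\<bar>c\<bar> powr p"] by (simp add: powr_mult)

lemma integrable_mid_defect:
  fixes f g :: "'b \<Rightarrow> 'c::euclidean_space"
  assumes "p > 1" and [measurable]: "f \<in> borel_measurable M" "g \<in> borel_measurable M"
    and fg: "integrable M (\<lambda>x. norm (f x) powr p)" "integrable M (\<lambda>x. norm (g x) powr p)"
  shows "integrable M (\<lambda>x. mid_defect p (f x) (g x))"
  unfolding mid_defect_def using assms(1)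
  by (intro Bochner_Integration.integrable_diff integrable_divide Bochner_Integration.integrable_add
      fg integrable_powr_scaleR integrable_powr_add) auto

text \<open>Pointwise, either |a - b| is at least e (|a| + |b|), and then the defect controls |a -
  b|^p, or |a - b|^p is at most e^p (|a| + |b|)^p, which is small in the mean by the bound
  \<open>C\<close>. The threshold \<eta> does not depend on the functions, as the Cauchy property
  requires.\<close>

lemma mid_defect_uniform_convexity:
  assumes p: "p > 1" and "C \<ge> 0" and "\<epsilon> > 0"
  obtains \<eta> where "\<eta> > 0" and
    "\<And>f g :: 'b \<Rightarrow> 'c::euclidean_space. f \<in> borel_measurable M \<Longrightarrow> g \<in> borel_measurable M \<Longrightarrow>
      integrable M (\<lambda>x. norm (f x) powr p) \<Longrightarrow> integrable M (\<lambda>x. norm (g x) powr p) \<Longrightarrow>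
      (LINT x|M. norm (f x) powr p) \<le> C \<Longrightarrow> (LINT x|M. norm (g x) powr p) \<le> C \<Longrightarrow>
      (LINT x|M. mid_defect p (f x) (g x)) \<le> \<eta> \<Longrightarrow> pint M p (\<lambda>x. f x - g x) \<le> ennreal \<epsilon>"
proof -
  define c where "c = 2 powr p"
  have c: "c > 0" by (simp add: c_def)
  obtain d where d: "d > 0" "C \<le> d"
    using \<open>C \<ge> 0\<close> by (intro that[of "C + 1"]) auto
  \<comment> \<open>Chosen so that the second alternative contributes e^p c * 2 C \<le> \<epsilon> /
    2; the value of \<eta> given below leaves the other half to the defect. \<open>d\<close>
    replaces \<open>C\<close>, which may be zero.\<close>
  define e where "e = (\<epsilon> / (4 * c * d)) powr (1 / p)"
  have e: "e > 0" "e powr p = \<epsilon> / (4 * c * d)"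
    unfolding e_def using assms c d by (auto simp: powr_powr)
  obtain \<delta> where \<delta>: "\<delta> > 0" "\<And>a b::'c. e * (norm a + norm b) \<le> norm (a - b) \<Longrightarrow>
       \<delta> * (norm a powr p + norm b powr p) \<le> mid_defect p a b"
    using mid_defect_lower_bound[OF p e(1)] by metis
  have pw: "norm (a - b) powr p \<le> (e powr p * c) * (norm a powr p + norm b powr p) + (c / \<delta>) * mid_defect p a b" for a b :: 'c
  proof -
    have s: "(norm a + norm b) powr p \<le> c * (norm a powr p + norm b powr p)"
      using norm_add_powr_le[of p "norm a" "norm b"] p by (simp add: c_def)
    show ?thesis
    proof (cases "e * (norm a + norm b) \<le> norm (a - b)")
      case True
      have "norm (a - b) powr p \<le> (norm a + norm b) powr p"
        using p norm_triangle_ineq4[of a b] by (intro powr_mono2) auto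
      also have "\<dots> \<le> (c / \<delta>) * (\<delta> * (norm a powr p + norm b powr p))"
        using s \<delta> by simp
      also have "\<dots> \<le> (c / \<delta>) * mid_defect p a b"
        using \<delta> True c by (intro mult_left_mono) auto
      finally show ?thesis using c by (simp add: add_increasing)
    next
      case False
      have "norm (a - b) powr p \<le> (e * (norm a + norm b)) powr p"
        using p False by (intro powr_mono2) auto
      also have "\<dots> = e powr p * (norm a + norm b) powr p"
        by (rule powr_mult)
      also have "\<dots> \<le> e powr p * (c * (norm a powr p + norm b powr p))"
        using s by (intro mult_left_mono) auto
      finally show ?thesis
        using c \<delta> mid_defect_nonneg[OF p, of a b] by (simp add: mult.assoc add_increasing2)
    qed
  qed
  show thesis
  proof (rule that[of "\<epsilon> * \<delta> / (2 * c)"])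
    show "\<epsilon> * \<delta> / (2 * c) > 0" using assms \<delta> c by simp
    fix f g :: "'b \<Rightarrow> 'c"
    assume [measurable]: "f \<in> borel_measurable M" "g \<in> borel_measurable M"
      and f: "integrable M (\<lambda>x. norm (f x) powr p)" "(LINT x|M. norm (f x) powr p) \<le> C"
      and g: "integrable M (\<lambda>x. norm (g x) powr p)" "(LINT x|M. norm (g x) powr p) \<le> C"
      and D: "(LINT x|M. mid_defect p (f x) (g x)) \<le> \<epsilon> * \<delta> / (2 * c)"
    have int: "integrable M (\<lambda>x. norm (f x - g x) powr p)"
      using integrable_powr_add[of p f M "\<lambda>x. - g x"] p f g by simp
    have iD: "integrable M (\<lambda>x. mid_defect p (f x) (g x))"
      by (rule integrable_mid_defect[OF p _ _ f(1) g(1)]) measurable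
    have "(LINT x|M. norm (f x - g x) powr p) \<le>
        (LINT x|M. (e powr p * c) * (norm (f x) powr p + norm (g x) powr p) + (c / \<delta>) * mid_defect p (f x) (g x))"
      using int f g iD by (intro integral_mono pw) auto
    also have "\<dots> = (e powr p * c) * ((LINT x|M. norm (f x) powr p) + (LINT x|M. norm (g x) powr p))
        + (c / \<delta>) * (LINT x|M. mid_defect p (f x) (g x))"
      using f g iD by simp
    also have "\<dots> \<le> (e powr p * c) * (C + C) + (c / \<delta>) * (\<epsilon> * \<delta> / (2 * c))"
      using f g D c \<delta> by (intro add_mono mult_left_mono) auto
    also have "\<dots> = \<epsilon> * C / (2 * d) + \<epsilon> / 2"
      unfolding e(2) using c \<delta>(1) d(1) by (simp add: field_simps)
    also have "\<dots> \<le> \<epsilon>"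
      using d \<open>\<epsilon> > 0\<close> by (simp add: field_simps)
    finally show "pint M p (\<lambda>x. f x - g x) \<le> ennreal \<epsilon>"
      by (simp add: pint_eq_integral[OF int] ennreal_leI)
  qed
qed

lemma integrable_powr_mult:
  fixes U :: "'b \<Rightarrow> 'c::euclidean_space" and V :: "'b \<Rightarrow> 'd::euclidean_space"
  assumes p: "p > 1" and [measurable]: "U \<in> borel_measurable M" "V \<in> borel_measurable M"
    and UV: "integrable M (\<lambda>x. norm (U x) powr p)" "integrable M (\<lambda>x. norm (V x) powr p)"
  shows "integrable M (\<lambda>x. norm (U x) powr (p - 1) * norm (V x))"
proof (rule Bochner_Integration.integrable_bound)
  show "integrable M (\<lambda>x. norm (norm (U x) + norm (V x)) powr p)"
    using UV p by (intro integrable_powr_add) auto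
  have le: "norm (U x) powr (p - 1) * norm (V x) \<le> norm (norm (U x) + norm (V x)) powr p" for x
  proof -
    let ?s = "norm (U x) + norm (V x)"
    have "norm (U x) powr (p - 1) * norm (V x) \<le> ?s powr (p - 1) * ?s"
      using p by (intro mult_mono powr_mono2) auto
    also have "\<dots> = ?s powr p"
      using powr_mult_base[of ?s "p - 1"] by (simp add: mult.commute)
    finally show ?thesis by simp
  qed
  then show "AE x in M. norm (norm (U x) powr (p - 1) * norm (V x)) \<le> norm (norm (norm (U x) + norm (V x)) powr p)"
    by (intro AE_I2) simp
qed auto

lemma pflux_integrable:
  fixes U V :: "'b \<Rightarrow> 'c::euclidean_space"
  assumes p: "p > 1" and [measurable]: "U \<in> borel_measurable M" "V \<in> borel_measurable M"
    and UV: "integrable M (\<lambda>x. norm (U x) powr p)" "integrable M (\<lambda>x. norm (V x) powr p)"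
  shows "integrable M (\<lambda>x. pflux p (U x) \<bullet> V x)"
  by (rule Bochner_Integration.integrable_bound[OF integrable_powr_mult[OF p _ _ UV]])
    (auto intro!: AE_I2 abs_pflux_inner_le)

lemma pflux_inner_tendsto:
  fixes U V :: "'b \<Rightarrow> 'c::euclidean_space"
  assumes p: "p > 1" and [measurable]: "U \<in> borel_measurable M" "V \<in> borel_measurable M"
    and UV: "integrable M (\<lambda>x. norm (U x) powr p)" "integrable M (\<lambda>x. norm (V x) powr p)"
    and t: "t \<longlonglongrightarrow> 0" "\<And>n. \<bar>t n\<bar> \<le> 1"
  shows "(\<lambda>n. LINT x|M. pflux p (U x + t n *\<^sub>R V x) \<bullet> V x) \<longlonglongrightarrow> (LINT x|M. pflux p (U x) \<bullet> V x)"
proof (rule integral_dominated_convergence[where w = "\<lambda>x. norm (norm (U x) + norm (V x)) powr (p - 1) * norm (V x)"])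
  have "integrable M (\<lambda>x. norm (norm (U x) + norm (V x)) powr p)"
    using UV p by (intro integrable_powr_add) auto
  then show "integrable M (\<lambda>x. norm (norm (U x) + norm (V x)) powr (p - 1) * norm (V x))"
    using p UV by (intro integrable_powr_mult[of p "\<lambda>x. norm (U x) + norm (V x)"]) auto
  show "AE x in M. (\<lambda>n. pflux p (U x + t n *\<^sub>R V x) \<bullet> V x) \<longlonglongrightarrow> pflux p (U x) \<bullet> V x"
  proof (rule AE_I2)
    fix x
    have "(\<lambda>n. U x + t n *\<^sub>R V x) \<longlonglongrightarrow> U x + 0 *\<^sub>R V x"
      by (intro tendsto_intros t)
    then show "(\<lambda>n. pflux p (U x + t n *\<^sub>R V x) \<bullet> V x) \<longlonglongrightarrow> pflux p (U x) \<bullet> V x"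
      by (intro tendsto_inner tendsto_const isCont_tendsto_compose[OF continuous_pflux[OF p]]) simp
  qed
  show "AE x in M. norm (pflux p (U x + t n *\<^sub>R V x) \<bullet> V x)
      \<le> norm (norm (U x) + norm (V x)) powr (p - 1) * norm (V x)" for n
  proof (rule AE_I2)
    fix x
    have "norm (U x + t n *\<^sub>R V x) \<le> norm (U x) + norm (V x)"
      using norm_triangle_ineq[of "U x" "t n *\<^sub>R V x"] mult_left_le_one_le[of "norm (V x)" "\<bar>t n\<bar>"] t(2)[of n] by simp
    then have "norm (U x + t n *\<^sub>R V x) powr (p - 1) * norm (V x) \<le> (norm (U x) + norm (V x)) powr (p - 1) * norm (V x)"
      using p by (intro mult_right_mono powr_mono2) auto
    then show "norm (pflux p (U x + t n *\<^sub>R V x) \<bullet> V x)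
      \<le> norm (norm (U x) + norm (V x)) powr (p - 1) * norm (V x)"
      using abs_pflux_inner_le[of p "U x + t n *\<^sub>R V x" "V x"] by simp
  qed
qed auto

section \<open>Functions vanishing on the boundary\<close>

lemma pint_tendsto_0_add:
  fixes a b :: "nat \<Rightarrow> 'b \<Rightarrow> 'c::euclidean_space"
  assumes p: "p > 0" and "\<And>n. a n \<in> borel_measurable M" "\<And>n. b n \<in> borel_measurable M"
    and "(\<lambda>n. pint M p (a n)) \<longlonglongrightarrow> 0" "(\<lambda>n. pint M p (b n)) \<longlonglongrightarrow> 0"
  shows "(\<lambda>n. pint M p (\<lambda>x. a n x + b n x)) \<longlonglongrightarrow> 0"
proof (rule tendsto_sandwich[where f = "\<lambda>_. 0"])
  have "(\<lambda>n. ennreal (2 powr p) * (pint M p (a n) + pint M p (b n))) \<longlonglongrightarrow> ennreal (2 powr p) * (0 + 0)"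
    by (intro tendsto_mult_ennreal tendsto_add tendsto_const assms) auto
  then show "(\<lambda>n. ennreal (2 powr p) * (pint M p (a n) + pint M p (b n))) \<longlonglongrightarrow> 0" by simp
  show "\<forall>\<^sub>F n in sequentially. pint M p (\<lambda>x. a n x + b n x) \<le> ennreal (2 powr p) * (pint M p (a n) + pint M p (b n))"
    using assms by (intro always_eventually allI pint_add) auto
qed auto

lemma pint_tendsto_0_bound:
  fixes a :: "nat \<Rightarrow> 'b \<Rightarrow> 'c::euclidean_space" and b :: "nat \<Rightarrow> 'b \<Rightarrow> 'd::euclidean_space"
  assumes p: "p > 0" and [measurable]: "\<And>n. b n \<in> borel_measurable M"
    and lim: "(\<lambda>n. pint M p (b n)) \<longlonglongrightarrow> 0"
    and le: "\<And>n x. norm (a n x) \<le> C * norm (b n x)"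
  shows "(\<lambda>n. pint M p (a n)) \<longlonglongrightarrow> 0"
proof (rule tendsto_sandwich[where f = "\<lambda>_. 0"])
  have "(\<lambda>n. ennreal (\<bar>C\<bar> powr p) * pint M p (b n)) \<longlonglongrightarrow> ennreal (\<bar>C\<bar> powr p) * 0"
    by (intro tendsto_mult_ennreal tendsto_const lim) auto
  then show "(\<lambda>n. ennreal (\<bar>C\<bar> powr p) * pint M p (b n)) \<longlonglongrightarrow> 0" by simp
  have "pint M p (a n) \<le> ennreal (\<bar>C\<bar> powr p) * pint M p (b n)" for n
  proof -
    have "norm (a n x) \<le> norm (C *\<^sub>R b n x)" for x
      using le[of n x] mult_right_mono[OF abs_ge_self, of "norm (b n x)" C] by simp
    then have "pint M p (a n) \<le> pint M p (\<lambda>x. C *\<^sub>R b n x)"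
      by (intro pint_mono p AE_I2)
    then show ?thesis by (simp add: pint_cmult)
  qed
  then show "\<forall>\<^sub>F n in sequentially. pint M p (a n) \<le> ennreal (\<bar>C\<bar> powr p) * pint M p (b n)"
    by (intro always_eventually allI)
qed auto

lemma pint_tendsto_integral_inner:
  fixes g :: "nat \<Rightarrow> 'b \<Rightarrow> 'c::euclidean_space"
  assumes p: "p > 1" and [measurable]: "\<And>n. g n \<in> borel_measurable M" "u \<in> borel_measurable M" "w \<in> borel_measurable M"
    and g: "\<And>n. integrable M (\<lambda>x. norm (g n x) powr p)" and u: "integrable M (\<lambda>x. norm (u x) powr p)"
    and w: "integrable M (\<lambda>x. norm (w x) powr (p / (p - 1)))"
    and lim: "(\<lambda>n. pint M p (\<lambda>x. g n x - u x)) \<longlonglongrightarrow> 0"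
  shows "(\<lambda>n. LINT x|M. g n x \<bullet> w x) \<longlonglongrightarrow> (LINT x|M. u x \<bullet> w x)"
proof -
  define q where "q = p / (p - 1)"
  have q: "q > 1" "1 / p + 1 / q = 1" using p by (auto simp: q_def field_simps)
  have w': "integrable M (\<lambda>x. \<bar>norm (w x)\<bar> powr q)" using w by (simp add: q_def)
  have int: "integrable M (\<lambda>x. h x \<bullet> w x)"
    if [measurable]: "h \<in> borel_measurable M" and "integrable M (\<lambda>x. norm (h x) powr p)" for h :: "'b \<Rightarrow> 'c"
  proof -
    have "integrable M (\<lambda>x. norm (h x) * norm (w x))"
      using that by (intro Holder(1)[OF p q] w') auto
    then show ?thesis
      by (rule Bochner_Integration.integrable_bound) (auto intro!: AE_I2 Cauchy_Schwarz_ineq2)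
  qed
  let ?d = "\<lambda>n x. g n x - u x"
  have d: "integrable M (\<lambda>x. norm (?d n x) powr p)" for n
    using integrable_powr_add[of p "g n" M "\<lambda>x. - u x"] g u p by simp
  have "(\<lambda>n. ennreal (LINT x|M. norm (?d n x) powr p)) \<longlonglongrightarrow> ennreal 0"
    using lim by (simp add: pint_eq_integral[OF d])
  then have lim': "(\<lambda>n. LINT x|M. norm (?d n x) powr p) \<longlonglongrightarrow> 0"
    by (subst (asm) tendsto_ennreal_iff) auto
  have "(\<lambda>n. (LINT x|M. g n x \<bullet> w x) - (LINT x|M. u x \<bullet> w x)) \<longlonglongrightarrow> 0"
  proof (rule Lim_null_comparison)
    show "\<forall>\<^sub>F n in sequentially. norm ((LINT x|M. g n x \<bullet> w x) - (LINT x|M. u x \<bullet> w x))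
      \<le> (LINT x|M. norm (?d n x) powr p) powr (1 / p) * (LINT x|M. \<bar>norm (w x)\<bar> powr q) powr (1 / q)"
    proof (intro always_eventually allI)
      fix n
      have "(LINT x|M. g n x \<bullet> w x) - (LINT x|M. u x \<bullet> w x) = (LINT x|M. ?d n x \<bullet> w x)"
        using int[OF _ g] int[OF _ u] by (simp add: inner_diff_left)
      also have "norm \<dots> \<le> (LINT x|M. norm (?d n x \<bullet> w x))"
        by (rule integral_norm_bound)
      also have "\<dots> \<le> (LINT x|M. \<bar>norm (?d n x) * norm (w x)\<bar>)"
      proof (rule integral_mono)
        show "integrable M (\<lambda>x. norm (?d n x \<bullet> w x))" using int[OF _ d] by simp
        show "integrable M (\<lambda>x. \<bar>norm (?d n x) * norm (w x)\<bar>)"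
          using d w' by (intro integrable_abs Holder(1)[OF p q]) auto
      qed (auto intro: Cauchy_Schwarz_ineq2)
      also have "\<dots> \<le> (LINT x|M. \<bar>norm (?d n x)\<bar> powr p) powr (1 / p) * (LINT x|M. \<bar>norm (w x)\<bar> powr q) powr (1 / q)"
        using d w' by (intro Holder(2)[OF p q]) auto
      finally show "norm ((LINT x|M. g n x \<bullet> w x) - (LINT x|M. u x \<bullet> w x))
      \<le> (LINT x|M. norm (?d n x) powr p) powr (1 / p) * (LINT x|M. \<bar>norm (w x)\<bar> powr q) powr (1 / q)" by simp
    qed
    have "(\<lambda>n. (LINT x|M. norm (?d n x) powr p) powr (1 / p) * (LINT x|M. \<bar>norm (w x)\<bar> powr q) powr (1 / q))
        \<longlonglongrightarrow> 0 powr (1 / p) * (LINT x|M. \<bar>norm (w x)\<bar> powr q) powr (1 / q)"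
      using p by (intro tendsto_mult tendsto_powr' lim' tendsto_const) auto
    then show "(\<lambda>n. (LINT x|M. norm (?d n x) powr p) powr (1 / p) * (LINT x|M. \<bar>norm (w x)\<bar> powr q) powr (1 / q)) \<longlonglongrightarrow> 0"
      by simp
  qed
  then show ?thesis by (simp add: LIM_zero_iff)
qed

text \<open>The Sobolev space with zero boundary values on the whole space: the closure of the pairs
  (\<phi>, grad \<phi>), with Borel representatives. Carrying the gradient as a second argument
  makes sums, limits and the chain rule statements about pairs; the link to
  \<open>has_weak_gradient\<close> is made at the end.\<close>

definition sob0 :: "real \<Rightarrow> 'a::euclidean_space set \<Rightarrow> ('a \<Rightarrow> real) \<Rightarrow> ('a \<Rightarrow> 'a) \<Rightarrow> bool" where
  "sob0 p \<Omega> u U \<longleftrightarrow> u \<in> borel_measurable borel \<and> U \<in> borel_measurable borel \<and>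
     (\<exists>\<phi>. (\<forall>n::nat. \<phi> n \<in> C0_infinity \<Omega>) \<and>
        (\<lambda>n. pint lborel p (\<lambda>x. \<phi> n x - u x)) \<longlonglongrightarrow> 0 \<and>
        (\<lambda>n. pint lborel p (\<lambda>x. grad (\<phi> n) x - U x)) \<longlonglongrightarrow> 0)"

lemma sob0_measurable:
  assumes "sob0 p \<Omega> u U"
  shows "u \<in> borel_measurable borel" "U \<in> borel_measurable borel"
  using assms by (auto simp: sob0_def)

lemma sob0E:
  assumes "sob0 p \<Omega> u U"
  obtains \<phi> where "\<And>n::nat. \<phi> n \<in> C0_infinity \<Omega>"
    "(\<lambda>n. pint lborel p (\<lambda>x. \<phi> n x - u x)) \<longlonglongrightarrow> 0" "(\<lambda>n. pint lborel p (\<lambda>x. grad (\<phi> n) x - U x)) \<longlonglongrightarrow> 0"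
  using assms unfolding sob0_def by blast

lemma C0_infinity_measurable:
  assumes "\<phi> \<in> C0_infinity \<Omega>"
  shows "\<phi> \<in> borel_measurable borel" "grad \<phi> \<in> borel_measurable borel"
  using smooth_measurable[OF C0_infinity_smooth[OF assms]] .

lemma sob0_C0_infinity:
  assumes "\<phi> \<in> C0_infinity \<Omega>"
  shows "sob0 p \<Omega> \<phi> (grad \<phi>)"
  unfolding sob0_def using C0_infinity_measurable[OF assms] assms
  by (auto intro!: exI[of _ "\<lambda>_. \<phi>"] simp: pint_def)

lemma pint_of_tendsto:
  fixes g :: "nat \<Rightarrow> 'b \<Rightarrow> 'c::euclidean_space"
  assumes p: "p > 0" and [measurable]: "\<And>n. g n \<in> borel_measurable M" "u \<in> borel_measurable M"
    and g: "\<And>n. integrable M (\<lambda>x. norm (g n x) powr p)"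
    and lim: "(\<lambda>n. pint M p (\<lambda>x. g n x - u x)) \<longlonglongrightarrow> 0"
  shows "integrable M (\<lambda>x. norm (u x) powr p)"
proof -
  have "\<forall>\<^sub>F n in sequentially. pint M p (\<lambda>x. g n x - u x) < 1"
    using lim by (rule order_tendstoD) auto
  then obtain n where n: "pint M p (\<lambda>x. g n x - u x) < 1"
    by (auto simp: eventually_sequentially)
  then have "integrable M (\<lambda>x. norm (g n x - u x) powr p)"
    by (subst pint_finite_iff[symmetric]) (auto intro: less_trans ennreal_one_less_top)
  then have "integrable M (\<lambda>x. norm ((g n x - u x) + (- 1) *\<^sub>R g n x) powr p)"
    using integrable_powr_scaleR[OF g, of "-1" n] p by (intro integrable_powr_add) auto
  then show ?thesis by simp
qed

lemma sob0_integrable: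
  assumes p: "p > 0" and "sob0 p \<Omega> u U"
  shows "integrable lborel (\<lambda>x. norm (u x) powr p)" "integrable lborel (\<lambda>x. norm (U x) powr p)"
proof -
  obtain \<phi> where \<phi>: "\<And>n. \<phi> n \<in> C0_infinity \<Omega>"
    "(\<lambda>n. pint lborel p (\<lambda>x. \<phi> n x - u x)) \<longlonglongrightarrow> 0" "(\<lambda>n. pint lborel p (\<lambda>x. grad (\<phi> n) x - U x)) \<longlonglongrightarrow> 0"
    using sob0E[OF assms(2)] by blast
  note [measurable] = sob0_measurable[OF assms(2)] C0_infinity_measurable[OF \<phi>(1)]
  show "integrable lborel (\<lambda>x. norm (u x) powr p)"
    by (rule pint_of_tendsto[OF p _ _ _ \<phi>(2)]) (auto intro: integrable_C0_infinity_powr(1)[OF \<phi>(1) p, simplified])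
  show "integrable lborel (\<lambda>x. norm (U x) powr p)"
    by (rule pint_of_tendsto[OF p _ _ _ \<phi>(3)]) (auto intro: integrable_C0_infinity_powr[OF \<phi>(1) p])
qed

lemma sob0_AE_approx:
  assumes p: "p > 0" and "sob0 p \<Omega> u U"
  obtains \<phi> where "\<And>n::nat. \<phi> n \<in> C0_infinity \<Omega>"
    "(\<lambda>n. pint lborel p (\<lambda>x. \<phi> n x - u x)) \<longlonglongrightarrow> 0" "(\<lambda>n. pint lborel p (\<lambda>x. grad (\<phi> n) x - U x)) \<longlonglongrightarrow> 0"
    "AE x in lborel. (\<lambda>n. \<phi> n x) \<longlonglongrightarrow> u x" "AE x in lborel. (\<lambda>n. grad (\<phi> n) x) \<longlonglongrightarrow> U x"
proof -
  obtain \<phi> where \<phi>: "\<And>n. \<phi> n \<in> C0_infinity \<Omega>"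
    "(\<lambda>n. pint lborel p (\<lambda>x. \<phi> n x - u x)) \<longlonglongrightarrow> 0" "(\<lambda>n. pint lborel p (\<lambda>x. grad (\<phi> n) x - U x)) \<longlonglongrightarrow> 0"
    using sob0E[OF assms(2)] by blast
  note [measurable] = sob0_measurable[OF assms(2)] C0_infinity_measurable[OF \<phi>(1)]
  obtain r where r: "strict_mono r" "AE x in lborel. (\<lambda>n. \<phi> (r n) x) \<longlonglongrightarrow> u x"
    by (rule pint_AE_subseq[OF p _ _ \<phi>(2)]) auto
  have "(\<lambda>n. pint lborel p (\<lambda>x. grad (\<phi> (r n)) x - U x)) \<longlonglongrightarrow> 0"
    using LIMSEQ_subseq_LIMSEQ[OF \<phi>(3) r(1)] by (simp add: o_def)
  then obtain s where s: "strict_mono s" "AE x in lborel. (\<lambda>n. grad (\<phi> (r (s n))) x) \<longlonglongrightarrow> U x"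
    by (rule pint_AE_subseq[OF p, rotated 2]) auto
  have rs: "strict_mono (r \<circ> s)" by (rule strict_mono_o[OF r(1) s(1)])
  show thesis
  proof (rule that[of "\<lambda>n. \<phi> ((r \<circ> s) n)"])
    show "AE x in lborel. (\<lambda>n. \<phi> ((r \<circ> s) n) x) \<longlonglongrightarrow> u x"
      using r(2) by eventually_elim (use LIMSEQ_subseq_LIMSEQ s(1) in \<open>fastforce simp: o_def\<close>)
    show "AE x in lborel. (\<lambda>n. grad (\<phi> ((r \<circ> s) n)) x) \<longlonglongrightarrow> U x"
      using s(2) by simp
  qed (use \<phi> LIMSEQ_subseq_LIMSEQ[OF \<phi>(2) rs] LIMSEQ_subseq_LIMSEQ[OF \<phi>(3) rs] in \<open>auto simp: o_def\<close>)
qed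

lemma sob0_AE_outside:
  assumes p: "p > 0" and u: "sob0 p \<Omega> u U"
  shows "AE x in lborel. x \<notin> \<Omega> \<longrightarrow> u x = 0" "AE x in lborel. x \<notin> \<Omega> \<longrightarrow> U x = 0"
proof -
  obtain \<phi> where \<phi>: "\<And>n::nat. \<phi> n \<in> C0_infinity \<Omega>"
    "AE x in lborel. (\<lambda>n. \<phi> n x) \<longlonglongrightarrow> u x" "AE x in lborel. (\<lambda>n. grad (\<phi> n) x) \<longlonglongrightarrow> U x"
    using sob0_AE_approx[OF p u] by blast
  show "AE x in lborel. x \<notin> \<Omega> \<longrightarrow> u x = 0"
    using \<phi>(2) by eventually_elim (auto simp: C0_infinity_eq_0[OF \<phi>(1)] LIMSEQ_const_iff)
  show "AE x in lborel. x \<notin> \<Omega> \<longrightarrow> U x = 0"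
    using \<phi>(3) by eventually_elim (auto simp: C0_infinity_grad_eq_0[OF \<phi>(1)] LIMSEQ_const_iff)
qed

lemma sob0_add:
  assumes p: "p > 0" and u: "sob0 p \<Omega> u U" and v: "sob0 p \<Omega> v V"
  shows "sob0 p \<Omega> (\<lambda>x. u x + v x) (\<lambda>x. U x + V x)"
proof -
  obtain \<phi> where \<phi>: "\<And>n. \<phi> n \<in> C0_infinity \<Omega>"
    "(\<lambda>n. pint lborel p (\<lambda>x. \<phi> n x - u x)) \<longlonglongrightarrow> 0" "(\<lambda>n. pint lborel p (\<lambda>x. grad (\<phi> n) x - U x)) \<longlonglongrightarrow> 0"
    using sob0E[OF u] by blast
  obtain \<psi> where \<psi>: "\<And>n. \<psi> n \<in> C0_infinity \<Omega>"
    "(\<lambda>n. pint lborel p (\<lambda>x. \<psi> n x - v x)) \<longlonglongrightarrow> 0" "(\<lambda>n. pint lborel p (\<lambda>x. grad (\<psi> n) x - V x)) \<longlonglongrightarrow> 0"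
    using sob0E[OF v] by blast
  note [measurable] = sob0_measurable[OF u] sob0_measurable[OF v] C0_infinity_measurable[OF \<phi>(1)] C0_infinity_measurable[OF \<psi>(1)]
  have "(\<lambda>n. pint lborel p (\<lambda>x. (\<phi> n x - u x) + (\<psi> n x - v x))) \<longlonglongrightarrow> 0"
    by (rule pint_tendsto_0_add[OF p _ _ \<phi>(2) \<psi>(2)]) auto
  moreover have "(\<lambda>n. pint lborel p (\<lambda>x. (grad (\<phi> n) x - U x) + (grad (\<psi> n) x - V x))) \<longlonglongrightarrow> 0"
    by (rule pint_tendsto_0_add[OF p _ _ \<phi>(3) \<psi>(3)]) auto
  ultimately show ?thesis
    unfolding sob0_def
    by (intro conjI exI[of _ "\<lambda>n x. \<phi> n x + \<psi> n x"] allI C0_infinity_add \<phi> \<psi>)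
      (auto simp: grad_add C0_infinity_smooth[OF \<phi>(1)] C0_infinity_smooth[OF \<psi>(1)] algebra_simps)
qed

lemma sob0_cmult:
  assumes p: "p > 0" and u: "sob0 p \<Omega> u U"
  shows "sob0 p \<Omega> (\<lambda>x. c * u x) (\<lambda>x. c *\<^sub>R U x)"
proof -
  obtain \<phi> where \<phi>: "\<And>n. \<phi> n \<in> C0_infinity \<Omega>"
    "(\<lambda>n. pint lborel p (\<lambda>x. \<phi> n x - u x)) \<longlonglongrightarrow> 0" "(\<lambda>n. pint lborel p (\<lambda>x. grad (\<phi> n) x - U x)) \<longlonglongrightarrow> 0"
    using sob0E[OF u] by blast
  note [measurable] = sob0_measurable[OF u] C0_infinity_measurable[OF \<phi>(1)]
  have "(\<lambda>n. pint lborel p (\<lambda>x. c *\<^sub>R (\<phi> n x - u x))) \<longlonglongrightarrow> 0"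
    by (rule pint_tendsto_0_bound[OF p _ \<phi>(2), of _ "\<bar>c\<bar>"]) (auto simp: abs_mult)
  moreover have "(\<lambda>n. pint lborel p (\<lambda>x. c *\<^sub>R (grad (\<phi> n) x - U x))) \<longlonglongrightarrow> 0"
    by (rule pint_tendsto_0_bound[OF p _ \<phi>(3), of _ "\<bar>c\<bar>"]) auto
  ultimately show ?thesis
    unfolding sob0_def
    by (intro conjI exI[of _ "\<lambda>n x. c * \<phi> n x"] allI C0_infinity_cmult \<phi>)
      (auto simp: grad_cmult C0_infinity_smooth[OF \<phi>(1)] algebra_simps)
qed

lemma sob0_closed:
  assumes p: "p > 0" and u: "\<And>n::nat. sob0 p \<Omega> (u n) (U n)"
    and [measurable]: "v \<in> borel_measurable borel" "V \<in> borel_measurable borel"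
    and lim: "(\<lambda>n. pint lborel p (\<lambda>x. u n x - v x)) \<longlonglongrightarrow> 0" "(\<lambda>n. pint lborel p (\<lambda>x. U n x - V x)) \<longlonglongrightarrow> 0"
  shows "sob0 p \<Omega> v V"
proof -
  note [measurable] = sob0_measurable[OF u]
  have "\<exists>\<phi>. \<phi> \<in> C0_infinity \<Omega> \<and> pint lborel p (\<lambda>x. \<phi> x - u n x) < ennreal (inverse (Suc n))
      \<and> pint lborel p (\<lambda>x. grad \<phi> x - U n x) < ennreal (inverse (Suc n))" for n
  proof -
    obtain \<phi> where \<phi>: "\<And>k. \<phi> k \<in> C0_infinity \<Omega>"
      "(\<lambda>k. pint lborel p (\<lambda>x. \<phi> k x - u n x)) \<longlonglongrightarrow> 0" "(\<lambda>k. pint lborel p (\<lambda>x. grad (\<phi> k) x - U n x)) \<longlonglongrightarrow> 0"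
      using sob0E[OF u[of n]] by blast
    have "\<forall>\<^sub>F k in sequentially. pint lborel p (\<lambda>x. \<phi> k x - u n x) < ennreal (inverse (Suc n)) \<and>
        pint lborel p (\<lambda>x. grad (\<phi> k) x - U n x) < ennreal (inverse (Suc n))"
      by (intro eventually_conj order_tendstoD(2)[OF \<phi>(2)] order_tendstoD(2)[OF \<phi>(3)]) auto
    then show ?thesis using \<phi>(1) by (auto simp: eventually_sequentially)
  qed
  then obtain \<phi> where \<phi>: "\<And>n. \<phi> n \<in> C0_infinity \<Omega>"
    "\<And>n. pint lborel p (\<lambda>x. \<phi> n x - u n x) < ennreal (inverse (Suc n))"
    "\<And>n. pint lborel p (\<lambda>x. grad (\<phi> n) x - U n x) < ennreal (inverse (Suc n))"
    by metis
  note [measurable] = C0_infinity_measurable[OF \<phi>(1)]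
  have 0: "(\<lambda>n. ennreal (inverse (Suc n))) \<longlonglongrightarrow> 0"
    using tendsto_ennrealI[OF LIMSEQ_inverse_real_of_nat] by simp
  have "(\<lambda>n. pint lborel p (\<lambda>x. \<phi> n x - u n x)) \<longlonglongrightarrow> 0" "(\<lambda>n. pint lborel p (\<lambda>x. grad (\<phi> n) x - U n x)) \<longlonglongrightarrow> 0"
    by (rule tendsto_sandwich[OF _ _ tendsto_const 0]; use \<phi> in \<open>auto intro!: always_eventually less_imp_le simp del: of_nat_Suc\<close>)+
  from pint_tendsto_0_add[OF p _ _ this(1) lim(1)] pint_tendsto_0_add[OF p _ _ this(2) lim(2)]
  have "(\<lambda>n. pint lborel p (\<lambda>x. \<phi> n x - v x)) \<longlonglongrightarrow> 0" "(\<lambda>n. pint lborel p (\<lambda>x. grad (\<phi> n) x - V x)) \<longlonglongrightarrow> 0"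
    by simp_all
  then show ?thesis using \<phi>(1) by (auto simp: sob0_def)
qed

text \<open>The assumption on \<open>\<lambda>x. \<zeta> x * G (\<phi> x)\<close> holds if \<open>\<zeta>\<close> is a test function, or if \<open>G 0 = 0\<close>.\<close>

lemma sob0_compose:
  assumes p: "p > 0" and u: "sob0 p \<Omega> u U"
    and \<zeta>: "smooth \<zeta>" "\<And>x. \<bar>\<zeta> x\<bar> \<le> C" "\<And>x. norm (grad \<zeta> x) \<le> C"
    and G: "\<And>t. (G has_real_derivative G' t) (at t)" "\<And>t. \<bar>G' t\<bar> \<le> L" "continuous_on UNIV G'"
    and G_smooth: "\<And>\<phi>. \<phi> \<in> C0_infinity \<Omega> \<Longrightarrow> smooth (\<lambda>x. G (\<phi> x))"
    and C0: "\<And>\<phi>. \<phi> \<in> C0_infinity \<Omega> \<Longrightarrow> (\<lambda>x. \<zeta> x * G (\<phi> x)) \<in> C0_infinity \<Omega>"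
  shows "sob0 p \<Omega> (\<lambda>x. \<zeta> x * G (u x)) (\<lambda>x. G (u x) *\<^sub>R grad \<zeta> x + (\<zeta> x * G' (u x)) *\<^sub>R U x)"
proof -
  obtain \<phi> where \<phi>: "\<And>n::nat. \<phi> n \<in> C0_infinity \<Omega>"
    "(\<lambda>n. pint lborel p (\<lambda>x. \<phi> n x - u x)) \<longlonglongrightarrow> 0" "(\<lambda>n. pint lborel p (\<lambda>x. grad (\<phi> n) x - U x)) \<longlonglongrightarrow> 0"
    "AE x in lborel. (\<lambda>n. \<phi> n x) \<longlonglongrightarrow> u x" "AE x in lborel. (\<lambda>n. grad (\<phi> n) x) \<longlonglongrightarrow> U x"
    using sob0_AE_approx[OF p u] by blast
  have L: "L \<ge> 0" using G(2)[of 0] by linarith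
  have C: "C \<ge> 0" using \<zeta>(2)[of 0] by linarith
  have G_lip: "\<bar>G s - G t\<bar> \<le> L * \<bar>s - t\<bar>" for s t
    using field_differentiable_bound[of UNIV G G' L s t] G(1,2) by auto
  have contG: "continuous_on UNIV G"
    using G(1) by (meson DERIV_isCont continuous_at_imp_continuous_on)
  note [measurable] = sob0_measurable[OF u] C0_infinity_measurable[OF \<phi>(1)] smooth_measurable[OF \<zeta>(1)]
    borel_measurable_continuous_onI[OF contG] borel_measurable_continuous_onI[OF G(3)]
  let ?v = "\<lambda>x. \<zeta> x * G (u x)" and ?V = "\<lambda>x. G (u x) *\<^sub>R grad \<zeta> x + (\<zeta> x * G' (u x)) *\<^sub>R U x"
  have g: "grad (\<lambda>x. \<zeta> x * G (\<phi> n x)) x = G (\<phi> n x) *\<^sub>R grad \<zeta> x + (\<zeta> x * G' (\<phi> n x)) *\<^sub>R grad (\<phi> n) x" for n x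
    by (simp add: grad_mult[OF \<zeta>(1) G_smooth[OF \<phi>(1)]] grad_compose[OF C0_infinity_smooth[OF \<phi>(1)] G(1)])
  have 1: "(\<lambda>n. pint lborel p (\<lambda>x. \<zeta> x * G (\<phi> n x) - ?v x)) \<longlonglongrightarrow> 0"
  proof (rule pint_tendsto_0_bound[OF p _ \<phi>(2)])
    show "norm (\<zeta> x * G (\<phi> n x) - ?v x) \<le> (C * L) * norm (\<phi> n x - u x)" for n x
      using mult_mono[OF \<zeta>(2)[of x] G_lip[of "\<phi> n x" "u x"]] C
      by (simp add: abs_mult flip: right_diff_distrib)
  qed measurable
  have 2: "(\<lambda>n. pint lborel p (\<lambda>x. (G (\<phi> n x) - G (u x)) *\<^sub>R grad \<zeta> x)) \<longlonglongrightarrow> 0"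
  proof (rule pint_tendsto_0_bound[OF p _ \<phi>(2)])
    show "norm ((G (\<phi> n x) - G (u x)) *\<^sub>R grad \<zeta> x) \<le> (C * L) * norm (\<phi> n x - u x)" for n x
      using mult_mono[OF \<zeta>(3)[of x] G_lip[of "\<phi> n x" "u x"]] C by (simp add: mult_ac)
  qed measurable
  have 3: "(\<lambda>n. pint lborel p (\<lambda>x. (\<zeta> x * G' (\<phi> n x)) *\<^sub>R (grad (\<phi> n) x - U x))) \<longlonglongrightarrow> 0"
  proof (rule pint_tendsto_0_bound[OF p _ \<phi>(3)])
    show "norm ((\<zeta> x * G' (\<phi> n x)) *\<^sub>R (grad (\<phi> n) x - U x)) \<le> (C * L) * norm (grad (\<phi> n) x - U x)" for n x
      using mult_mono[OF \<zeta>(2)[of x] G(2)[of "\<phi> n x"]] C by (simp add: abs_mult mult_right_mono)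
  qed measurable
  \<comment> \<open>\<open>G'\<close> is merely continuous and bounded, so this term comes without a
    rate: almost everywhere convergence of \<phi>_n and the majorant 2 C L |U| are used.\<close>
  have 4: "(\<lambda>n. pint lborel p (\<lambda>x. (\<zeta> x * (G' (\<phi> n x) - G' (u x))) *\<^sub>R U x)) \<longlonglongrightarrow> 0"
  proof -
    have "(\<lambda>n. pint lborel p (\<lambda>x. (\<zeta> x * (G' (\<phi> n x) - G' (u x))) *\<^sub>R U x)) \<longlonglongrightarrow> (\<integral>\<^sup>+ x. 0 \<partial>(lborel::'a measure))"
      unfolding pint_def
    proof (rule nn_integral_dominated_convergence[where w = "\<lambda>x. ennreal (norm ((C * (2 * L)) *\<^sub>R U x) powr p)"])
      show "(\<integral>\<^sup>+ x. ennreal (norm ((C * (2 * L)) *\<^sub>R U x) powr p) \<partial>lborel) < \<infinity>"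
        using pint_finite_iff[of "\<lambda>x. (C * (2 * L)) *\<^sub>R U x" lborel p]
          integrable_powr_scaleR[OF sob0_integrable(2)[OF p u], of "C * (2 * L)"]
        by (simp add: pint_def infinity_ennreal_def)
      show "AE x in lborel. ennreal (norm ((\<zeta> x * (G' (\<phi> n x) - G' (u x))) *\<^sub>R U x) powr p)
          \<le> ennreal (norm ((C * (2 * L)) *\<^sub>R U x) powr p)" for n
      proof (rule AE_I2)
        fix x
        have "\<bar>G' (\<phi> n x) - G' (u x)\<bar> \<le> 2 * L" using G(2)[of "\<phi> n x"] G(2)[of "u x"] by linarith
        then have "\<bar>\<zeta> x\<bar> * \<bar>G' (\<phi> n x) - G' (u x)\<bar> \<le> C * (2 * L)"
          using \<zeta>(2)[of x] C by (intro mult_mono) auto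
        then have "norm ((\<zeta> x * (G' (\<phi> n x) - G' (u x))) *\<^sub>R U x) \<le> norm ((C * (2 * L)) *\<^sub>R U x)"
          unfolding norm_scaleR abs_mult using C L by (intro mult_right_mono) auto
        then show "ennreal (norm ((\<zeta> x * (G' (\<phi> n x) - G' (u x))) *\<^sub>R U x) powr p)
          \<le> ennreal (norm ((C * (2 * L)) *\<^sub>R U x) powr p)"
          using p by (intro ennreal_leI powr_mono2) auto
      qed
      show "AE x in lborel. (\<lambda>n. ennreal (norm ((\<zeta> x * (G' (\<phi> n x) - G' (u x))) *\<^sub>R U x) powr p)) \<longlonglongrightarrow> 0"
        using \<phi>(4)
      proof eventually_elim
        case (elim x)
        have "isCont G' (u x)" using G(3) by (simp add: continuous_on_eq_continuous_at)
        then have "(\<lambda>n. G' (\<phi> n x)) \<longlonglongrightarrow> G' (u x)" using elim by (rule isCont_tendsto_compose)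
        then have "(\<lambda>n. ennreal (norm ((\<zeta> x * (G' (\<phi> n x) - G' (u x))) *\<^sub>R U x) powr p))
            \<longlonglongrightarrow> ennreal (norm ((\<zeta> x * (G' (u x) - G' (u x))) *\<^sub>R U x) powr p)"
          using p by (intro tendsto_ennrealI tendsto_powr' tendsto_intros) auto
        then show ?case by simp
      qed
    qed measurable
    then show ?thesis by simp
  qed
  have "(\<lambda>n. pint lborel p (\<lambda>x. (G (\<phi> n x) - G (u x)) *\<^sub>R grad \<zeta> x +
      ((\<zeta> x * G' (\<phi> n x)) *\<^sub>R (grad (\<phi> n) x - U x) + (\<zeta> x * (G' (\<phi> n x) - G' (u x))) *\<^sub>R U x))) \<longlonglongrightarrow> 0"
    by (intro pint_tendsto_0_add p 2 3 4) measurable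
  then have 5: "(\<lambda>n. pint lborel p (\<lambda>x. grad (\<lambda>x. \<zeta> x * G (\<phi> n x)) x - ?V x)) \<longlonglongrightarrow> 0"
    unfolding g by (simp add: algebra_simps)
  have "?v \<in> borel_measurable borel" "?V \<in> borel_measurable borel" by measurable
  then show ?thesis
    unfolding sob0_def using 1 5 C0[OF \<phi>(1)]
    by (intro conjI exI[of _ "\<lambda>n x. \<zeta> x * G (\<phi> n x)"]) auto
qed

lemma sob0_compose_0:
  assumes p: "p > 0" and u: "sob0 p \<Omega> u U"
    and G: "\<And>t. (G has_real_derivative G' t) (at t)" "\<And>t. \<bar>G' t\<bar> \<le> L" "continuous_on UNIV G'" "G 0 = 0"
    and G_smooth: "\<And>\<phi>::'a::euclidean_space \<Rightarrow> real. smooth \<phi> \<Longrightarrow> smooth (\<lambda>x. G (\<phi> x))"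
  shows "sob0 p \<Omega> (\<lambda>x::'a. G (u x)) (\<lambda>x. G' (u x) *\<^sub>R U x)"
proof -
  have "sob0 p \<Omega> (\<lambda>x. 1 * G (u x)) (\<lambda>x. G (u x) *\<^sub>R grad (\<lambda>x. 1) x + (1 * G' (u x)) *\<^sub>R U x)"
  proof (rule sob0_compose[OF p u smooth_const, where C = 1, OF _ _ G(1-3)])
    show "smooth (\<lambda>x. G (\<phi> x))" if "\<phi> \<in> C0_infinity \<Omega>" for \<phi>
      using G_smooth C0_infinity_smooth[OF that] .
    then show "(\<lambda>x. 1 * G (\<phi> x)) \<in> C0_infinity \<Omega>" if "\<phi> \<in> C0_infinity \<Omega>" for \<phi>
      using that G(4) by (intro C0_infinity_supportI[OF that]) auto
  qed (auto simp: grad_const)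
  then show ?thesis by (simp add: grad_const)
qed

text \<open>Fatou's lemma on the left. On the right the gradients of the approximations are compared
  with \<open>U\<close> through \<open>pint_add\<close>, which is the origin of
  \<open>2 powr p\<close>; the error \<open>d\<close> is sent to zero at the end.\<close>

lemma sob0_sobolev:
  fixes u :: "'a::euclidean_space \<Rightarrow> real" and N p :: real
  defines "N \<equiv> real DIM('a)"
  assumes p: "1 < p" "p < N" and u: "sob0 p \<Omega> u U"
  shows "integrable lborel (\<lambda>x. \<bar>u x\<bar> powr (N * p / (N - p)))"
    and "(LINT x|lborel. \<bar>u x\<bar> powr (N * p / (N - p))) \<le>
      (p * (N - 1) / (N - p)) powr (N * p / (N - p)) * (2 powr p * (LINT x|lborel. norm (U x) powr p)) powr (N / (N - p))"
proof -
  define ps where "ps = N * p / (N - p)"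
  define K where "K = (p * (N - 1) / (N - p)) powr ps"
  define Y where "Y = (LINT x|lborel. norm (U x) powr p)"
  have ps: "ps > 0" using p by (simp add: ps_def)
  have p0: "p > 0" using p by simp
  have K: "K \<ge> 0" by (simp add: K_def)
  have Y: "Y \<ge> 0" by (simp add: Y_def)
  obtain \<phi> where \<phi>: "\<And>n::nat. \<phi> n \<in> C0_infinity \<Omega>"
    "(\<lambda>n. pint lborel p (\<lambda>x. grad (\<phi> n) x - U x)) \<longlonglongrightarrow> 0"
    "AE x in lborel. (\<lambda>n. \<phi> n x) \<longlonglongrightarrow> u x"
    using sob0_AE_approx[OF p0 u] by blast
  note [measurable] = sob0_measurable[OF u] C0_infinity_measurable[OF \<phi>(1)]
  have bound: "pint lborel ps u \<le> ennreal (K * (2 powr p * (d + Y)) powr (N / (N - p)))" if d: "d > 0" for d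
  proof -
    have "\<forall>\<^sub>F n in sequentially. pint lborel p (\<lambda>x. grad (\<phi> n) x - U x) < ennreal d"
      using d by (intro order_tendstoD(2)[OF \<phi>(2)]) auto
    then have "\<forall>\<^sub>F n in sequentially. pint lborel ps (\<phi> n) \<le> ennreal (K * (2 powr p * (d + Y)) powr (N / (N - p)))"
    proof eventually_elim
      case (elim n)
      have int: "integrable lborel (\<lambda>x. norm (grad (\<phi> n) x) powr p)"
        by (rule integrable_C0_infinity_powr(2)[OF \<phi>(1) p0])
      have "pint lborel p (\<lambda>x. (grad (\<phi> n) x - U x) + U x) \<le> ennreal (2 powr p) * (ennreal d + ennreal Y)"
        using elim pint_eq_integral[OF sob0_integrable(2)[OF p0 u]]
        by (intro order_trans[OF pint_add[OF p0]] mult_left_mono add_mono) (auto simp: Y_def less_imp_le)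
      then have "(LINT x|lborel. norm (grad (\<phi> n) x) powr p) \<le> 2 powr p * (d + Y)"
        using d Y by (simp add: pint_eq_integral[OF int] flip: ennreal_plus ennreal_mult)
      then have "(LINT x|lborel. norm (grad (\<phi> n) x) powr p) powr (N / (N - p)) \<le> (2 powr p * (d + Y)) powr (N / (N - p))"
        using p by (intro powr_mono2) auto
      then have "(LINT x|lborel. norm (\<phi> n x) powr ps) \<le> K * (2 powr p * (d + Y)) powr (N / (N - p))"
        using sobolev_C0_infinity[OF \<phi>(1)[of n] p(1) p(2)[unfolded N_def]] K mult_left_mono
        unfolding real_norm_def K_def ps_def N_def by (meson order_trans)
      then show ?case
        by (subst pint_eq_integral) (auto intro!: ennreal_leI integrable_C0_infinity_powr(1)[OF \<phi>(1) ps, simplified])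
    qed
    then have "liminf (\<lambda>n. pint lborel ps (\<phi> n)) \<le> ennreal (K * (2 powr p * (d + Y)) powr (N / (N - p)))"
      by (rule liminf_le_const)
    moreover have "pint lborel ps u \<le> liminf (\<lambda>n. pint lborel ps (\<phi> n))"
      by (rule pint_Fatou[OF ps _ \<phi>(3)]) measurable
    ultimately show ?thesis by order
  qed
  have "pint lborel ps u < top"
    using bound[of 1] by (auto intro: le_less_trans)
  then have int: "integrable lborel (\<lambda>x. \<bar>u x\<bar> powr ps)"
    using pint_finite_iff[of u lborel ps] by simp
  then show "integrable lborel (\<lambda>x. \<bar>u x\<bar> powr (N * p / (N - p)))" by (simp add: ps_def)
  let ?X = "LINT x|lborel. \<bar>u x\<bar> powr ps"
  have "?X \<le> K * (2 powr p * (d + Y)) powr (N / (N - p))" if "d > 0" for d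
    using bound[OF that] K by (simp add: pint_eq_integral int)
  moreover have "((\<lambda>d. K * (2 powr p * (d + Y)) powr (N / (N - p))) \<longlongrightarrow> K * (2 powr p * (0 + Y)) powr (N / (N - p))) (at_right 0)"
    using p Y by (intro tendsto_intros tendsto_powr') (auto simp: eventually_at_filter)
  ultimately have "?X \<le> K * (2 powr p * (0 + Y)) powr (N / (N - p))"
    by (intro tendsto_lowerbound[of _ _ "at_right 0"]) (auto simp: eventually_at_filter)
  then show "(LINT x|lborel. \<bar>u x\<bar> powr (N * p / (N - p))) \<le>
      (p * (N - 1) / (N - p)) powr (N * p / (N - p)) * (2 powr p * (LINT x|lborel. norm (U x) powr p)) powr (N / (N - p))"
    by (simp add: K_def ps_def Y_def)
qed

lemma sob0_integral_by_parts:
  assumes p: "p > 1" and u: "sob0 p \<Omega> u U" and \<psi>: "\<psi> \<in> C0_infinity \<Omega>" and b: "b \<in> Basis"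
  shows "(LINT x|lborel. u x * (grad \<psi> x \<bullet> b)) = - (LINT x|lborel. (U x \<bullet> b) * \<psi> x)"
proof -
  obtain \<phi> where \<phi>: "\<And>n. \<phi> n \<in> C0_infinity \<Omega>"
    "(\<lambda>n. pint lborel p (\<lambda>x. \<phi> n x - u x)) \<longlonglongrightarrow> 0" "(\<lambda>n. pint lborel p (\<lambda>x. grad (\<phi> n) x - U x)) \<longlonglongrightarrow> 0"
    using sob0E[OF u] by blast
  note [measurable] = sob0_measurable[OF u] C0_infinity_measurable[OF \<phi>(1)] C0_infinity_measurable[OF \<psi>]
  have p0: "p > 0" and q: "p / (p - 1) > 0" using p by auto
  have "continuous_on UNIV (\<lambda>z::real \<times> 'a. norm (snd z \<bullet> b) powr (p / (p - 1)))"
    and "continuous_on UNIV (\<lambda>z::real \<times> 'a. norm (fst z *\<^sub>R b) powr (p / (p - 1)))"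
    by (intro continuous_on_norm_powr[OF q] continuous_intros)+
  from this[THEN integrable_C0_infinity_comp[OF \<psi>]] q
  have w: "integrable lborel (\<lambda>x. norm (grad \<psi> x \<bullet> b) powr (p / (p - 1)))"
    "integrable lborel (\<lambda>x. norm (\<psi> x *\<^sub>R b) powr (p / (p - 1)))" by simp_all
  have "(\<lambda>n. LINT x|lborel. \<phi> n x \<bullet> (grad \<psi> x \<bullet> b)) \<longlonglongrightarrow> (LINT x|lborel. u x \<bullet> (grad \<psi> x \<bullet> b))"
    using integrable_C0_infinity_powr(1)[OF \<phi>(1) p0] sob0_integrable(1)[OF p0 u]
    by (intro pint_tendsto_integral_inner[OF p _ _ _ _ _ w(1) \<phi>(2)]) auto
  moreover have "(\<lambda>n. LINT x|lborel. grad (\<phi> n) x \<bullet> (\<psi> x *\<^sub>R b)) \<longlonglongrightarrow> (LINT x|lborel. U x \<bullet> (\<psi> x *\<^sub>R b))"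
    using integrable_C0_infinity_powr(2)[OF \<phi>(1) p0] sob0_integrable(2)[OF p0 u]
    by (intro pint_tendsto_integral_inner[OF p _ _ _ _ _ w(2) \<phi>(3)]) auto
  moreover have "(LINT x|lborel. \<phi> n x \<bullet> (grad \<psi> x \<bullet> b)) = - (LINT x|lborel. grad (\<phi> n) x \<bullet> (\<psi> x *\<^sub>R b))" for n
    using integral_by_parts_C0_infinity[OF \<psi> C0_infinity_smooth[OF \<phi>(1)]] by (simp add: mult.commute)
  ultimately have "(LINT x|lborel. u x \<bullet> (grad \<psi> x \<bullet> b)) = - (LINT x|lborel. U x \<bullet> (\<psi> x *\<^sub>R b))"
    using LIMSEQ_unique[OF _ tendsto_minus] by fastforce
  then show ?thesis by (simp add: mult.commute)
qed

section \<open>Translations of Sobolev functions\<close>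

lemma AE_lborel_translate:
  fixes z :: "'a::euclidean_space"
  assumes "AE x in lborel. P x"
  shows "AE x in lborel. P (x + z)"
proof -
  from assms have "AE x in distr lborel borel ((+) z). P x"
    by (subst lborel_distr_plus)
  then have "AE x in lborel. P (z + x)"
    by (rule AE_distrD[rotated]) simp
  then show ?thesis by (simp add: add.commute)
qed

text \<open>The elementary inequality s \<le> \<epsilon> + \<epsilon>^(1-p) s^p turns smallness of
  the p-th power integral into smallness of the integral over a set of finite measure.\<close>

lemma pint_tendsto_0_set_nn_integral:
  fixes d :: "nat \<Rightarrow> 'b \<Rightarrow> 'c::euclidean_space"
  assumes p: "p > 1" and [measurable]: "\<And>n. d n \<in> borel_measurable M" "B \<in> sets M" and "emeasure M B < \<infinity>"
    and lim: "(\<lambda>n. pint M p (d n)) \<longlonglongrightarrow> 0"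
  shows "(\<lambda>n. \<integral>\<^sup>+ x. ennreal (norm (d n x)) * indicator B x \<partial>M) \<longlonglongrightarrow> 0"
proof (rule tendsto_0_ennrealI)
  fix e :: real assume e: "e > 0"
  obtain m where m: "m \<ge> 0" "emeasure M B = ennreal m"
    using assms(4) by (cases "emeasure M B") (auto simp: infinity_ennreal_def)
  define \<epsilon> where "\<epsilon> = e / (2 * (m + 1))"
  have \<epsilon>: "\<epsilon> > 0" "\<epsilon> * m \<le> e / 2" using e m by (auto simp: \<epsilon>_def field_simps)
  define K where "K = \<epsilon> powr (1 - p)"
  have K: "K > 0" using \<epsilon> by (simp add: K_def)
  have pw: "s \<le> \<epsilon> + K * s powr p" if "s \<ge> 0" for s
  proof (cases "s \<le> \<epsilon>")
    case False
    then have "s powr (1 - p) \<le> K"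
      unfolding K_def using p \<epsilon> by (intro powr_mono2') auto
    then have "s powr (1 - p) * s powr p \<le> K * s powr p"
      by (rule mult_right_mono) auto
    then show ?thesis using False \<epsilon> by (simp flip: powr_add)
  qed (use K in \<open>simp add: add_increasing2\<close>)
  have "\<forall>\<^sub>F n in sequentially. pint M p (d n) < ennreal (e / (2 * K))"
    using e K by (intro order_tendstoD(2)[OF lim]) auto
  then show "\<forall>\<^sub>F n in sequentially. (\<integral>\<^sup>+ x. ennreal (norm (d n x)) * indicator B x \<partial>M) \<le> ennreal e"
  proof eventually_elim
    case (elim n)
    have "(\<integral>\<^sup>+ x. ennreal (norm (d n x)) * indicator B x \<partial>M)
        \<le> (\<integral>\<^sup>+ x. ennreal \<epsilon> * indicator B x + ennreal K * ennreal (norm (d n x) powr p) \<partial>M)"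
    proof (intro nn_integral_mono)
      fix x
      have "ennreal (norm (d n x)) \<le> ennreal \<epsilon> + ennreal K * ennreal (norm (d n x) powr p)"
        using pw[of "norm (d n x)"] \<epsilon> K by (simp add: ennreal_leI flip: ennreal_mult ennreal_plus)
      then show "ennreal (norm (d n x)) * indicator B x \<le> ennreal \<epsilon> * indicator B x + ennreal K * ennreal (norm (d n x) powr p)"
        by (auto simp: indicator_def)
    qed
    also have "\<dots> = ennreal \<epsilon> * emeasure M B + ennreal K * pint M p (d n)"
      unfolding pint_def by (simp add: nn_integral_add nn_integral_cmult)
    also have "\<dots> \<le> ennreal (\<epsilon> * m) + ennreal K * ennreal (e / (2 * K))"
      using elim \<epsilon> m by (intro add_mono mult_left_mono) (auto simp: ennreal_mult less_imp_le)
    also have "\<dots> = ennreal (\<epsilon> * m + e / 2)"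
      using \<epsilon> m K e by (simp flip: ennreal_mult ennreal_plus)
    also have "\<dots> \<le> ennreal e"
      using \<epsilon> by (intro ennreal_leI) linarith
    finally show ?case .
  qed
qed

text \<open>In \<open>ball_dichotomy\<close> this plays the part of Poincare's inequality. The limit
  passage uses Fatou's lemma on the left and convergence of the gradients in L^1 on
  \<open>B'\<close> on the right.\<close>

lemma sob0_translation_estimate:
  fixes u :: "'a::euclidean_space \<Rightarrow> real"
  assumes p: "p > 1" and u: "sob0 p \<Omega> u U" and [measurable]: "B \<in> sets borel" "B' \<in> sets borel"
    and B': "emeasure lborel B' < \<infinity>"
    and sub: "\<And>x t. x \<in> B \<Longrightarrow> 0 \<le> t \<Longrightarrow> t \<le> 1 \<Longrightarrow> x + t *\<^sub>R z \<in> B'"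
  shows "(\<integral>\<^sup>+ x. ennreal \<bar>u (x + z) - u x\<bar> * indicator B x \<partial>lborel)
      \<le> ennreal (norm z) * (\<integral>\<^sup>+ x. ennreal (norm (U x)) * indicator B' x \<partial>lborel)"
proof (cases "z = 0")
  case False
  have p0: "p > 0" using p by simp
  obtain \<phi> where \<phi>: "\<And>n::nat. \<phi> n \<in> C0_infinity \<Omega>"
    "(\<lambda>n. pint lborel p (\<lambda>x. grad (\<phi> n) x - U x)) \<longlonglongrightarrow> 0"
    "AE x in lborel. (\<lambda>n. \<phi> n x) \<longlonglongrightarrow> u x"
    using sob0_AE_approx[OF p0 u] by blast
  note [measurable] = sob0_measurable[OF u] C0_infinity_measurable[OF \<phi>(1)]
  let ?I = "\<integral>\<^sup>+ x. ennreal (norm (U x)) * indicator B' x \<partial>lborel"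
  let ?D = "\<lambda>n. \<integral>\<^sup>+ x. ennreal (norm (grad (\<phi> n) x - U x)) * indicator B' x \<partial>lborel"
  let ?L = "\<lambda>n. \<integral>\<^sup>+ x. ennreal \<bar>\<phi> n (x + z) - \<phi> n x\<bar> * indicator B x \<partial>lborel"
  have D: "?D \<longlonglongrightarrow> 0"
    using \<phi>(2) B' by (intro pint_tendsto_0_set_nn_integral[OF p]) auto
  have le: "?L n \<le> ennreal (norm z) * (?I + ?D n)" for n
  proof -
    have "?L n \<le> ennreal (norm z) * (\<integral>\<^sup>+ x. ennreal (norm (grad (\<phi> n) x)) * indicator B' x \<partial>lborel)"
      by (rule translation_estimate_smooth[OF C0_infinity_smooth[OF \<phi>(1)] _ _ sub]) auto
    also have "(\<integral>\<^sup>+ x. ennreal (norm (grad (\<phi> n) x)) * indicator B' x \<partial>lborel)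
        \<le> (\<integral>\<^sup>+ x. ennreal (norm (U x)) * indicator B' x + ennreal (norm (grad (\<phi> n) x - U x)) * indicator B' x \<partial>lborel)"
    proof (intro nn_integral_mono)
      fix x
      have "norm (grad (\<phi> n) x) \<le> norm (U x) + norm (grad (\<phi> n) x - U x)"
        using norm_triangle_ineq[of "U x" "grad (\<phi> n) x - U x"] by simp
      then show "ennreal (norm (grad (\<phi> n) x)) * indicator B' x
          \<le> ennreal (norm (U x)) * indicator B' x + ennreal (norm (grad (\<phi> n) x - U x)) * indicator B' x"
        by (auto simp: indicator_def ennreal_leI simp flip: ennreal_plus)
    qed
    also have "\<dots> = ?I + ?D n" by (rule nn_integral_add) auto
    finally show ?thesis by (simp add: mult_left_mono)
  qed
  have "(\<integral>\<^sup>+ x. ennreal \<bar>u (x + z) - u x\<bar> * indicator B x \<partial>lborel)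
      = (\<integral>\<^sup>+ x. liminf (\<lambda>n. ennreal \<bar>\<phi> n (x + z) - \<phi> n x\<bar> * indicator B x) \<partial>lborel)"
  proof (rule nn_integral_cong_AE, use \<phi>(3) AE_lborel_translate[OF \<phi>(3), of z] in eventually_elim)
    case (elim x)
    have "(\<lambda>n. ennreal \<bar>\<phi> n (x + z) - \<phi> n x\<bar> * indicator B x) \<longlonglongrightarrow> ennreal \<bar>u (x + z) - u x\<bar> * indicator B x"
      using elim by (intro tendsto_mult_ennreal tendsto_ennrealI tendsto_intros) (auto simp: indicator_def)
    then show ?case by (intro lim_imp_Liminf[symmetric]) auto
  qed
  also have "\<dots> \<le> liminf ?L"
    by (rule nn_integral_liminf) measurable
  also have "\<dots> \<le> liminf (\<lambda>n. ennreal (norm z) * (?I + ?D n))"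
    by (intro Liminf_mono always_eventually allI le)
  also have "\<dots> = ennreal (norm z) * (?I + 0)"
    using False by (intro lim_imp_Liminf tendsto_mult_ennreal tendsto_const tendsto_add D) auto
  finally show ?thesis by simp
qed simp

section \<open>Minimization of the energy\<close>

lemma powr_tangent_concave:
  fixes s m \<beta> :: real
  assumes "0 < \<beta>" "\<beta> < 1" "0 \<le> s" "0 < m"
  shows "s powr \<beta> \<le> m powr \<beta> + \<beta> * m powr (\<beta> - 1) * (s - m)"
proof -
  have m: "m powr (\<beta> - 1) * m = m powr \<beta>"
    using powr_mult_base[of m "\<beta> - 1"] assms by (simp add: mult.commute)
  show ?thesis
  proof (cases "s = 0")
    case True
    have "\<beta> * m powr (\<beta> - 1) * m = \<beta> * m powr \<beta>" using m by (simp add: mult.assoc)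
    also have "\<dots> \<le> m powr \<beta>" using assms by (simp add: mult_left_le_one_le)
    finally show ?thesis using True by simp
  next
    case False
    have "s powr \<beta> * m powr (1 - \<beta>) \<le> \<beta> * s + (1 - \<beta>) * m"
      using assms False by (intro Youngs_inequality_0) auto
    then have "m powr (\<beta> - 1) * (s powr \<beta> * m powr (1 - \<beta>)) \<le> m powr (\<beta> - 1) * (\<beta> * s + (1 - \<beta>) * m)"
      by (intro mult_left_mono) auto
    also have "\<dots> = m powr \<beta> + \<beta> * m powr (\<beta> - 1) * (s - m)"
      using m by (simp add: algebra_simps)
    also have "m powr (\<beta> - 1) * (s powr \<beta> * m powr (1 - \<beta>)) = s powr \<beta>"
      using assms by (simp add: mult.left_commute[of "m powr _"] flip: powr_add)
    finally show ?thesis .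
  qed
qed

lemma powr_concave_le:
  fixes a b t \<beta> :: real
  assumes \<beta>: "0 < \<beta>" "\<beta> < 1" and ab: "0 \<le> a" "0 \<le> b" and t: "0 \<le> t" "t \<le> 1"
  shows "(1 - t) * a powr \<beta> + t * b powr \<beta> \<le> ((1 - t) * a + t * b) powr \<beta>"
proof -
  define m where "m = (1 - t) * a + t * b"
  have nn: "(1 - t) * a \<ge> 0" "t * b \<ge> 0" using assms by auto
  show ?thesis
  proof (cases "m = 0")
    case True
    then have "(1 - t) * a = 0" "t * b = 0" using nn unfolding m_def by linarith+
    then have "(1 - t) * a powr \<beta> = 0" "t * b powr \<beta> = 0" by auto
    then show ?thesis by (simp only: add_0 powr_ge_zero)
  next
    case False
    then have m: "m > 0" using nn unfolding m_def by linarith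
    have "(1 - t) * a powr \<beta> + t * b powr \<beta> \<le>
        (1 - t) * (m powr \<beta> + \<beta> * m powr (\<beta> - 1) * (a - m)) + t * (m powr \<beta> + \<beta> * m powr (\<beta> - 1) * (b - m))"
      using t by (intro add_mono mult_left_mono powr_tangent_concave \<beta> ab m) auto
    also have "\<dots> = m powr \<beta> + \<beta> * m powr (\<beta> - 1) * (((1 - t) * a + t * b) - m)"
      by (simp add: algebra_simps)
    finally show ?thesis by (simp add: m_def)
  qed
qed

lemma powr_subadditive:
  fixes a b \<beta> :: real
  assumes "0 < \<beta>" "\<beta> < 1" "0 \<le> a" "0 \<le> b"
  shows "(a + b) powr \<beta> \<le> a powr \<beta> + b powr \<beta>"
proof (cases "a = 0 \<or> b = 0")
  case False
  then have ab: "a > 0" "b > 0" using assms by auto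
  have "(a + b) powr \<beta> = (a + b) powr (\<beta> - 1) * (a + b)"
    using powr_mult_base[of "a + b" "\<beta> - 1"] ab by (simp add: mult.commute)
  also have "\<dots> = (a + b) powr (\<beta> - 1) * a + (a + b) powr (\<beta> - 1) * b"
    by (simp add: distrib_left)
  also have "\<dots> \<le> a powr (\<beta> - 1) * a + b powr (\<beta> - 1) * b"
    using ab assms by (intro add_mono mult_right_mono powr_mono2') auto
  also have "\<dots> = a powr \<beta> + b powr \<beta>"
    using powr_mult_base[of a "\<beta> - 1"] powr_mult_base[of b "\<beta> - 1"] ab by (simp add: mult.commute)
  finally show ?thesis .
qed auto

text \<open>Absorption of a lower power: beyond the threshold \<open>L\<close> the linear term wins,
  below it the power is bounded. Used for coercivity of the energy and again for statement
  (ii).\<close>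

lemma powr_sublinear:
  fixes K \<beta> c :: real
  assumes "K \<ge> 0" "\<beta> < 1" "0 < \<beta>" "c > 0"
  obtains C where "C \<ge> 0" "\<And>Y. Y \<ge> 0 \<Longrightarrow> K * Y powr \<beta> \<le> c * Y + C"
proof -
  define L where "L = (K / c) powr (1 / (1 - \<beta>))"
  show thesis
  proof (rule that[of "K * L powr \<beta>"])
    fix Y :: real assume Y: "Y \<ge> 0"
    show "K * Y powr \<beta> \<le> c * Y + K * L powr \<beta>"
    proof (cases "Y \<le> L")
      case True
      then have "K * Y powr \<beta> \<le> K * L powr \<beta>" using Y assms by (intro mult_left_mono powr_mono2) auto
      then show ?thesis using Y assms by (simp add: add_increasing)
    next
      case False
      then have Y0: "Y > 0" using L_def powr_ge_zero by (metis le_less_linear order_less_le_trans order_trans not_le)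
      have "K / c = L powr (1 - \<beta>)" using assms by (simp add: L_def powr_powr)
      also have "\<dots> \<le> Y powr (1 - \<beta>)" using False assms by (intro powr_mono2) (auto simp: L_def)
      finally have "K \<le> c * Y powr (1 - \<beta>)" using assms by (simp add: field_simps)
      then have "K * Y powr \<beta> \<le> c * Y powr (1 - \<beta>) * Y powr \<beta>" by (intro mult_right_mono) auto
      also have "\<dots> = c * Y" using Y0 by (simp add: mult.assoc flip: powr_add)
      finally show ?thesis using assms by (simp add: add_increasing2)
    qed
  qed (use assms in auto)
qed

lemma integral_powr_tangent:
  fixes U V :: "'b \<Rightarrow> 'c::euclidean_space"
  assumes p: "p > 1" and [measurable]: "U \<in> borel_measurable M" "V \<in> borel_measurable M"
    and UV: "integrable M (\<lambda>x. norm (U x) powr p)" "integrable M (\<lambda>x. norm (V x) powr p)"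
  shows "(LINT x|M. norm (U x) powr p) + p * (LINT x|M. pflux p (U x) \<bullet> V x) \<le> (LINT x|M. norm (U x + V x) powr p)"
proof -
  note i = pflux_integrable[OF p _ _ UV]
  have "(LINT x|M. norm (U x) powr p) + p * (LINT x|M. pflux p (U x) \<bullet> V x)
      = (LINT x|M. norm (U x) powr p + p * (pflux p (U x) \<bullet> V x))"
    using UV i by simp
  also have "\<dots> \<le> (LINT x|M. norm (U x + V x) powr p)"
    using p UV i by (intro integral_mono powr_tangent integrable_powr_add Bochner_Integration.integrable_add integrable_mult_right) auto
  finally show ?thesis .
qed

lemma pflux_dual_integrable:
  fixes U :: "'b \<Rightarrow> 'c::euclidean_space"
  assumes "p > 1" "integrable M (\<lambda>x. norm (U x) powr p)"
  shows "integrable M (\<lambda>x. norm (pflux p (U x)) powr (p / (p - 1)))"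
  using assms by (simp add: norm_pflux powr_powr)

lemma pflux_inner_diff_tendsto_0:
  fixes g :: "nat \<Rightarrow> 'b \<Rightarrow> 'c::euclidean_space"
  assumes p: "p > 1" and [measurable]: "\<And>n. g n \<in> borel_measurable M" "u \<in> borel_measurable M"
    and g: "\<And>n. integrable M (\<lambda>x. norm (g n x) powr p)" and u: "integrable M (\<lambda>x. norm (u x) powr p)"
    and lim: "(\<lambda>n. pint M p (\<lambda>x. g n x - u x)) \<longlonglongrightarrow> 0"
  shows "(\<lambda>n. LINT x|M. pflux p (u x) \<bullet> (g n x - u x)) \<longlonglongrightarrow> 0"
proof -
  have "(\<lambda>n. LINT x|M. g n x \<bullet> pflux p (u x)) \<longlonglongrightarrow> (LINT x|M. u x \<bullet> pflux p (u x))"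
    by (rule pint_tendsto_integral_inner[OF p _ _ _ g u pflux_dual_integrable[OF p u] lim]) measurable
  from tendsto_diff[OF this tendsto_const[of "LINT x|M. u x \<bullet> pflux p (u x)"]]
  have "(\<lambda>n. (LINT x|M. g n x \<bullet> pflux p (u x)) - (LINT x|M. u x \<bullet> pflux p (u x))) \<longlonglongrightarrow> 0" by simp
  moreover have "(LINT x|M. g n x \<bullet> pflux p (u x)) - (LINT x|M. u x \<bullet> pflux p (u x)) = (LINT x|M. pflux p (u x) \<bullet> (g n x - u x))" for n
    using pflux_integrable[OF p _ _ u g[of n]] pflux_integrable[OF p _ _ u u]
    by (simp add: inner_diff_right inner_commute)
  ultimately show ?thesis by simp
qed

text \<open>The datum is a Borel representative, nonnegative everywhere, as prepared in
  \<open>theorem3p1\<close>. Integrability is stated at the exponent \<open>m_star\<close>; larger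
  exponents enter with the regularity theorems.\<close>

locale singular_problem =
  fixes \<Omega> :: "'a::euclidean_space set" and f :: "'a \<Rightarrow> real" and N p \<alpha> :: real
  assumes N: "N = real DIM('a)" and p: "1 < p" "p < N" and \<alpha>: "0 < \<alpha>" "\<alpha> < 1"
    and f_measurable [measurable]: "f \<in> borel_measurable borel" and f_nonneg: "\<And>x. 0 \<le> f x"
    and f_integrable: "integrable lborel (\<lambda>x. f x powr m_star N p \<alpha>)"
    and open_\<Omega>: "open \<Omega>" and bounded_\<Omega>: "bounded \<Omega>"
begin

text \<open>The critical Sobolev exponent.\<close>

definition ps :: real where "ps = N * p / (N - p)"

lemma p_pos: "0 < p" using p by simp

lemma ps_gt: "ps > p" and ps_pos: "ps > 0"
proof -
  have "p * (N - p) < N * p" using p by (simp add: algebra_simps)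
  then show "ps > p" using p by (simp add: ps_def pos_less_divide_eq)
  then show "ps > 0" using p by simp
qed

text \<open>The origin of \<open>m_star\<close>: Hoelder's inequality pairs f with v^(1-\<alpha>),
  and the latter has an integrable power ps / (1 - \<alpha>) by Sobolev's inequality.\<close>

lemma m_star_conj: "m_star N p \<alpha> > 1" "ps / (1 - \<alpha>) > 1" "1 / m_star N p \<alpha> + 1 / (ps / (1 - \<alpha>)) = 1"
proof -
  have d: "N * p - (1 - \<alpha>) * (N - p) > 0"
  proof -
    have "(1 - \<alpha>) * (N - p) \<le> 1 * (N - p)" using \<alpha> p by (intro mult_right_mono) auto
    also have "\<dots> < N * 1" using p by simp
    also have "\<dots> \<le> N * p" using p by (intro mult_left_mono) auto
    finally show ?thesis by simp
  qed
  have pos: "(1 - \<alpha>) * (N - p) > 0" using \<alpha> p by simp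
  show "m_star N p \<alpha> > 1" using d pos by (simp add: m_star_def)
  show "ps / (1 - \<alpha>) > 1" using ps_gt p \<alpha> by (simp add: field_simps)
  have "N * p > 0" using p by simp
  then show "1 / m_star N p \<alpha> + 1 / (ps / (1 - \<alpha>)) = 1"
    unfolding m_star_def ps_def using p \<alpha> by (simp add: divide_simps)
qed

lemma sobolev:
  assumes "sob0 p \<Omega> v V"
  shows "integrable lborel (\<lambda>x. \<bar>v x\<bar> powr ps)"
    and "(LINT x|lborel. \<bar>v x\<bar> powr ps) \<le>
      (p * (N - 1) / (N - p)) powr ps * (2 powr p * (LINT x|lborel. norm (V x) powr p)) powr (N / (N - p))"
  using sob0_sobolev[OF p(1) p(2)[unfolded N] assms, folded N] by (simp_all add: ps_def)

lemma f_term_integrable: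
  assumes "sob0 p \<Omega> v V"
  shows "integrable lborel (\<lambda>x. f x * \<bar>v x\<bar> powr (1 - \<alpha>))"
proof (rule Holder(1)[OF m_star_conj])
  note [measurable] = sob0_measurable[OF assms]
  show "(\<lambda>x. \<bar>v x\<bar> powr (1 - \<alpha>)) \<in> borel_measurable lborel" by measurable
  show "integrable lborel (\<lambda>x. \<bar>f x\<bar> powr m_star N p \<alpha>)" using f_integrable f_nonneg by simp
  show "integrable lborel (\<lambda>x. \<bar>\<bar>v x\<bar> powr (1 - \<alpha>)\<bar> powr (ps / (1 - \<alpha>)))"
    using sobolev(1)[OF assms] \<alpha> by (simp add: powr_powr)
qed measurable

text \<open>Hoelder and Sobolev combined; the exponents multiply to (N / (N - p)) (1 - \<alpha>) /
  ps = (1 - \<alpha>) / p. Being below one, this power of the gradient integral is dominated by the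
  leading term of the energy.\<close>

lemma f_term_bound:
  obtains K where "K \<ge> 0"
    "\<And>v V. sob0 p \<Omega> v V \<Longrightarrow>
      (LINT x|lborel. f x * \<bar>v x\<bar> powr (1 - \<alpha>)) \<le> K * (LINT x|lborel. norm (V x) powr p) powr ((1 - \<alpha>) / p)"
proof -
  define K0 where "K0 = (p * (N - 1) / (N - p)) powr ps"
  define F where "F = (LINT x|lborel. f x powr m_star N p \<alpha>) powr (1 / m_star N p \<alpha>)"
  define K where "K = F * (K0 powr ((1 - \<alpha>) / ps) * (2 powr p) powr ((1 - \<alpha>) / p))"
  have "(LINT x|lborel. f x * \<bar>v x\<bar> powr (1 - \<alpha>)) \<le> K * (LINT x|lborel. norm (V x) powr p) powr ((1 - \<alpha>) / p)"
    if v: "sob0 p \<Omega> v V" for v V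
  proof -
    note [measurable] = sob0_measurable[OF v]
    let ?Y = "LINT x|lborel. norm (V x) powr p" and ?X = "LINT x|lborel. \<bar>v x\<bar> powr ps"
    have e: "\<bar>\<bar>v x\<bar> powr (1 - \<alpha>)\<bar> powr (ps / (1 - \<alpha>)) = \<bar>v x\<bar> powr ps" for x
      using \<alpha> by (simp add: powr_powr)
    have X: "integrable lborel (\<lambda>x. \<bar>v x\<bar> powr ps)" "?X \<le> K0 * (2 powr p * ?Y) powr (N / (N - p))"
      using sobolev[OF v] by (auto simp: K0_def)
    have "(LINT x|lborel. f x * \<bar>v x\<bar> powr (1 - \<alpha>)) = (LINT x|lborel. \<bar>f x * \<bar>v x\<bar> powr (1 - \<alpha>)\<bar>)"
      using f_nonneg by (simp add: abs_mult)
    also have "\<dots> \<le> (LINT x|lborel. \<bar>f x\<bar> powr m_star N p \<alpha>) powr (1 / m_star N p \<alpha>)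
        * (LINT x|lborel. \<bar>\<bar>v x\<bar> powr (1 - \<alpha>)\<bar> powr (ps / (1 - \<alpha>))) powr (1 / (ps / (1 - \<alpha>)))"
      by (rule Holder(2)[OF m_star_conj]) (use f_integrable f_nonneg X(1) \<alpha> in \<open>auto simp: powr_powr\<close>)
    also have "\<dots> = F * ?X powr ((1 - \<alpha>) / ps)"
      unfolding e F_def using f_nonneg by simp
    also have "\<dots> \<le> F * (K0 * (2 powr p * ?Y) powr (N / (N - p))) powr ((1 - \<alpha>) / ps)"
      using X(2) \<alpha> ps_pos by (intro mult_left_mono powr_mono2) (auto simp: F_def)
    also have "\<dots> = F * (K0 powr ((1 - \<alpha>) / ps) * (2 powr p * ?Y) powr ((N / (N - p)) * ((1 - \<alpha>) / ps)))"
      by (simp only: powr_mult[of K0] powr_powr[of "2 powr p * ?Y"])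
    also have "(N / (N - p)) * ((1 - \<alpha>) / ps) = (1 - \<alpha>) / p"
      using p by (simp add: ps_def field_simps)
    finally show ?thesis by (simp add: K_def powr_mult mult_ac)
  qed
  then show thesis
    by (intro that[of K]) (auto simp: K_def F_def)
qed

text \<open>The absolute value in the last term gives the energy a reasonable meaning for every
  \<open>v\<close>, although only nonnegative functions compete.\<close>

definition energy :: "('a \<Rightarrow> real) \<Rightarrow> ('a \<Rightarrow> 'a) \<Rightarrow> real" where
  "energy v V = ((LINT x|lborel. norm (V x) powr p) + (LINT x|lborel. norm (v x) powr p)) / p
     - (LINT x|lborel. f x * \<bar>v x\<bar> powr (1 - \<alpha>)) / (1 - \<alpha>)"

definition admissible :: "('a \<Rightarrow> real) \<Rightarrow> ('a \<Rightarrow> 'a) \<Rightarrow> bool" where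
  "admissible v V \<longleftrightarrow> sob0 p \<Omega> v V \<and> (AE x in lborel. v x \<ge> 0)"

lemma energy_coercive:
  obtains C where "\<And>v V. sob0 p \<Omega> v V \<Longrightarrow>
    ((LINT x|lborel. norm (V x) powr p) + (LINT x|lborel. norm (v x) powr p)) / (2 * p) - C \<le> energy v V"
proof -
  obtain K where K: "K \<ge> 0" "\<And>v V. sob0 p \<Omega> v V \<Longrightarrow>
      (LINT x|lborel. f x * \<bar>v x\<bar> powr (1 - \<alpha>)) \<le> K * (LINT x|lborel. norm (V x) powr p) powr ((1 - \<alpha>) / p)"
    using f_term_bound by blast
  obtain C where C: "C \<ge> 0" "\<And>Y. Y \<ge> 0 \<Longrightarrow> K / (1 - \<alpha>) * Y powr ((1 - \<alpha>) / p) \<le> 1 / (2 * p) * Y + C"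
    using powr_sublinear[of "K / (1 - \<alpha>)" "(1 - \<alpha>) / p" "1 / (2 * p)"] K(1) \<alpha> p by auto
  have "((LINT x|lborel. norm (V x) powr p) + (LINT x|lborel. norm (v x) powr p)) / (2 * p) - C \<le> energy v V"
    if v: "sob0 p \<Omega> v V" for v V
  proof -
    let ?Y = "LINT x|lborel. norm (V x) powr p" and ?Z = "LINT x|lborel. norm (v x) powr p"
    have "(LINT x|lborel. f x * \<bar>v x\<bar> powr (1 - \<alpha>)) / (1 - \<alpha>) \<le> K / (1 - \<alpha>) * ?Y powr ((1 - \<alpha>) / p)"
      using K(2)[OF v] \<alpha> by (simp add: divide_right_mono)
    also have "\<dots> \<le> 1 / (2 * p) * ?Y + C" by (rule C(2)) simp
    finally have "energy v V \<ge> (?Y + ?Z) / p - (1 / (2 * p) * ?Y + C)"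
      unfolding energy_def by linarith
    moreover have "(?Y + ?Z) / p - 1 / (2 * p) * ?Y = (?Y + ?Z) / (2 * p) + ?Z / (2 * p)"
      using p by (simp add: field_simps)
    moreover have "?Z / (2 * p) \<ge> 0" using p by simp
    ultimately show ?thesis by linarith
  qed
  then show thesis by (rule that)
qed

lemma admissible_mid:
  assumes "admissible v V" "admissible w W"
  shows "admissible (\<lambda>x. (1 / 2) * (v x + w x)) (\<lambda>x. (1 / 2) *\<^sub>R (V x + W x))"
  using assms sob0_cmult[OF p_pos sob0_add[OF p_pos], of \<Omega> v V w W "1 / 2"]
  by (auto simp: admissible_def elim!: eventually_elim2)

text \<open>Midpoint convexity with its surplus recorded: the singular term is concave on
  nonnegative functions and enters with a minus sign, so the defects of both p-th powers remain as
  gain.\<close>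

lemma energy_mid:
  assumes v: "admissible v V" and w: "admissible w W"
  shows "energy (\<lambda>x. (1 / 2) * (v x + w x)) (\<lambda>x. (1 / 2) *\<^sub>R (V x + W x)) \<le> (energy v V + energy w W) / 2
    - ((LINT x|lborel. mid_defect p (V x) (W x)) + (LINT x|lborel. mid_defect p (v x) (w x))) / p"
proof -
  have sv: "sob0 p \<Omega> v V" and sw: "sob0 p \<Omega> w W" using v w by (auto simp: admissible_def)
  note iv = sob0_integrable[OF p_pos sv] and iw = sob0_integrable[OF p_pos sw]
  note [measurable] = sob0_measurable[OF sv] sob0_measurable[OF sw]
  have D: "(LINT x|lborel. norm ((1 / 2) *\<^sub>R (g x + h x)) powr p) =
      ((LINT x|lborel. norm (g x) powr p) + (LINT x|lborel. norm (h x) powr p)) / 2 - (LINT x|lborel. mid_defect p (g x) (h x))"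
    if [measurable]: "g \<in> borel_measurable borel" "h \<in> borel_measurable borel"
      and g: "integrable lborel (\<lambda>x. norm (g x) powr p)" and h: "integrable lborel (\<lambda>x. norm (h x) powr p)"
    for g h :: "'a \<Rightarrow> 'd::euclidean_space"
  proof -
    have i: "integrable lborel (\<lambda>x. norm ((1 / 2) *\<^sub>R (g x + h x)) powr p)"
      using g h p_pos by (intro integrable_powr_scaleR integrable_powr_add) auto
    have "(LINT x|lborel. mid_defect p (g x) (h x)) = (LINT x|lborel. (norm (g x) powr p + norm (h x) powr p) / 2) - (LINT x|lborel. norm ((1 / 2) *\<^sub>R (g x + h x)) powr p)"
      unfolding mid_defect_def using g h i by (intro Bochner_Integration.integral_diff) auto
    then show ?thesis using g h by simp
  qed
  have fv: "integrable lborel (\<lambda>x. f x * \<bar>v x\<bar> powr (1 - \<alpha>))" "integrable lborel (\<lambda>x. f x * \<bar>w x\<bar> powr (1 - \<alpha>))"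
    and fm: "integrable lborel (\<lambda>x. f x * \<bar>(1 / 2) * (v x + w x)\<bar> powr (1 - \<alpha>))"
    using f_term_integrable sv sw admissible_mid[OF v w] unfolding admissible_def by blast+
  have "((LINT x|lborel. f x * \<bar>v x\<bar> powr (1 - \<alpha>)) + (LINT x|lborel. f x * \<bar>w x\<bar> powr (1 - \<alpha>))) / 2
      = (LINT x|lborel. (f x * \<bar>v x\<bar> powr (1 - \<alpha>) + f x * \<bar>w x\<bar> powr (1 - \<alpha>)) / 2)"
    using fv by simp
  also have "\<dots> \<le> (LINT x|lborel. f x * \<bar>(1 / 2) * (v x + w x)\<bar> powr (1 - \<alpha>))"
  proof (rule integral_mono_AE)
    show "AE x in lborel. (f x * \<bar>v x\<bar> powr (1 - \<alpha>) + f x * \<bar>w x\<bar> powr (1 - \<alpha>)) / 2 \<le> f x * \<bar>(1 / 2) * (v x + w x)\<bar> powr (1 - \<alpha>)"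
      using v[unfolded admissible_def, THEN conjunct2] w[unfolded admissible_def, THEN conjunct2]
    proof eventually_elim
      case (elim x)
      have "(1 - 1 / 2) * v x powr (1 - \<alpha>) + 1 / 2 * w x powr (1 - \<alpha>) \<le> ((1 - 1 / 2) * v x + 1 / 2 * w x) powr (1 - \<alpha>)"
        using elim \<alpha> by (intro powr_concave_le) auto
      moreover have "(1 - 1 / 2) * v x + 1 / 2 * w x = (1 / 2) * (v x + w x)" by simp
      ultimately have "(v x powr (1 - \<alpha>) + w x powr (1 - \<alpha>)) / 2 \<le> ((1 / 2) * (v x + w x)) powr (1 - \<alpha>)" by (simp only: add_divide_distrib) simp
      from mult_left_mono[OF this f_nonneg[of x]] show ?case using elim by (simp add: distrib_left)
    qed
  qed (use fv fm in auto)
  finally have half: "((LINT x|lborel. f x * \<bar>v x\<bar> powr (1 - \<alpha>)) + (LINT x|lborel. f x * \<bar>w x\<bar> powr (1 - \<alpha>))) / 2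
      \<le> (LINT x|lborel. f x * \<bar>(1 / 2) * (v x + w x)\<bar> powr (1 - \<alpha>))" .
  have F: "(LINT x|lborel. f x * \<bar>v x\<bar> powr (1 - \<alpha>)) / (1 - \<alpha>) / 2 + (LINT x|lborel. f x * \<bar>w x\<bar> powr (1 - \<alpha>)) / (1 - \<alpha>) / 2
      \<le> (LINT x|lborel. f x * \<bar>(1 / 2) * (v x + w x)\<bar> powr (1 - \<alpha>)) / (1 - \<alpha>)"
    using divide_right_mono[OF half, of "1 - \<alpha>"] \<alpha> by (simp add: add_divide_distrib mult.commute)
  note DV = D[OF _ _ iv(2) iw(2)] and Dv = D[OF _ _ iv(1) iw(1), unfolded real_scaleR_def]
  show ?thesis
    unfolding energy_def DV[OF sob0_measurable(2)[OF sv] sob0_measurable(2)[OF sw]]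
      Dv[OF sob0_measurable(1)[OF sv] sob0_measurable(1)[OF sw]]
    using F by (simp add: add_divide_distrib diff_divide_distrib)
qed

text \<open>Uniform convexity makes a minimizing sequence converge strongly, function and gradient
  alike; the energy of the limit is then compared with the infimum by tangent inequalities.\<close>

lemma minimizer_exists:
  obtains u U where "admissible u U" "\<And>v V. admissible v V \<Longrightarrow> energy u U \<le> energy v V"
proof -
  define A where "A = {energy v V | v V. admissible v V}"
  obtain C where C: "\<And>v V. sob0 p \<Omega> v V \<Longrightarrow>
    ((LINT x|lborel. norm (V x) powr p) + (LINT x|lborel. norm (v x) powr p)) / (2 * p) - C \<le> energy v V"
    using energy_coercive by blast
  have "admissible (\<lambda>x. 0) (grad (\<lambda>x. 0))"
    using sob0_C0_infinity[OF C0_infinity_zero] by (simp add: admissible_def)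
  then have A_ne: "A \<noteq> {}" by (auto simp: A_def)
  have lower: "- C \<le> e" if "e \<in> A" for e
  proof -
    from that obtain v V where vV: "e = energy v V" "admissible v V" by (auto simp: A_def)
    have "0 \<le> ((LINT x|lborel. norm (V x) powr p) + (LINT x|lborel. norm (v x) powr p)) / (2 * p)"
      using p by (intro divide_nonneg_nonneg add_nonneg_nonneg) auto
    then show ?thesis using C[of v V] vV by (simp add: admissible_def)
  qed
  have A_bdd: "bdd_below A" using lower by (auto simp: bdd_below_def)
  define I where "I = Inf A"
  have I_le: "I \<le> energy v V" if "admissible v V" for v V
    unfolding I_def using that A_bdd by (intro cInf_lower) (auto simp: A_def)
  have "\<exists>v V. admissible v V \<and> energy v V < I + inverse (real (Suc n))" for n
    using cInf_lessD[OF A_ne, of "I + inverse (real (Suc n))"] by (auto simp: A_def I_def)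
  then obtain v V where vV: "\<And>n. admissible (v n) (V n)" "\<And>n. energy (v n) (V n) < I + inverse (real (Suc n))"
    by metis
  have s: "sob0 p \<Omega> (v n) (V n)" for n using vV(1) by (simp add: admissible_def)
  note [measurable] = sob0_measurable[OF s]
  note int = sob0_integrable[OF p_pos s]
  \<comment> \<open>Coercivity, applied to energies below I + 1.\<close>
  define B where "B = 2 * p * (I + 1 + C)"
  have bd: "(LINT x|lborel. norm (V n x) powr p) \<le> B" "(LINT x|lborel. norm (v n x) powr p) \<le> B" for n
  proof -
    have "inverse (real (Suc n)) \<le> 1" by (simp add: field_simps)
    then have "((LINT x|lborel. norm (V n x) powr p) + (LINT x|lborel. norm (v n x) powr p)) / (2 * p) \<le> I + 1 + C"
      using C[OF s, of n] vV(2)[of n] by linarith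
    then have "(LINT x|lborel. norm (V n x) powr p) + (LINT x|lborel. norm (v n x) powr p) \<le> B"
      using p by (simp add: B_def field_simps)
    moreover have "(LINT x|lborel. norm (V n x) powr p) \<ge> 0" "(LINT x|lborel. norm (v n x) powr p) \<ge> 0"
      by simp_all
    ultimately show "(LINT x|lborel. norm (V n x) powr p) \<le> B" "(LINT x|lborel. norm (v n x) powr p) \<le> B" by linarith+
  qed
  have B: "B \<ge> 0" using bd(1)[of 0] by (rule order_trans[rotated]) simp
  \<comment> \<open>The midpoint is admissible, so its energy is at least \<open>I\<close>, while
    the energies of both endpoints exceed \<open>I\<close> by at most 1 / (k + 1);
    \<open>energy_mid\<close> leaves the defects no more room than this.\<close>
  have def: "(LINT x|lborel. mid_defect p (V m x) (V n x)) \<le> p * inverse (real (Suc k))"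
    "(LINT x|lborel. mid_defect p (v m x) (v n x)) \<le> p * inverse (real (Suc k))" if "m \<ge> k" "n \<ge> k" for m n k
  proof -
    have aux: "T \<le> c" if "I \<le> e" "e \<le> (x + y) / 2 - T" "x < I + a" "y < I + b" "a \<le> c" "b \<le> c"
      for T e x y a b c :: real
    proof -
      have "2 * T \<le> x + y - 2 * e" using that(2) by (simp add: field_simps)
      then have "2 * T \<le> 2 * c" using that(1,3-6) by linarith
      then show ?thesis by simp
    qed
    have le: "inverse (real (Suc j)) \<le> inverse (real (Suc k))" if "j \<ge> k" for j
      using that by (simp add: field_simps)
    have "I \<le> energy (\<lambda>x. (1 / 2) * (v m x + v n x)) (\<lambda>x. (1 / 2) *\<^sub>R (V m x + V n x))"
      by (rule I_le[OF admissible_mid[OF vV(1) vV(1)]])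
    then have "((LINT x|lborel. mid_defect p (V m x) (V n x)) + (LINT x|lborel. mid_defect p (v m x) (v n x))) / p \<le> inverse (real (Suc k))"
      by (rule aux[OF _ energy_mid[OF vV(1)[of m] vV(1)[of n]] vV(2)[of m] vV(2)[of n] le[OF that(1)] le[OF that(2)]])
    then have "(LINT x|lborel. mid_defect p (V m x) (V n x)) + (LINT x|lborel. mid_defect p (v m x) (v n x)) \<le> p * inverse (real (Suc k))"
      using p by (simp add: pos_divide_le_eq mult.commute)
    moreover have "(LINT x|lborel. mid_defect p (V m x) (V n x)) \<ge> 0" "(LINT x|lborel. mid_defect p (v m x) (v n x)) \<ge> 0"
      using mid_defect_nonneg[OF p(1)] by (auto intro!: integral_nonneg_AE)
    ultimately show "(LINT x|lborel. mid_defect p (V m x) (V n x)) \<le> p * inverse (real (Suc k))"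
      "(LINT x|lborel. mid_defect p (v m x) (v n x)) \<le> p * inverse (real (Suc k))" by linarith+
  qed
  have small: "\<exists>k. p * inverse (real (Suc k)) \<le> \<eta>" if \<eta>: "\<eta> > 0" for \<eta>
  proof -
    obtain k where "inverse (real (Suc k)) < \<eta> / p" using reals_Archimedean[of "\<eta> / p"] \<eta> p_pos by auto
    then show ?thesis using p by (auto simp: field_simps intro!: exI[of _ k])
  qed
  have "\<exists>n0. \<forall>m\<ge>n0. \<forall>n\<ge>n0. pint lborel p (\<lambda>x. V m x - V n x) \<le> ennreal e" if e: "e > 0" for e
  proof (rule mid_defect_uniform_convexity[OF p(1) B e, where M = lborel and 'b = 'a and 'c = 'a])
    fix \<eta> :: real
    assume \<eta>: "\<eta> > 0" and uc: "\<And>f g :: 'a \<Rightarrow> 'a. f \<in> borel_measurable lborel \<Longrightarrow> g \<in> borel_measurable lborel \<Longrightarrow>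
      integrable lborel (\<lambda>x. norm (f x) powr p) \<Longrightarrow> integrable lborel (\<lambda>x. norm (g x) powr p) \<Longrightarrow>
      (LINT x|lborel. norm (f x) powr p) \<le> B \<Longrightarrow> (LINT x|lborel. norm (g x) powr p) \<le> B \<Longrightarrow>
      (LINT x|lborel. mid_defect p (f x) (g x)) \<le> \<eta> \<Longrightarrow> pint lborel p (\<lambda>x. f x - g x) \<le> ennreal e"
    obtain k where k: "p * inverse (real (Suc k)) \<le> \<eta>" using small[OF \<eta>] by blast
    then show ?thesis
      using def(1) int(2) bd(1) by (intro exI[of _ k] allI impI uc) (auto intro: order_trans[OF _ k])
  qed
  then obtain U where U: "U \<in> borel_measurable lborel" "(\<lambda>n. pint lborel p (\<lambda>x. V n x - U x)) \<longlonglongrightarrow> 0"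
    by (rule pint_complete[OF p_pos, of V lborel, rotated]) auto
  have "\<exists>n0. \<forall>m\<ge>n0. \<forall>n\<ge>n0. pint lborel p (\<lambda>x. v m x - v n x) \<le> ennreal e" if e: "e > 0" for e
  proof (rule mid_defect_uniform_convexity[OF p(1) B e, where M = lborel and 'b = 'a and 'c = real])
    fix \<eta> :: real
    assume \<eta>: "\<eta> > 0" and uc: "\<And>f g :: 'a \<Rightarrow> real. f \<in> borel_measurable lborel \<Longrightarrow> g \<in> borel_measurable lborel \<Longrightarrow>
      integrable lborel (\<lambda>x. norm (f x) powr p) \<Longrightarrow> integrable lborel (\<lambda>x. norm (g x) powr p) \<Longrightarrow>
      (LINT x|lborel. norm (f x) powr p) \<le> B \<Longrightarrow> (LINT x|lborel. norm (g x) powr p) \<le> B \<Longrightarrow>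
      (LINT x|lborel. mid_defect p (f x) (g x)) \<le> \<eta> \<Longrightarrow> pint lborel p (\<lambda>x. f x - g x) \<le> ennreal e"
    obtain k where k: "p * inverse (real (Suc k)) \<le> \<eta>" using small[OF \<eta>] by blast
    then show ?thesis
      using def(2) int(1) bd(2) by (intro exI[of _ k] allI impI uc) (auto intro: order_trans[OF _ k])
  qed
  then obtain u where u: "u \<in> borel_measurable lborel" "(\<lambda>n. pint lborel p (\<lambda>x. v n x - u x)) \<longlonglongrightarrow> 0"
    by (rule pint_complete[OF p_pos, of v lborel, rotated]) auto
  have su: "sob0 p \<Omega> u U"
    using u U by (intro sob0_closed[OF p_pos s]) auto
  note [measurable] = sob0_measurable[OF su]
  note intu = sob0_integrable[OF p_pos su]
  obtain r where r: "strict_mono r" "AE x in lborel. (\<lambda>n. v (r n) x) \<longlonglongrightarrow> u x"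
    by (rule pint_AE_subseq[OF p_pos _ _ u(2)]) auto
  have "AE x in lborel. \<forall>n. v n x \<ge> 0"
    using vV(1) by (simp add: AE_all_countable admissible_def)
  with r(2) have "AE x in lborel. u x \<ge> 0"
    by eventually_elim (auto intro: LIMSEQ_le_const)
  with su have adm: "admissible u U" by (simp add: admissible_def)
  obtain K where K: "K \<ge> 0" "\<And>v V. sob0 p \<Omega> v V \<Longrightarrow>
      (LINT x|lborel. f x * \<bar>v x\<bar> powr (1 - \<alpha>)) \<le> K * (LINT x|lborel. norm (V x) powr p) powr ((1 - \<alpha>) / p)"
    using f_term_bound by blast
  let ?a = "\<lambda>n. LINT x|lborel. pflux p (U x) \<bullet> (V n x - U x)"
  let ?b = "\<lambda>n. LINT x|lborel. pflux p (u x) \<bullet> (v n x - u x)"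
  let ?c = "\<lambda>n. LINT x|lborel. norm (V n x - U x) powr p"
  have sd: "sob0 p \<Omega> (\<lambda>x. v n x - u x) (\<lambda>x. V n x - U x)" for n
    using sob0_add[OF p_pos s sob0_cmult[OF p_pos su, of "-1"], of n] by simp
  note intd = sob0_integrable[OF p_pos sd]
  have lim_a: "?a \<longlonglongrightarrow> 0"
    by (rule pflux_inner_diff_tendsto_0[OF p(1) _ _ int(2) intu(2) U(2)]) measurable
  have lim_b: "?b \<longlonglongrightarrow> 0"
    by (rule pflux_inner_diff_tendsto_0[OF p(1) _ _ int(1) intu(1) u(2)]) measurable
  have lim_c: "?c \<longlonglongrightarrow> 0"
  proof -
    have "(\<lambda>n. ennreal (?c n)) \<longlonglongrightarrow> ennreal 0"
      using U(2) by (simp add: pint_eq_integral[OF intd(2)])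
    then show ?thesis by (subst (asm) tendsto_ennreal_iff) auto
  qed
  have comb: "(y + z) / p + a + b \<le> (y' + z') / p" if "y + p * a \<le> y'" "z + p * b \<le> z'" for y z a b y' z'
    using divide_right_mono[OF add_mono[OF that], of p] p_pos by (simp add: add_divide_distrib)
  \<comment> \<open>The p-th powers lie above their tangents at the limit. The singular term is
    compared by subadditivity of s^(1-\<alpha>), and \<open>f_term_bound\<close>, applied to v_n -
    u, controls the error.\<close>
  have main: "energy u U + ?a n + ?b n - K / (1 - \<alpha>) * ?c n powr ((1 - \<alpha>) / p) \<le> energy (v n) (V n)" for n
  proof -
    have 1: "(LINT x|lborel. norm (U x) powr p) + p * ?a n \<le> (LINT x|lborel. norm (V n x) powr p)"
      using integral_powr_tangent[OF p(1) _ _ intu(2) intd(2), of n] by simp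
    have 2: "(LINT x|lborel. norm (u x) powr p) + p * ?b n \<le> (LINT x|lborel. norm (v n x) powr p)"
      using integral_powr_tangent[OF p(1) _ _ intu(1) intd(1), of n] by simp
    have "(LINT x|lborel. f x * \<bar>v n x\<bar> powr (1 - \<alpha>)) \<le> (LINT x|lborel. f x * \<bar>u x\<bar> powr (1 - \<alpha>) + f x * \<bar>v n x - u x\<bar> powr (1 - \<alpha>))"
    proof (rule integral_mono)
      fix x
      have "\<bar>v n x\<bar> powr (1 - \<alpha>) \<le> (\<bar>u x\<bar> + \<bar>v n x - u x\<bar>) powr (1 - \<alpha>)"
        using \<alpha> by (intro powr_mono2) auto
      also have "\<dots> \<le> \<bar>u x\<bar> powr (1 - \<alpha>) + \<bar>v n x - u x\<bar> powr (1 - \<alpha>)"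
        using \<alpha> by (intro powr_subadditive) auto
      finally show "f x * \<bar>v n x\<bar> powr (1 - \<alpha>) \<le> f x * \<bar>u x\<bar> powr (1 - \<alpha>) + f x * \<bar>v n x - u x\<bar> powr (1 - \<alpha>)"
        using f_nonneg[of x] by (simp add: mult_left_mono flip: distrib_left)
    qed (use f_term_integrable[OF s] f_term_integrable[OF su] f_term_integrable[OF sd] in auto)
    also have "\<dots> = (LINT x|lborel. f x * \<bar>u x\<bar> powr (1 - \<alpha>)) + (LINT x|lborel. f x * \<bar>v n x - u x\<bar> powr (1 - \<alpha>))"
      using f_term_integrable[OF su] f_term_integrable[OF sd] by simp
    also have "\<dots> \<le> (LINT x|lborel. f x * \<bar>u x\<bar> powr (1 - \<alpha>)) + K * ?c n powr ((1 - \<alpha>) / p)"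
      using K(2)[OF sd] by simp
    finally have 3: "(LINT x|lborel. f x * \<bar>v n x\<bar> powr (1 - \<alpha>)) / (1 - \<alpha>)
        \<le> (LINT x|lborel. f x * \<bar>u x\<bar> powr (1 - \<alpha>)) / (1 - \<alpha>) + K / (1 - \<alpha>) * ?c n powr ((1 - \<alpha>) / p)"
      using \<alpha> by (simp add: divide_simps mult.commute)
    have "((LINT x|lborel. norm (U x) powr p) + (LINT x|lborel. norm (u x) powr p)) / p + ?a n + ?b n
        \<le> ((LINT x|lborel. norm (V n x) powr p) + (LINT x|lborel. norm (v n x) powr p)) / p"
      by (rule comb[OF 1 2])
    with 3 show ?thesis unfolding energy_def by linarith
  qed
  have "energy u U \<le> I"
  proof (rule LIMSEQ_le)
    have "(\<lambda>n. energy u U + ?a n + ?b n - K / (1 - \<alpha>) * ?c n powr ((1 - \<alpha>) / p))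
        \<longlonglongrightarrow> energy u U + 0 + 0 - K / (1 - \<alpha>) * 0 powr ((1 - \<alpha>) / p)"
      using \<alpha> p by (intro tendsto_intros tendsto_powr' lim_a lim_b lim_c) auto
    then show "(\<lambda>n. energy u U + ?a n + ?b n - K / (1 - \<alpha>) * ?c n powr ((1 - \<alpha>) / p)) \<longlonglongrightarrow> energy u U" by simp
    show "(\<lambda>n. I + inverse (real (Suc n))) \<longlonglongrightarrow> I"
      using tendsto_add[OF tendsto_const[of I] LIMSEQ_inverse_real_of_nat] by simp
    show "\<exists>N. \<forall>n\<ge>N. energy u U + ?a n + ?b n - K / (1 - \<alpha>) * ?c n powr ((1 - \<alpha>) / p) \<le> I + inverse (real (Suc n))"
      using main vV(2) by (meson less_imp_le order_trans)
  qed
  then have "energy u U \<le> energy w W" if "admissible w W" for w W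
    using I_le[OF that] by linarith
  then show thesis using adm that by blast
qed

end

section \<open>The variational inequality\<close>

lemma filterlim_powr_at_top_pos:
  fixes a :: real
  assumes "0 < a"
  shows "filterlim (\<lambda>x. x powr a) at_top at_top"
proof -
  have "filterlim (\<lambda>x::real. exp (a * ln x)) at_top at_top"
    by (intro filterlim_compose[OF exp_at_top] filterlim_tendsto_pos_mult_at_top[OF tendsto_const assms ln_at_top])
  then show ?thesis
    by (rule filterlim_mono_eventually)
      (auto intro!: eventually_mono[OF eventually_gt_at_top[of 0]] simp: powr_def)
qed

locale energy_minimizer = singular_problem +
  fixes u :: "'a \<Rightarrow> real" and U :: "'a \<Rightarrow> 'a"
  assumes admissible_u: "admissible u U"
    and energy_min: "\<And>v V. admissible v V \<Longrightarrow> energy u U \<le> energy v V"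
begin

lemma sob0_u: "sob0 p \<Omega> u U"
  using admissible_u by (simp add: admissible_def)

lemma u_nonneg: "AE x in lborel. u x \<ge> 0"
  using admissible_u by (simp add: admissible_def)

lemmas u_measurable [measurable] = sob0_measurable[OF sob0_u]

lemmas u_integrable = sob0_integrable[OF p_pos sob0_u]

text \<open>For t \<le> 1 the competitor u + t \<psi> is a convex combination of u and u + \<psi>,
  hence admissible. The tangent inequality is taken at the perturbed point, which bounds the
  increase of the p-th power integrals from above by the fluxes there.\<close>

lemma difference_quotient_le:
  assumes \<psi>: "sob0 p \<Omega> \<psi> \<Psi>" and nn: "AE x in lborel. u x + \<psi> x \<ge> 0" and t: "0 < t" "t \<le> 1"
  shows "integrable lborel (\<lambda>x. f x * (\<bar>u x + t * \<psi> x\<bar> powr (1 - \<alpha>) - \<bar>u x\<bar> powr (1 - \<alpha>)) / ((1 - \<alpha>) * t))"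
    and "(LINT x|lborel. f x * (\<bar>u x + t * \<psi> x\<bar> powr (1 - \<alpha>) - \<bar>u x\<bar> powr (1 - \<alpha>)) / ((1 - \<alpha>) * t))
      \<le> (LINT x|lborel. pflux p (U x + t *\<^sub>R \<Psi> x) \<bullet> \<Psi> x) + (LINT x|lborel. pflux p (u x + t *\<^sub>R \<psi> x) \<bullet> \<psi> x)"
proof -
  have s: "sob0 p \<Omega> (\<lambda>x. u x + t * \<psi> x) (\<lambda>x. U x + t *\<^sub>R \<Psi> x)"
    by (intro sob0_add sob0_cmult p_pos sob0_u \<psi>)
  have "AE x in lborel. u x + t * \<psi> x \<ge> 0"
    using u_nonneg nn
  proof eventually_elim
    case (elim x)
    have "0 \<le> (1 - t) * u x + t * (u x + \<psi> x)" using elim t by (intro add_nonneg_nonneg[OF mult_nonneg_nonneg mult_nonneg_nonneg]) auto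
    then show ?case by (simp add: algebra_simps)
  qed
  then have E: "energy u U \<le> energy (\<lambda>x. u x + t * \<psi> x) (\<lambda>x. U x + t *\<^sub>R \<Psi> x)"
    using s by (intro energy_min) (simp add: admissible_def)
  note [measurable] = sob0_measurable[OF \<psi>] sob0_measurable[OF s]
  note i\<psi> = sob0_integrable[OF p_pos \<psi>] and i_s = sob0_integrable[OF p_pos s]
  have tangent: "(LINT x|lborel. norm (g x + t *\<^sub>R h x) powr p) - p * t * (LINT x|lborel. pflux p (g x + t *\<^sub>R h x) \<bullet> h x) \<le> (LINT x|lborel. norm (g x) powr p)"
    if [measurable]: "g \<in> borel_measurable borel" "h \<in> borel_measurable borel"
      and "integrable lborel (\<lambda>x. norm (g x + t *\<^sub>R h x) powr p)" "integrable lborel (\<lambda>x. norm (h x) powr p)"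
    for g h :: "'a \<Rightarrow> 'd::euclidean_space"
  proof -
    have "(LINT x|lborel. norm (g x + t *\<^sub>R h x) powr p) + p * (LINT x|lborel. pflux p (g x + t *\<^sub>R h x) \<bullet> ((- t) *\<^sub>R h x))
        \<le> (LINT x|lborel. norm (g x + t *\<^sub>R h x + (- t) *\<^sub>R h x) powr p)"
      using that by (intro integral_powr_tangent p integrable_powr_scaleR) auto
    then show ?thesis by simp
  qed
  have fi: "integrable lborel (\<lambda>x. f x * \<bar>u x + t * \<psi> x\<bar> powr (1 - \<alpha>))" "integrable lborel (\<lambda>x. f x * \<bar>u x\<bar> powr (1 - \<alpha>))"
    using f_term_integrable[OF s] f_term_integrable[OF sob0_u] by auto
  show "integrable lborel (\<lambda>x. f x * (\<bar>u x + t * \<psi> x\<bar> powr (1 - \<alpha>) - \<bar>u x\<bar> powr (1 - \<alpha>)) / ((1 - \<alpha>) * t))"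
    using fi by (simp add: right_diff_distrib)
  let ?F1 = "LINT x|lborel. f x * \<bar>u x + t * \<psi> x\<bar> powr (1 - \<alpha>)" and ?F0 = "LINT x|lborel. f x * \<bar>u x\<bar> powr (1 - \<alpha>)"
  let ?A = "LINT x|lborel. pflux p (U x + t *\<^sub>R \<Psi> x) \<bullet> \<Psi> x" and ?a = "LINT x|lborel. pflux p (u x + t *\<^sub>R \<psi> x) \<bullet> \<psi> x"
  let ?Y1 = "LINT x|lborel. norm (U x + t *\<^sub>R \<Psi> x) powr p" and ?Y0 = "LINT x|lborel. norm (U x) powr p"
  let ?Z1 = "LINT x|lborel. norm (u x + t * \<psi> x) powr p" and ?Z0 = "LINT x|lborel. norm (u x) powr p"
  have "?Y1 - p * t * ?A \<le> ?Y0"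
    using tangent[of U \<Psi>] i\<psi> i_s by simp
  moreover have "?Z1 - p * t * ?a \<le> ?Z0"
    using tangent[of u \<psi>] i\<psi> i_s by simp
  ultimately have "(?Y1 + ?Z1) - (?Y0 + ?Z0) \<le> p * (t * (?A + ?a))"
    by (simp add: algebra_simps)
  then have 1: "(?Y1 + ?Z1) / p - (?Y0 + ?Z0) / p \<le> t * (?A + ?a)"
    using p by (simp add: diff_divide_distrib[symmetric] pos_divide_le_eq mult.commute)
  have "?F1 / (1 - \<alpha>) - ?F0 / (1 - \<alpha>) \<le> (?Y1 + ?Z1) / p - (?Y0 + ?Z0) / p"
    using E by (simp add: energy_def)
  with 1 have "(?F1 - ?F0) / (1 - \<alpha>) \<le> t * (?A + ?a)" by (simp add: diff_divide_distrib)
  then have le: "(?F1 - ?F0) / ((1 - \<alpha>) * t) \<le> ?A + ?a"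
    using t \<alpha> by (simp add: pos_divide_le_eq mult_ac)
  have eq: "(LINT x|lborel. f x * (\<bar>u x + t * \<psi> x\<bar> powr (1 - \<alpha>) - \<bar>u x\<bar> powr (1 - \<alpha>)) / ((1 - \<alpha>) * t)) = (?F1 - ?F0) / ((1 - \<alpha>) * t)"
    using fi by (simp add: right_diff_distrib)
  show "(LINT x|lborel. f x * (\<bar>u x + t * \<psi> x\<bar> powr (1 - \<alpha>) - \<bar>u x\<bar> powr (1 - \<alpha>)) / ((1 - \<alpha>) * t)) \<le> ?A + ?a"
    by (rule ord_eq_le_trans[OF eq le])
qed

text \<open>Concavity, with the quotient at t = 1 as the smallest one. It provides the integrable
  minorant for Fatou's lemma, since the quotients may change sign.\<close>

lemma difference_quotient_mono:
  fixes a b t \<phi> :: real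
  assumes "0 \<le> a" "0 \<le> a + b" "0 < t" "t \<le> 1" "0 \<le> \<phi>"
  shows "\<phi> * (\<bar>a + b\<bar> powr (1 - \<alpha>) - \<bar>a\<bar> powr (1 - \<alpha>)) / (1 - \<alpha>)
    \<le> \<phi> * (\<bar>a + t * b\<bar> powr (1 - \<alpha>) - \<bar>a\<bar> powr (1 - \<alpha>)) / ((1 - \<alpha>) * t)"
proof -
  have eq: "(1 - t) * a + t * (a + b) = a + t * b" by (simp add: algebra_simps)
  have nn: "0 \<le> (1 - t) * a + t * (a + b)" using assms by (intro add_nonneg_nonneg[OF mult_nonneg_nonneg mult_nonneg_nonneg]) auto
  have "(1 - t) * a powr (1 - \<alpha>) + t * (a + b) powr (1 - \<alpha>) \<le> ((1 - t) * a + t * (a + b)) powr (1 - \<alpha>)"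
    using \<alpha> assms by (intro powr_concave_le) auto
  then have "t * ((a + b) powr (1 - \<alpha>) - a powr (1 - \<alpha>)) \<le> (a + t * b) powr (1 - \<alpha>) - a powr (1 - \<alpha>)"
    unfolding eq by (simp add: algebra_simps)
  then have "(a + b) powr (1 - \<alpha>) - a powr (1 - \<alpha>) \<le> ((a + t * b) powr (1 - \<alpha>) - a powr (1 - \<alpha>)) / t"
    using assms by (simp add: pos_le_divide_eq mult.commute)
  then have "\<phi> / (1 - \<alpha>) * ((a + b) powr (1 - \<alpha>) - a powr (1 - \<alpha>)) \<le> \<phi> / (1 - \<alpha>) * (((a + t * b) powr (1 - \<alpha>) - a powr (1 - \<alpha>)) / t)"
    using assms \<alpha> by (intro mult_left_mono) auto
  then show ?thesis using assms nn[unfolded eq] by simp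
qed

lemma difference_quotient_tendsto:
  fixes a b \<phi> :: real and t :: "nat \<Rightarrow> real"
  assumes "0 < a" "0 \<le> a + b" "\<And>n. 0 < t n" "\<And>n. t n \<le> 1" "t \<longlonglongrightarrow> 0"
  shows "(\<lambda>n. \<phi> * (\<bar>a + t n * b\<bar> powr (1 - \<alpha>) - \<bar>a\<bar> powr (1 - \<alpha>)) / ((1 - \<alpha>) * t n)) \<longlonglongrightarrow> \<phi> * b / a powr \<alpha>"
proof -
  have "((\<lambda>s. \<bar>a + s * b\<bar> powr (1 - \<alpha>)) has_real_derivative (1 - \<alpha>) * a powr (- \<alpha>) * b) (at 0)"
  proof -
    have "((\<lambda>s. (a + s * b) powr (1 - \<alpha>)) has_real_derivative (1 - \<alpha>) * a powr (- \<alpha>) * b) (at 0)"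
      using assms(1) by (auto intro!: derivative_eq_intros)
    moreover have "\<forall>\<^sub>F s in nhds 0. \<bar>a + s * b\<bar> powr (1 - \<alpha>) = (a + s * b) powr (1 - \<alpha>)"
    proof -
      have "((\<lambda>s. a + s * b) \<longlongrightarrow> a + 0 * b) (nhds 0)"
        by (intro tendsto_intros filterlim_ident)
      then have "\<forall>\<^sub>F s in nhds 0. 0 < a + s * b" using assms(1) by (intro order_tendstoD) auto
      then show ?thesis by eventually_elim simp
    qed
    ultimately show ?thesis by (subst DERIV_cong_ev[OF refl _ refl]) auto
  qed
  then have "((\<lambda>h. (\<bar>a + h * b\<bar> powr (1 - \<alpha>) - \<bar>a\<bar> powr (1 - \<alpha>)) / h) \<longlongrightarrow> (1 - \<alpha>) * a powr (- \<alpha>) * b) (at 0)"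
    by (simp add: DERIV_def)
  moreover have "filterlim t (at 0) sequentially"
    using assms(3,5) by (auto simp: filterlim_at intro!: always_eventually less_imp_neq[symmetric])
  ultimately have "(\<lambda>n. (\<bar>a + t n * b\<bar> powr (1 - \<alpha>) - \<bar>a\<bar> powr (1 - \<alpha>)) / t n) \<longlonglongrightarrow> (1 - \<alpha>) * a powr (- \<alpha>) * b"
    by (rule filterlim_compose)
  then have "(\<lambda>n. \<phi> / (1 - \<alpha>) * ((\<bar>a + t n * b\<bar> powr (1 - \<alpha>) - \<bar>a\<bar> powr (1 - \<alpha>)) / t n)) \<longlonglongrightarrow> \<phi> / (1 - \<alpha>) * ((1 - \<alpha>) * a powr (- \<alpha>) * b)"
    by (intro tendsto_intros)
  then show ?thesis using \<alpha> by (simp add: powr_minus divide_simps)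
qed

text \<open>Starting from 0 the quotient is a positive multiple of t^(-\<alpha>), here with t = 1 /
  (n + 1). Fatou's lemma thus forbids u = 0 where f and \<psi> are positive.\<close>

lemma difference_quotient_at_0:
  fixes b \<phi> :: real
  assumes "0 < b" "0 < \<phi>"
  shows "filterlim (\<lambda>n. \<phi> * (\<bar>0 + inverse (real (Suc n)) * b\<bar> powr (1 - \<alpha>) - \<bar>0\<bar> powr (1 - \<alpha>)) / ((1 - \<alpha>) * inverse (real (Suc n)))) at_top sequentially"
proof -
  have "filterlim (\<lambda>n. real (Suc n)) at_top sequentially"
    by (rule filterlim_compose[OF filterlim_real_sequentially filterlim_Suc])
  then have "filterlim (\<lambda>n. real (Suc n) powr \<alpha>) at_top sequentially"
    by (rule filterlim_compose[OF filterlim_powr_at_top_pos[OF \<alpha>(1)]])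
  then have "filterlim (\<lambda>n. (\<phi> * b powr (1 - \<alpha>) / (1 - \<alpha>)) * real (Suc n) powr \<alpha>) at_top sequentially"
    using assms \<alpha> by (intro filterlim_tendsto_pos_mult_at_top[OF tendsto_const]) auto
  moreover have "\<phi> * (\<bar>0 + inverse (real (Suc n)) * b\<bar> powr (1 - \<alpha>) - \<bar>0\<bar> powr (1 - \<alpha>)) / ((1 - \<alpha>) * inverse (real (Suc n)))
      = (\<phi> * b powr (1 - \<alpha>) / (1 - \<alpha>)) * real (Suc n) powr \<alpha>" for n
  proof -
    define r where "r = real (Suc n)"
    have r: "r > 0" by (simp add: r_def)
    have "(inverse r * b) powr (1 - \<alpha>) = b powr (1 - \<alpha>) / r powr (1 - \<alpha>)"
      using r by (simp add: powr_mult inverse_powr divide_inverse)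
    moreover have "r = r powr \<alpha> * r powr (1 - \<alpha>)" using r by (simp flip: powr_add)
    ultimately have "(inverse r * b) powr (1 - \<alpha>) * r = (b powr (1 - \<alpha>) / r powr (1 - \<alpha>)) * (r powr \<alpha> * r powr (1 - \<alpha>))"
      by metis
    also have "\<dots> = b powr (1 - \<alpha>) * r powr \<alpha>" using r by simp
    finally have X: "(inverse r * b) powr (1 - \<alpha>) * r = b powr (1 - \<alpha>) * r powr \<alpha>" .
    have "\<phi> * (inverse r * b) powr (1 - \<alpha>) / ((1 - \<alpha>) * inverse r) = \<phi> * ((inverse r * b) powr (1 - \<alpha>) * r) / (1 - \<alpha>)"
      by (simp add: divide_inverse mult_ac)
    also have "\<dots> = (\<phi> * b powr (1 - \<alpha>) / (1 - \<alpha>)) * r powr \<alpha>"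
      unfolding X by simp
    finally have "\<phi> * (inverse r * b) powr (1 - \<alpha>) / ((1 - \<alpha>) * inverse r) = (\<phi> * b powr (1 - \<alpha>) / (1 - \<alpha>)) * r powr \<alpha>" .
    then show ?thesis using r assms by (simp add: r_def[symmetric] abs_mult del: of_nat_Suc)
  qed
  ultimately show ?thesis by (simp del: of_nat_Suc)
qed

text \<open>The first conclusion is recorded separately because division by zero yields zero: at
  zeros of u the quotient f \<psi> / u^\<alpha> is 0 in the formalisation and would hide the
  blow-up.\<close>

theorem variational_inequality:
  assumes \<psi>: "sob0 p \<Omega> \<psi> \<Psi>" and nn: "AE x in lborel. u x + \<psi> x \<ge> 0"
  shows "AE x in lborel. u x = 0 \<longrightarrow> f x * \<psi> x = 0"
    and "integrable lborel (\<lambda>x. f x * \<psi> x / u x powr \<alpha>)"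
    and "(LINT x|lborel. f x * \<psi> x / u x powr \<alpha>)
      \<le> (LINT x|lborel. pflux p (U x) \<bullet> \<Psi> x) + (LINT x|lborel. pflux p (u x) \<bullet> \<psi> x)"
proof -
  define t where "t n = inverse (real (Suc n))" for n
  have t: "0 < t n" "t n \<le> 1" for n unfolding t_def by (auto simp: field_simps)
  have t0: "t \<longlonglongrightarrow> 0" unfolding t_def by (rule LIMSEQ_inverse_real_of_nat)
  define Q where "Q s x = f x * (\<bar>u x + s * \<psi> x\<bar> powr (1 - \<alpha>) - \<bar>u x\<bar> powr (1 - \<alpha>)) / ((1 - \<alpha>) * s)" for s x
  define A where "A s = (LINT x|lborel. pflux p (U x + s *\<^sub>R \<Psi> x) \<bullet> \<Psi> x) + (LINT x|lborel. pflux p (u x + s *\<^sub>R \<psi> x) \<bullet> \<psi> x)" for s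
  define q where "q x = f x * \<psi> x / u x powr \<alpha>" for x
  note [measurable] = sob0_measurable[OF \<psi>]
  have [measurable]: "Q s \<in> borel_measurable borel" "q \<in> borel_measurable borel" for s
    unfolding Q_def q_def by measurable
  have Qi: "integrable lborel (Q s)" and QA: "integral\<^sup>L lborel (Q s) \<le> A s" if "0 < s" "s \<le> 1" for s
    using difference_quotient_le[OF \<psi> nn that] by (auto simp: Q_def[abs_def] A_def)
  have A_lim: "(\<lambda>n. A (t n)) \<longlonglongrightarrow> A 0"
  proof -
    have t1: "\<bar>t n\<bar> \<le> 1" for n using t[of n] by simp
    note i = sob0_integrable[OF p_pos \<psi>]
    have "(\<lambda>n. LINT x|lborel. pflux p (U x + t n *\<^sub>R \<Psi> x) \<bullet> \<Psi> x) \<longlonglongrightarrow> (LINT x|lborel. pflux p (U x) \<bullet> \<Psi> x)"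
      by (rule pflux_inner_tendsto[OF p(1) _ _ u_integrable(2) i(2) t0 t1]) measurable
    moreover have "(\<lambda>n. LINT x|lborel. pflux p (u x + t n *\<^sub>R \<psi> x) \<bullet> \<psi> x) \<longlonglongrightarrow> (LINT x|lborel. pflux p (u x) \<bullet> \<psi> x)"
      by (rule pflux_inner_tendsto[OF p(1) _ _ u_integrable(1) i(1) t0 t1]) measurable
    ultimately show ?thesis unfolding A_def by (auto intro: tendsto_add)
  qed
  have Q1: "AE x in lborel. \<forall>n. Q 1 x \<le> Q (t n) x"
    using u_nonneg nn
  proof eventually_elim
    case (elim x)
    show ?case
      using difference_quotient_mono[OF elim t f_nonneg[of x]] by (simp add: Q_def)
  qed
  have Q1_le: "integral\<^sup>L lborel (Q 1) \<le> A 0"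
  proof (rule LIMSEQ_le_const[OF A_lim])
    have "integral\<^sup>L lborel (Q 1) \<le> A (t n)" for n
    proof -
      have "integral\<^sup>L lborel (Q 1) \<le> integral\<^sup>L lborel (Q (t n))"
        using Q1 t by (intro integral_mono_AE Qi) auto
      then show ?thesis using QA[OF t] by (rule order_trans)
    qed
    then show "\<exists>N. \<forall>n\<ge>N. integral\<^sup>L lborel (Q 1) \<le> A (t n)" by blast
  qed
  \<comment> \<open>Fatou's lemma is applied after subtracting the minorant \<open>Q 1\<close>; the
    bound on the integrals of \<open>Q (t n)\<close> comes from minimality.\<close>
  let ?L = "\<lambda>x. liminf (\<lambda>n. ennreal (Q (t n) x - Q 1 x))"
  have L: "(\<integral>\<^sup>+ x. ?L x \<partial>lborel) \<le> ennreal (A 0 - integral\<^sup>L lborel (Q 1))"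
  proof -
    have "(\<integral>\<^sup>+ x. ?L x \<partial>lborel) \<le> liminf (\<lambda>n. \<integral>\<^sup>+ x. ennreal (Q (t n) x - Q 1 x) \<partial>lborel)"
      by (rule nn_integral_liminf) measurable
    also have "\<dots> \<le> liminf (\<lambda>n. ennreal (A (t n) - integral\<^sup>L lborel (Q 1)))"
    proof (intro Liminf_mono always_eventually allI)
      fix n
      have "(\<integral>\<^sup>+ x. ennreal (Q (t n) x - Q 1 x) \<partial>lborel) = ennreal (LINT x|lborel. Q (t n) x - Q 1 x)"
        using Q1 t by (intro nn_integral_eq_integral Bochner_Integration.integrable_diff Qi) auto
      also have "\<dots> \<le> ennreal (A (t n) - integral\<^sup>L lborel (Q 1))"
        using QA[OF t, of n] t Qi by (intro ennreal_leI) simp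
      finally show "(\<integral>\<^sup>+ x. ennreal (Q (t n) x - Q 1 x) \<partial>lborel) \<le> ennreal (A (t n) - integral\<^sup>L lborel (Q 1))" .
    qed
    also have "\<dots> = ennreal (A 0 - integral\<^sup>L lborel (Q 1))"
      by (intro lim_imp_Liminf tendsto_ennrealI tendsto_diff A_lim tendsto_const) auto
    finally show ?thesis .
  qed
  then have "AE x in lborel. ?L x \<noteq> \<infinity>"
    by (intro nn_integral_noteq_infinite) (auto simp: infinity_ennreal_def top_unique)
  with u_nonneg nn show zero: "AE x in lborel. u x = 0 \<longrightarrow> f x * \<psi> x = 0"
  proof eventually_elim
    case (elim x)
    show ?case
    proof (intro impI, rule ccontr)
      assume u0: "u x = 0" and "f x * \<psi> x \<noteq> 0"
      then have "0 < \<psi> x" "0 < f x" using elim(2) f_nonneg[of x] by (auto simp: less_le)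
      from difference_quotient_at_0[OF this] u0
      have "filterlim (\<lambda>n. Q (t n) x) at_top sequentially" by (simp add: Q_def t_def)
      then have "filterlim (\<lambda>n. - Q 1 x + Q (t n) x) at_top sequentially"
        by (rule filterlim_tendsto_add_at_top[OF tendsto_const])
      then have "(\<lambda>n. ennreal (Q (t n) x - Q 1 x)) \<longlonglongrightarrow> top"
        by (simp add: ennreal_tendsto_top_eq_at_top)
      then have "?L x = top" by (intro lim_imp_Liminf) auto
      then show False using elim(3) by (simp add: infinity_ennreal_def)
    qed
  qed
  have Q_lim: "AE x in lborel. (\<lambda>n. Q (t n) x) \<longlonglongrightarrow> q x"
    using u_nonneg nn zero
  proof eventually_elim
    case (elim x)
    show ?case
    proof (cases "u x = 0")
      case True
      \<comment> \<open>Here all quotients vanish, and so does \<open>q x\<close> by division by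
        zero, so the limit is correct at zeros of u as well.\<close>
      then have "f x = 0 \<or> \<psi> x = 0" using elim by simp
      then have "Q (t n) x = 0" for n by (auto simp: Q_def)
      then show ?thesis using True by (simp add: q_def)
    next
      case False
      then show ?thesis
        unfolding Q_def q_def using elim t t0 by (intro difference_quotient_tendsto) auto
    qed
  qed
  have q_ge: "AE x in lborel. 0 \<le> q x - Q 1 x"
    using Q1 Q_lim by eventually_elim (auto intro: LIMSEQ_le_const)
  have "(\<integral>\<^sup>+ x. ennreal (q x - Q 1 x) \<partial>lborel) = (\<integral>\<^sup>+ x. ?L x \<partial>lborel)"
  proof (rule nn_integral_cong_AE, use Q_lim in eventually_elim)
    case (elim x)
    then have "(\<lambda>n. ennreal (Q (t n) x - Q 1 x)) \<longlonglongrightarrow> ennreal (q x - Q 1 x)"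
      by (intro tendsto_ennrealI tendsto_intros)
    then show ?case by (intro lim_imp_Liminf[symmetric]) auto
  qed
  with L have qQ: "(\<integral>\<^sup>+ x. ennreal (q x - Q 1 x) \<partial>lborel) \<le> ennreal (A 0 - integral\<^sup>L lborel (Q 1))" by simp
  have iqQ: "integrable lborel (\<lambda>x. q x - Q 1 x)"
    using q_ge qQ by (intro integrableI_nonneg) (auto simp: top_unique less_top[symmetric])
  have "integrable lborel (\<lambda>x. (q x - Q 1 x) + Q 1 x)"
    using iqQ Qi[of 1] by (intro Bochner_Integration.integrable_add) auto
  then have iq: "integrable lborel q" by simp
  then show "integrable lborel (\<lambda>x. f x * \<psi> x / u x powr \<alpha>)" by (simp add: q_def[abs_def])
  have "ennreal (LINT x|lborel. q x - Q 1 x) \<le> ennreal (A 0 - integral\<^sup>L lborel (Q 1))"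
    using qQ q_ge iqQ by (simp add: nn_integral_eq_integral)
  then have "integral\<^sup>L lborel q - integral\<^sup>L lborel (Q 1) \<le> A 0 - integral\<^sup>L lborel (Q 1)"
    using Q1_le iq Qi[of 1] by simp
  then show "(LINT x|lborel. f x * \<psi> x / u x powr \<alpha>)
      \<le> (LINT x|lborel. pflux p (U x) \<bullet> \<Psi> x) + (LINT x|lborel. pflux p (u x) \<bullet> \<psi> x)"
    by (simp add: A_def q_def[abs_def])
qed

end

section \<open>Positivity of the minimizer\<close>

lemma AE_ball_cover:
  fixes \<Omega> :: "'a::euclidean_space set"
  assumes "\<And>x. x \<in> \<Omega> \<Longrightarrow> \<exists>r>0. AE y in lborel. y \<in> ball x r \<longrightarrow> P y"
  shows "AE y in lborel. y \<in> \<Omega> \<longrightarrow> P y"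
proof -
  obtain r where r: "\<And>x. x \<in> \<Omega> \<Longrightarrow> r x > 0 \<and> (AE y in lborel. y \<in> ball x (r x) \<longrightarrow> P y)"
    using assms by metis
  define F where "F = (\<lambda>x. ball x (r x)) ` \<Omega>"
  obtain F' where F': "F' \<subseteq> F" "countable F'" "\<Union>F' = \<Union>F"
    using Lindelof[of F] by (auto simp: F_def)
  have "AE y in lborel. \<forall>S\<in>F'. y \<in> S \<longrightarrow> P y"
    using F' r by (subst AE_ball_countable) (auto simp: F_def)
  then show ?thesis
  proof eventually_elim
    case (elim y)
    show ?case
    proof
      assume "y \<in> \<Omega>"
      then have "y \<in> \<Union>F" using r[of y] by (auto simp: F_def intro!: bexI[of _ y])
      then show "P y" using F'(3) elim by blast
    qed
  qed
qed

lemma AE_open_contradiction: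
  fixes S :: "'a::euclidean_space set"
  assumes "open S" "S \<noteq> {}" "AE y in lborel. y \<in> S \<longrightarrow> False"
  shows False
proof -
  obtain x where "x \<in> S" using assms(2) by blast
  moreover have "AE y in lebesgue. y \<in> S \<longrightarrow> y \<in> {}"
    using AE_completion[OF assms(3)] by simp
  ultimately show False
    using mem_closed_if_AE_lebesgue_open[OF assms(1) closed_empty] by blast
qed

text \<open>A smooth substitute for \<open>\<epsilon> + max 0 t\<close> with derivative bounded below on \<open>t \<ge> 0\<close>.\<close>

definition spos :: "real \<Rightarrow> real \<Rightarrow> real" where
  "spos \<epsilon> t = \<epsilon> + (t + (t\<^sup>2 + \<epsilon>\<^sup>2) powr (1 / 2)) / 2"

definition spos' :: "real \<Rightarrow> real \<Rightarrow> real" where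
  "spos' \<epsilon> t = (1 + t * (t\<^sup>2 + \<epsilon>\<^sup>2) powr (- 1 / 2)) / 2"

context
  fixes \<epsilon> :: real
  assumes \<epsilon>: "\<epsilon> > 0"
begin

lemma sq_pos: "t\<^sup>2 + \<epsilon>\<^sup>2 > 0"
  using \<epsilon> by (simp add: add_nonneg_pos)

lemma abs_less_root: "\<bar>t\<bar> < (t\<^sup>2 + \<epsilon>\<^sup>2) powr (1 / 2)"
  using sq_pos[of t] \<epsilon> by (simp add: powr_half_sqrt real_less_rsqrt)

lemma spos_ge: "\<epsilon> \<le> spos \<epsilon> t" and spos_ge_self: "t \<le> spos \<epsilon> t" and spos_pos: "0 < spos \<epsilon> t"
  using abs_less_root[of t] \<epsilon> unfolding spos_def abs_less_iff add_divide_distrib by - linarith+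

lemma spos'_bounds: "0 \<le> spos' \<epsilon> t" "spos' \<epsilon> t \<le> 1" and spos'_half: "0 \<le> t \<Longrightarrow> 1 / 2 \<le> spos' \<epsilon> t"
proof -
  have "(t\<^sup>2 + \<epsilon>\<^sup>2) powr (- 1 / 2) = inverse ((t\<^sup>2 + \<epsilon>\<^sup>2) powr (1 / 2))"
    by (simp add: powr_minus[symmetric])
  moreover define r where "r = (t\<^sup>2 + \<epsilon>\<^sup>2) powr (1 / 2)"
  moreover have "\<bar>t\<bar> < r" using abs_less_root[of t] by (simp add: r_def)
  ultimately have "\<bar>t * (t\<^sup>2 + \<epsilon>\<^sup>2) powr (- 1 / 2)\<bar> \<le> 1"
    by (simp only: abs_mult) (simp add: divide_simps)
  then show "0 \<le> spos' \<epsilon> t" "spos' \<epsilon> t \<le> 1"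
    unfolding spos'_def by (auto simp: abs_le_iff)
  show "0 \<le> t \<Longrightarrow> 1 / 2 \<le> spos' \<epsilon> t" by (simp add: spos'_def)
qed

lemma spos_0: "spos \<epsilon> 0 = 3 / 2 * \<epsilon>"
  using \<epsilon> by (simp add: spos_def powr_half_sqrt)

lemma spos_has_derivative: "(spos \<epsilon> has_real_derivative spos' \<epsilon> t) (at t)"
proof -
  have e: "1 / 2 - 1 = (- 1 / 2 :: real)" by simp
  show ?thesis
    unfolding spos_def[abs_def] spos'_def using sq_pos[of t]
    by (auto intro!: derivative_eq_intros simp: e)
qed

lemma continuous_spos: "continuous_on S (spos \<epsilon>)"
  using spos_has_derivative by (meson DERIV_isCont continuous_at_imp_continuous_on)

lemma continuous_spos': "continuous_on S (spos' \<epsilon>)"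
  unfolding spos'_def[abs_def] using sq_pos
  by (intro continuous_intros) (auto simp: less_imp_neq[symmetric])

lemma smooth_spos: "smooth \<phi> \<Longrightarrow> smooth (\<lambda>x. spos \<epsilon> (\<phi> x))"
proof -
  assume "smooth \<phi>"
  then have "smooth (\<lambda>x. \<epsilon> + (1 / 2) * (\<phi> x + ((\<phi> x)\<^sup>2 + \<epsilon>\<^sup>2) powr (1 / 2)))"
    by (intro smooth_add smooth_mult smooth_const smooth_powr smooth_power sq_pos)
  then show ?thesis by (simp add: spos_def)
qed

end

text \<open>A bump \<beta> is raised to a power k \<ge> p: its gradient then carries \<beta>^(k-1),
  which is at most (\<beta>^k)^((p-1)/p) because \<beta> \<le> 1. In
  \<open>log_gradient_estimate\<close> this weight is what allows the term with grad \<eta> to be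
  absorbed.\<close>

lemma bump_power_exists:
  fixes x0 :: "'a::euclidean_space"
  assumes "R > 0" and "cball x0 R \<subseteq> \<Omega>" and "p > 1"
  obtains \<eta> C c where "\<eta> \<in> C0_infinity \<Omega>" and "\<And>x. 0 \<le> \<eta> x" and "\<And>x. \<eta> x \<le> 1"
    and "\<And>x. x \<notin> ball x0 R \<Longrightarrow> \<eta> x = 0" and "c > 0" and "\<And>x. x \<in> ball x0 (R / 2) \<Longrightarrow> c \<le> \<eta> x"
    and "C > 0" and "\<And>x. norm (grad \<eta> x) \<le> C * \<eta> x powr ((p - 1) / p)"
proof -
  obtain \<beta> where \<beta>: "\<beta> \<in> C0_infinity \<Omega>" "\<And>x. 0 \<le> \<beta> x" "\<And>x. \<beta> x \<le> 1" "\<And>x. \<beta> x > 0 \<longleftrightarrow> x \<in> ball x0 R"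
    using bump_exists[OF assms(1,2)] by metis
  note s = C0_infinity_smooth[OF \<beta>(1)]
  obtain C where C: "C > 0" "\<And>x. norm (grad \<beta> x) \<le> C"
    using C0_infinity_bounded[OF \<beta>(1)] by metis
  \<comment> \<open>A natural exponent, so that the power stays smooth at the zeros of \<beta>; the
    condition k (p - 1) / p \<le> k - 1 amounts to k \<ge> p.\<close>
  define k where "k = nat \<lceil>p\<rceil>"
  have k: "p \<le> real k" "k \<ge> 2" using assms(3) by (auto simp: k_def) linarith+
  have "cball x0 (R / 2) \<noteq> {}" using assms(1) by simp
  then obtain y where y: "y \<in> cball x0 (R / 2)" "\<And>x. x \<in> cball x0 (R / 2) \<Longrightarrow> \<beta> y \<le> \<beta> x"
    using continuous_attains_inf[OF compact_cball _ smooth_continuous[OF s]] by blast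
  have \<beta>y: "\<beta> y > 0" using y(1) assms(1) \<beta>(4)[of y] by auto
  have g: "grad (\<lambda>x. \<beta> x ^ k) x = (real k * \<beta> x ^ (k - 1)) *\<^sub>R grad \<beta> x" for x
    by (rule grad_compose[OF s, where G = "\<lambda>t. t ^ k"]) (auto intro!: derivative_eq_intros)
  show thesis
  proof (rule that[of "\<lambda>x. \<beta> x ^ k" "\<beta> y ^ k" "real k * C"])
    show "(\<lambda>x. \<beta> x ^ k) \<in> C0_infinity \<Omega>"
      using k by (intro C0_infinity_supportI[OF \<beta>(1)] smooth_power s) (auto simp: zero_power)
    show "0 \<le> \<beta> x ^ k" "\<beta> x ^ k \<le> 1" for x using \<beta>(2,3)[of x] by (auto intro: power_le_one)
    show "\<beta> x ^ k = 0" if "x \<notin> ball x0 R" for x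
      using \<beta>(2,4)[of x] that k by (auto simp: zero_power less_le)
    show "\<beta> y ^ k > 0" using \<beta>y by simp
    show "\<beta> y ^ k \<le> \<beta> x ^ k" if "x \<in> ball x0 (R / 2)" for x
      using y(2)[of x] that \<beta>y by (intro power_mono) auto
    show "real k * C > 0" using k C by simp
    show "norm (grad (\<lambda>x. \<beta> x ^ k) x) \<le> (real k * C) * (\<beta> x ^ k) powr ((p - 1) / p)" for x
    proof (cases "\<beta> x = 0")
      case True
      then show ?thesis using k by (simp add: g zero_power)
    next
      case False
      then have pos: "\<beta> x > 0" using \<beta>(2)[of x] by simp
      have "k * ((p - 1) / p) \<le> real (k - 1)"
        using k assms(3) by (simp add: field_simps of_nat_diff)
      then have "\<beta> x powr real (k - 1) \<le> \<beta> x powr (k * ((p - 1) / p))"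
        using pos \<beta>(3)[of x] by (intro powr_mono') auto
      then have "\<beta> x ^ (k - 1) \<le> (\<beta> x ^ k) powr ((p - 1) / p)"
        using pos by (simp add: powr_realpow[symmetric] powr_powr del: of_nat_diff)
      then have "(real k * \<beta> x ^ (k - 1)) * norm (grad \<beta> x) \<le> (real k * (\<beta> x ^ k) powr ((p - 1) / p)) * C"
        using C(2)[of x] pos by (intro mult_mono) auto
      then show ?thesis using pos by (simp add: g mult_ac)
    qed
  qed
qed

lemma Young_scaled:
  fixes a b \<delta> p :: real
  assumes "p > 1" "\<delta> > 0" "0 \<le> a" "0 \<le> b"
  shows "a * b powr (p - 1) \<le> \<delta> * b powr p + a powr p * \<delta> powr (1 - p)"
proof (cases "a \<le> \<delta> * b")
  case True
  have "a * b powr (p - 1) \<le> (\<delta> * b) * b powr (p - 1)" using True by (intro mult_right_mono) auto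
  also have "\<dots> = \<delta> * b powr p" using assms powr_mult_base[of b "p - 1"] by (simp add: mult.assoc)
  finally show ?thesis by (simp add: add_increasing2)
next
  case False
  then have "b \<le> a / \<delta>" using assms by (simp add: field_simps)
  then have "a * b powr (p - 1) \<le> a * (a / \<delta>) powr (p - 1)"
    using assms by (intro mult_left_mono powr_mono2) auto
  also have "\<dots> = (a * a powr (p - 1)) * \<delta> powr (1 - p)"
  proof -
    have "\<delta> powr (1 - p) = inverse (\<delta> powr (p - 1))" using powr_minus[of \<delta> "p - 1"] by simp
    then show ?thesis unfolding powr_divide by (simp add: divide_inverse)
  qed
  also have "a * a powr (p - 1) = a powr p" using assms powr_mult_base[of a "p - 1"] by simp
  finally show ?thesis using assms by (simp add: add_increasing)
qed

context energy_minimizer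
begin

text \<open>The variational inequality is tested with \<open>\<eta> * spos \<epsilon> u powr (1 - p)\<close>.\<close>

lemma log_gradient_estimate:
  assumes "R > 0" and "cball x0 R \<subseteq> \<Omega>"
  obtains C where "\<And>\<epsilon>. \<epsilon> > 0 \<Longrightarrow>
    (\<integral>\<^sup>+ x. ennreal (norm ((spos' \<epsilon> (u x) / spos \<epsilon> (u x)) *\<^sub>R U x)) * indicator (ball x0 (R / 2)) x \<partial>lborel) \<le> ennreal C"
proof -
  obtain \<eta> C c where \<eta>: "\<eta> \<in> C0_infinity \<Omega>" "\<And>x. 0 \<le> \<eta> x" "\<And>x. \<eta> x \<le> 1"
    "\<And>x. x \<notin> ball x0 R \<Longrightarrow> \<eta> x = 0" and c: "c > 0" "\<And>x. x \<in> ball x0 (R / 2) \<Longrightarrow> c \<le> \<eta> x"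
    and C: "C > 0" "\<And>x. norm (grad \<eta> x) \<le> C * \<eta> x powr ((p - 1) / p)"
    using bump_power_exists[OF assms p(1)] by metis
  \<comment> \<open>Differentiating \<open>spos \<epsilon> u powr (1 - p)\<close> gives a good term
    of size at least (p - 1) / 2 = 2 \<delta>, because \<open>spos'\<close> \<ge> 1/2 for u \<ge> 0.
    Young's inequality spends one \<delta>, the other remains.\<close>
  define \<delta> where "\<delta> = (p - 1) / 4"
  have \<delta>: "\<delta> > 0" using p by (simp add: \<delta>_def)
  \<comment> \<open>The first summand is the remainder in Young's inequality, the second bounds the
    zeroth-order term. Neither depends on \<epsilon>.\<close>
  define K where "K = C powr p * \<delta> powr (1 - p) + 1"
  have K: "K \<ge> 0" by (simp add: K_def)
  let ?m = "measure lborel (ball x0 R)"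
  note [measurable] = C0_infinity_measurable[OF \<eta>(1)]
  have main: "(\<integral>\<^sup>+ x. ennreal (norm ((spos' \<epsilon> (u x) / spos \<epsilon> (u x)) *\<^sub>R U x)) * indicator (ball x0 (R / 2)) x \<partial>lborel)
      \<le> ennreal (?m + K * ?m / \<delta> / c)" if \<epsilon>: "\<epsilon> > 0" for \<epsilon>
  proof -
    define G where "G t = spos \<epsilon> t powr (1 - p)" for t
    define G' where "G' t = (1 - p) * spos \<epsilon> t powr (- p) * spos' \<epsilon> t" for t
    have G_der: "(G has_real_derivative G' t) (at t)" for t
    proof -
      from DERIV_fun_powr[OF spos_has_derivative[OF \<epsilon>, of t] spos_pos[OF \<epsilon>, of t], of "1 - p"]
      show ?thesis by (simp add: G_def[abs_def] G'_def)
    qed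
    have pw_le: "spos \<epsilon> t powr (- p) \<le> \<epsilon> powr (- p)" for t
      using spos_ge[OF \<epsilon>, of t] \<epsilon> p by (intro powr_mono2') auto
    have G'_bd: "\<bar>G' t\<bar> \<le> (p - 1) * \<epsilon> powr (- p)" for t
    proof -
      have "\<bar>G' t\<bar> = (p - 1) * (spos \<epsilon> t powr (- p) * spos' \<epsilon> t)"
        using p spos'_bounds[OF \<epsilon>, of t] by (simp add: G'_def abs_mult)
      also have "\<dots> \<le> (p - 1) * (\<epsilon> powr (- p) * 1)"
        using p spos'_bounds[OF \<epsilon>, of t] pw_le by (intro mult_left_mono mult_mono) auto
      finally show ?thesis by simp
    qed
    have G'_cont: "continuous_on UNIV G'"
      unfolding G'_def[abs_def] using spos_pos[OF \<epsilon>]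
      by (intro continuous_intros continuous_spos[OF \<epsilon>] continuous_spos'[OF \<epsilon>]) (auto simp: less_imp_neq[symmetric])
    have G_smooth: "smooth (\<lambda>x. G (\<phi> x))" if "smooth \<phi>" for \<phi> :: "'a \<Rightarrow> real"
      unfolding G_def using that by (intro smooth_powr smooth_spos[OF \<epsilon>] spos_pos[OF \<epsilon>])
    obtain D where D: "D > 0" "\<And>x. \<bar>\<eta> x\<bar> \<le> D" "\<And>x. norm (grad \<eta> x) \<le> D"
      using C0_infinity_bounded[OF \<eta>(1)] by metis
    define \<psi> where "\<psi> x = \<eta> x * G (u x)" for x
    define \<Psi> where "\<Psi> x = G (u x) *\<^sub>R grad \<eta> x + (\<eta> x * G' (u x)) *\<^sub>R U x" for x
    have \<psi>: "sob0 p \<Omega> \<psi> \<Psi>"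
      unfolding \<psi>_def[abs_def] \<Psi>_def[abs_def]
    proof (rule sob0_compose[OF p_pos sob0_u C0_infinity_smooth[OF \<eta>(1)] D(2,3) G_der G'_bd G'_cont])
      fix \<phi> assume "\<phi> \<in> C0_infinity \<Omega>"
      then show "smooth (\<lambda>x. G (\<phi> x))" by (intro G_smooth C0_infinity_smooth)
      then show "(\<lambda>x. \<eta> x * G (\<phi> x)) \<in> C0_infinity \<Omega>"
        using C0_infinity_mult[OF \<eta>(1), of "\<lambda>x. G (\<phi> x)"] by (simp add: mult.commute)
    qed
    have \<psi>_nn: "\<psi> x \<ge> 0" for x using \<eta>(2) by (simp add: \<psi>_def G_def)
    note [measurable] = sob0_measurable[OF \<psi>]
    have [measurable]: "spos \<epsilon> \<in> borel_measurable borel" "spos' \<epsilon> \<in> borel_measurable borel"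
      by (auto intro: borel_measurable_continuous_onI continuous_spos[OF \<epsilon>] continuous_spos'[OF \<epsilon>])
    have "AE x in lborel. u x + \<psi> x \<ge> 0" using u_nonneg by eventually_elim (simp add: \<psi>_nn)
    note VI = variational_inequality[OF \<psi> this]
    \<comment> \<open>Of the right-hand side only the sign is used: u is a supersolution.\<close>
    have "0 \<le> (LINT x|lborel. f x * \<psi> x / u x powr \<alpha>)"
      using f_nonneg \<psi>_nn by (intro integral_nonneg_AE) auto
    then have VI0: "0 \<le> (LINT x|lborel. pflux p (U x) \<bullet> \<Psi> x) + (LINT x|lborel. pflux p (u x) \<bullet> \<psi> x)"
      using VI(3) by linarith
    \<comment> \<open>A smoothed |grad u| / (u + \<epsilon>): the gradient of the logarithm of
      \<open>spos \<epsilon> u\<close>, up to the factor \<open>spos'\<close>, which is at most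
      1.\<close>
    define Q where "Q x = norm (U x) / spos \<epsilon> (u x)" for x
    have Q0: "Q x \<ge> 0" for x using spos_pos[OF \<epsilon>, of "u x"] by (simp add: Q_def)
    have [measurable]: "Q \<in> borel_measurable borel" unfolding Q_def by measurable
    have Qp: "Q x powr p = norm (U x) powr p * spos \<epsilon> (u x) powr (- p)" for x
      unfolding Q_def powr_divide by (simp add: powr_minus divide_inverse)
    have Qp1: "Q x powr (p - 1) = norm (U x) powr (p - 1) * spos \<epsilon> (u x) powr (1 - p)" for x
    proof -
      have "spos \<epsilon> (u x) powr (1 - p) = inverse (spos \<epsilon> (u x) powr (p - 1))"
        using powr_minus[of "spos \<epsilon> (u x)" "p - 1"] by simp
      then show ?thesis unfolding Q_def powr_divide by (simp add: divide_inverse)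
    qed
    have intQ: "integrable lborel (\<lambda>x. \<eta> x * Q x powr p)"
    proof (rule Bochner_Integration.integrable_bound)
      show "integrable lborel (\<lambda>x. \<epsilon> powr (- p) * norm (U x) powr p)"
        using u_integrable by simp
      show "AE x in lborel. norm (\<eta> x * Q x powr p) \<le> norm (\<epsilon> powr (- p) * norm (U x) powr p)"
      proof (rule AE_I2)
        fix x
        have "\<eta> x * Q x powr p \<le> 1 * (norm (U x) powr p * \<epsilon> powr (- p))"
          unfolding Qp using \<eta>(2,3)[of x] pw_le by (intro mult_mono mult_left_mono) auto
        then show "norm (\<eta> x * Q x powr p) \<le> norm (\<epsilon> powr (- p) * norm (U x) powr p)"
          using \<eta>(2)[of x] by (simp add: abs_mult mult.commute)
      qed
    qed measurable
    have fin: "emeasure lborel (ball x0 R) < \<infinity>" by (rule emeasure_lborel_ball_finite)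
    then have int1: "integrable lborel (\<lambda>x. K * indicator (ball x0 R) x :: real)"
      by (intro integrable_mult_right integrable_real_indicator) auto
    have pw: "AE x in lborel. pflux p (U x) \<bullet> \<Psi> x + pflux p (u x) \<bullet> \<psi> x \<le> K * indicator (ball x0 R) x - \<delta> * (\<eta> x * Q x powr p)"
      using u_nonneg
    proof eventually_elim
      case (elim x)
      let ?s = "spos \<epsilon> (u x)"
      have s: "?s > 0" by (rule spos_pos[OF \<epsilon>])
      have 1: "pflux p (U x) \<bullet> (G (u x) *\<^sub>R grad \<eta> x) \<le> \<delta> * (\<eta> x * Q x powr p) + (K - 1) * indicator (ball x0 R) x"
      proof -
        have "pflux p (U x) \<bullet> (G (u x) *\<^sub>R grad \<eta> x) \<le> norm (U x) powr (p - 1) * norm (G (u x) *\<^sub>R grad \<eta> x)"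
          using abs_pflux_inner_le[of p "U x" "G (u x) *\<^sub>R grad \<eta> x"] by linarith
        also have "\<dots> = Q x powr (p - 1) * norm (grad \<eta> x)"
          by (simp add: Qp1 G_def)
        also have "\<dots> \<le> Q x powr (p - 1) * (C * \<eta> x powr ((p - 1) / p))"
          by (intro mult_left_mono C(2)) auto
        also have "\<dots> = C * (\<eta> x powr (1 / p) * Q x) powr (p - 1)"
          by (simp add: powr_mult powr_powr)
        finally have le: "pflux p (U x) \<bullet> (G (u x) *\<^sub>R grad \<eta> x) \<le> C * (\<eta> x powr (1 / p) * Q x) powr (p - 1)" .
        show ?thesis
        proof (cases "x \<in> ball x0 R")
          case True
          have "C * (\<eta> x powr (1 / p) * Q x) powr (p - 1)
              \<le> \<delta> * (\<eta> x powr (1 / p) * Q x) powr p + C powr p * \<delta> powr (1 - p)"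
            using C(1) Q0 by (intro Young_scaled p \<delta>) auto
          also have "(\<eta> x powr (1 / p) * Q x) powr p = \<eta> x * Q x powr p"
            using p \<eta>(2)[of x] by (simp add: powr_mult powr_powr)
          finally show ?thesis using le True by (simp add: K_def)
        next
          case False
          then show ?thesis using le \<eta>(4)[OF False] by simp
        qed
      qed
      have 2: "pflux p (U x) \<bullet> ((\<eta> x * G' (u x)) *\<^sub>R U x) \<le> - (2 * \<delta>) * (\<eta> x * Q x powr p)"
      proof -
        have "pflux p (U x) \<bullet> ((\<eta> x * G' (u x)) *\<^sub>R U x) = - ((p - 1) * (\<eta> x * Q x powr p)) * spos' \<epsilon> (u x)"
          by (simp add: pflux_inner_self G'_def Qp algebra_simps)
        also have "\<dots> \<le> - ((p - 1) * (\<eta> x * Q x powr p)) * (1 / 2)"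
          using p \<eta>(2)[of x] spos'_half[OF \<epsilon> elim] by (intro mult_left_mono_neg) auto
        also have "\<dots> = - (2 * \<delta>) * (\<eta> x * Q x powr p)"
          by (simp add: \<delta>_def field_simps)
        finally show ?thesis .
      qed
      have 3: "pflux p (u x) \<bullet> \<psi> x \<le> indicator (ball x0 R) x"
      proof (cases "x \<in> ball x0 R")
        case True
        have "u x powr (p - 1) * G (u x) \<le> ?s powr (p - 1) * G (u x)"
          using elim spos_ge_self[OF \<epsilon>, of "u x"] p by (intro mult_right_mono powr_mono2) (auto simp: G_def)
        also have "\<dots> = 1" using s by (simp add: G_def flip: powr_add)
        finally have "\<eta> x * (u x powr (p - 1) * G (u x)) \<le> 1 * 1"
          using \<eta>(2,3)[of x] by (intro mult_mono) (auto simp: G_def)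
        moreover have "pflux p (u x) \<bullet> \<psi> x \<le> norm (u x) powr (p - 1) * norm (\<psi> x)"
          using abs_pflux_inner_le[of p "u x" "\<psi> x"] by linarith
        ultimately show ?thesis using True elim \<psi>_nn[of x] by (simp add: \<psi>_def mult_ac)
      next
        case False
        then show ?thesis using \<eta>(4)[OF False] by (simp add: \<psi>_def)
      qed
      have "pflux p (U x) \<bullet> \<Psi> x + pflux p (u x) \<bullet> \<psi> x
          \<le> \<delta> * (\<eta> x * Q x powr p) + (K - 1) * indicator (ball x0 R) x + - (2 * \<delta>) * (\<eta> x * Q x powr p) + indicator (ball x0 R) x"
        using 1 2 3 unfolding \<Psi>_def inner_add_right by linarith
      also have "\<dots> = K * indicator (ball x0 R) x - \<delta> * (\<eta> x * Q x powr p)"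
        by (simp add: algebra_simps)
      finally show ?case .
    qed
    have i\<psi>: "integrable lborel (\<lambda>x. pflux p (U x) \<bullet> \<Psi> x)" "integrable lborel (\<lambda>x. pflux p (u x) \<bullet> \<psi> x)"
      by (rule pflux_integrable[OF p(1) _ _ u_integrable(2) sob0_integrable(2)[OF p_pos \<psi>]]; measurable)
        (rule pflux_integrable[OF p(1) _ _ u_integrable(1) sob0_integrable(1)[OF p_pos \<psi>]]; measurable)
    have "0 \<le> (LINT x|lborel. pflux p (U x) \<bullet> \<Psi> x + pflux p (u x) \<bullet> \<psi> x)"
      using VI0 i\<psi> by simp
    also have "\<dots> \<le> (LINT x|lborel. K * indicator (ball x0 R) x - \<delta> * (\<eta> x * Q x powr p))"
      using pw i\<psi> int1 intQ by (intro integral_mono_AE) auto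
    also have "\<dots> = K * ?m - \<delta> * (LINT x|lborel. \<eta> x * Q x powr p)"
      using int1 intQ fin by simp
    finally have IQ: "(LINT x|lborel. \<eta> x * Q x powr p) \<le> K * ?m / \<delta>"
      using \<delta> by (simp add: field_simps)
    have "(\<integral>\<^sup>+ x. ennreal (norm ((spos' \<epsilon> (u x) / spos \<epsilon> (u x)) *\<^sub>R U x)) * indicator (ball x0 (R / 2)) x \<partial>lborel)
        \<le> (\<integral>\<^sup>+ x. ennreal (indicator (ball x0 R) x + \<eta> x * Q x powr p / c) \<partial>lborel)"
    proof (intro nn_integral_mono)
      fix x
      show "ennreal (norm ((spos' \<epsilon> (u x) / spos \<epsilon> (u x)) *\<^sub>R U x)) * indicator (ball x0 (R / 2)) x
          \<le> ennreal (indicator (ball x0 R) x + \<eta> x * Q x powr p / c)"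
      proof (cases "x \<in> ball x0 (R / 2)")
        case True
        then have xR: "x \<in> ball x0 R" using assms(1) by auto
        have "norm ((spos' \<epsilon> (u x) / spos \<epsilon> (u x)) *\<^sub>R U x) = spos' \<epsilon> (u x) * Q x"
          using spos_pos[OF \<epsilon>, of "u x"] spos'_bounds[OF \<epsilon>, of "u x"] by (simp add: Q_def)
        also have "\<dots> \<le> Q x"
          using spos'_bounds[OF \<epsilon>, of "u x"] Q0[of x] by (simp add: mult_left_le_one_le)
        also have "Q x \<le> 1 + Q x powr p"
        proof (cases "Q x \<le> 1")
          case False
          then have "Q x powr 1 \<le> Q x powr p" using p by (intro powr_mono) auto
          then show ?thesis using False by simp
        qed (simp add: add_increasing2)
        also have "Q x powr p \<le> \<eta> x * Q x powr p / c"
          using c(1) c(2)[OF True] by (simp add: pos_le_divide_eq mult.commute[of _ c] mult_right_mono)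
        finally show ?thesis using True xR by (auto intro!: ennreal_leI)
      qed simp
    qed
    also have "\<dots> = ennreal (LINT x|lborel. indicator (ball x0 R) x + \<eta> x * Q x powr p / c)"
      using intQ fin \<eta>(2) c(1) by (intro nn_integral_eq_integral) (auto intro!: AE_I2 add_nonneg_nonneg)
    also have "(LINT x|lborel. indicator (ball x0 R) x + \<eta> x * Q x powr p / c) = ?m + (LINT x|lborel. \<eta> x * Q x powr p) / c"
      using intQ fin by simp
    also have "ennreal \<dots> \<le> ennreal (?m + K * ?m / \<delta> / c)"
      using IQ c(1) by (intro ennreal_leI add_left_mono divide_right_mono) auto
    finally show ?thesis .
  qed
  then show thesis by (rule that)
qed

end

context energy_minimizer
begin

text \<open>The constant is subtracted because composition within \<open>sob0\<close> asks for G 0 =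
  0. The resulting function is 0 where u = 0 and tends to infinity with \<epsilon> tending to 0
  where u > 0.\<close>

lemma log_transform:
  assumes \<epsilon>: "\<epsilon> > 0"
  shows "sob0 p \<Omega> (\<lambda>x. ln (spos \<epsilon> (u x)) - ln (spos \<epsilon> 0)) (\<lambda>x. (spos' \<epsilon> (u x) / spos \<epsilon> (u x)) *\<^sub>R U x)"
proof (rule sob0_compose_0[OF p_pos sob0_u, where G = "\<lambda>t. ln (spos \<epsilon> t) - ln (spos \<epsilon> 0)" and G' = "\<lambda>t. spos' \<epsilon> t / spos \<epsilon> t"])
  show "((\<lambda>t. ln (spos \<epsilon> t) - ln (spos \<epsilon> 0)) has_real_derivative spos' \<epsilon> t / spos \<epsilon> t) (at t)" for t
    using spos_pos[OF \<epsilon>, of t] spos_has_derivative[OF \<epsilon>, of t] by (auto intro!: derivative_eq_intros)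
  show "\<bar>spos' \<epsilon> t / spos \<epsilon> t\<bar> \<le> 1 / \<epsilon>" for t
    using spos'_bounds[OF \<epsilon>, of t] spos_ge[OF \<epsilon>, of t] spos_pos[OF \<epsilon>, of t] \<epsilon> by (simp add: abs_divide frac_le)
  show "continuous_on UNIV (\<lambda>t. spos' \<epsilon> t / spos \<epsilon> t)"
    using spos_pos[OF \<epsilon>] by (intro continuous_intros continuous_spos[OF \<epsilon>] continuous_spos'[OF \<epsilon>]) (metis less_irrefl)
  show "smooth (\<lambda>x. ln (spos \<epsilon> (\<phi> x)) - ln (spos \<epsilon> 0))" if "smooth \<phi>" for \<phi> :: "'a \<Rightarrow> real"
    using that by (intro smooth_diff smooth_const smooth_ln smooth_spos[OF \<epsilon>] spos_pos[OF \<epsilon>])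
qed simp

lemma ln_spos_at_top:
  assumes "s > 0"
  shows "(\<lambda>n. ennreal (ln (spos (inverse (real (Suc n))) s) - ln (spos (inverse (real (Suc n))) 0))) \<longlonglongrightarrow> top"
proof -
  have "filterlim (\<lambda>n. real (Suc n)) at_top sequentially"
    by (rule filterlim_compose[OF filterlim_real_sequentially filterlim_Suc])
  then have "filterlim (\<lambda>n. ln (real (Suc n))) at_top sequentially"
    by (rule filterlim_compose[OF ln_at_top])
  then have "filterlim (\<lambda>n. (ln s - ln (3 / 2)) + ln (real (Suc n))) at_top sequentially"
    by (rule filterlim_tendsto_add_at_top[OF tendsto_const])
  then have "filterlim (\<lambda>n. ln (spos (inverse (real (Suc n))) s) - ln (spos (inverse (real (Suc n))) 0)) at_top sequentially"
  proof (rule filterlim_at_top_mono, intro always_eventually allI)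
    fix n
    let ?e = "inverse (real (Suc n))"
    have e: "?e > 0" by simp
    have "ln s \<le> ln (spos ?e s)"
      using spos_ge_self[OF e, of s] assms by simp
    moreover have "ln (spos ?e 0) = ln (3 / 2) - ln (real (Suc n))"
      unfolding spos_0[OF e] by (subst ln_mult) (auto simp: ln_inverse simp del: of_nat_Suc)
    ultimately show "(ln s - ln (3 / 2)) + ln (real (Suc n)) \<le> ln (spos ?e s) - ln (spos ?e 0)" by linarith
  qed
  then show ?thesis by (simp only: ennreal_tendsto_top_eq_at_top)
qed

text \<open>Otherwise some translation by z carries a part of {u > 0} of positive measure into {u =
  0} within the ball. On that part the log transform changes by an amount that tends to infinity,
  whereas the translation estimate bounds the integral of its change by |z| C, uniformly in
  \<epsilon>.\<close>

lemma ball_dichotomy: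
  assumes "x0 \<in> \<Omega>"
  obtains r where "r > 0" "ball x0 r \<subseteq> \<Omega>"
    "(AE y in lborel. y \<in> ball x0 r \<longrightarrow> u y > 0) \<or> (AE y in lborel. y \<in> ball x0 r \<longrightarrow> u y = 0)"
proof -
  obtain R where R: "R > 0" "cball x0 R \<subseteq> \<Omega>"
    using open_\<Omega> assms open_contains_cball_eq by blast
  obtain C where C: "\<And>\<epsilon>. \<epsilon> > 0 \<Longrightarrow>
    (\<integral>\<^sup>+ x. ennreal (norm ((spos' \<epsilon> (u x) / spos \<epsilon> (u x)) *\<^sub>R U x)) * indicator (ball x0 (R / 2)) x \<partial>lborel) \<le> ennreal C"
    using log_gradient_estimate[OF R] by metis
  \<comment> \<open>Points of \<open>P\<close> and \<open>Z\<close> are less than 2 r apart, so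
    segments by z from the ball of radius r stay within 3 r = R / 2, where the gradient is
    controlled.\<close>
  define r where "r = R / 6"
  have r: "r > 0" using R by (simp add: r_def)
  let ?B = "ball x0 r"
  define P where "P = {x \<in> ?B. u x > 0}"
  define Z where "Z = {x \<in> ?B. u x = 0}"
  have [measurable]: "P \<in> sets borel" "Z \<in> sets borel"
    unfolding P_def Z_def by measurable
  have "(AE y in lborel. y \<in> ?B \<longrightarrow> u y > 0) \<or> (AE y in lborel. y \<in> ?B \<longrightarrow> u y = 0)"
  proof (rule ccontr)
    assume neg: "\<not> ?thesis"
    have PZ: "emeasure lborel P \<noteq> 0" "emeasure lborel Z \<noteq> 0"
    proof -
      have "AE y in lborel. y \<in> ?B \<longrightarrow> u y = 0" if "emeasure lborel P = 0"
      proof -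
        have "AE y in lborel. y \<notin> P" using that by (intro AE_not_in) (auto simp: null_sets_def)
        with u_nonneg show ?thesis by eventually_elim (auto simp: P_def)
      qed
      moreover have "AE y in lborel. y \<in> ?B \<longrightarrow> u y > 0" if "emeasure lborel Z = 0"
      proof -
        have "AE y in lborel. y \<notin> Z" using that by (intro AE_not_in) (auto simp: null_sets_def)
        with u_nonneg show ?thesis by eventually_elim (auto simp: Z_def less_le)
      qed
      ultimately show "emeasure lborel P \<noteq> 0" "emeasure lborel Z \<noteq> 0" using neg by blast+
    qed
    \<comment> \<open>The measure of the part of \<open>P\<close> that z carries into
      \<open>Z\<close>. Its integral over all z is the product of the two measures, hence some z has
      h z \<noteq> 0.\<close>
    define h where "h z = (\<integral>\<^sup>+ x. indicator P x * indicator Z (x + z) \<partial>lborel)" for z :: 'a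
    have "(\<integral>\<^sup>+ z. h z \<partial>lborel) = (\<integral>\<^sup>+ x. \<integral>\<^sup>+ z. indicator P x * indicator Z (x + z) \<partial>lborel \<partial>lborel)"
      unfolding h_def by (rule lborel_pair.Fubini') measurable
    also have "\<dots> = (\<integral>\<^sup>+ x. indicator P x * emeasure lborel Z \<partial>lborel)"
    proof (intro nn_integral_cong)
      fix x :: 'a
      have "(\<integral>\<^sup>+ z. indicator Z (x + z) \<partial>lborel) = (\<integral>\<^sup>+ z. indicator Z z \<partial>lborel)"
        using nn_integral_lborel_translate[of "indicator Z" x] by (simp add: add.commute)
      then show "(\<integral>\<^sup>+ z. indicator P x * indicator Z (x + z) \<partial>lborel) = indicator P x * emeasure lborel Z"
        by (simp add: nn_integral_cmult)
    qed
    also have "\<dots> = emeasure lborel P * emeasure lborel Z"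
      by (simp add: nn_integral_multc)
    finally have "(\<integral>\<^sup>+ z. h z \<partial>lborel) \<noteq> 0" using PZ by simp
    then have "h \<noteq> (\<lambda>z. 0)" by auto
    then obtain z where z: "h z \<noteq> 0" by auto
    have "\<exists>x. x \<in> P \<and> x + z \<in> Z"
    proof (rule ccontr)
      assume "\<nexists>x. x \<in> P \<and> x + z \<in> Z"
      then have "(\<lambda>x. indicator P x * indicator Z (x + z) :: ennreal) = (\<lambda>x. 0)"
        by (auto simp: indicator_def fun_eq_iff)
      then show False using z by (simp add: h_def)
    qed
    then obtain x where x: "x \<in> P" "x + z \<in> Z" by blast
    have nz: "norm z < 2 * r"
    proof -
      have "norm z = dist x (x + z)" by (simp add: dist_norm)
      also have "\<dots> \<le> dist x0 x + dist x0 (x + z)" by (rule dist_triangle3)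
      also have "\<dots> < 2 * r" using x by (auto simp: P_def Z_def)
      finally show ?thesis .
    qed
    have sub: "y + t *\<^sub>R z \<in> ball x0 (R / 2)" if "y \<in> ?B" "0 \<le> t" "t \<le> 1" for y t
    proof -
      have "dist x0 (y + t *\<^sub>R z) \<le> dist x0 y + norm (t *\<^sub>R z)"
        using dist_triangle[of x0 "y + t *\<^sub>R z" y] by (simp add: dist_norm)
      also have "norm (t *\<^sub>R z) \<le> norm z" using that by (simp add: mult_left_le_one_le)
      finally show ?thesis using that nz by (simp add: r_def)
    qed
    let ?w = "\<lambda>n x. ln (spos (inverse (real (Suc n))) (u x)) - ln (spos (inverse (real (Suc n))) 0)"
    have bound: "(\<integral>\<^sup>+ x. ennreal (?w n x) * (indicator P x * indicator Z (x + z)) \<partial>lborel) \<le> ennreal (norm z) * ennreal C" for n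
    proof -
      have e: "inverse (real (Suc n)) > 0" by simp
      have "(\<integral>\<^sup>+ x. ennreal (?w n x) * (indicator P x * indicator Z (x + z)) \<partial>lborel)
          \<le> (\<integral>\<^sup>+ x. ennreal \<bar>?w n (x + z) - ?w n x\<bar> * indicator ?B x \<partial>lborel)"
        by (intro nn_integral_mono) (auto simp: indicator_def P_def Z_def intro!: ennreal_leI)
      also have "\<dots> \<le> ennreal (norm z) * (\<integral>\<^sup>+ x. ennreal (norm ((spos' (inverse (real (Suc n))) (u x) / spos (inverse (real (Suc n))) (u x)) *\<^sub>R U x))
            * indicator (ball x0 (R / 2)) x \<partial>lborel)"
        using emeasure_lborel_ball_finite by (intro sob0_translation_estimate[OF p(1) log_transform[OF e]] sub) auto
      also have "\<dots> \<le> ennreal (norm z) * ennreal C"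
        by (intro mult_left_mono C e) auto
      finally show ?thesis .
    qed
    have [measurable]: "spos (inverse (real (Suc n))) \<in> borel_measurable borel" for n
      by (intro borel_measurable_continuous_onI continuous_spos) simp
    let ?L = "\<lambda>x. liminf (\<lambda>n. ennreal (?w n x) * (indicator P x * indicator Z (x + z)))"
    have "(\<integral>\<^sup>+ x. ?L x \<partial>lborel) \<le> liminf (\<lambda>n. \<integral>\<^sup>+ x. ennreal (?w n x) * (indicator P x * indicator Z (x + z)) \<partial>lborel)"
      by (rule nn_integral_liminf) measurable
    also have "\<dots> \<le> ennreal (norm z) * ennreal C"
      by (intro liminf_le_const always_eventually allI bound)
    also have "\<dots> < top" by (simp add: ennreal_mult_less_top)
    finally have "AE x in lborel. ?L x \<noteq> \<infinity>"
      by (intro nn_integral_noteq_infinite) (auto simp: infinity_ennreal_def simp del: of_nat_Suc)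
    then have "AE x in lborel. indicator P x * indicator Z (x + z) = (0 :: ennreal)"
    proof eventually_elim
      case (elim x)
      show ?case
      proof (rule ccontr)
        assume "indicator P x * indicator Z (x + z) \<noteq> (0 :: ennreal)"
        then have i: "x \<in> P" "x + z \<in> Z" by (auto simp: indicator_def split: if_splits)
        then have "(\<lambda>n. ennreal (?w n x) * (indicator P x * indicator Z (x + z))) \<longlonglongrightarrow> top"
          using ln_spos_at_top[of "u x"] by (simp add: P_def del: of_nat_Suc)
        then have "?L x = top" by (intro lim_imp_Liminf) auto
        then show False using elim by (simp add: infinity_ennreal_def)
      qed
    qed
    then have "h z = (\<integral>\<^sup>+ x. 0 \<partial>(lborel :: 'a measure))"
      unfolding h_def by (rule nn_integral_cong_AE)
    then show False using z by simp
  qed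
  moreover have "?B \<subseteq> \<Omega>" using R r by (auto simp: r_def subset_iff)
  ultimately show thesis using r that by blast
qed

text \<open>Points near which u is positive and points near which u vanishes form disjoint open sets
  covering \<Omega>, so by connectedness only one kind occurs. If u vanished throughout, the
  variational inequality with bumps as \<psi> would force f = 0 almost everywhere.\<close>

theorem u_positive:
  assumes "connected \<Omega>" and f_nontrivial: "\<not> (AE x in lborel. x \<in> \<Omega> \<longrightarrow> f x = 0)"
  shows "AE x in lborel. x \<in> \<Omega> \<longrightarrow> u x > 0"
proof -
  define A where "A = {x. \<exists>r>0. AE y in lborel. y \<in> ball x r \<longrightarrow> u y > 0}"
  define B where "B = {x. \<exists>r>0. AE y in lborel. y \<in> ball x r \<longrightarrow> u y = 0}"
  have opn: "open {x. \<exists>r>0. AE y in lborel. y \<in> ball x r \<longrightarrow> Q y}" for Q :: "'a \<Rightarrow> bool"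
  proof (rule openI)
    fix x :: 'a
    assume "x \<in> {x. \<exists>r>0. AE y in lborel. y \<in> ball x r \<longrightarrow> Q y}"
    then obtain r where r: "r > 0" "AE y in lborel. y \<in> ball x r \<longrightarrow> Q y" by blast
    have "x' \<in> {x. \<exists>r>0. AE y in lborel. y \<in> ball x r \<longrightarrow> Q y}" if x': "x' \<in> ball x (r / 2)" for x'
    proof -
      have "ball x' (r / 2) \<subseteq> ball x r"
      proof
        fix y assume "y \<in> ball x' (r / 2)"
        then show "y \<in> ball x r" using x' dist_triangle[of x y x'] by auto
      qed
      with r(2) have "AE y in lborel. y \<in> ball x' (r / 2) \<longrightarrow> Q y"
        by (auto elim!: eventually_mono)
      then show ?thesis using r(1) by (intro CollectI exI[of _ "r / 2"]) auto
    qed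
    then show "\<exists>e>0. ball x e \<subseteq> {x. \<exists>r>0. AE y in lborel. y \<in> ball x r \<longrightarrow> Q y}"
      using r(1) by (intro exI[of _ "r / 2"]) auto
  qed
  have "A \<inter> B = {}"
  proof (rule ccontr)
    assume "A \<inter> B \<noteq> {}"
    then obtain x r s where "r > 0" "s > 0" "AE y in lborel. y \<in> ball x r \<longrightarrow> u y > 0" "AE y in lborel. y \<in> ball x s \<longrightarrow> u y = 0"
      by (auto simp: A_def B_def)
    then have "AE y in lborel. y \<in> ball x (min r s) \<longrightarrow> False"
      by (auto elim!: eventually_elim2)
    then show False
      using \<open>r > 0\<close> \<open>s > 0\<close> by (intro AE_open_contradiction[of "ball x (min r s)"]) auto
  qed
  moreover have "\<Omega> \<subseteq> A \<union> B"
  proof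
    fix x assume x: "x \<in> \<Omega>"
    obtain r where "r > 0" "ball x r \<subseteq> \<Omega>" "(AE y in lborel. y \<in> ball x r \<longrightarrow> u y > 0) \<or> (AE y in lborel. y \<in> ball x r \<longrightarrow> u y = 0)"
      by (rule ball_dichotomy[OF x])
    then show "x \<in> A \<union> B" by (auto simp: A_def B_def)
  qed
  ultimately have AB: "A \<inter> \<Omega> = {} \<or> B \<inter> \<Omega> = {}"
    using connectedD[OF assms(1), of A B] opn[of "\<lambda>y. u y > 0"] opn[of "\<lambda>y. u y = 0"] by (auto simp: A_def B_def)
  have "A \<inter> \<Omega> \<noteq> {}"
  proof
    assume "A \<inter> \<Omega> = {}"
    then have sub: "\<Omega> \<subseteq> B" using \<open>\<Omega> \<subseteq> A \<union> B\<close> by blast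
    have "AE y in lborel. y \<in> \<Omega> \<longrightarrow> f y = 0"
    proof (rule AE_ball_cover)
      fix x assume x: "x \<in> \<Omega>"
      then obtain r where r: "r > 0" "AE y in lborel. y \<in> ball x r \<longrightarrow> u y = 0"
        using sub by (auto simp: B_def)
      obtain R where R: "R > 0" "cball x R \<subseteq> \<Omega>"
        using open_\<Omega> x open_contains_cball_eq by blast
      obtain \<beta> where \<beta>: "\<beta> \<in> C0_infinity \<Omega>" "\<And>y. 0 \<le> \<beta> y" "\<And>y. \<beta> y > 0 \<longleftrightarrow> y \<in> ball x R"
        using bump_exists[OF R] by metis
      have "AE y in lborel. u y + \<beta> y \<ge> 0"
        using u_nonneg by eventually_elim (simp add: \<beta>(2))
      from variational_inequality(1)[OF sob0_C0_infinity[OF \<beta>(1)] this] r(2)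
      have "AE y in lborel. y \<in> ball x (min r R) \<longrightarrow> f y = 0"
      proof eventually_elim
        case (elim y)
        then show ?case using \<beta>(3)[of y] by auto
      qed
      then show "\<exists>r>0. AE y in lborel. y \<in> ball x r \<longrightarrow> f y = 0"
        using r(1) R(1) by (intro exI[of _ "min r R"]) auto
    qed
    then show False using f_nontrivial by blast
  qed
  then have "\<Omega> \<subseteq> A" using AB \<open>\<Omega> \<subseteq> A \<union> B\<close> by blast
  then show ?thesis
    by (intro AE_ball_cover) (auto simp: A_def)
qed

end

section \<open>The Euler--Lagrange equation\<close>

locale positive_minimizer = energy_minimizer +
  assumes u_pos: "AE x in lborel. x \<in> \<Omega> \<longrightarrow> u x > 0"
begin

lemma equation_nonneg_ge:
  assumes \<phi>: "\<phi> \<in> C0_infinity \<Omega>" and nn: "\<And>x. 0 \<le> \<phi> x"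
  shows "integrable lborel (\<lambda>x. f x * \<phi> x / u x powr \<alpha>)"
    and "(LINT x|lborel. f x * \<phi> x / u x powr \<alpha>)
      \<le> (LINT x|lborel. pflux p (U x) \<bullet> grad \<phi> x) + (LINT x|lborel. pflux p (u x) \<bullet> \<phi> x)"
proof -
  have "AE x in lborel. u x + \<phi> x \<ge> 0" using u_nonneg by eventually_elim (simp add: nn)
  from variational_inequality(2,3)[OF sob0_C0_infinity[OF \<phi>] this]
  show "integrable lborel (\<lambda>x. f x * \<phi> x / u x powr \<alpha>)"
    and "(LINT x|lborel. f x * \<phi> x / u x powr \<alpha>)
      \<le> (LINT x|lborel. pflux p (U x) \<bullet> grad \<phi> x) + (LINT x|lborel. pflux p (u x) \<bullet> \<phi> x)" by auto
qed

lemma flux_integrable: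
  assumes "sob0 p \<Omega> \<psi> \<Psi>"
  shows "integrable lborel (\<lambda>x. pflux p (U x) \<bullet> \<Psi> x)" "integrable lborel (\<lambda>x. pflux p (u x) \<bullet> \<psi> x)"
proof -
  note [measurable] = sob0_measurable[OF assms]
  show "integrable lborel (\<lambda>x. pflux p (U x) \<bullet> \<Psi> x)"
    by (rule pflux_integrable[OF p(1) _ _ u_integrable(2) sob0_integrable(2)[OF p_pos assms]]) measurable
  show "integrable lborel (\<lambda>x. pflux p (u x) \<bullet> \<psi> x)"
    by (rule pflux_integrable[OF p(1) _ _ u_integrable(1) sob0_integrable(1)[OF p_pos assms]]) measurable
qed

text \<open>Since \<open>t\<^sup>2 / (t\<^sup>2 + \<epsilon>\<^sup>2) \<le> t / (2 * \<epsilon>)\<close>, a small multiple of \<open>\<phi> * u\<^sup>2 / (u\<^sup>2 + \<epsilon>\<^sup>2)\<close> may be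
  subtracted from \<open>u\<close> without leaving the cone of nonnegative functions.\<close>

lemma equation_nonneg_cutoff:
  assumes \<phi>: "\<phi> \<in> C0_infinity \<Omega>" and nn: "\<And>x. 0 \<le> \<phi> x" and \<epsilon>: "\<epsilon> > 0"
  shows "(LINT x|lborel. (pflux p (U x) \<bullet> grad \<phi> x + pflux p (u x) \<bullet> \<phi> x) * ((u x)\<^sup>2 / ((u x)\<^sup>2 + \<epsilon>\<^sup>2)))
      \<le> (LINT x|lborel. f x * \<phi> x / u x powr \<alpha>)"
proof -
  \<comment> \<open>Written with \<open>powr (-1)\<close> so that \<open>smooth_powr\<close>
    applies; \<open>G_eq\<close> recovers the quotient.\<close>
  define G where "G t = t\<^sup>2 * (t\<^sup>2 + \<epsilon>\<^sup>2) powr (-1)" for t :: real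
  define G' where "G' t = 2 * t * \<epsilon>\<^sup>2 / (t\<^sup>2 + \<epsilon>\<^sup>2)\<^sup>2" for t :: real
  have G_eq: "G t = t\<^sup>2 / (t\<^sup>2 + \<epsilon>\<^sup>2)" for t
    using sq_pos[OF \<epsilon>, of t] by (simp add: G_def powr_minus divide_inverse)
  have G01: "0 \<le> G t" "G t \<le> 1" for t
    using sq_pos[OF \<epsilon>, of t] \<epsilon> by (auto simp: G_eq)
  have twice: "2 * \<bar>t\<bar> * \<epsilon> \<le> t\<^sup>2 + \<epsilon>\<^sup>2" for t
    using sum_squares_bound[of "\<bar>t\<bar>" \<epsilon>] by simp
  have G_lin: "G t \<le> t / (2 * \<epsilon>)" if "t \<ge> 0" for t
  proof -
    have "t\<^sup>2 * (2 * \<epsilon>) \<le> t * (t\<^sup>2 + \<epsilon>\<^sup>2)"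
      using mult_left_mono[OF twice[of t] that] that by (simp add: power2_eq_square mult_ac)
    then show ?thesis using \<epsilon> sq_pos[OF \<epsilon>, of t] by (simp add: G_eq divide_le_eq pos_le_divide_eq mult_ac)
  qed
  have G_der: "(G has_real_derivative G' t) (at t)" for t
  proof -
    have "((\<lambda>t. t\<^sup>2 / (t\<^sup>2 + \<epsilon>\<^sup>2)) has_real_derivative G' t) (at t)"
      using sq_pos[OF \<epsilon>, of t]
      by (auto intro!: derivative_eq_intros simp: G'_def power2_eq_square divide_simps algebra_simps)
    moreover have "G = (\<lambda>t. t\<^sup>2 / (t\<^sup>2 + \<epsilon>\<^sup>2))" by (simp add: G_eq fun_eq_iff)
    ultimately show ?thesis by simp
  qed
  have G'_bd: "\<bar>G' t\<bar> \<le> 1 / \<epsilon>" for t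
  proof -
    have s: "t\<^sup>2 + \<epsilon>\<^sup>2 > 0" by (rule sq_pos[OF \<epsilon>])
    have "2 * \<bar>t\<bar> * \<epsilon>\<^sup>2 * \<epsilon> = (2 * \<bar>t\<bar> * \<epsilon>) * \<epsilon>\<^sup>2" by simp
    also have "\<dots> \<le> (t\<^sup>2 + \<epsilon>\<^sup>2) * (t\<^sup>2 + \<epsilon>\<^sup>2)"
      using twice s by (intro mult_mono) auto
    finally have "2 * \<bar>t\<bar> * \<epsilon>\<^sup>2 * \<epsilon> \<le> (t\<^sup>2 + \<epsilon>\<^sup>2)\<^sup>2" by (simp add: power2_eq_square)
    moreover have "(t\<^sup>2 + \<epsilon>\<^sup>2)\<^sup>2 > 0" by (rule zero_less_power[OF s])
    ultimately show ?thesis using \<epsilon> by (simp add: G'_def abs_mult pos_divide_le_eq pos_le_divide_eq)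
  qed
  have G'_cont: "continuous_on UNIV G'"
    unfolding G'_def[abs_def] using sq_pos[OF \<epsilon>] \<epsilon>
    by (intro continuous_intros) (auto simp: less_imp_neq[symmetric])
  have G_smooth: "smooth (\<lambda>x. G (\<psi> x))" if "smooth \<psi>" for \<psi> :: "'a \<Rightarrow> real"
    unfolding G_def using that by (intro smooth_mult smooth_powr smooth_add smooth_power smooth_const sq_pos[OF \<epsilon>])
  obtain M where M: "M > 0" "\<And>x. \<bar>\<phi> x\<bar> \<le> M" "\<And>x. norm (grad \<phi> x) \<le> M"
    using C0_infinity_bounded[OF \<phi>] by metis
  define \<psi> where "\<psi> x = \<phi> x * G (u x)" for x
  define \<Psi> where "\<Psi> x = G (u x) *\<^sub>R grad \<phi> x + (\<phi> x * G' (u x)) *\<^sub>R U x" for x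
  have \<psi>: "sob0 p \<Omega> \<psi> \<Psi>"
    unfolding \<psi>_def[abs_def] \<Psi>_def[abs_def]
  proof (rule sob0_compose[OF p_pos sob0_u C0_infinity_smooth[OF \<phi>] M(2,3) G_der G'_bd G'_cont])
    fix \<xi> assume "\<xi> \<in> C0_infinity \<Omega>"
    then show "smooth (\<lambda>x. G (\<xi> x))" by (intro G_smooth C0_infinity_smooth)
    then show "(\<lambda>x. \<phi> x * G (\<xi> x)) \<in> C0_infinity \<Omega>"
      using C0_infinity_mult[OF \<phi>, of "\<lambda>x. G (\<xi> x)"] by (simp add: mult.commute)
  qed
  note [measurable] = sob0_measurable[OF \<psi>] C0_infinity_measurable[OF \<phi>]
  \<comment> \<open>With \<phi> \<le> M and G t \<le> t / (2 \<epsilon>) this gives c \<psi> \<le> u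
    / 2.\<close>
  define c where "c = \<epsilon> / M"
  have c: "c > 0" using \<epsilon> M by (simp add: c_def)
  have "AE x in lborel. u x + (- c) * \<psi> x \<ge> 0"
    using u_nonneg
  proof eventually_elim
    case (elim x)
    have "c * \<psi> x \<le> c * (M * (u x / (2 * \<epsilon>)))"
      unfolding \<psi>_def using c M(2)[of x] nn[of x] G_lin[OF elim] G01(1) by (intro mult_left_mono mult_mono) auto
    also have "\<dots> = u x / 2" using \<epsilon> M by (simp add: c_def)
    finally show ?case using elim by simp
  qed
  note VI = variational_inequality(2,3)[OF sob0_cmult[OF p_pos \<psi>, of "- c"] this]
  have iV: "integrable lborel (\<lambda>x. f x * \<psi> x / u x powr \<alpha>)"
    using integrable_mult_right[OF VI(1), of "- inverse c"] c by (simp add: field_simps)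
  have "(- c) * (LINT x|lborel. f x * \<psi> x / u x powr \<alpha>) = (LINT x|lborel. f x * ((- c) * \<psi> x) / u x powr \<alpha>)"
    by (subst Bochner_Integration.integral_mult_right_zero[symmetric]) (simp add: mult_ac)
  also have "\<dots> \<le> (LINT x|lborel. pflux p (U x) \<bullet> ((- c) *\<^sub>R \<Psi> x)) + (LINT x|lborel. pflux p (u x) \<bullet> ((- c) * \<psi> x))"
    by (rule VI(2))
  also have "\<dots> = (- c) * ((LINT x|lborel. pflux p (U x) \<bullet> \<Psi> x) + (LINT x|lborel. pflux p (u x) \<bullet> \<psi> x))"
    by (simp add: distrib_left mult.left_commute)
  finally have le1: "(LINT x|lborel. pflux p (U x) \<bullet> \<Psi> x) + (LINT x|lborel. pflux p (u x) \<bullet> \<psi> x) \<le> (LINT x|lborel. f x * \<psi> x / u x powr \<alpha>)"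
    using c by simp
  have le2: "(LINT x|lborel. f x * \<psi> x / u x powr \<alpha>) \<le> (LINT x|lborel. f x * \<phi> x / u x powr \<alpha>)"
  proof (rule integral_mono[OF iV equation_nonneg_ge(1)[OF \<phi> nn]])
    fix x
    have "f x * \<psi> x \<le> f x * \<phi> x"
      unfolding \<psi>_def using f_nonneg[of x] nn[of x] G01[of "u x"] by (intro mult_left_mono) (auto simp: mult_left_le)
    then show "f x * \<psi> x / u x powr \<alpha> \<le> f x * \<phi> x / u x powr \<alpha>" by (rule divide_right_mono) simp
  qed
  have [measurable]: "G \<in> borel_measurable borel" unfolding G_def by measurable
  note i\<phi> = flux_integrable[OF sob0_C0_infinity[OF \<phi>]] and i\<psi> = flux_integrable[OF \<psi>]
  have "(LINT x|lborel. (pflux p (U x) \<bullet> grad \<phi> x + pflux p (u x) \<bullet> \<phi> x) * G (u x))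
      \<le> (LINT x|lborel. pflux p (U x) \<bullet> \<Psi> x + pflux p (u x) \<bullet> \<psi> x)"
  proof (rule integral_mono_AE)
    show "integrable lborel (\<lambda>x. (pflux p (U x) \<bullet> grad \<phi> x + pflux p (u x) \<bullet> \<phi> x) * G (u x))"
    proof (rule Bochner_Integration.integrable_bound)
      show "integrable lborel (\<lambda>x. pflux p (U x) \<bullet> grad \<phi> x + pflux p (u x) \<bullet> \<phi> x)" using i\<phi> by simp
      show "AE x in lborel. norm ((pflux p (U x) \<bullet> grad \<phi> x + pflux p (u x) \<bullet> \<phi> x) * G (u x))
          \<le> norm (pflux p (U x) \<bullet> grad \<phi> x + pflux p (u x) \<bullet> \<phi> x)"
        using G01 by (intro AE_I2) (simp add: abs_mult mult_left_le)
    qed measurable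
    show "AE x in lborel. (pflux p (U x) \<bullet> grad \<phi> x + pflux p (u x) \<bullet> \<phi> x) * G (u x) \<le> pflux p (U x) \<bullet> \<Psi> x + pflux p (u x) \<bullet> \<psi> x"
      using u_nonneg
    proof eventually_elim
      case (elim x)
      \<comment> \<open>The part of the flux containing \<open>G'\<close> is nonnegative since u
        \<ge> 0, and is discarded; this is why an inequality between the integrals results.\<close>
      have "0 \<le> \<phi> x * G' (u x) * norm (U x) powr p"
        using nn[of x] elim by (intro mult_nonneg_nonneg) (auto simp: G'_def)
      then show ?case
        by (simp add: \<Psi>_def \<psi>_def inner_add_right pflux_inner_self algebra_simps)
    qed
  qed (use i\<psi> in simp)
  then show ?thesis using le1 le2 i\<psi> by (simp add: G_eq)
qed

text \<open>The factor u^2 / (u^2 + \<epsilon>^2) tends to 1 wherever u > 0. Positivity of u on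
  \<Omega> enters the equation at this point.\<close>

lemma equation_nonneg:
  assumes \<phi>: "\<phi> \<in> C0_infinity \<Omega>" and nn: "\<And>x. 0 \<le> \<phi> x"
  shows "(LINT x|lborel. pflux p (U x) \<bullet> grad \<phi> x) + (LINT x|lborel. pflux p (u x) \<bullet> \<phi> x) = (LINT x|lborel. f x * \<phi> x / u x powr \<alpha>)"
proof (rule antisym[OF _ equation_nonneg_ge(2)[OF assms]])
  note [measurable] = C0_infinity_measurable[OF \<phi>]
  note i\<phi> = flux_integrable[OF sob0_C0_infinity[OF \<phi>]]
  let ?h = "\<lambda>x. pflux p (U x) \<bullet> grad \<phi> x + pflux p (u x) \<bullet> \<phi> x"
  define e where "e n = inverse (real (Suc n))" for n
  have e: "e n > 0" for n by (simp add: e_def)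
  have e0: "e \<longlonglongrightarrow> 0" unfolding e_def by (rule LIMSEQ_inverse_real_of_nat)
  have "(\<lambda>n. LINT x|lborel. ?h x * ((u x)\<^sup>2 / ((u x)\<^sup>2 + (e n)\<^sup>2))) \<longlonglongrightarrow> (LINT x|lborel. ?h x)"
  proof (rule integral_dominated_convergence[where w = "\<lambda>x. norm (?h x)"])
    show "integrable lborel (\<lambda>x. norm (?h x))" using i\<phi> by (intro integrable_norm) simp
    show "AE x in lborel. (\<lambda>n. ?h x * ((u x)\<^sup>2 / ((u x)\<^sup>2 + (e n)\<^sup>2))) \<longlonglongrightarrow> ?h x"
      using u_pos
    proof eventually_elim
      case (elim x)
      show ?case
      proof (cases "x \<in> \<Omega>")
        case True
        then have "u x > 0" using elim by simp
        then have "(\<lambda>n. ?h x * ((u x)\<^sup>2 / ((u x)\<^sup>2 + (e n)\<^sup>2))) \<longlonglongrightarrow> ?h x * ((u x)\<^sup>2 / ((u x)\<^sup>2 + 0\<^sup>2))"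
          by (intro tendsto_intros e0) auto
        then show ?thesis using \<open>u x > 0\<close> by simp
      next
        case False
        then show ?thesis by (simp add: C0_infinity_eq_0[OF \<phi>] C0_infinity_grad_eq_0[OF \<phi>])
      qed
    qed
    show "AE x in lborel. norm (?h x * ((u x)\<^sup>2 / ((u x)\<^sup>2 + (e n)\<^sup>2))) \<le> norm (?h x)" for n
    proof (rule AE_I2)
      fix x
      have "0 \<le> (u x)\<^sup>2 / ((u x)\<^sup>2 + (e n)\<^sup>2)" "(u x)\<^sup>2 / ((u x)\<^sup>2 + (e n)\<^sup>2) \<le> 1"
        using sq_pos[OF e[of n], of "u x"] by (auto simp: divide_le_eq)
      then show "norm (?h x * ((u x)\<^sup>2 / ((u x)\<^sup>2 + (e n)\<^sup>2))) \<le> norm (?h x)"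
        unfolding norm_mult by (intro mult_right_le_one_le) auto
    qed
  qed measurable
  then have "(LINT x|lborel. ?h x) \<le> (LINT x|lborel. f x * \<phi> x / u x powr \<alpha>)"
    using equation_nonneg_cutoff[OF assms e] by (intro LIMSEQ_le_const2) auto
  then show "(LINT x|lborel. pflux p (U x) \<bullet> grad \<phi> x) + (LINT x|lborel. pflux p (u x) \<bullet> \<phi> x) \<le> (LINT x|lborel. f x * \<phi> x / u x powr \<alpha>)"
    using i\<phi> by simp
qed

text \<open>A test function of changing sign is the difference of \<phi> + \<zeta> and \<zeta>, with
  \<zeta> a large multiple of a cutoff; unlike positive and negative parts, these are again
  smooth.\<close>

theorem equation:
  assumes \<phi>: "\<phi> \<in> C0_infinity \<Omega>"
  shows "integrable lborel (\<lambda>x. f x * \<phi> x / u x powr \<alpha>)"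
    and "(LINT x|lborel. pflux p (U x) \<bullet> grad \<phi> x) + (LINT x|lborel. pflux p (u x) \<bullet> \<phi> x) = (LINT x|lborel. f x * \<phi> x / u x powr \<alpha>)"
proof -
  obtain K where K: "compact K" "K \<subseteq> \<Omega>" "\<And>x. x \<notin> K \<Longrightarrow> \<phi> x = 0"
    using C0_infinity_support[OF \<phi>] by metis
  obtain \<zeta>1 where \<zeta>1: "\<zeta>1 \<in> C0_infinity \<Omega>" "\<And>x. 0 \<le> \<zeta>1 x" "\<And>x. x \<in> K \<Longrightarrow> 1 \<le> \<zeta>1 x"
    using cutoff_exists[OF open_\<Omega> K(1,2)] by metis
  obtain M where M: "M > 0" "\<And>x. \<bar>\<phi> x\<bar> \<le> M"
    using C0_infinity_bounded[OF \<phi>] by metis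
  define \<zeta> where "\<zeta> x = M * \<zeta>1 x" for x
  have \<zeta>: "\<zeta> \<in> C0_infinity \<Omega>" "\<And>x. 0 \<le> \<zeta> x"
    unfolding \<zeta>_def using \<zeta>1 M by (auto intro: C0_infinity_cmult)
  define \<xi> where "\<xi> x = \<phi> x + \<zeta> x" for x
  have \<xi>: "\<xi> \<in> C0_infinity \<Omega>" unfolding \<xi>_def by (intro C0_infinity_add \<phi> \<zeta>)
  have \<xi>_nn: "0 \<le> \<xi> x" for x
  proof (cases "x \<in> K")
    case True
    have "M * 1 \<le> \<zeta> x" unfolding \<zeta>_def using \<zeta>1(3)[OF True] M by (intro mult_left_mono) auto
    then show ?thesis using M(2)[of x] by (simp add: \<xi>_def)
  qed (simp add: \<xi>_def K \<zeta>)
  have g: "grad \<xi> x = grad \<phi> x + grad \<zeta> x" for x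
    unfolding \<xi>_def by (intro grad_add C0_infinity_smooth[OF \<phi>] C0_infinity_smooth[OF \<zeta>(1)])
  note i1 = equation_nonneg_ge(1)[OF \<xi> \<xi>_nn] and i2 = equation_nonneg_ge(1)[OF \<zeta>]
  have eq: "f x * \<phi> x / u x powr \<alpha> = f x * \<xi> x / u x powr \<alpha> - f x * \<zeta> x / u x powr \<alpha>" for x
    by (simp add: \<xi>_def distrib_left add_divide_distrib)
  show "integrable lborel (\<lambda>x. f x * \<phi> x / u x powr \<alpha>)"
    unfolding eq using i1 i2 by simp
  have "(LINT x|lborel. f x * \<phi> x / u x powr \<alpha>) = (LINT x|lborel. f x * \<xi> x / u x powr \<alpha>) - (LINT x|lborel. f x * \<zeta> x / u x powr \<alpha>)"
    unfolding eq using i1 i2 by simp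
  also have "\<dots> = ((LINT x|lborel. pflux p (U x) \<bullet> grad \<xi> x) + (LINT x|lborel. pflux p (u x) \<bullet> \<xi> x))
      - ((LINT x|lborel. pflux p (U x) \<bullet> grad \<zeta> x) + (LINT x|lborel. pflux p (u x) \<bullet> \<zeta> x))"
    by (simp only: equation_nonneg[OF \<xi> \<xi>_nn] equation_nonneg[OF \<zeta>])
  also have "\<dots> = (LINT x|lborel. pflux p (U x) \<bullet> grad \<phi> x) + (LINT x|lborel. pflux p (u x) \<bullet> \<phi> x)"
    using flux_integrable[OF sob0_C0_infinity[OF \<phi>]] flux_integrable[OF sob0_C0_infinity[OF \<zeta>(1)]]
    by (simp add: g \<xi>_def inner_add_right distrib_left)
  finally show "(LINT x|lborel. pflux p (U x) \<bullet> grad \<phi> x) + (LINT x|lborel. pflux p (u x) \<bullet> \<phi> x) = (LINT x|lborel. f x * \<phi> x / u x powr \<alpha>)"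
    by simp
qed

end

section \<open>Regularity\<close>

text \<open>Stampacchia's iteration along the levels \<open>k0 + d (1 - 2\<^sup>-\<^sup>n)\<close>; the value of \<open>d\<close> makes the
  bound \<open>a (k0) 2\<^sup>-\<^sup>n\<^sup>\<mu>\<close>, \<open>\<mu> = s / (b - 1)\<close>, reproduce itself.\<close>

lemma stampacchia:
  fixes a :: "real \<Rightarrow> real"
  assumes nn: "\<And>k. 0 \<le> a k" and mono: "\<And>h k. k \<le> h \<Longrightarrow> a h \<le> a k"
    and C: "C > 0" and s: "s > 0" and b: "b > 1"
    and rec: "\<And>h k. k0 \<le> k \<Longrightarrow> k < h \<Longrightarrow> a h \<le> C * a k powr b / (h - k) powr s"
  obtains d where "a (k0 + d) = 0"
proof (cases "a k0 = 0")
  case True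
  then show thesis using that[of 0] by simp
next
  case False
  then have A: "a k0 > 0" using nn[of k0] by simp
  define \<mu> where "\<mu> = s / (b - 1)"
  have \<mu>: "\<mu> > 0" using s b by (simp add: \<mu>_def)
  have \<mu>s: "s - \<mu> * b = - \<mu>" using b by (simp add: \<mu>_def field_simps)
  define d where "d = (C * a k0 powr (b - 1) * 2 powr (\<mu> * b)) powr (1 / s)"
  have d: "d > 0" using C A by (simp add: d_def)
  have ds: "d powr s = C * a k0 powr (b - 1) * 2 powr (\<mu> * b)"
    using C A s by (simp add: d_def powr_powr)
  define \<kappa> where "\<kappa> n = k0 + d * (1 - (1 / 2) ^ n)" for n :: nat
  have step: "a (\<kappa> n) \<le> a k0 * 2 powr (- (n * \<mu>))" for n
  proof (induction n)
    case 0
    then show ?case by (simp add: \<kappa>_def)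
  next
    case (Suc n)
    have k0: "k0 \<le> \<kappa> n" using d by (simp add: \<kappa>_def power_le_one)
    have diff: "\<kappa> (Suc n) - \<kappa> n = d * 2 powr (- real (Suc n))"
    proof -
      have "(2::real) powr (- real (Suc n)) = inverse (2 ^ Suc n)"
        using powr_realpow[of 2 "Suc n"] by (simp only: powr_minus zero_less_numeral)
      then show ?thesis by (simp add: \<kappa>_def power_divide field_simps)
    qed
    then have pos: "\<kappa> n < \<kappa> (Suc n)" using d by (smt (verit) mult_pos_pos powr_gt_zero)
    have "a (\<kappa> (Suc n)) \<le> C * a (\<kappa> n) powr b / (\<kappa> (Suc n) - \<kappa> n) powr s"
      by (rule rec[OF k0 pos])
    also have "\<dots> \<le> C * (a k0 * 2 powr (- (n * \<mu>))) powr b / (d * 2 powr (- real (Suc n))) powr s"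
      unfolding diff using Suc nn C b by (intro divide_right_mono mult_left_mono powr_mono2) auto
    also have "\<dots> = C * (a k0 powr b * 2 powr (- (n * \<mu>) * b)) / (d powr s * 2 powr (- real (Suc n) * s))"
      by (simp only: powr_mult powr_powr)
    also have "\<dots> = a k0 * 2 powr (- (real (Suc n) * \<mu>))"
    proof -
      have "a k0 powr b = a k0 * a k0 powr (b - 1)"
        using A powr_mult_base[of "a k0" "b - 1"] by simp
      then have "C * (a k0 powr b * 2 powr (- (n * \<mu>) * b)) / (d powr s * 2 powr (- real (Suc n) * s))
          = a k0 * (2 powr (- (n * \<mu>) * b) / (2 powr (\<mu> * b) * 2 powr (- real (Suc n) * s)))"
        using C A by (simp add: ds)
      also have "2 powr (- (n * \<mu>) * b) / (2 powr (\<mu> * b) * 2 powr (- real (Suc n) * s))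
          = 2 powr (- (n * \<mu>) * b - (\<mu> * b + - real (Suc n) * s))"
        by (simp only: powr_add powr_diff)
      also have "- (n * \<mu>) * b - (\<mu> * b + - real (Suc n) * s) = real (Suc n) * (s - \<mu> * b)"
        by (simp add: algebra_simps)
      finally show ?thesis by (simp add: \<mu>s)
    qed
    finally show ?case .
  qed
  have "a (k0 + d) \<le> a k0 * 2 powr (- (n * \<mu>))" for n :: nat
  proof -
    have "\<kappa> n \<le> k0 + d" using d by (simp add: \<kappa>_def mult_left_le)
    then show ?thesis using mono[of "\<kappa> n" "k0 + d"] step[of n] by linarith
  qed
  moreover have "(\<lambda>n. a k0 * 2 powr (- (real n * \<mu>))) \<longlonglongrightarrow> a k0 * 0"
  proof -
    have "2 powr (- (real n * \<mu>)) = (2 powr (- \<mu>)) ^ n" for n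
      by (simp add: powr_powr[symmetric] mult.commute[of _ \<mu>] flip: powr_realpow) (simp add: powr_powr)
    moreover have "(\<lambda>n. (2 powr (- \<mu>)) ^ n) \<longlonglongrightarrow> (0::real)"
      using \<mu> powr_less_one[of 2 "- \<mu>"] by (intro LIMSEQ_realpow_zero) auto
    ultimately show ?thesis by (intro tendsto_mult tendsto_const) simp
  qed
  ultimately have "a (k0 + d) \<le> a k0 * 0"
    by (intro LIMSEQ_le_const) auto
  then show thesis using nn[of "k0 + d"] that[of d] by simp
qed

lemma conjugate_exponent:
  fixes t :: real
  assumes "t > 1"
  shows "t / (t - 1) > 1" "1 / t + 1 / (t / (t - 1)) = 1"
  using assms by (auto simp: field_simps)

context positive_minimizer
begin

definition Ks :: real where "Ks = (p * (N - 1) / (N - p)) powr ps"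

lemma Ks_nonneg: "Ks \<ge> 0"
  by (simp add: Ks_def)

text \<open>The variational inequality with \<psi> = - c G (u): the bound |G t| \<le> L |t| makes u
  + \<psi> \<ge> 0 for c = 1 / (L + 1), and division by - c reverses the inequality. The
  zeroth-order term is nonnegative and is dropped. Testing is thus done with functions of u
  itself.\<close>

lemma test_composition:
  assumes G: "\<And>t. (G has_real_derivative G' t) (at t)" "\<And>t. \<bar>G' t\<bar> \<le> L" "continuous_on UNIV G'" "G 0 = 0"
    and G_smooth: "\<And>\<phi>::'a \<Rightarrow> real. smooth \<phi> \<Longrightarrow> smooth (\<lambda>x. G (\<phi> x))"
    and G_nn: "\<And>t. 0 \<le> t \<Longrightarrow> 0 \<le> G t"
  shows "integrable lborel (\<lambda>x. f x * G (u x) / u x powr \<alpha>)"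
    and "integrable lborel (\<lambda>x. G' (u x) * norm (U x) powr p)"
    and "(LINT x|lborel. G' (u x) * norm (U x) powr p) \<le> (LINT x|lborel. f x * G (u x) / u x powr \<alpha>)"
proof -
  note \<psi> = sob0_compose_0[OF p_pos sob0_u G G_smooth]
  have L: "L \<ge> 0" using G(2)[of 0] by linarith
  define c where "c = 1 / (L + 1)"
  have c: "c > 0" "c * L \<le> 1" using L by (auto simp: c_def)
  have lin: "\<bar>G t\<bar> \<le> L * \<bar>t\<bar>" for t
    using field_differentiable_bound[of UNIV G G' L t 0] G(1,2,4) by auto
  have "AE x in lborel. u x + (- c) * G (u x) \<ge> 0"
    using u_nonneg
  proof eventually_elim
    case (elim x)
    have "c * G (u x) \<le> c * (L * u x)" using c lin[of "u x"] elim by (intro mult_left_mono) auto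
    also have "\<dots> \<le> 1 * u x" using c elim by (simp only: mult.assoc[symmetric]) (intro mult_right_mono)
    finally show ?case by simp
  qed
  note VI = variational_inequality(2,3)[OF sob0_cmult[OF p_pos \<psi>, of "- c"] this]
  show iV: "integrable lborel (\<lambda>x. f x * G (u x) / u x powr \<alpha>)"
    using integrable_mult_right[OF VI(1), of "- inverse c"] c by (simp add: field_simps)
  note i\<psi> = flux_integrable[OF \<psi>]
  have eq: "pflux p (U x) \<bullet> (G' (u x) *\<^sub>R U x) = G' (u x) * norm (U x) powr p" for x
    by (simp add: pflux_inner_self)
  show "integrable lborel (\<lambda>x. G' (u x) * norm (U x) powr p)"
    using i\<psi>(1) unfolding eq .
  have "(- c) * (LINT x|lborel. f x * G (u x) / u x powr \<alpha>) = (LINT x|lborel. f x * ((- c) * G (u x)) / u x powr \<alpha>)"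
    by (subst Bochner_Integration.integral_mult_right_zero[symmetric]) (simp add: mult_ac)
  also have "\<dots> \<le> (LINT x|lborel. pflux p (U x) \<bullet> ((- c) *\<^sub>R (G' (u x) *\<^sub>R U x))) + (LINT x|lborel. pflux p (u x) \<bullet> ((- c) * G (u x)))"
    by (rule VI(2))
  also have "\<dots> = (- c) * ((LINT x|lborel. pflux p (U x) \<bullet> (G' (u x) *\<^sub>R U x)) + (LINT x|lborel. pflux p (u x) \<bullet> G (u x)))"
  proof -
    have "(LINT x|lborel. pflux p (U x) \<bullet> ((- c) *\<^sub>R V x)) = (- c) * (LINT x|lborel. pflux p (U x) \<bullet> V x)" for V
      by simp
    moreover have "(LINT x|lborel. pflux p (u x) \<bullet> ((- c) * v x)) = (- c) * (LINT x|lborel. pflux p (u x) \<bullet> v x)" for v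
      by (simp add: mult.left_commute)
    ultimately show ?thesis by (simp only: distrib_left)
  qed
  finally have "(LINT x|lborel. pflux p (U x) \<bullet> (G' (u x) *\<^sub>R U x)) + (LINT x|lborel. pflux p (u x) \<bullet> G (u x)) \<le> (LINT x|lborel. f x * G (u x) / u x powr \<alpha>)"
    using c by simp
  moreover have "0 \<le> (LINT x|lborel. pflux p (u x) \<bullet> G (u x))"
    using u_nonneg by (intro integral_nonneg_AE) (auto elim!: eventually_mono simp: pflux_def G_nn)
  ultimately show "(LINT x|lborel. G' (u x) * norm (U x) powr p) \<le> (LINT x|lborel. f x * G (u x) / u x powr \<alpha>)"
    unfolding eq by linarith
qed

text \<open>The choice \<open>G' = \<Phi>'\<^sup>p\<close> makes the test function \<open>G (u)\<close> produce the gradient of \<open>\<Phi> (u)\<close>.\<close>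

lemma sobolev_composition:
  assumes G: "\<And>t. (G has_real_derivative G' t) (at t)" "\<And>t. \<bar>G' t\<bar> \<le> L" "continuous_on UNIV G'" "G 0 = 0"
    and G_smooth: "\<And>\<phi>::'a \<Rightarrow> real. smooth \<phi> \<Longrightarrow> smooth (\<lambda>x. G (\<phi> x))"
    and G_nn: "\<And>t. 0 \<le> t \<Longrightarrow> 0 \<le> G t"
    and \<Phi>: "\<And>t. (\<Phi> has_real_derivative \<Phi>' t) (at t)" "\<And>t. \<bar>\<Phi>' t\<bar> \<le> L'" "continuous_on UNIV \<Phi>'" "\<Phi> 0 = 0"
    and \<Phi>_smooth: "\<And>\<phi>::'a \<Rightarrow> real. smooth \<phi> \<Longrightarrow> smooth (\<lambda>x. \<Phi> (\<phi> x))"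
    and C: "C \<ge> 0" "\<And>t. 0 \<le> t \<Longrightarrow> \<bar>\<Phi>' t\<bar> powr p \<le> C * G' t"
  shows "integrable lborel (\<lambda>x. \<bar>\<Phi> (u x)\<bar> powr ps)"
    and "(LINT x|lborel. \<bar>\<Phi> (u x)\<bar> powr ps) \<le> Ks * (2 powr p * (C * (LINT x|lborel. f x * G (u x) / u x powr \<alpha>))) powr (N / (N - p))"
proof -
  note w = sob0_compose_0[OF p_pos sob0_u \<Phi> \<Phi>_smooth]
  note T = test_composition[OF G G_smooth G_nn]
  show "integrable lborel (\<lambda>x. \<bar>\<Phi> (u x)\<bar> powr ps)" by (rule sobolev(1)[OF w])
  have "(LINT x|lborel. norm (\<Phi>' (u x) *\<^sub>R U x) powr p) \<le> (LINT x|lborel. C * (G' (u x) * norm (U x) powr p))"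
  proof (rule integral_mono_AE)
    show "AE x in lborel. norm (\<Phi>' (u x) *\<^sub>R U x) powr p \<le> C * (G' (u x) * norm (U x) powr p)"
      using u_nonneg
    proof eventually_elim
      case (elim x)
      from mult_right_mono[OF C(2)[OF elim], of "norm (U x) powr p"]
      show ?case by (simp add: powr_mult mult.assoc)
    qed
  qed (use sob0_integrable(2)[OF p_pos w] T(2) in auto)
  also have "\<dots> \<le> C * (LINT x|lborel. f x * G (u x) / u x powr \<alpha>)"
    using T(3) C(1) by (simp add: mult_left_mono)
  finally have "(2 powr p * (LINT x|lborel. norm (\<Phi>' (u x) *\<^sub>R U x) powr p)) powr (N / (N - p))
      \<le> (2 powr p * (C * (LINT x|lborel. f x * G (u x) / u x powr \<alpha>))) powr (N / (N - p))"
    using p by (intro powr_mono2 mult_left_mono mult_nonneg_nonneg) auto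
  then show "(LINT x|lborel. \<bar>\<Phi> (u x)\<bar> powr ps) \<le> Ks * (2 powr p * (C * (LINT x|lborel. f x * G (u x) / u x powr \<alpha>))) powr (N / (N - p))"
    using sobolev(2)[OF w] Ks_nonneg mult_left_mono unfolding Ks_def by (meson order_trans)
qed

section \<open>Boundedness for m > N / p\<close>

text \<open>Here \<open>t \<mapsto> max 0 (t - k)\<close> is the limit of \<open>t \<mapsto> spos d (t - k) - spos d (- k)\<close> as \<open>d \<rightarrow> 0\<close>.\<close>

lemma truncation_estimate:
  assumes k: "k \<ge> 1"
  shows "integrable lborel (\<lambda>x. max 0 (u x - k) powr ps)"
    and "integrable lborel (\<lambda>x. f x * max 0 (u x - k) / u x powr \<alpha>)"
    and "(LINT x|lborel. max 0 (u x - k) powr ps) \<le>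
      Ks * (2 powr p * (LINT x|lborel. f x * max 0 (u x - k) / u x powr \<alpha>)) powr (N / (N - p))"
proof -
  define e where "e n = inverse (real (Suc n))" for n
  have e: "e n > 0" for n by (simp add: e_def)
  have e0: "e \<longlonglongrightarrow> 0" unfolding e_def by (rule LIMSEQ_inverse_real_of_nat)
  define G where "G n t = spos (e n) (t - k) - spos (e n) (- k)" for n t
  have G_der: "(G n has_real_derivative spos' (e n) (t - k)) (at t)" for n t
  proof -
    have "((\<lambda>t. spos (e n) (t - k)) has_real_derivative spos' (e n) (t - k) * 1) (at t)"
      by (rule DERIV_chain2[OF spos_has_derivative[OF e]]) (auto intro!: derivative_eq_intros)
    then show ?thesis unfolding G_def[abs_def] by (auto intro!: derivative_eq_intros)
  qed
  have G'_bd: "0 \<le> spos' (e n) (t - k)" "\<bar>spos' (e n) (t - k)\<bar> \<le> 1" for n t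
    using spos'_bounds[OF e[of n], of "t - k"] by auto
  have G'_cont: "continuous_on UNIV (\<lambda>t. spos' (e n) (t - k))" for n
    by (rule continuous_on_compose2[OF continuous_spos'[OF e, of UNIV]]) (auto intro!: continuous_intros)
  have G0: "G n 0 = 0" for n by (simp add: G_def)
  have G_smooth: "smooth (\<lambda>x. G n (\<phi> x))" if "smooth \<phi>" for n and \<phi> :: "'a \<Rightarrow> real"
    unfolding G_def using that by (intro smooth_diff smooth_const smooth_spos[OF e])
  have G_bounds: "0 \<le> G n t \<and> G n t \<le> t" if "t \<ge> 0" for n t
  proof -
    have "\<bar>G n t\<bar> \<le> 1 * \<bar>t\<bar>"
      using field_differentiable_bound[of UNIV "G n" "\<lambda>t. spos' (e n) (t - k)" 1 t 0] G_der G'_bd G0 by auto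
    moreover have "G n 0 \<le> G n t"
      by (rule DERIV_nonneg_imp_nondecreasing[OF that]) (use G_der G'_bd in blast)
    ultimately show ?thesis using that G0 by simp
  qed
  \<comment> \<open>Since 0 \<le> \<open>spos'\<close> \<le> 1 and p > 1, the p-th power is at most
    \<open>spos'\<close> itself, so the same function can serve as G and as \<Phi>, with constant
    1.\<close>
  have pow1: "\<bar>spos' (e n) (t - k)\<bar> powr p \<le> 1 * spos' (e n) (t - k)" for n t
    using G'_bd[of n t] powr_mono'[of 1 p "spos' (e n) (t - k)"] p
    by (cases "spos' (e n) (t - k) = 0") auto
  have S: "integrable lborel (\<lambda>x. \<bar>G n (u x)\<bar> powr ps)"
    "(LINT x|lborel. \<bar>G n (u x)\<bar> powr ps) \<le> Ks * (2 powr p * (LINT x|lborel. f x * G n (u x) / u x powr \<alpha>)) powr (N / (N - p))" for n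
    using sobolev_composition[of "G n" "\<lambda>t. spos' (e n) (t - k)" 1 "G n" "\<lambda>t. spos' (e n) (t - k)" 1 1]
      G_der[of n] G'_bd(2)[of n] G'_cont[of n] G0[of n] G_smooth[where n = n] G_bounds[where n = n] pow1[of n] by auto
  have G_lim: "(\<lambda>n. G n t) \<longlonglongrightarrow> max 0 (t - k)" for t
  proof -
    have "(\<lambda>n. spos (e n) r) \<longlonglongrightarrow> max 0 r" for r
    proof -
      have "(\<lambda>n. spos (e n) r) \<longlonglongrightarrow> 0 + (r + (r\<^sup>2 + 0\<^sup>2) powr (1 / 2)) / 2"
        unfolding spos_def by (intro tendsto_intros tendsto_powr' e0) auto
      moreover have "0 + (r + (r\<^sup>2 + 0\<^sup>2) powr (1 / 2)) / 2 = max 0 r"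
        by (auto simp: powr_half_sqrt max_def)
      ultimately show ?thesis by simp
    qed
    from tendsto_diff[OF this[of "t - k"] this[of "- k"]] show ?thesis using k by (simp add: G_def)
  qed
  have [measurable]: "G n \<in> borel_measurable borel" for n
    using G_der[of n] by (intro borel_measurable_continuous_onI) (meson DERIV_isCont continuous_at_imp_continuous_on)
  have dom1: "integrable lborel (\<lambda>x. \<bar>u x\<bar> powr ps)" by (rule sobolev(1)[OF sob0_u])
  have dom2: "integrable lborel (\<lambda>x. f x * \<bar>u x\<bar> powr (1 - \<alpha>))" by (rule f_term_integrable[OF sob0_u])
  have lim1: "AE x in lborel. (\<lambda>n. \<bar>G n (u x)\<bar> powr ps) \<longlonglongrightarrow> max 0 (u x - k) powr ps"
  proof (rule AE_I2)
    fix x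
    have "(\<lambda>n. \<bar>G n (u x)\<bar> powr ps) \<longlonglongrightarrow> \<bar>max 0 (u x - k)\<bar> powr ps"
      using ps_pos by (intro tendsto_powr' tendsto_intros G_lim) auto
    then show "(\<lambda>n. \<bar>G n (u x)\<bar> powr ps) \<longlonglongrightarrow> max 0 (u x - k) powr ps" by simp
  qed
  have bd1: "AE x in lborel. norm (\<bar>G n (u x)\<bar> powr ps) \<le> \<bar>u x\<bar> powr ps" for n
    using u_nonneg
  proof eventually_elim
    case (elim x)
    show ?case using G_bounds[OF elim, of n] ps_pos elim by (auto intro!: powr_mono2)
  qed
  have lim2: "AE x in lborel. (\<lambda>n. f x * G n (u x) / u x powr \<alpha>) \<longlonglongrightarrow> f x * max 0 (u x - k) / u x powr \<alpha>"
  proof (rule AE_I2)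
    fix x
    have "(\<lambda>n. f x * G n (u x) * inverse (u x powr \<alpha>)) \<longlonglongrightarrow> f x * max 0 (u x - k) * inverse (u x powr \<alpha>)"
      by (intro tendsto_intros G_lim)
    then show "(\<lambda>n. f x * G n (u x) / u x powr \<alpha>) \<longlonglongrightarrow> f x * max 0 (u x - k) / u x powr \<alpha>"
      by (simp add: divide_inverse)
  qed
  have bd2: "AE x in lborel. norm (f x * G n (u x) / u x powr \<alpha>) \<le> f x * \<bar>u x\<bar> powr (1 - \<alpha>)" for n
    using u_nonneg
  proof eventually_elim
    case (elim x)
    show ?case
    proof (cases "u x = 0")
      case False
      then have u0: "u x > 0" using elim by simp
      have "f x * G n (u x) / u x powr \<alpha> \<le> f x * u x / u x powr \<alpha>"
        using G_bounds[OF elim, of n] f_nonneg[of x] by (intro divide_right_mono mult_left_mono) auto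
      also have "\<dots> = f x * u x powr (1 - \<alpha>)" using u0 by (simp add: powr_diff)
      finally show ?thesis using G_bounds[OF elim, of n] f_nonneg[of x] u0 by (simp add: abs_mult)
    qed (use G0 f_nonneg in simp)
  qed
  show "integrable lborel (\<lambda>x. max 0 (u x - k) powr ps)"
    by (rule integrable_dominated_convergence[OF _ _ dom1 lim1 bd1]) measurable
  show "integrable lborel (\<lambda>x. f x * max 0 (u x - k) / u x powr \<alpha>)"
    by (rule integrable_dominated_convergence[OF _ _ dom2 lim2 bd2]) measurable
  have L1: "(\<lambda>n. LINT x|lborel. \<bar>G n (u x)\<bar> powr ps) \<longlonglongrightarrow> (LINT x|lborel. max 0 (u x - k) powr ps)"
    by (rule integral_dominated_convergence[OF _ _ dom1 lim1 bd1]) measurable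
  have L2: "(\<lambda>n. LINT x|lborel. f x * G n (u x) / u x powr \<alpha>) \<longlonglongrightarrow> (LINT x|lborel. f x * max 0 (u x - k) / u x powr \<alpha>)"
    by (rule integral_dominated_convergence[OF _ _ dom2 lim2 bd2]) measurable
  have nn2: "0 \<le> (LINT x|lborel. f x * G n (u x) / u x powr \<alpha>)" for n
    using u_nonneg by (intro integral_nonneg_AE) (auto elim!: eventually_mono simp: f_nonneg G_bounds)
  have "(\<lambda>n. Ks * (2 powr p * (LINT x|lborel. f x * G n (u x) / u x powr \<alpha>)) powr (N / (N - p)))
      \<longlonglongrightarrow> Ks * (2 powr p * (LINT x|lborel. f x * max 0 (u x - k) / u x powr \<alpha>)) powr (N / (N - p))"
    using p nn2 by (intro tendsto_intros tendsto_powr' L2) auto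
  then show "(LINT x|lborel. max 0 (u x - k) powr ps) \<le>
      Ks * (2 powr p * (LINT x|lborel. f x * max 0 (u x - k) / u x powr \<alpha>)) powr (N / (N - p))"
    by (rule LIMSEQ_le[OF L1]) (use S in auto)
qed

text \<open>A Hoelder inequality with three factors, f, (u - k)_+ and the indicator of {u > k},
  obtained from two with two factors. On {u > k} the singular denominator is at least 1 because k
  \<ge> 1.\<close>

lemma f_truncation_Holder:
  assumes k: "k \<ge> 1" and m: "m > N / p" and fm: "integrable lborel (\<lambda>x. f x powr m)"
  shows "(LINT x|lborel. f x * max 0 (u x - k) / u x powr \<alpha>) \<le>
    (LINT x|lborel. f x powr m) powr (1 / m) * (LINT x|lborel. max 0 (u x - k) powr ps) powr (1 / ps)
      * measure lborel {x. u x > k} powr (1 - 1 / m - 1 / ps)"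
proof -
  define q where "q = ps / (ps - 1)"
  have ps1: "ps > 1" using ps_gt p by simp
  have q: "q > 1" "1 / ps + 1 / q = 1" using ps1 by (auto simp: q_def field_simps)
  have N0: "N > 0" using p by simp
  have m1: "m > 1" using m p by (smt (verit) less_divide_eq_1_pos)
  have inv_ps: "1 / ps = 1 / p - 1 / N" using p by (simp add: ps_def field_simps)
  \<comment> \<open>The aim is 1/m + 1/ps < 1, which leaves a positive exponent for the measure of
    the level set.\<close>
  have "1 / m < p / N" using m p N0 m1 by (simp add: field_simps)
  also have "p / N \<le> 1 - 1 / ps"
  proof -
    have "(p - 1) / N \<le> (p - 1) / p" using p by (intro divide_left_mono) auto
    then show ?thesis using p inv_ps by (simp add: diff_divide_distrib)
  qed
  finally have e: "1 / m + 1 / ps < 1" by simp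
  have mq: "m / q > 1"
  proof -
    have "1 / m < 1 / q" using e q(2) by linarith
    then show ?thesis using m1 q by (simp add: field_simps)
  qed
  define r where "r = (m / q) / (m / q - 1)"
  have r: "r > 1" "1 / (m / q) + 1 / r = 1" unfolding r_def by (rule conjugate_exponent[OF mq])+
  let ?A = "{x. u x > k}"
  have A_fin: "emeasure lborel ?A < \<infinity>"
  proof -
    have "emeasure lborel ?A \<le> (\<integral>\<^sup>+ x. ennreal (\<bar>u x\<bar> powr ps) \<partial>lborel)"
    proof -
      have "emeasure lborel ?A = (\<integral>\<^sup>+ x. indicator ?A x \<partial>lborel)" by simp
      also have "\<dots> \<le> (\<integral>\<^sup>+ x. ennreal (\<bar>u x\<bar> powr ps) \<partial>lborel)"
      proof (intro nn_integral_mono)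
        fix x
        show "indicator ?A x \<le> ennreal (\<bar>u x\<bar> powr ps)"
        proof (cases "x \<in> ?A")
          case True
          then have "1 \<le> \<bar>u x\<bar> powr ps" using k ps_pos by (intro ge_one_powr_ge_zero) auto
          then show ?thesis using True by simp
        qed simp
      qed
      finally show ?thesis .
    qed
    also have "\<dots> < \<infinity>" using sobolev(1)[OF sob0_u] by (simp add: nn_integral_eq_integral)
    finally show ?thesis .
  qed
  let ?w = "\<lambda>x. max 0 (u x - k)" and ?g = "\<lambda>x. f x * indicator ?A x"
  have f_pow: "\<bar>f x powr q\<bar> powr (m / q) = f x powr m" for x using q by (simp add: powr_powr)
  have g_pow: "\<bar>?g x\<bar> powr q = f x powr q * indicator ?A x" for x
    using f_nonneg[of x] by (auto simp: indicator_def)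
  have i_pow: "\<bar>indicator ?A x :: real\<bar> powr r = indicator ?A x" for x by (auto simp: indicator_def)
  have iA: "integrable lborel (\<lambda>x. indicator ?A x :: real)" using A_fin by (intro integrable_real_indicator) auto
  have H1: "integrable lborel (\<lambda>x. f x powr q * indicator ?A x)"
    "(LINT x|lborel. \<bar>f x powr q * indicator ?A x\<bar>) \<le> (LINT x|lborel. f x powr m) powr (1 / (m / q)) * measure lborel ?A powr (1 / r)"
    using Holder[OF mq r, of "\<lambda>x. f x powr q" lborel "indicator ?A"] fm iA unfolding f_pow i_pow by auto
  have H2: "(LINT x|lborel. \<bar>?w x * ?g x\<bar>) \<le> (LINT x|lborel. \<bar>?w x\<bar> powr ps) powr (1 / ps) * (LINT x|lborel. \<bar>?g x\<bar> powr q) powr (1 / q)"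
    "integrable lborel (\<lambda>x. ?w x * ?g x)"
    using Holder[OF ps1 q, of ?w lborel ?g] truncation_estimate(1)[OF k] H1(1) unfolding g_pow by auto
  have "(LINT x|lborel. f x * ?w x / u x powr \<alpha>) \<le> (LINT x|lborel. \<bar>?w x * ?g x\<bar>)"
  proof (rule integral_mono[OF truncation_estimate(2)[OF k] integrable_abs[OF H2(2)]])
    fix x
    show "f x * ?w x / u x powr \<alpha> \<le> \<bar>?w x * ?g x\<bar>"
    proof (cases "u x > k")
      case True
      then have "1 \<le> u x powr \<alpha>" using k \<alpha> by (intro ge_one_powr_ge_zero) auto
      then have "f x * ?w x / u x powr \<alpha> \<le> f x * ?w x / 1"
        using f_nonneg[of x] by (intro divide_left_mono) auto
      then show ?thesis using True f_nonneg[of x] by (simp add: abs_mult mult.commute)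
    qed simp
  qed
  also have "\<dots> \<le> (LINT x|lborel. ?w x powr ps) powr (1 / ps) * (LINT x|lborel. f x powr q * indicator ?A x) powr (1 / q)"
    using H2(1) unfolding g_pow by simp
  also have "\<dots> \<le> (LINT x|lborel. ?w x powr ps) powr (1 / ps) * ((LINT x|lborel. f x powr m) powr (1 / (m / q)) * measure lborel ?A powr (1 / r)) powr (1 / q)"
    using H1(2) q by (intro mult_left_mono powr_mono2) (auto simp: abs_mult)
  also have "((LINT x|lborel. f x powr m) powr (1 / (m / q)) * measure lborel ?A powr (1 / r)) powr (1 / q)
      = (LINT x|lborel. f x powr m) powr (1 / (m / q) * (1 / q)) * measure lborel ?A powr (1 / r * (1 / q))"
    by (simp only: powr_mult powr_powr)
  also have "1 / (m / q) * (1 / q) = 1 / m" using q by simp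
  also have "1 / r * (1 / q) = 1 - 1 / m - 1 / ps"
  proof -
    have "1 / r = 1 - q / m" using r(2) by simp
    then have "1 / r * (1 / q) = 1 / q - 1 / m" using q m1 by (simp add: field_simps)
    then show ?thesis using q(2) by linarith
  qed
  finally show ?thesis by (simp add: mult_ac)
qed

text \<open>With X the integral of (u - k)_+^ps, the two preceding lemmas give X at most a constant
  times X^(1/p) and a power of the measure of {u > k}. Cancelling X^(1/p), possible as p > 1, bounds
  X by that measure to the power \<open>b\<close>; Chebyshev's inequality then gives Stampacchia's
  recursion. The condition b > 1 is equivalent to m > N / p.\<close>

theorem u_bounded:
  assumes m: "m > N / p" and fm: "integrable lborel (\<lambda>x. f x powr m)"
  obtains B where "AE x in lborel. u x \<le> B"
proof -
  have ps1: "ps > 1" using ps_gt p by simp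
  have N0: "N > 0" using p by simp
  have m1: "m > 1" using m p by (smt (verit) less_divide_eq_1_pos)
  define F where "F = (LINT x|lborel. f x powr m) powr (1 / m)"
  define e where "e = 1 - 1 / m - 1 / ps"
  define b where "b = e * ps / (p - 1)"
  have b: "b > 1"
  proof -
    have "1 / m < p / N" using m p N0 m1 by (simp add: field_simps)
    then have "ps * (1 - p / N) < ps * (1 - 1 / m)" using ps_pos by simp
    moreover have "ps * (1 - p / N) = p" using p by (simp add: ps_def field_simps)
    moreover have "e * ps = ps * (1 - 1 / m) - 1" using ps_pos by (simp add: e_def field_simps)
    ultimately have "e * ps > p - 1" by linarith
    then show ?thesis using p by (simp add: b_def)
  qed
  \<comment> \<open>The summand 1 guarantees the positive constant that \<open>stampacchia\<close>
    asks for.\<close>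
  define D where "D = (Ks * (2 powr p * F) powr (N / (N - p)) + 1) powr (p / (p - 1))"
  have "Ks * (2 powr p * F) powr (N / (N - p)) + 1 > 0"
    using Ks_nonneg by (intro add_nonneg_pos mult_nonneg_nonneg) auto
  then have D: "D > 0" by (simp add: D_def)
  have rp: "N / (N - p) = ps / p" using p by (simp add: ps_def)
  have X_le: "(LINT x|lborel. max 0 (u x - k) powr ps) \<le> D * measure lborel {x. u x > k} powr b" if k: "k \<ge> 1" for k
  proof -
    define X where "X = (LINT x|lborel. max 0 (u x - k) powr ps)"
    define A where "A = measure lborel {x. u x > k}"
    have X0: "X \<ge> 0" by (simp add: X_def)
    have T: "X \<le> Ks * (2 powr p * (LINT x|lborel. f x * max 0 (u x - k) / u x powr \<alpha>)) powr (N / (N - p))"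
      using truncation_estimate(3)[OF k] by (simp add: X_def)
    have nn: "0 \<le> (LINT x|lborel. f x * max 0 (u x - k) / u x powr \<alpha>)"
      using f_nonneg by (intro integral_nonneg_AE) auto
    have "X \<le> Ks * (2 powr p * (F * X powr (1 / ps) * A powr e)) powr (N / (N - p))"
      using f_truncation_Holder[OF k m fm] nn p Ks_nonneg unfolding X_def[symmetric] A_def[symmetric] F_def[symmetric] e_def[symmetric]
      by (intro order_trans[OF T] mult_left_mono powr_mono2) auto
    also have "\<dots> = Ks * ((2 powr p * F) powr (N / (N - p)) * (X powr (1 / ps * (N / (N - p))) * A powr (e * (N / (N - p)))))"
      by (simp only: powr_mult powr_powr mult.assoc)
    also have "1 / ps * (N / (N - p)) = 1 / p" unfolding rp using ps_pos by simp
    finally have main: "X \<le> Ks * (2 powr p * F) powr (N / (N - p)) * (X powr (1 / p) * A powr (e * (N / (N - p))))"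
      by (simp add: mult.assoc)
    show ?thesis
    proof (cases "X = 0")
      case True
      then show ?thesis using D by (simp add: X_def[symmetric])
    next
      case False
      then have Xp: "X > 0" using X0 by simp
      have "X = X powr (1 / p) * X powr ((p - 1) / p)"
        using Xp p by (simp add: field_simps flip: powr_add)
      with main have "X powr (1 / p) * X powr ((p - 1) / p) \<le> X powr (1 / p) * (Ks * (2 powr p * F) powr (N / (N - p)) * A powr (e * (N / (N - p))))"
        by (simp add: mult_ac)
      then have "X powr ((p - 1) / p) \<le> Ks * (2 powr p * F) powr (N / (N - p)) * A powr (e * (N / (N - p)))"
        using Xp by simp
      also have "\<dots> \<le> (Ks * (2 powr p * F) powr (N / (N - p)) + 1) * A powr (e * (N / (N - p)))"
        by (intro mult_right_mono) auto
      finally have "(X powr ((p - 1) / p)) powr (p / (p - 1)) \<le> ((Ks * (2 powr p * F) powr (N / (N - p)) + 1) * A powr (e * (N / (N - p)))) powr (p / (p - 1))"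
        using p by (intro powr_mono2) auto
      also have "\<dots> = D * A powr (e * (N / (N - p)) * (p / (p - 1)))"
        by (simp only: powr_mult powr_powr D_def)
      also have "e * (N / (N - p)) * (p / (p - 1)) = b" unfolding rp b_def using p by simp
      finally show ?thesis using Xp p by (simp add: powr_powr X_def[symmetric] A_def[symmetric])
    qed
  qed
  \<comment> \<open>Frozen below level 1: at negative levels the set has infinite measure, for which
    \<open>measure\<close> returns 0, and monotonicity could fail.\<close>
  define a where "a k = (if k \<ge> 1 then measure lborel {x. u x > k} else measure lborel {x. u x > 1})" for k
  have fin: "{x. u x > k} \<in> fmeasurable lborel" if "k \<ge> 1" for k
  proof -
    have "(\<integral>\<^sup>+ x. ennreal (\<bar>u x\<bar> powr ps) \<partial>lborel) < \<infinity>" using sobolev(1)[OF sob0_u] by (simp add: nn_integral_eq_integral)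
    moreover have "emeasure lborel {x. u x > k} \<le> (\<integral>\<^sup>+ x. ennreal (\<bar>u x\<bar> powr ps) \<partial>lborel)"
    proof -
      have "emeasure lborel {x. u x > k} = (\<integral>\<^sup>+ x. indicator {x. u x > k} x \<partial>lborel)" by simp
      also have "\<dots> \<le> (\<integral>\<^sup>+ x. ennreal (\<bar>u x\<bar> powr ps) \<partial>lborel)"
      proof (intro nn_integral_mono)
        fix x
        show "indicator {x. u x > k} x \<le> ennreal (\<bar>u x\<bar> powr ps)"
        proof (cases "u x > k")
          case True
          then have "1 \<le> \<bar>u x\<bar> powr ps" using that ps_pos by (intro ge_one_powr_ge_zero) auto
          then show ?thesis using True by simp
        qed simp
      qed
      finally show ?thesis .
    qed
    ultimately show ?thesis by (intro fmeasurableI) auto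
  qed
  have mono: "a h \<le> a k" if "k \<le> h" for h k
    using that fin[of k] fin[of 1] by (auto simp: a_def intro!: measure_mono_fmeasurable)
  have rec: "a h \<le> D * a k powr b / (h - k) powr ps" if k: "1 \<le> k" and h: "k < h" for h k
  proof -
    have h1: "h \<ge> 1" using k h by simp
    have "(h - k) powr ps * measure lborel {x. u x > h} = (LINT x|lborel. (h - k) powr ps * indicator {x. u x > h} x)"
      using fin[OF h1] by (simp add: fmeasurable_def)
    also have "\<dots> \<le> (LINT x|lborel. max 0 (u x - k) powr ps)"
    proof (rule integral_mono[OF _ truncation_estimate(1)[OF k]])
      show "integrable lborel (\<lambda>x. (h - k) powr ps * indicator {x. u x > h} x)"
        using fin[OF h1] by (intro integrable_mult_right integrable_real_indicator) (auto simp: fmeasurable_def)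
      fix x
      show "(h - k) powr ps * indicator {x. u x > h} x \<le> max 0 (u x - k) powr ps"
        using h ps_pos by (auto simp: indicator_def intro!: powr_mono2)
    qed
    also have "\<dots> \<le> D * measure lborel {x. u x > k} powr b" by (rule X_le[OF k])
    finally show ?thesis using h k h1 by (simp add: a_def pos_le_divide_eq mult.commute)
  qed
  obtain d where d: "a (1 + d) = 0"
    by (rule stampacchia[of a D ps b 1]) (use mono D ps_pos b rec in \<open>auto simp: a_def\<close>)
  define B where "B = max 1 (1 + d)"
  have "measure lborel {x. u x > B} = 0"
    using d mono[of "1 + d" B] unfolding B_def a_def by (auto simp: max_def measure_le_0_iff split: if_splits)
  then have "emeasure lborel {x. u x > B} = 0"
    using fin[of B] by (simp add: B_def emeasure_eq_measure2)
  then have "AE x in lborel. x \<notin> {x. u x > B}"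
    by (intro AE_not_in) (auto simp: null_sets_def)
  then show thesis by (intro that[of B]) (auto elim!: eventually_mono)
qed

end

section \<open>Higher integrability for m < N / p\<close>

text \<open>For \<open>t \<ge> 0\<close> and \<open>\<kappa> \<rightarrow> 0\<close>, \<open>growth \<kappa> e t\<close> increases to \<open>t * (1 + t\<^sup>2) powr (e / 2)\<close>; for \<open>\<kappa> > 0\<close> it
  grows only linearly.\<close>

definition ratio :: "real \<Rightarrow> real \<Rightarrow> real" where
  "ratio \<kappa> t = (1 + t\<^sup>2) * (1 + \<kappa> * t\<^sup>2) powr (-1)"

definition growth :: "real \<Rightarrow> real \<Rightarrow> real \<Rightarrow> real" where
  "growth \<kappa> e t = t * ratio \<kappa> t powr (e / 2)"

definition growth' :: "real \<Rightarrow> real \<Rightarrow> real \<Rightarrow> real" where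
  "growth' \<kappa> e t = ratio \<kappa> t powr (e / 2) * (1 + e * (t\<^sup>2 * (1 - \<kappa>) / ((1 + t\<^sup>2) * (1 + \<kappa> * t\<^sup>2))))"

context
  fixes \<kappa> :: real
  assumes \<kappa>: "0 < \<kappa>" "\<kappa> \<le> 1"
begin

lemma denominator_pos: "1 + \<kappa> * t\<^sup>2 > 0"
  using \<kappa> by (simp add: add_pos_nonneg)

lemma ratio_eq: "ratio \<kappa> t = (1 + t\<^sup>2) / (1 + \<kappa> * t\<^sup>2)"
  using denominator_pos[of t] by (simp add: ratio_def powr_minus divide_inverse)

lemma ratio_pos: "ratio \<kappa> t > 0"
  using denominator_pos[of t] by (simp add: ratio_eq add_pos_nonneg)

lemma ratio_le: "ratio \<kappa> t \<le> 1 / \<kappa>" "ratio \<kappa> t \<le> 1 + t\<^sup>2"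
proof -
  have "\<kappa> * (1 + t\<^sup>2) \<le> 1 + \<kappa> * t\<^sup>2" using \<kappa> by (simp add: distrib_left)
  then show "ratio \<kappa> t \<le> 1 / \<kappa>" using \<kappa> denominator_pos[of t] by (simp add: ratio_eq divide_le_eq pos_le_divide_eq mult.commute)
  have "1 \<le> 1 + \<kappa> * t\<^sup>2" using \<kappa> by simp
  then have "(1 + t\<^sup>2) / (1 + \<kappa> * t\<^sup>2) \<le> (1 + t\<^sup>2) / 1" by (intro divide_left_mono) (auto simp: add_pos_nonneg)
  then show "ratio \<kappa> t \<le> 1 + t\<^sup>2" by (simp add: ratio_eq)
qed

lemma ratio_has_derivative: "(ratio \<kappa> has_real_derivative 2 * t * (1 - \<kappa>) / (1 + \<kappa> * t\<^sup>2)\<^sup>2) (at t)"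
proof -
  have "((\<lambda>t. (1 + t\<^sup>2) / (1 + \<kappa> * t\<^sup>2)) has_real_derivative 2 * t * (1 - \<kappa>) / (1 + \<kappa> * t\<^sup>2)\<^sup>2) (at t)"
    using denominator_pos[of t]
    by (auto intro!: derivative_eq_intros simp: power2_eq_square divide_simps) (simp add: algebra_simps)
  moreover have "ratio \<kappa> = (\<lambda>t. (1 + t\<^sup>2) / (1 + \<kappa> * t\<^sup>2))" by (simp add: ratio_eq fun_eq_iff)
  ultimately show ?thesis by simp
qed

lemma growth_has_derivative: "(growth \<kappa> e has_real_derivative growth' \<kappa> e t) (at t)"
proof -
  have r: "ratio \<kappa> t > 0" by (rule ratio_pos)
  have "((\<lambda>t. ratio \<kappa> t powr (e / 2)) has_real_derivative
      (e / 2) * ratio \<kappa> t powr (e / 2 - 1) * (2 * t * (1 - \<kappa>) / (1 + \<kappa> * t\<^sup>2)\<^sup>2)) (at t)"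
    using DERIV_fun_powr[OF ratio_has_derivative[of t] ratio_pos[of t], of "e / 2"] by simp
  from DERIV_mult[OF DERIV_ident this]
  have "(growth \<kappa> e has_real_derivative ratio \<kappa> t powr (e / 2) +
      t * ((e / 2) * ratio \<kappa> t powr (e / 2 - 1) * (2 * t * (1 - \<kappa>) / (1 + \<kappa> * t\<^sup>2)\<^sup>2))) (at t)"
    by (simp add: growth_def[abs_def] mult.commute add.commute)
  moreover have "ratio \<kappa> t powr (e / 2) + t * ((e / 2) * ratio \<kappa> t powr (e / 2 - 1) * (2 * t * (1 - \<kappa>) / (1 + \<kappa> * t\<^sup>2)\<^sup>2)) = growth' \<kappa> e t"
  proof -
    have "ratio \<kappa> t powr (e / 2 - 1) = ratio \<kappa> t powr (e / 2) * ((1 + \<kappa> * t\<^sup>2) / (1 + t\<^sup>2))"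
      using r by (simp add: powr_diff) (simp add: ratio_eq)
    moreover have "t * ((e / 2) * (R * (b / a)) * (2 * t * (1 - \<kappa>) / b\<^sup>2)) = R * (e * (t\<^sup>2 * (1 - \<kappa>) * (b / (a * b\<^sup>2))))"
      if "a \<noteq> 0" "b \<noteq> 0" for R a b :: real
      using that by (simp add: power2_eq_square field_simps)
    moreover have "1 + t\<^sup>2 \<noteq> 0" "1 + \<kappa> * t\<^sup>2 \<noteq> 0"
      using denominator_pos[of t] by (auto simp: add_nonneg_eq_0_iff)
    ultimately have "t * ((e / 2) * ratio \<kappa> t powr (e / 2 - 1) * (2 * t * (1 - \<kappa>) / (1 + \<kappa> * t\<^sup>2)\<^sup>2))
        = ratio \<kappa> t powr (e / 2) * (e * (t\<^sup>2 * (1 - \<kappa>) * ((1 + \<kappa> * t\<^sup>2) / ((1 + t\<^sup>2) * (1 + \<kappa> * t\<^sup>2)\<^sup>2))))"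
      by metis
    also have "(1 + \<kappa> * t\<^sup>2) / ((1 + t\<^sup>2) * (1 + \<kappa> * t\<^sup>2)\<^sup>2) = 1 / ((1 + t\<^sup>2) * (1 + \<kappa> * t\<^sup>2))"
      using denominator_pos[of t] by (simp add: power2_eq_square)
    finally show ?thesis by (simp add: growth'_def distrib_left)
  qed
  ultimately show ?thesis by simp
qed

lemma growth_factor: "0 \<le> t\<^sup>2 * (1 - \<kappa>) / ((1 + t\<^sup>2) * (1 + \<kappa> * t\<^sup>2))" "t\<^sup>2 * (1 - \<kappa>) / ((1 + t\<^sup>2) * (1 + \<kappa> * t\<^sup>2)) \<le> 1"
proof -
  have pos: "(1 + t\<^sup>2) * (1 + \<kappa> * t\<^sup>2) > 0" using denominator_pos[of t] by (simp add: add_pos_nonneg)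
  show "0 \<le> t\<^sup>2 * (1 - \<kappa>) / ((1 + t\<^sup>2) * (1 + \<kappa> * t\<^sup>2))"
    using pos \<kappa> by (intro divide_nonneg_pos mult_nonneg_nonneg) auto
  have "t\<^sup>2 * (1 - \<kappa>) \<le> (1 + t\<^sup>2) * 1" using \<kappa> by (intro mult_mono) auto
  also have "\<dots> \<le> (1 + t\<^sup>2) * (1 + \<kappa> * t\<^sup>2)" using \<kappa> by (intro mult_left_mono) auto
  finally show "t\<^sup>2 * (1 - \<kappa>) / ((1 + t\<^sup>2) * (1 + \<kappa> * t\<^sup>2)) \<le> 1" using pos by (simp add: divide_le_eq)
qed

text \<open>Apart from \<open>ratio \<kappa> t powr (e / 2)\<close> the derivative contains only a
  factor between 1 and 1 + e. The upper bound is used for \<Phi>, the lower one for G; together they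
  give the comparison of \<Phi>'^p with G' uniformly in \<kappa>.\<close>

lemma growth'_bounds:
  assumes "e \<ge> 0"
  shows "ratio \<kappa> t powr (e / 2) \<le> growth' \<kappa> e t" "growth' \<kappa> e t \<le> (1 + e) * ratio \<kappa> t powr (e / 2)"
    "\<bar>growth' \<kappa> e t\<bar> \<le> (1 + e) * (1 / \<kappa>) powr (e / 2)"
proof -
  let ?c = "t\<^sup>2 * (1 - \<kappa>) / ((1 + t\<^sup>2) * (1 + \<kappa> * t\<^sup>2))"
  have "0 \<le> e * ?c" "e * ?c \<le> e"
    by (rule mult_nonneg_nonneg[OF assms growth_factor(1)], rule mult_left_le[OF growth_factor(2) assms])
  then have c: "1 \<le> 1 + e * ?c" "1 + e * ?c \<le> 1 + e"
    by - linarith+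
  show 1: "ratio \<kappa> t powr (e / 2) \<le> growth' \<kappa> e t"
    unfolding growth'_def using mult_left_mono[OF c(1), of "ratio \<kappa> t powr (e / 2)"] by simp
  show 2: "growth' \<kappa> e t \<le> (1 + e) * ratio \<kappa> t powr (e / 2)"
    unfolding growth'_def using mult_left_mono[OF c(2), of "ratio \<kappa> t powr (e / 2)"] by (simp add: mult.commute)
  have "ratio \<kappa> t powr (e / 2) \<le> (1 / \<kappa>) powr (e / 2)"
    using ratio_le(1)[of t] ratio_pos[of t] assms by (intro powr_mono2) auto
  then have "(1 + e) * ratio \<kappa> t powr (e / 2) \<le> (1 + e) * (1 / \<kappa>) powr (e / 2)"
    using assms by (intro mult_left_mono) auto
  moreover have "0 \<le> growth' \<kappa> e t" by (rule order_trans[OF _ 1]) simp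
  ultimately show "\<bar>growth' \<kappa> e t\<bar> \<le> (1 + e) * (1 / \<kappa>) powr (e / 2)" using 2 by linarith
qed

lemma continuous_growth': "continuous_on S (growth' \<kappa> e)"
proof -
  have "continuous_on UNIV (ratio \<kappa>)"
    using ratio_has_derivative by (meson DERIV_isCont continuous_at_imp_continuous_on)
  moreover have "ratio \<kappa> t \<noteq> 0" "(1 + t\<^sup>2) * (1 + \<kappa> * t\<^sup>2) \<noteq> 0" for t
    using ratio_pos[of t] denominator_pos[of t] by (auto simp: add_nonneg_eq_0_iff)
  ultimately have "continuous_on UNIV (growth' \<kappa> e)"
    unfolding growth'_def[abs_def] by (intro continuous_intros) auto
  then show ?thesis by (rule continuous_on_subset) simp
qed

lemma smooth_growth: "smooth \<phi> \<Longrightarrow> smooth (\<lambda>x. growth \<kappa> e (\<phi> x))"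
proof -
  assume "smooth \<phi>"
  then have "smooth (\<lambda>x. ratio \<kappa> (\<phi> x))"
    unfolding ratio_def
    by (intro smooth_mult smooth_add smooth_const smooth_powr smooth_power denominator_pos)
  with \<open>smooth \<phi>\<close> show "smooth (\<lambda>x. growth \<kappa> e (\<phi> x))"
    unfolding growth_def by (intro smooth_mult smooth_powr ratio_pos)
qed

lemma growth_0: "growth \<kappa> e 0 = 0"
  by (simp add: growth_def)

text \<open>Both sides are homogeneous of the same degree in \<open>(t, sqrt (ratio \<kappa> t))\<close>, and \<open>ratio \<kappa> t \<le> 2 t\<^sup>2\<close> for \<open>t \<ge> 1\<close>.\<close>

lemma growth_comparison:
  fixes A B C D :: real
  assumes t: "0 \<le> t" and A: "0 < A" "A \<le> C" and hom: "A + B = C + D" and B: "0 \<le> B" and D: "0 \<le> D"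
  shows "t powr A * ratio \<kappa> t powr (B / 2) \<le> 2 powr ((B + C) / 2) * (t powr C * ratio \<kappa> t powr (D / 2) + 1)"
proof -
  let ?R = "ratio \<kappa> t"
  have R: "?R > 0" by (rule ratio_pos)
  have B_eq: "B = D + (C - A)" using hom by simp
  show ?thesis
  proof (cases "t \<le> 1")
    case True
    then have "?R \<le> 2" using ratio_le(2)[of t] power_le_one[OF t True, of 2] by simp
    then have "t powr A * ?R powr (B / 2) \<le> 1 * 2 powr (B / 2)"
      using t True A B R by (intro mult_mono powr_mono2 powr_le1) auto
    also have "\<dots> \<le> 2 powr ((B + C) / 2) * 1" using A by simp
    also have "\<dots> \<le> 2 powr ((B + C) / 2) * (t powr C * ?R powr (D / 2) + 1)"
      by (intro mult_left_mono) auto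
    finally show ?thesis .
  next
    case False
    then have t1: "t > 1" by simp
    then have "1 \<le> t\<^sup>2" by simp
    then have "?R \<le> 2 * t\<^sup>2" using ratio_le(2)[of t] by linarith
    then have "?R powr ((C - A) / 2) \<le> (2 * t\<^sup>2) powr ((C - A) / 2)"
      using A R by (intro powr_mono2) auto
    also have "\<dots> = 2 powr ((C - A) / 2) * t powr (C - A)"
    proof -
      have "(2 * t\<^sup>2) powr ((C - A) / 2) = 2 powr ((C - A) / 2) * (t\<^sup>2) powr ((C - A) / 2)" by (rule powr_mult)
      also have "(t\<^sup>2) powr ((C - A) / 2) = t powr (C - A)"
      proof -
        have "2 * ((C - A) / 2) = C - A" by (simp only: mult_2 field_sum_of_halves)
        moreover have "t\<^sup>2 = t powr 2" using t1 by simp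
        ultimately show ?thesis by (simp only: powr_powr)
      qed
      finally show ?thesis .
    qed
    finally have Rle: "?R powr ((C - A) / 2) \<le> 2 powr ((C - A) / 2) * t powr (C - A)" .
    have "t powr A * ?R powr (B / 2) = t powr A * (?R powr (D / 2) * ?R powr ((C - A) / 2))"
      by (simp add: B_eq add_divide_distrib powr_add)
    also have "\<dots> \<le> t powr A * (?R powr (D / 2) * (2 powr ((C - A) / 2) * t powr (C - A)))"
      using Rle by (intro mult_left_mono) auto
    also have "\<dots> = 2 powr ((C - A) / 2) * ((t powr A * t powr (C - A)) * ?R powr (D / 2))"
      by (simp only: mult_ac)
    also have "t powr A * t powr (C - A) = t powr C" by (simp flip: powr_add)
    also have "2 powr ((C - A) / 2) * (t powr C * ?R powr (D / 2)) \<le> 2 powr ((B + C) / 2) * (t powr C * ?R powr (D / 2) + 1)"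
      using A B by (intro mult_mono) auto
    finally show ?thesis .
  qed
qed

end

context positive_minimizer
begin

text \<open>Testing with order u^\<gamma> yields the gradient of a power 1 + (\<gamma> - 1) / p of
  u, hence by Sobolev the exponent (1 + (\<gamma> - 1) / p) ps on the left. Hoelder's inequality on
  the right, with f in L^m, produces the exponent (\<gamma> - \<alpha>) m / (m - 1). The number
  \<open>s\<close> is where the two agree, and m \<ge> \<open>m_star\<close> gives s \<ge> ps, that
  is \<gamma> \<ge> 1.\<close>

lemma exponent_identities:
  fixes m s \<gamma> :: real
  defines "s \<equiv> (p + \<alpha> - 1) * N * m / (N - p * m)" and "\<gamma> \<equiv> 1 + (s / ps - 1) * p"
  assumes m: "m_star N p \<alpha> \<le> m" "m < N / p"
  shows "m > 1" "s \<ge> ps" "\<gamma> \<ge> 1" "(1 - \<alpha>) * (m / (m - 1)) + (\<gamma> - 1) * (m / (m - 1)) = s"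
    "ps + (\<gamma> - 1) / p * ps = s" "(1 - \<alpha>) * (m / (m - 1)) \<le> ps"
proof -
  show m1: "m > 1" using m_star_conj(1) m(1) by linarith
  have pm: "N - p * m > 0" using m p by (simp add: field_simps)
  have N0: "N > 0" using p by simp
  define E where "E = N * p - (1 - \<alpha>) * (N - p)"
  have E_eq: "E = (p + \<alpha> - 1) * (N - p) + p * p" by (simp add: E_def algebra_simps)
  have "E > 0"
    unfolding E_eq using p \<alpha> by (intro add_nonneg_pos mult_nonneg_nonneg) auto
  then have mE: "N * p \<le> m * E" using m(1) by (simp add: m_star_def E_def pos_divide_le_eq)
  show sps: "s \<ge> ps"
  proof -
    have "p * (N - p * m) \<le> (p + \<alpha> - 1) * m * (N - p)"
      using mE unfolding E_eq by (simp add: algebra_simps)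
    then have "N * (p * (N - p * m)) \<le> N * ((p + \<alpha> - 1) * m * (N - p))"
      using N0 by (intro mult_left_mono) auto
    then show ?thesis
      unfolding s_def ps_def using pm p by (simp add: divide_simps mult_ac)
  qed
  have sps1: "s / ps \<ge> 1" using sps ps_pos by simp
  then show "\<gamma> \<ge> 1" using p by (simp add: \<gamma>_def)
  show 5: "ps + (\<gamma> - 1) / p * ps = s" using p ps_pos by (simp add: \<gamma>_def field_simps)
  have g: "\<gamma> - 1 = s * (N - p) / N - p"
  proof -
    have "s / ps * p = s * (N - p) / N" using p N0 by (simp add: ps_def field_simps)
    then show ?thesis by (simp add: \<gamma>_def left_diff_distrib)
  qed
  have "s * (1 / m - p / N) = p + \<alpha> - 1"
  proof -
    have "1 / m - p / N = (N - p * m) / (N * m)" using N0 m1 by (simp add: field_simps)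
    then show ?thesis using pm N0 m1 by (simp add: s_def)
  qed
  moreover have "s * (1 / m - p / N) = s / m - s * p / N" by (simp add: right_diff_distrib)
  moreover have "s * (N - p) / N = s - s * p / N" using N0 by (simp add: field_simps)
  ultimately have "(1 - \<alpha>) + (\<gamma> - 1) = s - s / m" using g by linarith
  also have "\<dots> = s * ((m - 1) / m)" using m1 by (simp add: field_simps)
  finally have "((1 - \<alpha>) + (\<gamma> - 1)) * (m / (m - 1)) = s" using m1 by simp
  then show "(1 - \<alpha>) * (m / (m - 1)) + (\<gamma> - 1) * (m / (m - 1)) = s" by (simp only: distrib_right)
  have ms: "m_star N p \<alpha> > 1" by (rule m_star_conj(1))
  have "1 - 1 / m \<ge> 1 - 1 / m_star N p \<alpha>" using m(1) ms by (simp add: frac_le)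
  also have "1 - 1 / m_star N p \<alpha> = (1 - \<alpha>) / ps" using m_star_conj(3) by simp
  finally have "(1 - \<alpha>) / ps \<le> (m - 1) / m" using m1 by (simp add: diff_divide_distrib)
  then show "(1 - \<alpha>) * (m / (m - 1)) \<le> ps" using m1 ps_pos by (simp add: field_simps)
qed

text \<open>For \<kappa> > 0 the test function grows linearly, so the integral \<open>X\<close> is
  finite. It recurs on the right with the exponent \<theta>, and \<theta> < 1 because m < N / p.
  Absorbing it leaves a bound independent of \<kappa>, and Fatou's lemma lets \<kappa> tend to
  0.\<close>

theorem u_integrable_powr:
  assumes m: "m_star N p \<alpha> \<le> m" "m < N / p" and fm: "integrable lborel (\<lambda>x. f x powr m)"
  shows "integrable lborel (\<lambda>x. \<bar>u x\<bar> powr ((p + \<alpha> - 1) * N * m / (N - p * m)))"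
proof -
  define s where "s = (p + \<alpha> - 1) * N * m / (N - p * m)"
  define \<gamma> where "\<gamma> = 1 + (s / ps - 1) * p"
  note ids = exponent_identities[OF m, folded s_def, folded \<gamma>_def]
  define mc where "mc = m / (m - 1)"
  have mc: "mc > 1" "1 / m + 1 / mc = 1" unfolding mc_def by (rule conjugate_exponent[OF ids(1)])+
  define e where "e = (\<gamma> - 1) / p"
  have e: "e \<ge> 0" "e * p = \<gamma> - 1" using ids(3) p by (auto simp: e_def)
  define F where "F = (LINT x|lborel. f x powr m) powr (1 / m)"
  define W where "W = measure lborel \<Omega>"
  have \<Omega>_fin: "emeasure lborel \<Omega> < \<infinity>" using bounded_\<Omega> by (rule emeasure_bounded_finite)
  have [measurable]: "\<Omega> \<in> sets borel" using open_\<Omega> by simp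
  have i\<Omega>: "integrable lborel (\<lambda>x. indicator \<Omega> x :: real)"
    using \<Omega>_fin by (intro integrable_real_indicator) auto
  have outside: "AE x in lborel. x \<notin> \<Omega> \<longrightarrow> u x = 0" by (rule sob0_AE_outside(1)[OF p_pos sob0_u])
  \<comment> \<open>\<open>C1\<close> comes from \<open>growth'_bounds\<close> and \<open>C2\<close>
    from \<open>growth_comparison\<close>; neither depends on \<kappa>.\<close>
  define C1 where "C1 = (1 + e) powr p"
  define C2 where "C2 = 2 powr (((\<gamma> - 1) * mc + ps) / 2)"
  define \<theta> where "\<theta> = (1 / mc) * (N / (N - p))"
  define C3 where "C3 = Ks * (2 powr p * (C1 * (F * C2 powr (1 / mc)))) powr (N / (N - p))"
  have C3: "C3 \<ge> 0" using Ks_nonneg by (simp add: C3_def)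
  have \<theta>: "0 < \<theta>" "\<theta> < 1"
  proof -
    show "0 < \<theta>" using mc p by (simp add: \<theta>_def)
    have "p / N < 1 / m" using m(2) p ids(1) by (simp add: field_simps)
    then have "1 / mc < 1 - p / N" using mc(2) by linarith
    then have "1 / mc * (N / (N - p)) < (1 - p / N) * (N / (N - p))"
      using p by (intro mult_strict_right_mono) auto
    also have "\<dots> = 1" using p by (simp add: field_simps)
    finally show "\<theta> < 1" by (simp add: \<theta>_def)
  qed
  obtain C4 where C4: "C4 \<ge> 0" "\<And>Y. Y \<ge> 0 \<Longrightarrow> C3 * Y powr \<theta> \<le> (1 / 2) * Y + C4"
    using powr_sublinear[of C3 \<theta> "1 / 2"] C3 \<theta> by auto
  have bound: "pint lborel ps (\<lambda>x. growth \<kappa> e (u x)) \<le> ennreal (W + 2 * C4)" if \<kappa>: "0 < \<kappa>" "\<kappa> \<le> 1" for \<kappa>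
  proof -
    have g1: "\<gamma> - 1 \<ge> 0" using ids(3) by simp
    have dom: "\<bar>growth' \<kappa> e t\<bar> powr p \<le> C1 * growth' \<kappa> (\<gamma> - 1) t" for t
    proof -
      have "0 \<le> growth' \<kappa> e t" using growth'_bounds(1)[OF \<kappa> e(1), of t] by (rule order_trans[rotated]) simp
      then have "\<bar>growth' \<kappa> e t\<bar> powr p \<le> ((1 + e) * ratio \<kappa> t powr (e / 2)) powr p"
        using growth'_bounds(2)[OF \<kappa> e(1), of t] p by (intro powr_mono2) auto
      also have "\<dots> = C1 * ratio \<kappa> t powr (e / 2 * p)" by (simp only: powr_mult powr_powr C1_def)
      also have "e / 2 * p = (\<gamma> - 1) / 2" using e(2) by simp
      also have "C1 * ratio \<kappa> t powr ((\<gamma> - 1) / 2) \<le> C1 * growth' \<kappa> (\<gamma> - 1) t"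
        using growth'_bounds(1)[OF \<kappa> g1, of t] by (intro mult_left_mono) (auto simp: C1_def)
      finally show ?thesis .
    qed
    have nn: "0 \<le> growth \<kappa> (\<gamma> - 1) t" if "0 \<le> t" for t using that by (simp add: growth_def)
    note S = sobolev_composition[OF growth_has_derivative[OF \<kappa>] growth'_bounds(3)[OF \<kappa> g1] continuous_growth'[OF \<kappa>] growth_0[OF \<kappa>]
        smooth_growth[OF \<kappa>] nn growth_has_derivative[OF \<kappa>] growth'_bounds(3)[OF \<kappa> e(1)] continuous_growth'[OF \<kappa>] growth_0[OF \<kappa>]
        smooth_growth[OF \<kappa>] _ dom]
    have C1: "C1 \<ge> 0" by (simp add: C1_def)
    define X where "X = (LINT x|lborel. \<bar>growth \<kappa> e (u x)\<bar> powr ps)"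
    have iX: "integrable lborel (\<lambda>x. \<bar>growth \<kappa> e (u x)\<bar> powr ps)" by (rule S(1)) (use C1 in auto)
    have XS: "X \<le> Ks * (2 powr p * (C1 * (LINT x|lborel. f x * growth \<kappa> (\<gamma> - 1) (u x) / u x powr \<alpha>))) powr (N / (N - p))"
      unfolding X_def by (rule S(2)) (use C1 in auto)
    have X0: "X \<ge> 0" by (simp add: X_def)
    have [measurable]: "growth \<kappa> e' \<in> borel_measurable borel" for e'
      unfolding growth_def ratio_def by measurable
    define h where "h x = growth \<kappa> (\<gamma> - 1) (u x) / u x powr \<alpha>" for x
    have [measurable]: "h \<in> borel_measurable borel" unfolding h_def by measurable
    \<comment> \<open>With the regularised powers the two exponents agree only up to homogeneity in
      u and the square root of \<open>ratio\<close>. \<open>growth_comparison\<close> bridges this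
      at the cost of an additive constant, which is needed only on \<Omega>, a set of finite
      measure, since u vanishes outside.\<close>
    have h_le: "AE x in lborel. \<bar>h x\<bar> powr mc \<le> C2 * (\<bar>growth \<kappa> e (u x)\<bar> powr ps + indicator \<Omega> x)"
      using u_nonneg outside
    proof eventually_elim
      case (elim x)
      show ?case
      proof (cases "u x = 0")
        case True
        then show ?thesis by (simp add: h_def growth_def C2_def)
      next
        case False
        then have u0: "u x > 0" and x\<Omega>: "x \<in> \<Omega>" using elim by auto
        let ?R = "ratio \<kappa> (u x)"
        have "h x = u x powr (1 - \<alpha>) * ?R powr ((\<gamma> - 1) / 2)"
          using u0 by (simp add: h_def growth_def powr_diff)
        then have "\<bar>h x\<bar> powr mc = u x powr ((1 - \<alpha>) * mc) * ?R powr ((\<gamma> - 1) / 2 * mc)"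
          by (simp add: powr_mult powr_powr)
        also have "(\<gamma> - 1) / 2 * mc = (\<gamma> - 1) * mc / 2" by simp
        also have "u x powr ((1 - \<alpha>) * mc) * ?R powr ((\<gamma> - 1) * mc / 2)
            \<le> 2 powr (((\<gamma> - 1) * mc + ps) / 2) * (u x powr ps * ?R powr ((e * ps) / 2) + 1)"
        proof (rule growth_comparison[OF \<kappa>])
          show "(1 - \<alpha>) * mc + (\<gamma> - 1) * mc = ps + e * ps"
            using ids(4,5) by (simp add: mc_def e_def)
          show "(1 - \<alpha>) * mc \<le> ps" using ids(6) by (simp add: mc_def)
        qed (use u0 \<alpha> mc g1 e ps_pos in auto)
        also have "u x powr ps * ?R powr ((e * ps) / 2) = \<bar>growth \<kappa> e (u x)\<bar> powr ps"
          using u0 by (simp add: growth_def powr_mult powr_powr)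
        finally show ?thesis using x\<Omega> by (simp add: C2_def)
      qed
    qed
    have i_dom: "integrable lborel (\<lambda>x. C2 * (\<bar>growth \<kappa> e (u x)\<bar> powr ps + indicator \<Omega> x))"
      using iX i\<Omega> by simp
    have ih: "integrable lborel (\<lambda>x. \<bar>h x\<bar> powr mc)"
      by (rule Bochner_Integration.integrable_bound[OF i_dom]) (use h_le in \<open>auto elim!: eventually_mono\<close>)
    have if': "integrable lborel (\<lambda>x. \<bar>f x\<bar> powr m)" using fm f_nonneg by simp
    have "(LINT x|lborel. f x * h x) \<le> (LINT x|lborel. \<bar>f x * h x\<bar>)"
      using Holder(1)[OF ids(1) mc _ _ if' ih] by (intro integral_mono) auto
    also have "\<dots> \<le> F * (LINT x|lborel. \<bar>h x\<bar> powr mc) powr (1 / mc)"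
      using Holder(2)[OF ids(1) mc _ _ if' ih] f_nonneg by (simp add: F_def)
    also have "\<dots> \<le> F * (C2 * (X + W)) powr (1 / mc)"
    proof -
      have "(LINT x|lborel. \<bar>h x\<bar> powr mc) \<le> (LINT x|lborel. C2 * (\<bar>growth \<kappa> e (u x)\<bar> powr ps + indicator \<Omega> x))"
        by (rule integral_mono_AE[OF ih i_dom h_le])
      also have "\<dots> = C2 * (X + W)" using iX i\<Omega> by (simp add: X_def W_def)
      finally show ?thesis using mc by (intro mult_left_mono powr_mono2) (auto simp: F_def)
    qed
    finally have fh: "(LINT x|lborel. f x * growth \<kappa> (\<gamma> - 1) (u x) / u x powr \<alpha>) \<le> F * (C2 * (X + W)) powr (1 / mc)"
      by (simp add: h_def)
    have fh0: "0 \<le> (LINT x|lborel. f x * growth \<kappa> (\<gamma> - 1) (u x) / u x powr \<alpha>)"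
      using u_nonneg by (intro integral_nonneg_AE) (auto elim!: eventually_mono simp: f_nonneg nn)
    have "X \<le> Ks * (2 powr p * (C1 * (F * (C2 * (X + W)) powr (1 / mc)))) powr (N / (N - p))"
      using fh fh0 C1 p Ks_nonneg by (intro order_trans[OF XS] mult_left_mono powr_mono2 mult_nonneg_nonneg) auto
    also have "2 powr p * (C1 * (F * (C2 * (X + W)) powr (1 / mc))) = (2 powr p * (C1 * (F * C2 powr (1 / mc)))) * (X + W) powr (1 / mc)"
      by (simp add: powr_mult)
    also have "Ks * (\<dots>) powr (N / (N - p)) = C3 * (X + W) powr \<theta>"
    proof -
      have "k * (v * y powr b) powr r = k * v powr r * y powr (b * r)" for k v y b r :: real
        by (simp only: powr_mult powr_powr mult.assoc)
      then show ?thesis unfolding C3_def \<theta>_def .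
    qed
    also have "\<dots> \<le> (1 / 2) * (X + W) + C4"
      using X0 by (intro C4(2)) (simp add: W_def)
    finally have "X \<le> W + 2 * C4" unfolding distrib_left by linarith
    then show ?thesis
      using pint_eq_integral[of lborel "\<lambda>x. growth \<kappa> e (u x)" ps] iX by (simp add: X_def ennreal_leI)
  qed
  define k where "k n = inverse (real (Suc n))" for n
  have k: "0 < k n" "k n \<le> 1" for n unfolding k_def by (auto simp: field_simps)
  have k0: "k \<longlonglongrightarrow> 0" unfolding k_def by (rule LIMSEQ_inverse_real_of_nat)
  have [measurable]: "growth \<kappa> e \<in> borel_measurable borel" for \<kappa>
    unfolding growth_def ratio_def by measurable
  have lim: "AE x in lborel. (\<lambda>n. growth (k n) e (u x)) \<longlonglongrightarrow> u x * (1 + (u x)\<^sup>2) powr (e / 2)"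
  proof (rule AE_I2)
    fix x
    have "(\<lambda>n. (1 + (u x)\<^sup>2) * (1 + k n * (u x)\<^sup>2) powr (-1)) \<longlonglongrightarrow> (1 + (u x)\<^sup>2) * (1 + 0 * (u x)\<^sup>2) powr (-1)"
      by (intro tendsto_intros k0) auto
    then have "(\<lambda>n. ratio (k n) (u x)) \<longlonglongrightarrow> 1 + (u x)\<^sup>2" by (simp add: ratio_def)
    moreover have "1 + (u x)\<^sup>2 \<noteq> 0" by (simp add: add_nonneg_eq_0_iff)
    ultimately show "(\<lambda>n. growth (k n) e (u x)) \<longlonglongrightarrow> u x * (1 + (u x)\<^sup>2) powr (e / 2)"
      unfolding growth_def by (intro tendsto_intros) auto
  qed
  have "pint lborel ps (\<lambda>x. u x * (1 + (u x)\<^sup>2) powr (e / 2)) \<le> liminf (\<lambda>n. pint lborel ps (\<lambda>x. growth (k n) e (u x)))"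
    by (rule pint_Fatou[OF ps_pos _ lim]) measurable
  also have "\<dots> \<le> ennreal (W + 2 * C4)"
    by (intro liminf_le_const always_eventually allI bound k)
  also have "\<dots> < top" by simp
  finally have "integrable lborel (\<lambda>x. norm (u x * (1 + (u x)\<^sup>2) powr (e / 2)) powr ps)"
    by (subst (asm) pint_finite_iff) auto
  then have "integrable lborel (\<lambda>x. \<bar>u x\<bar> powr s)"
  proof (rule Bochner_Integration.integrable_bound)
    show "AE x in lborel. norm (\<bar>u x\<bar> powr s) \<le> norm (norm (u x * (1 + (u x)\<^sup>2) powr (e / 2)) powr ps)"
    proof (rule AE_I2)
      fix x
      show "norm (\<bar>u x\<bar> powr s) \<le> norm (norm (u x * (1 + (u x)\<^sup>2) powr (e / 2)) powr ps)"
      proof (cases "u x = 0")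
        case False
        have s_eq: "s = (1 + e) * ps" using ids(5) by (simp add: e_def distrib_right)
        have "\<bar>u x\<bar> powr e = (\<bar>u x\<bar>\<^sup>2) powr (e / 2)"
          using powr_powr[of "\<bar>u x\<bar>" 2 "e / 2"] False by simp
        also have "\<dots> \<le> (1 + (u x)\<^sup>2) powr (e / 2)" using e by (intro powr_mono2) auto
        finally have "\<bar>u x\<bar> * \<bar>u x\<bar> powr e \<le> \<bar>u x\<bar> * (1 + (u x)\<^sup>2) powr (e / 2)" by (intro mult_left_mono) auto
        then have "(\<bar>u x\<bar> powr (1 + e)) powr ps \<le> (\<bar>u x\<bar> * (1 + (u x)\<^sup>2) powr (e / 2)) powr ps"
          using ps_pos powr_mult_base[of "\<bar>u x\<bar>" e] by (intro powr_mono2) auto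
        then show ?thesis by (simp add: s_eq powr_powr abs_mult)
      qed simp
    qed
  qed measurable
  then show ?thesis by (simp add: s_def)
qed

end

section \<open>From the whole space to the domain\<close>

text \<open>The bridge from the measure of the definitions to that of the proof: completion does not
  change integrals of Borel functions, and those considered vanish almost everywhere outside
  \<Omega>.\<close>

lemma integrable_lebesgue_on_lborel:
  fixes g :: "'a::euclidean_space \<Rightarrow> 'b::{banach, second_countable_topology}"
  assumes \<Omega>: "\<Omega> \<in> sets borel" and [measurable]: "g \<in> borel_measurable borel"
    and out: "AE x in lborel. x \<notin> \<Omega> \<longrightarrow> g x = 0"
  shows "integrable (lebesgue_on \<Omega>) g \<longleftrightarrow> integrable lborel g"
    and "integral\<^sup>L (lebesgue_on \<Omega>) g = integral\<^sup>L lborel g"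
proof -
  have [measurable]: "\<Omega> \<in> sets borel" by (rule \<Omega>)
  have \<Omega>': "\<Omega> \<inter> space lebesgue \<in> sets lebesgue" using \<Omega> by simp
  have [measurable]: "(\<lambda>x. indicator \<Omega> x *\<^sub>R g x) \<in> borel_measurable lborel" by measurable
  have ae: "AE x in lborel. indicator \<Omega> x *\<^sub>R g x = g x"
    using out by eventually_elim (auto simp: indicator_def)
  have "integrable lebesgue (\<lambda>x. indicator \<Omega> x *\<^sub>R g x) \<longleftrightarrow> integrable lborel (\<lambda>x. indicator \<Omega> x *\<^sub>R g x)"
    by (rule integrable_completion) measurable
  also have "\<dots> \<longleftrightarrow> integrable lborel g"
    by (rule integrable_cong_AE[OF _ _ ae]) auto
  finally show "integrable (lebesgue_on \<Omega>) g \<longleftrightarrow> integrable lborel g"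
    unfolding integrable_restrict_space[OF \<Omega>'] .
  have "integral\<^sup>L lebesgue (\<lambda>x. indicator \<Omega> x *\<^sub>R g x) = integral\<^sup>L lborel (\<lambda>x. indicator \<Omega> x *\<^sub>R g x)"
    by (rule integral_completion) measurable
  also have "\<dots> = integral\<^sup>L lborel g"
    by (rule integral_cong_AE[OF _ _ ae]) auto
  finally show "integral\<^sup>L (lebesgue_on \<Omega>) g = integral\<^sup>L lborel g"
    unfolding integral_restrict_space[OF \<Omega>'] .
qed

lemma borel_measurable_lebesgue_on:
  "g \<in> borel_measurable borel \<Longrightarrow> g \<in> borel_measurable (lebesgue_on \<Omega>)"
  by (intro measurable_restrict_space1 measurable_completion) simp

lemma AE_lebesgue_on_iff:
  fixes \<Omega> :: "'a::euclidean_space set"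
  assumes "\<Omega> \<in> sets borel"
  shows "(AE x in lebesgue_on \<Omega>. P x) \<longleftrightarrow> (AE x in lborel. x \<in> \<Omega> \<longrightarrow> P x)"
proof -
  have "(AE x in lebesgue_on \<Omega>. P x) \<longleftrightarrow> (AE x in lebesgue. x \<in> \<Omega> \<longrightarrow> P x)"
    using assms by (subst AE_restrict_space_iff) auto
  also have "\<dots> \<longleftrightarrow> (AE x in lborel. x \<in> \<Omega> \<longrightarrow> P x)"
    by (rule AE_completion_iff)
  finally show ?thesis .
qed

lemma sob0_Lp:
  assumes p: "p > 1" and \<Omega>: "open \<Omega>" and u: "sob0 p \<Omega> u U"
  shows "u \<in> Lp p \<Omega>" "U \<in> Lp p \<Omega>"
proof -
  have p0: "p > 0" using p by simp
  note [measurable] = sob0_measurable[OF u]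
  have \<Omega>b: "\<Omega> \<in> sets borel" using \<Omega> by simp
  have "integrable (lebesgue_on \<Omega>) (\<lambda>x. norm (u x) powr p)"
    using sob0_integrable(1)[OF p0 u] sob0_AE_outside(1)[OF p0 u]
    by (subst integrable_lebesgue_on_lborel(1)[OF \<Omega>b]) (auto elim!: eventually_mono)
  moreover have "integrable (lebesgue_on \<Omega>) (\<lambda>x. norm (U x) powr p)"
    using sob0_integrable(2)[OF p0 u] sob0_AE_outside(2)[OF p0 u]
    by (subst integrable_lebesgue_on_lborel(1)[OF \<Omega>b]) (auto elim!: eventually_mono)
  ultimately show "u \<in> Lp p \<Omega>" "U \<in> Lp p \<Omega>"
    using sob0_measurable[OF u] by (auto simp: Lp_def intro: borel_measurable_lebesgue_on)
qed

lemma absolutely_integrable_on_compact: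
  fixes g :: "'a::euclidean_space \<Rightarrow> 'b::euclidean_space"
  assumes p: "p \<ge> 1" and [measurable]: "g \<in> borel_measurable borel"
    and g: "integrable lborel (\<lambda>x. norm (g x) powr p)" and K: "compact K"
  shows "g absolutely_integrable_on K"
proof -
  have [measurable]: "K \<in> sets borel" using K by (simp add: compact_imp_closed)
  have "integrable lborel (\<lambda>x. indicator K x *\<^sub>R g x)"
  proof (rule Bochner_Integration.integrable_bound)
    show "integrable lborel (\<lambda>x. indicator K x + norm (g x) powr p)"
      using g emeasure_compact_finite[OF K] by (intro Bochner_Integration.integrable_add integrable_real_indicator) auto
    show "AE x in lborel. norm (indicator K x *\<^sub>R g x) \<le> norm (indicator K x + norm (g x) powr p)"
    proof (rule AE_I2)
      fix x
      have "norm (g x) \<le> 1 + norm (g x) powr p"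
      proof (cases "norm (g x) \<le> 1")
        case False
        then have "norm (g x) powr 1 \<le> norm (g x) powr p" using p by (intro powr_mono) auto
        then show ?thesis using False by simp
      qed (simp add: add_increasing2)
      then show "norm (indicator K x *\<^sub>R g x) \<le> norm (indicator K x + norm (g x) powr p)"
        by (auto simp: indicator_def)
    qed
  qed measurable
  then show ?thesis
    unfolding set_integrable_def by (subst integrable_completion) auto
qed

lemma sob0_has_weak_gradient:
  assumes p: "p > 1" and \<Omega>: "open \<Omega>" and u: "sob0 p \<Omega> u U"
  shows "has_weak_gradient u U \<Omega>"
  unfolding has_weak_gradient_def
proof (intro conjI allI impI ballI)
  have p0: "p > 0" using p by simp
  note um = sob0_measurable[OF u]
  note [measurable] = um
  show "u absolutely_integrable_on K" "U absolutely_integrable_on K" if "compact K \<and> K \<subseteq> \<Omega>" for K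
    using sob0_integrable[OF p0 u] um that p by (auto intro!: absolutely_integrable_on_compact[of p])
  fix \<phi> :: "'a \<Rightarrow> real" and b :: 'a
  assume \<phi>: "\<phi> \<in> C0_infinity \<Omega>" and b: "b \<in> Basis"
  note [measurable] = C0_infinity_measurable[OF \<phi>]
  have \<Omega>b: "\<Omega> \<in> sets borel" using \<Omega> by simp
  show "(LINT x|lebesgue_on \<Omega>. u x * (grad \<phi> x \<bullet> b)) = - (LINT x|lebesgue_on \<Omega>. (U x \<bullet> b) * \<phi> x)"
    using sob0_integral_by_parts[OF p u \<phi> b]
    by (subst (1 2) integrable_lebesgue_on_lborel(2)[OF \<Omega>b])
      (auto simp: C0_infinity_eq_0[OF \<phi>] C0_infinity_grad_eq_0[OF \<phi>])
qed

lemma Lp_norm_tendsto_0: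
  fixes g :: "nat \<Rightarrow> 'a::euclidean_space \<Rightarrow> 'b::euclidean_space"
  assumes p: "p > 0" and \<Omega>: "\<Omega> \<in> sets borel" and [measurable]: "\<And>n. g n \<in> borel_measurable borel"
    and g: "\<And>n. integrable lborel (\<lambda>x. norm (g n x) powr p)" and out: "\<And>n. AE x in lborel. x \<notin> \<Omega> \<longrightarrow> g n x = 0"
    and lim: "(\<lambda>n. pint lborel p (g n)) \<longlonglongrightarrow> 0"
  shows "(\<lambda>n. Lp_norm p \<Omega> (g n)) \<longlonglongrightarrow> 0"
proof -
  have "(\<lambda>n. ennreal (LINT x|lborel. norm (g n x) powr p)) \<longlonglongrightarrow> ennreal 0"
    using lim by (simp add: pint_eq_integral[OF g])
  then have "(\<lambda>n. LINT x|lborel. norm (g n x) powr p) \<longlonglongrightarrow> 0"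
    by (subst (asm) tendsto_ennreal_iff) auto
  then have "(\<lambda>n. (LINT x|lborel. norm (g n x) powr p) powr (1 / p)) \<longlonglongrightarrow> 0 powr (1 / p)"
    using p by (intro tendsto_powr' tendsto_const) auto
  moreover have "(LINT x|lebesgue_on \<Omega>. norm (g n x) powr p) = (LINT x|lborel. norm (g n x) powr p)" for n
    using out[of n] by (intro integrable_lebesgue_on_lborel(2)[OF \<Omega>]) (auto elim!: eventually_mono)
  ultimately show ?thesis by (simp add: Lp_norm_def)
qed

lemma sob0_W1p_0:
  assumes p: "p > 1" and \<Omega>: "open \<Omega>" and u: "sob0 p \<Omega> u U"
  shows "u \<in> W1p_0 p \<Omega>"
proof -
  have p0: "p > 0" using p by simp
  have \<Omega>b: "\<Omega> \<in> sets borel" using \<Omega> by simp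
  obtain \<phi> where \<phi>: "\<And>n::nat. \<phi> n \<in> C0_infinity \<Omega>"
    "(\<lambda>n. pint lborel p (\<lambda>x. \<phi> n x - u x)) \<longlonglongrightarrow> 0" "(\<lambda>n. pint lborel p (\<lambda>x. grad (\<phi> n) x - U x)) \<longlonglongrightarrow> 0"
    using sob0E[OF u] by blast
  note Lp = sob0_Lp[OF p \<Omega> u] and grad = sob0_has_weak_gradient[OF p \<Omega> u]
  have s: "sob0 p \<Omega> (\<lambda>x. \<phi> n x - u x) (\<lambda>x. grad (\<phi> n) x - U x)" for n
    using sob0_add[OF p0 sob0_C0_infinity[OF \<phi>(1)] sob0_cmult[OF p0 u, of "-1"], of n] by simp
  have "(\<lambda>n. Lp_norm p \<Omega> (\<lambda>x. \<phi> n x - u x)) \<longlonglongrightarrow> 0"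
    using sob0_measurable[OF s] sob0_integrable[OF p0 s] sob0_AE_outside[OF p0 s] \<phi>(2)
    by (intro Lp_norm_tendsto_0[OF p0 \<Omega>b])
  moreover have "(\<lambda>n. Lp_norm p \<Omega> (\<lambda>x. grad (\<phi> n) x - U x)) \<longlonglongrightarrow> 0"
    using sob0_measurable[OF s] sob0_integrable[OF p0 s] sob0_AE_outside[OF p0 s] \<phi>(3)
    by (intro Lp_norm_tendsto_0[OF p0 \<Omega>b])
  ultimately have "(\<lambda>n. Lp_norm p \<Omega> (\<lambda>x. \<phi> n x - u x) + Lp_norm p \<Omega> (\<lambda>x. grad (\<phi> n) x - U x)) \<longlonglongrightarrow> 0"
    using tendsto_add by fastforce
  then show ?thesis
    unfolding W1p_0_def W1p_def using Lp grad \<phi>(1) by blast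
qed

context positive_minimizer
begin

text \<open>\<open>f0\<close> is the given right-hand side, measurable only with respect to Lebesgue
  measure, while \<open>f\<close> is the Borel representative for which the energy was
  minimized.\<close>

lemma weak_solution_u:
  assumes f0_measurable: "f0 \<in> borel_measurable (lebesgue_on \<Omega>)"
    and f0: "AE x in lborel. x \<in> \<Omega> \<longrightarrow> f0 x = f x"
  shows "weak_solution p \<alpha> f0 \<Omega> u"
  unfolding weak_solution_def
proof (intro conjI bexI[of _ U] ballI)
  have \<Omega>b [measurable]: "\<Omega> \<in> sets borel" using open_\<Omega> by simp
  show "u \<in> W1p_0 p \<Omega>" by (rule sob0_W1p_0[OF p(1) open_\<Omega> sob0_u])
  show "AE x in lebesgue_on \<Omega>. u x > 0"
    using u_pos by (simp add: AE_lebesgue_on_iff[OF \<Omega>b])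
  show "has_weak_gradient u U \<Omega>" by (rule sob0_has_weak_gradient[OF p(1) open_\<Omega> sob0_u])
  show "U \<in> Lp p \<Omega>" by (rule sob0_Lp[OF p(1) open_\<Omega> sob0_u])
  fix \<phi> assume \<phi>: "\<phi> \<in> C0_infinity \<Omega>"
  note \<phi>m [measurable] = C0_infinity_measurable[OF \<phi>]
  note i = flux_integrable[OF sob0_C0_infinity[OF \<phi>]]
  have e1: "norm (U x) powr (p - 2) * (U x \<bullet> grad \<phi> x) = pflux p (U x) \<bullet> grad \<phi> x" for x
    by (simp add: pflux_def)
  have e2: "\<bar>u x\<bar> powr (p - 2) * u x * \<phi> x = pflux p (u x) \<bullet> \<phi> x" for x
    by (simp add: pflux_def)
  have z: "x \<notin> \<Omega> \<Longrightarrow> \<phi> x = 0" "x \<notin> \<Omega> \<Longrightarrow> grad \<phi> x = 0" for x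
    by (rule C0_infinity_eq_0[OF \<phi>], assumption) (rule C0_infinity_grad_eq_0[OF \<phi>])
  have I1: "integrable (lebesgue_on \<Omega>) (\<lambda>x. pflux p (U x) \<bullet> grad \<phi> x) \<longleftrightarrow> integrable lborel (\<lambda>x. pflux p (U x) \<bullet> grad \<phi> x)"
    "(LINT x|lebesgue_on \<Omega>. pflux p (U x) \<bullet> grad \<phi> x) = (LINT x|lborel. pflux p (U x) \<bullet> grad \<phi> x)"
    by (rule integrable_lebesgue_on_lborel(1)[OF \<Omega>b], measurable, simp add: z)
      (rule integrable_lebesgue_on_lborel(2)[OF \<Omega>b], measurable, simp add: z)
  have I2: "integrable (lebesgue_on \<Omega>) (\<lambda>x. pflux p (u x) \<bullet> \<phi> x) \<longleftrightarrow> integrable lborel (\<lambda>x. pflux p (u x) \<bullet> \<phi> x)"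
    "(LINT x|lebesgue_on \<Omega>. pflux p (u x) \<bullet> \<phi> x) = (LINT x|lborel. pflux p (u x) \<bullet> \<phi> x)"
    by (rule integrable_lebesgue_on_lborel(1)[OF \<Omega>b], measurable, simp add: z)
      (rule integrable_lebesgue_on_lborel(2)[OF \<Omega>b], measurable, simp add: z)
  have I3: "integrable (lebesgue_on \<Omega>) (\<lambda>x. f x * \<phi> x / u x powr \<alpha>) \<longleftrightarrow> integrable lborel (\<lambda>x. f x * \<phi> x / u x powr \<alpha>)"
    "(LINT x|lebesgue_on \<Omega>. f x * \<phi> x / u x powr \<alpha>) = (LINT x|lborel. f x * \<phi> x / u x powr \<alpha>)"
    by (rule integrable_lebesgue_on_lborel(1)[OF \<Omega>b], measurable, simp add: z)
      (rule integrable_lebesgue_on_lborel(2)[OF \<Omega>b], measurable, simp add: z)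
  have I4: "integrable (lebesgue_on \<Omega>) (\<lambda>x. f0 x * \<phi> x / u x powr \<alpha>)"
    "(LINT x|lebesgue_on \<Omega>. f0 x * \<phi> x / u x powr \<alpha>) = (LINT x|lebesgue_on \<Omega>. f x * \<phi> x / u x powr \<alpha>)"
  proof -
    have ae: "AE x in lebesgue_on \<Omega>. f x * \<phi> x / u x powr \<alpha> = f0 x * \<phi> x / u x powr \<alpha>"
      using f0 unfolding AE_lebesgue_on_iff[OF \<Omega>b] by eventually_elim simp
    have m: "(\<lambda>x. f x * \<phi> x / u x powr \<alpha>) \<in> borel_measurable (lebesgue_on \<Omega>)"
      by (rule borel_measurable_lebesgue_on) measurable
    have "(\<lambda>x. \<phi> x / u x powr \<alpha>) \<in> borel_measurable (lebesgue_on \<Omega>)"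
      by (rule borel_measurable_lebesgue_on) measurable
    from borel_measurable_times[OF f0_measurable this]
    have m0: "(\<lambda>x. f0 x * \<phi> x / u x powr \<alpha>) \<in> borel_measurable (lebesgue_on \<Omega>)" by simp
    show "integrable (lebesgue_on \<Omega>) (\<lambda>x. f0 x * \<phi> x / u x powr \<alpha>)"
      using I3(1) equation(1)[OF \<phi>] integrable_cong_AE[OF m m0 ae] by simp
    show "(LINT x|lebesgue_on \<Omega>. f0 x * \<phi> x / u x powr \<alpha>) = (LINT x|lebesgue_on \<Omega>. f x * \<phi> x / u x powr \<alpha>)"
      by (rule integral_cong_AE[OF m m0 ae, symmetric])
  qed
  show "integrable (lebesgue_on \<Omega>) (\<lambda>x. norm (U x) powr (p - 2) * (U x \<bullet> grad \<phi> x))"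
    unfolding e1 I1 by (rule i)
  show "integrable (lebesgue_on \<Omega>) (\<lambda>x. \<bar>u x\<bar> powr (p - 2) * u x * \<phi> x)"
    unfolding e2 I2 by (rule i)
  show "integrable (lebesgue_on \<Omega>) (\<lambda>x. f0 x * \<phi> x / u x powr \<alpha>)" by (rule I4)
  show "(LINT x|lebesgue_on \<Omega>. norm (U x) powr (p - 2) * (U x \<bullet> grad \<phi> x)) +
      (LINT x|lebesgue_on \<Omega>. \<bar>u x\<bar> powr (p - 2) * u x * \<phi> x) = (LINT x|lebesgue_on \<Omega>. f0 x * \<phi> x / u x powr \<alpha>)"
    unfolding e1 e2 I1 I2 I4 I3 by (rule equation(2)[OF \<phi>])
qed

end

theorem theorem3p1:
  fixes \<Omega> :: "'a::euclidean_space set"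
    and f :: "'a \<Rightarrow> real"
    and N p \<alpha> m :: real
  assumes "N = real DIM('a)"
    and "domain \<Omega>" and "bounded \<Omega>" and "smooth_boundary \<Omega>"
    and "p > 1" and "0 < \<alpha>" and "\<alpha> < 1"
    and "f \<in> Lp m \<Omega>"
    and "AE x in lebesgue_on \<Omega>. f x \<ge> 0"
    and "\<not> (AE x in lebesgue_on \<Omega>. f x = 0)"
    and "m \<ge> m_star N p \<alpha>" and "m_star N p \<alpha> > 1"
  shows "\<exists>u. weak_solution p \<alpha> f \<Omega> u \<and>
           (m > N / p \<and> 2 - 2 / m < p \<and> p < N \<longrightarrow> u \<in> L_infinity \<Omega>) \<and>
           (1 < m_star N p \<alpha> \<and> m_star N p \<alpha> \<le> m \<and> m < N / p \<longrightarrow>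
             (\<forall>s. 1 < s \<and> s \<le> (p + \<alpha> - 1) * N * m / (N - p * m) \<longrightarrow> u \<in> Lp s \<Omega>))"
proof -
  have \<Omega>: "open \<Omega>" "connected \<Omega>" using assms(2) by (auto simp: domain_def)
  have \<Omega>b [measurable]: "\<Omega> \<in> sets borel" using \<Omega> by simp
  have \<Omega>_fin: "emeasure lborel \<Omega> < \<infinity>" by (rule emeasure_bounded_finite[OF assms(3)])
  have i\<Omega>: "integrable lborel (\<lambda>x. indicator \<Omega> x :: real)"
    using \<Omega>_fin by (intro integrable_real_indicator) auto
  \<comment> \<open>For p \<ge> N the denominator of \<open>m_star\<close> is at least N p, so
    \<open>m_star\<close> \<le> 1; the assumption \<open>m_star\<close> > 1 therefore puts the
    problem within reach of Sobolev's inequality.\<close>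
  have pN: "p < N"
  proof (rule ccontr)
    assume "\<not> p < N"
    then have le: "(1 - \<alpha>) * (N - p) \<le> 0" using assms(7) by (intro mult_nonneg_nonpos) auto
    have "N > 0" using assms(1) by simp
    then have "0 < N * p" using assms(5) by simp
    then have "m_star N p \<alpha> \<le> 1" using le by (simp add: m_star_def divide_le_eq)
    then show False using assms(12) by simp
  qed
  have f_meas: "f \<in> borel_measurable (lebesgue_on \<Omega>)" and f_int: "integrable (lebesgue_on \<Omega>) (\<lambda>x. norm (f x) powr m)"
    using assms(8) by (auto simp: Lp_def)
  have "(\<lambda>x. if x \<in> \<Omega> then f x else 0) \<in> borel_measurable lebesgue"
    using f_meas \<Omega>b by (intro borel_measurable_if_I) auto
  then obtain f1 where f1 [measurable]: "f1 \<in> borel_measurable lborel"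
    and f1_eq: "AE x in lborel. (if x \<in> \<Omega> then f x else 0) = f1 x"
    using completion_ex_borel_measurable_real by blast
  \<comment> \<open>\<open>max 0\<close> and the indicator turn a Borel version of f into one that
    is nonnegative everywhere and zero outside \<Omega>.\<close>
  define g where "g x = indicator \<Omega> x * max 0 (f1 x)" for x
  have g_meas [measurable]: "g \<in> borel_measurable borel" unfolding g_def using f1 by measurable
  have g_nn: "0 \<le> g x" for x by (simp add: g_def)
  have g_out: "x \<notin> \<Omega> \<Longrightarrow> g x = 0" for x by (simp add: g_def)
  have fg: "AE x in lborel. x \<in> \<Omega> \<longrightarrow> f x = g x"
    using f1_eq assms(9)[unfolded AE_lebesgue_on_iff[OF \<Omega>b]]
    by eventually_elim (auto simp: g_def)
  have gm: "integrable lborel (\<lambda>x. g x powr m)"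
  proof -
    have "integrable (lebesgue_on \<Omega>) (\<lambda>x. g x powr m) \<longleftrightarrow> integrable (lebesgue_on \<Omega>) (\<lambda>x. norm (f x) powr m)"
    proof (rule integrable_cong_AE)
      show "(\<lambda>x. g x powr m) \<in> borel_measurable (lebesgue_on \<Omega>)"
        by (rule borel_measurable_lebesgue_on) measurable
      show "(\<lambda>x. norm (f x) powr m) \<in> borel_measurable (lebesgue_on \<Omega>)" using f_int by simp
      show "AE x in lebesgue_on \<Omega>. g x powr m = norm (f x) powr m"
        using fg unfolding AE_lebesgue_on_iff[OF \<Omega>b] by eventually_elim (auto simp: g_nn)
    qed
    then show ?thesis
      using f_int integrable_lebesgue_on_lborel(1)[OF \<Omega>b, of "\<lambda>x. g x powr m"] by (simp add: g_out)
  qed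
  \<comment> \<open>On the finite measure of \<Omega>, t^a \<le> 1 + t^b lowers exponents: from m to
    \<open>m_star\<close> for the datum, and from the largest exponent in (ii) to every smaller
    s.\<close>
  have lower: "integrable lborel (\<lambda>x. \<bar>h x\<bar> powr a)"
    if [measurable]: "h \<in> borel_measurable borel" and h: "integrable lborel (\<lambda>x. \<bar>h x\<bar> powr b)"
      and out: "AE x in lborel. x \<notin> \<Omega> \<longrightarrow> h x = 0" and ab: "0 < a" "a \<le> b" for h :: "'a \<Rightarrow> real" and a b
  proof (rule Bochner_Integration.integrable_bound)
    show "integrable lborel (\<lambda>x. indicator \<Omega> x + \<bar>h x\<bar> powr b)" using i\<Omega> h by simp
    show "AE x in lborel. norm (\<bar>h x\<bar> powr a) \<le> norm (indicator \<Omega> x + \<bar>h x\<bar> powr b)"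
      using out
    proof eventually_elim
      case (elim x)
      show ?case
      proof (cases "x \<in> \<Omega>")
        case True
        have "\<bar>h x\<bar> powr a \<le> 1 + \<bar>h x\<bar> powr b"
        proof (cases "\<bar>h x\<bar> \<le> 1")
          case True
          then have "\<bar>h x\<bar> powr a \<le> 1" using ab by (intro powr_le1) auto
          then show ?thesis by (simp add: add_increasing2)
        next
          case False
          then have "\<bar>h x\<bar> powr a \<le> \<bar>h x\<bar> powr b" using ab by (intro powr_mono) auto
          then show ?thesis by simp
        qed
        then show ?thesis using True by simp
      qed (use elim in simp)
    qed
  qed measurable
  have "integrable lborel (\<lambda>x. \<bar>g x\<bar> powr m_star N p \<alpha>)"
  proof (rule lower[OF g_meas])
    show "integrable lborel (\<lambda>x. \<bar>g x\<bar> powr m)" using gm g_nn by simp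
    show "AE x in lborel. x \<notin> \<Omega> \<longrightarrow> g x = 0" by (simp add: g_out)
  qed (use assms(11,12) in auto)
  then have g_ms: "integrable lborel (\<lambda>x. g x powr m_star N p \<alpha>)" using g_nn by simp
  interpret singular_problem \<Omega> g N p \<alpha>
    by unfold_locales (use assms pN g_nn g_ms \<Omega> in auto)
  obtain u U where min: "admissible u U" "\<And>v V. admissible v V \<Longrightarrow> energy u U \<le> energy v V"
    using minimizer_exists by blast
  interpret energy_minimizer \<Omega> g N p \<alpha> u U
    by unfold_locales (use min in auto)
  have g_nontrivial: "\<not> (AE x in lborel. x \<in> \<Omega> \<longrightarrow> g x = 0)"
  proof
    assume "AE x in lborel. x \<in> \<Omega> \<longrightarrow> g x = 0"
    with fg have "AE x in lborel. x \<in> \<Omega> \<longrightarrow> f x = 0" by eventually_elim simp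
    then show False using assms(10) by (simp add: AE_lebesgue_on_iff[OF \<Omega>b])
  qed
  interpret positive_minimizer \<Omega> g N p \<alpha> u U
    by unfold_locales (rule u_positive[OF \<Omega>(2) g_nontrivial])
  have um: "u \<in> borel_measurable (lebesgue_on \<Omega>)"
    by (rule borel_measurable_lebesgue_on[OF u_measurable(1)])
  have sol: "weak_solution p \<alpha> f \<Omega> u" by (rule weak_solution_u[OF f_meas fg])
  have bounded: "u \<in> L_infinity \<Omega>" if m: "m > N / p"
  proof -
    obtain B where "AE x in lborel. u x \<le> B" using u_bounded[OF m gm] by blast
    with u_nonneg have "AE x in lborel. x \<in> \<Omega> \<longrightarrow> \<bar>u x\<bar> \<le> B" by eventually_elim simp
    then show ?thesis using um by (auto simp: L_infinity_def AE_lebesgue_on_iff[OF \<Omega>b])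
  qed
  have powers: "u \<in> Lp s \<Omega>"
    if m: "m_star N p \<alpha> \<le> m" "m < N / p" and s: "1 < s" "s \<le> (p + \<alpha> - 1) * N * m / (N - p * m)" for s
  proof -
    note out = sob0_AE_outside(1)[OF p_pos sob0_u]
    have "integrable lborel (\<lambda>x. \<bar>u x\<bar> powr s)"
      using s by (intro lower[OF _ u_integrable_powr[OF m gm] out]) auto
    moreover have "integrable (lebesgue_on \<Omega>) (\<lambda>x. \<bar>u x\<bar> powr s) \<longleftrightarrow> integrable lborel (\<lambda>x. \<bar>u x\<bar> powr s)"
      using out by (intro integrable_lebesgue_on_lborel(1)[OF \<Omega>b]) (auto elim!: eventually_mono)
    ultimately show ?thesis using um by (simp add: Lp_def)
  qed
  show ?thesis using sol bounded powers by blast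
qed

end
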